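(* Let $\Bbbk$ be a field, $0\ne v\in\Bbbk$, and $\delta=\pm(v+v^{-1})$. Let $V=V(1)$ and let $\mathbf{U}=\mathbf{U}(\mathfrak{gl}_2)$ or $\mathbf{U}(\mathfrak{sl}_2)$ (Lusztig divided power forms, specialized at $v$). Then the commuting actions of $\mathbf{U}$ and $\mathrm{TL}_n(\delta)$ on $V^{\otimes n}$ satisfy Schur--Weyl duality; that is, each of the induced algebra maps $$\mathbf{U}\to\operatorname{End}_{\mathrm{TL}_n(\delta)}(V^{\otimes n}),\qquad \mathrm{TL}_n(\delta)\to\operatorname{End}_{\mathbf{U}}(V^{\otimes n})$$ is surjective. Moreover, the latter map is an isomorphism.
   Context: $\mathrm{TL}_n(\delta)$ is the unital $\Bbbk$-algebra with generators $e_1,\dots,e_{n-1}$ and relations $e_i^2=\delta e_i$; $e_ie_je_i=e_i$ if $|i-j|=1$; $e_ie_j=e_je_i$ if $|i-j|>1$. **Quantum algebras.** Let $t$ be an indeterminate, $\mathcal{A}=\mathbb{Z}[t,t^{-1}]$, $[j]_t=\sum_{k=0}^{j-1}t^{-(j-1)+2k}$, $[j]_t^!=[1]_t\cdots[j]_t$, $[0]^!_t=1$. $\mathbf{U}_{\mathbb{Q}(t)}(\mathfrak{gl}_2)$ is the $\mathbb{Q}(t)$-algebra generated by $E,F,K_1^{\pm1},K_2^{\pm1}$ with relations $K_1K_2=K_2K_1$, $K_iK_i^{-1}=1=K_i^{-1}K_i$, $K_1EK_1^{-1}=tE$, $K_2EK_2^{-1}=t^{-1}E$, $K_1FK_1^{-1}=t^{-1}F$,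 $K_2FK_2^{-1}=tF$, $EF-FE=\frac{K-K^{-1}}{t-t^{-1}}$ where $K=K_1K_2^{-1}$. It is a Hopf algebra with coproduct $\Delta(E)=E\otimes1+K\otimes E$, $\Delta(F)=F\otimes K^{-1}+1\otimes F$, $\Delta(K_i)=K_i\otimes K_i$. $\mathbf{U}_{\mathbb{Q}(t)}(\mathfrak{sl}_2)$ is the subalgebra generated by $E,F,K^{\pm1}$. Let $\mathbf{U}_{\mathcal{A}}(\mathfrak{gl}_2)$ (resp. $\mathbf{U}_{\mathcal{A}}(\mathfrak{sl}_2)$) be the $\mathcal{A}$-subalgebra generated by the divided powers $E^{(j)}=E^j/[j]_t^!$, $F^{(j)}=F^j/[j]_t^!$ ($j\ge0$) and $K_1^{\pm1},K_2^{\pm1}$ (resp. $K^{\pm1}$). Regard $\Bbbk$ as an $\mathcal{A}$-algebra via $t^{\pm1}\mapsto v^{\pm1}$, and set $\mathbf{U}(\mathfrak{gl}_2)=\mathbf{U}_{\mathcal{A}}(\mathfrak{gl}_2)\otimes_{\mathcal{A}}\Bbbk$, $\mathbf{U}(\mathfrak{sl}_2)=\mathbf{U}_{\mathcal{A}}(\mathfrak{sl}_2)\otimes_{\mathcal{A}}\Bbbk$; these inherit Hopf algebra structures. **The module $V$.** $V=V(1)$ is the $2$-dimensional vector module, with $\Bbbk$-basis $x_0,x_1$, obtained by specializing the $\mathcal{A}$-lattice spanned by $x_0,x_1$: $Fx_0=x_1$, $Fx_1=0$, $Ex_1=x_0$, $Ex_0=0$, $E^{(j)}$ and $F^{(j)}$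 act as $0$ for $j\ge2$, $K_1x_0=vx_0$, $K_1x_1=x_1$, $K_2x_0=x_0$, $K_2x_1=vx_1$ (so $Kx_0=vx_0$, $Kx_1=v^{-1}x_1$). $\mathbf{U}$ acts on $V^{\otimes n}$ via the iterated coproduct. **Temperley--Lieb action.** Write $x_{i,j}=x_i\otimes x_j$ and let $\xi:V\otimes V\to V\otimes V$ be the linear map $x_{0,0}\mapsto0$, $x_{0,1}\mapsto v^{-1}x_{0,1}-x_{1,0}$, $x_{1,0}\mapsto-x_{0,1}+vx_{1,0}$, $x_{1,1}\mapsto0$. If $\delta=\pm(v+v^{-1})$, then $e_i$ acts on $V^{\otimes n}$ as $1^{\otimes(i-1)}\otimes(\pm\xi)\otimes1^{\otimes(n-i-1)}$ (same choice of sign), with $\pm\xi$ in tensor positions $i,i+1$. This defines an action of $\mathrm{TL}_n(\delta)$ that commutes with the action of $\mathbf{U}$. *)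

theory Defs
  imports
    "HOL-Library.Poly_Mapping"
    "HOL-Library.Product_Plus"
    "HOL-Computational_Algebra.Fraction_Field"
    "HOL-Computational_Algebra.Polynomial"
    "HOL-Algebra.QuotRing"
    "HOL-Algebra.Generated_Rings"
    "HOL-Algebra.Module"
begin

section \<open>Algebras given by generators and relations\<close>

text \<open>Algebras over a field are records of type \<^typ>\<open>('k, 'a) module\<close>.  The locale
  \<^locale>\<open>algebra\<close> of the library is restricted to commutative algebras and is not used.\<close>

datatype 'g free_mon = Mon (letters: "'g list")

instantiation free_mon :: (type) monoid_add
begin

definition zero_free_mon :: "'a free_mon" where
  "0 = Mon []"

definition plus_free_mon :: "'a free_mon \<Rightarrow> 'a free_mon \<Rightarrow> 'a free_mon" where
  "p + q = Mon (letters p @ letters q)"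

instance
  by standard (simp_all add: zero_free_mon_def plus_free_mon_def)

end

text \<open>As the monoid \<^typ>\<open>'g free_mon\<close> is written additively, \<^typ>\<open>'g free_mon \<Rightarrow>\<^sub>0 'k\<close> with its
  convolution product is the free associative algebra on \<^typ>\<open>'g\<close>.\<close>

definition word :: "'g list \<Rightarrow> ('g free_mon \<Rightarrow>\<^sub>0 'k::field)" where
  "word xs = Poly_Mapping.single (Mon xs) 1"

definition const :: "'k \<Rightarrow> ('m::monoid_add \<Rightarrow>\<^sub>0 'k::field)" where
  "const c = Poly_Mapping.single 0 c"

definition free_alg :: "'g set \<Rightarrow> ('k::field, 'g free_mon \<Rightarrow>\<^sub>0 'k) module" where
  "free_alg X = \<lparr>carrier = {f. \<forall>w \<in> Poly_Mapping.keys f. set (letters w) \<subseteq> X},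
     mult = (*), one = 1, zero = 0, add = (+), smult = (\<lambda>c f. const c * f)\<rparr>"

definition quot_alg :: "('k, 'a) module \<Rightarrow> 'a set \<Rightarrow> ('k, 'a set) module" where
  "quot_alg A I = \<lparr>carrier = carrier (A Quot I), mult = mult (A Quot I), one = one (A Quot I),
     zero = zero (A Quot I), add = add (A Quot I),
     smult = (\<lambda>c X. \<Union>x\<in>X. I +>\<^bsub>A\<^esub> (c \<odot>\<^bsub>A\<^esub> x))\<rparr>"

definition presented_alg ::
    "'g set \<Rightarrow> ('g free_mon \<Rightarrow>\<^sub>0 'k::field) set \<Rightarrow> ('k, ('g free_mon \<Rightarrow>\<^sub>0 'k) set) module" where
  "presented_alg X R = quot_alg (free_alg X) (genideal (free_alg X) R)"

definition alg_hom :: "('k, 'a) module \<Rightarrow> ('k, 'b) module \<Rightarrow> ('a \<Rightarrow> 'b) set" where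
  "alg_hom A B = {h \<in> ring_hom A B. \<forall>c. \<forall>x\<in>carrier A. h (c \<odot>\<^bsub>A\<^esub> x) = c \<odot>\<^bsub>B\<^esub> h x}"


section \<open>The Temperley--Lieb algebra\<close>

definition TL_relations :: "nat \<Rightarrow> 'k::field \<Rightarrow> (nat free_mon \<Rightarrow>\<^sub>0 'k) set" where
  "TL_relations n \<delta> =
     {word [i, i] - const \<delta> * word [i] | i. i \<in> {1..<n}} \<union>
     {word [i, j, i] - word [i] | i j. i \<in> {1..<n} \<and> j \<in> {1..<n} \<and> \<bar>int i - int j\<bar> = 1} \<union>
     {word [i, j] - word [j, i] | i j. i \<in> {1..<n} \<and> j \<in> {1..<n} \<and> \<bar>int i - int j\<bar> > 1}"

definition TL :: "nat \<Rightarrow> 'k::field \<Rightarrow> ('k, (nat free_mon \<Rightarrow>\<^sub>0 'k) set) module" where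
  "TL n \<delta> = presented_alg {1..<n} (TL_relations n \<delta>)"


section \<open>The quantum algebras over \<open>\<rat>(t)\<close> and over \<open>\<int>[t, t\<^sup>-\<^sup>1]\<close>\<close>

type_synonym ratfun = "rat poly fract"

definition qt :: ratfun where
  "qt = Fraction_Field.Fract [:0, 1:] 1"

text \<open>\<open>\<int>[t, t\<^sup>-\<^sup>1]\<close> is the group ring of the additive group of the integers.
  Evaluation at \<^const>\<open>qt\<close> embeds it into \<open>\<rat>(t)\<close>; evaluation at \<open>v \<noteq> 0\<close> makes the field an algebra
  over it.\<close>

type_synonym laurent = "int \<Rightarrow>\<^sub>0 int"

definition laurent_eval :: "'k::field \<Rightarrow> laurent \<Rightarrow> 'k" where
  "laurent_eval x f = (\<Sum>i\<in>Poly_Mapping.keys f. of_int (Poly_Mapping.lookup f i) * x powi i)"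

definition qint :: "nat \<Rightarrow> ratfun" where
  "qint j = (\<Sum>k<j. qt powi (2 * int k - (int j - 1)))"

definition qfact :: "nat \<Rightarrow> ratfun" where
  "qfact j = (\<Prod>i=1..j. qint i)"

datatype ugen = gE | gF | gK1 | gK1inv | gK2 | gK2inv

type_synonym ufree = "ugen free_mon \<Rightarrow>\<^sub>0 ratfun"

definition gl2_relations :: "ufree set" where
  "gl2_relations =
    {word [gK1, gK2] - word [gK2, gK1],
     word [gK1, gK1inv] - 1, word [gK1inv, gK1] - 1,
     word [gK2, gK2inv] - 1, word [gK2inv, gK2] - 1,
     word [gK1, gE, gK1inv] - const qt * word [gE],
     word [gK2, gE, gK2inv] - const (inverse qt) * word [gE],
     word [gK1, gF, gK1inv] - const (inverse qt) * word [gF],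
     word [gK2, gF, gK2inv] - const qt * word [gF],
     word [gE, gF] - word [gF, gE]
       - const (1 / (qt - inverse qt)) * (word [gK1, gK2inv] - word [gK2, gK1inv])}"

definition UQ :: "(ratfun, ufree set) module" where
  "UQ = presented_alg UNIV gl2_relations"

definition uclass :: "ufree \<Rightarrow> ufree set" where
  "uclass x = genideal (free_alg UNIV) gl2_relations +>\<^bsub>free_alg UNIV\<^esub> x"

definition divided_power :: "ugen \<Rightarrow> nat \<Rightarrow> ufree set" where
  "divided_power g j = (1 / qfact j) \<odot>\<^bsub>UQ\<^esub> (uclass (word [g]) [^]\<^bsub>UQ\<^esub> j)"

definition gl2_generators :: "ufree set set" where
  "gl2_generators = range (divided_power gE) \<union> range (divided_power gF) \<union>
     {uclass (word [gK1]), uclass (word [gK1inv]), uclass (word [gK2]), uclass (word [gK2inv])}"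

text \<open>Here \<open>K = K\<^sub>1 K\<^sub>2\<^sup>-\<^sup>1\<close>.\<close>

definition sl2_generators :: "ufree set set" where
  "sl2_generators = range (divided_power gE) \<union> range (divided_power gF) \<union>
     {uclass (word [gK1, gK2inv]), uclass (word [gK2, gK1inv])}"

definition laurent_subalgebra :: "ufree set set \<Rightarrow> (ratfun, ufree set) module" where
  "laurent_subalgebra S = UQ\<lparr>carrier :=
     generate_ring UQ (range (\<lambda>f. laurent_eval qt f \<odot>\<^bsub>UQ\<^esub> \<one>\<^bsub>UQ\<^esub>) \<union> S)\<rparr>"

definition UA_gl2 :: "(ratfun, ufree set) module" where
  "UA_gl2 = laurent_subalgebra gl2_generators"

definition UA_sl2 :: "(ratfun, ufree set) module" where
  "UA_sl2 = laurent_subalgebra sl2_generators"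


section \<open>Specialization at \<open>v\<close>\<close>

text \<open>The tensor product of \<open>B\<close> with the field is the ring of formal integer combinations of
  pairs \<open>(b, c)\<close>, multiplied componentwise, modulo biadditivity and balancedness over
  \<open>\<int>[t, t\<^sup>-\<^sup>1]\<close>.  (The additive subgroup spanned by these relations is a two-sided ideal.)\<close>

definition formal_tensors :: "(ratfun, 'b) module \<Rightarrow> ('k::field, 'b \<times> 'k \<Rightarrow>\<^sub>0 int) module" where
  "formal_tensors B = \<lparr>carrier = {z. fst ` Poly_Mapping.keys z \<subseteq> carrier B},
     mult = (\<lambda>y z. \<Sum>p\<in>Poly_Mapping.keys y. \<Sum>q\<in>Poly_Mapping.keys z.
       Poly_Mapping.single (fst p \<otimes>\<^bsub>B\<^esub> fst q, snd p * snd q)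
         (Poly_Mapping.lookup y p * Poly_Mapping.lookup z q)),
     one = Poly_Mapping.single (\<one>\<^bsub>B\<^esub>, 1) 1, zero = 0, add = (+),
     smult = (\<lambda>c z. \<Sum>p\<in>Poly_Mapping.keys z.
       Poly_Mapping.single (fst p, c * snd p) (Poly_Mapping.lookup z p))\<rparr>"

definition tensor_relations :: "'k::field \<Rightarrow> (ratfun, 'b) module \<Rightarrow> ('b \<times> 'k \<Rightarrow>\<^sub>0 int) set" where
  "tensor_relations v B = (let p = (\<lambda>b c. Poly_Mapping.single (b, c) 1) in
     {p (a \<oplus>\<^bsub>B\<^esub> b) c - p a c - p b c | a b c. a \<in> carrier B \<and> b \<in> carrier B} \<union>
     {p a (c + d) - p a c - p a d | a c d. a \<in> carrier B} \<union>
     {p (laurent_eval qt f \<odot>\<^bsub>B\<^esub> a) c - p a (laurent_eval v f * c) | f a c. a \<in> carrier B})"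

definition specialized_alg ::
    "'k::field \<Rightarrow> (ratfun, 'b) module \<Rightarrow> ('k, ('b \<times> 'k \<Rightarrow>\<^sub>0 int) set) module" where
  "specialized_alg v B =
     quot_alg (formal_tensors B) (genideal (formal_tensors B) (tensor_relations v B))"


section \<open>Tensor powers of \<open>V\<close>\<close>

datatype vbasis = X0 | X1

text \<open>\<open>V\<^sup>\<otimes>\<^sup>n\<close> is the degree \<open>n\<close> part of the tensor algebra of \<open>V\<close>, which is the free algebra on
  \<open>x\<^sub>0, x\<^sub>1\<close>: thus \<^term>\<open>word xs\<close> is a basis tensor and \<open>(*)\<close> is the tensor product of vectors.\<close>

type_synonym 'k tensors = "vbasis free_mon \<Rightarrow>\<^sub>0 'k"

definition tensor_power :: "nat \<Rightarrow> 'k::field tensors set" where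
  "tensor_power n = {m. \<forall>w \<in> Poly_Mapping.keys m. length (letters w) = n}"

definition lin_ext :: "(vbasis list \<Rightarrow> 'k tensors) \<Rightarrow> 'k::field tensors \<Rightarrow> 'k tensors" where
  "lin_ext \<phi> m = (\<Sum>w\<in>Poly_Mapping.keys m. const (Poly_Mapping.lookup m w) * \<phi> (letters w))"

text \<open>Elements of the algebra of linear endomorphisms of \<open>V\<^sup>\<otimes>\<^sup>n\<close> are functions that are
  \<^const>\<open>undefined\<close> outside \<open>V\<^sup>\<otimes>\<^sup>n\<close>.\<close>

definition End_tensor :: "nat \<Rightarrow> ('k::field, 'k tensors \<Rightarrow> 'k tensors) module" where
  "End_tensor n = \<lparr>carrier = {f \<in> tensor_power n \<rightarrow>\<^sub>E tensor_power n.
       (\<forall>x\<in>tensor_power n. \<forall>y\<in>tensor_power n. f (x + y) = f x + f y) \<and>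
       (\<forall>c. \<forall>x\<in>tensor_power n. f (const c * x) = const c * f x)},
     mult = (\<lambda>f g. \<lambda>x\<in>tensor_power n. f (g x)), one = (\<lambda>x\<in>tensor_power n. x),
     zero = (\<lambda>x\<in>tensor_power n. 0), add = (\<lambda>f g. \<lambda>x\<in>tensor_power n. f x + g x),
     smult = (\<lambda>c f. \<lambda>x\<in>tensor_power n. const c * f x)\<rparr>"

text \<open>The endomorphisms commuting with an algebra \<open>A\<close> that acts through \<open>\<rho>\<close>.\<close>

definition End_over ::
    "('k::field, 'a) module \<Rightarrow> ('a \<Rightarrow> 'k tensors \<Rightarrow> 'k tensors) \<Rightarrow> nat \<Rightarrow>
     ('k, 'k tensors \<Rightarrow> 'k tensors) module" where
  "End_over A \<rho> n = End_tensor n\<lparr>carrier := {f \<in> carrier (End_tensor n).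
     \<forall>a\<in>carrier A. \<forall>x\<in>tensor_power n. f (\<rho> a x) = \<rho> a (f x)}\<rparr>"

text \<open>The induced operators below are read off from representatives of residue classes
  (\<^const>\<open>the_elem\<close>).\<close>

subsection \<open>The action of the Temperley--Lieb algebra\<close>

fun xi :: "'k::field \<Rightarrow> vbasis \<Rightarrow> vbasis \<Rightarrow> 'k tensors" where
  "xi v X0 X0 = 0"
| "xi v X0 X1 = const (inverse v) * word [X0, X1] - word [X1, X0]"
| "xi v X1 X0 = - word [X0, X1] + const v * word [X1, X0]"
| "xi v X1 X1 = 0"

text \<open>List positions start at 0, tensor positions at 1; \<open>s\<close> is the sign in \<open>\<delta> = \<plusminus>(v + v\<^sup>-\<^sup>1)\<close>.\<close>

definition TL_gen_op :: "'k::field \<Rightarrow> 'k \<Rightarrow> nat \<Rightarrow> 'k tensors \<Rightarrow> 'k tensors" where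
  "TL_gen_op v s i = lin_ext (\<lambda>l.
     word (take (i - 1) l) * (const s * xi v (l ! (i - 1)) (l ! i)) * word (drop (i + 1) l))"

definition TL_free_action ::
    "'k::field \<Rightarrow> 'k \<Rightarrow> (nat free_mon \<Rightarrow>\<^sub>0 'k) \<Rightarrow> 'k tensors \<Rightarrow> 'k tensors" where
  "TL_free_action v s f m = (\<Sum>w\<in>Poly_Mapping.keys f.
     const (Poly_Mapping.lookup f w) * foldr (TL_gen_op v s) (letters w) m)"

definition TL_action ::
    "'k::field \<Rightarrow> 'k \<Rightarrow> nat \<Rightarrow> (nat free_mon \<Rightarrow>\<^sub>0 'k) set \<Rightarrow> 'k tensors \<Rightarrow> 'k tensors" where
  "TL_action v s n X = (\<lambda>m\<in>tensor_power n. the_elem ((\<lambda>f. TL_free_action v s f m) ` X))"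

subsection \<open>The action of the quantum algebra\<close>

fun comult_gen :: "ugen \<Rightarrow> (ugen free_mon \<times> ugen free_mon \<Rightarrow>\<^sub>0 ratfun)" where
  "comult_gen gE = Poly_Mapping.single (Mon [gE], Mon []) 1
     + Poly_Mapping.single (Mon [gK1, gK2inv], Mon [gE]) 1"
| "comult_gen gF = Poly_Mapping.single (Mon [gF], Mon [gK2, gK1inv]) 1
     + Poly_Mapping.single (Mon [], Mon [gF]) 1"
| "comult_gen g = Poly_Mapping.single (Mon [g], Mon [g]) 1"

text \<open>The coproduct, as an algebra homomorphism on the free algebra.  Its target is the monoid
  algebra of pairs of words, that is, the tensor square of the free algebra.\<close>

definition comult :: "ufree \<Rightarrow> (ugen free_mon \<times> ugen free_mon \<Rightarrow>\<^sub>0 ratfun)" where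
  "comult x = (\<Sum>w\<in>Poly_Mapping.keys x.
     const (Poly_Mapping.lookup x w) * prod_list (map comult_gen (letters w)))"

fun counit_gen :: "ugen \<Rightarrow> ratfun" where
  "counit_gen gE = 0"
| "counit_gen gF = 0"
| "counit_gen g = 1"

definition counit :: "ufree \<Rightarrow> ratfun" where
  "counit x = (\<Sum>w\<in>Poly_Mapping.keys x.
     Poly_Mapping.lookup x w * prod_list (map counit_gen (letters w)))"

fun V_gen :: "ugen \<Rightarrow> vbasis \<Rightarrow> ratfun tensors" where
  "V_gen gE X0 = 0"
| "V_gen gE X1 = word [X0]"
| "V_gen gF X0 = word [X1]"
| "V_gen gF X1 = 0"
| "V_gen gK1 X0 = const qt * word [X0]"
| "V_gen gK1 X1 = word [X1]"
| "V_gen gK1inv X0 = const (inverse qt) * word [X0]"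
| "V_gen gK1inv X1 = word [X1]"
| "V_gen gK2 X0 = word [X0]"
| "V_gen gK2 X1 = const qt * word [X1]"
| "V_gen gK2inv X0 = word [X0]"
| "V_gen gK2inv X1 = const (inverse qt) * word [X1]"

definition V_op :: "ugen \<Rightarrow> ratfun tensors \<Rightarrow> ratfun tensors" where
  "V_op g = lin_ext (\<lambda>l. V_gen g (hd l))"

text \<open>The action on the generic tensor power through the iterated coproduct: on
  \<open>V \<otimes> V\<^sup>\<otimes>\<^sup>n\<close> the first leg of the coproduct acts on \<open>V\<close> and the second on \<open>V\<^sup>\<otimes>\<^sup>n\<close>.
  The trivial module \<open>V\<^sup>\<otimes>\<^sup>0\<close> is the unit for the tensor product.\<close>

primrec generic_free_action :: "nat \<Rightarrow> ufree \<Rightarrow> ratfun tensors \<Rightarrow> ratfun tensors" where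
  "generic_free_action 0 x m = const (counit x) * m"
| "generic_free_action (Suc n) x m = lin_ext (\<lambda>l. \<Sum>(p, q)\<in>Poly_Mapping.keys (comult x).
     const (Poly_Mapping.lookup (comult x) (p, q)) *
       (foldr V_op (letters p) (word [hd l]) * generic_free_action n (word (letters q)) (word (tl l)))) m"

definition generic_action :: "nat \<Rightarrow> ufree set \<Rightarrow> ratfun tensors \<Rightarrow> ratfun tensors" where
  "generic_action n a m = the_elem ((\<lambda>x. generic_free_action n x m) ` a)"

text \<open>The image at \<open>t = v\<close> of an element of \<open>\<int>[t, t\<^sup>-\<^sup>1] \<subseteq> \<rat>(t)\<close>; arbitrary on other arguments.\<close>

definition specialize :: "'k::field \<Rightarrow> ratfun \<Rightarrow> 'k" where
  "specialize v r = laurent_eval v (THE f. laurent_eval qt f = r)"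

text \<open>The integral form preserves the \<open>\<int>[t, t\<^sup>-\<^sup>1]\<close>-lattice spanned by the basis tensors, and
  \<open>a \<otimes> c\<close> acts on the specialized lattice by \<open>w \<mapsto> c (a w)|\<^bsub>t=v\<^esub>\<close>.\<close>

definition integral_action :: "'k::field \<Rightarrow> nat \<Rightarrow> ufree set \<Rightarrow> 'k tensors \<Rightarrow> 'k tensors" where
  "integral_action v n a =
     lin_ext (\<lambda>l. Poly_Mapping.map (specialize v) (generic_action n a (word l)))"

definition formal_action ::
    "'k::field \<Rightarrow> nat \<Rightarrow> (ufree set \<times> 'k \<Rightarrow>\<^sub>0 int) \<Rightarrow> 'k tensors \<Rightarrow> 'k tensors" where
  "formal_action v n z m = (\<Sum>(a, c)\<in>Poly_Mapping.keys z.
     const (of_int (Poly_Mapping.lookup z (a, c)) * c) * integral_action v n a m)"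

definition U_action ::
    "'k::field \<Rightarrow> nat \<Rightarrow> (ufree set \<times> 'k \<Rightarrow>\<^sub>0 int) set \<Rightarrow> 'k tensors \<Rightarrow> 'k tensors" where
  "U_action v n X = (\<lambda>m\<in>tensor_power n. the_elem ((\<lambda>z. formal_action v n z m) ` X))"

end

theory Submission
  imports Defs
begin

text \<open>Modulo the images of the \<open>e\<^sub>i\<close>, a word containing \<open>x\<^sub>1 x\<^sub>0\<close> is a multiple of the word with these
  letters exchanged, so a map commuting with the Temperley--Lieb algebra is determined by its values on
  \<open>y\<^sub>k = x\<^sub>0\<^sup>N x\<^sub>1\<^sup>k\<close>, \<open>N + k = n\<close>.  Such a value is killed by the \<open>e\<^sub>i\<close> with \<open>i \<noteq> N\<close>, hence is a combination
  of the vectors \<open>F\<^sup>(\<^sup>a\<^sup>) x\<^sub>0\<^sup>N \<otimes> E\<^sup>(\<^sup>b\<^sup>) x\<^sub>1\<^sup>k\<close>, and these are related to \<open>E\<^sup>(\<^sup>b\<^sup>) F\<^sup>(\<^sup>a\<^sup>) y\<^sub>k\<close> by a unitriangular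
  system up to units.  To treat all \<open>k\<close> at once one needs the projections onto the weight spaces: the
  commutation formula for \<open>E\<^sup>(\<^sup>c\<^sup>) F\<^sup>(\<^sup>c\<^sup>)\<close> shows that the operators with eigenvalues the quantum binomials of
  \<open>n - 2k\<close> over \<open>c\<close> come from \<open>U\<close>, and they span the projections for every \<open>v \<noteq> 0\<close>.

  Conversely, a map \<open>f\<close> commuting with \<open>U\<close>, applied to one half of \<open>n\<close> nested cups, gives a vector of
  \<open>V\<^sup>\<otimes>\<^sup>2\<^sup>n\<close> killed by all \<open>E\<^sup>(\<^sup>j\<^sup>)\<close>, \<open>j > 0\<close>; it is determined by its coefficients at ballot words, that is, \<open>f\<close>
  is determined by its matrix entries at certain pairs of words.  These pairs also index the Jones normal
  forms, which span the Temperley--Lieb algebra, and the matrix of the normal forms at these entries is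
  triangular with units on the diagonal.  This gives surjectivity and injectivity of the second map.\<close>

text \<open>The field is arbitrary and \<open>v\<close> may be a root of unity, so there is no
  complete reducibility, quantum integers may vanish, and the powers of \<open>K\<close> need not
  separate the weights. Every inversion is therefore a triangular system whose diagonal consists of
  signs and powers of \<open>v\<close>, and no dimensions are compared.

  For the same reason the divided powers are first given as operators on words, by recursions that
  contain only powers of \<open>v\<close> and make sense over every field. Over the rational
  functions at \<open>qt\<close> they are the generic action; at \<open>v\<close> they are its
  specialization, because both obey the same recursion.

  The rules of \<open>NF\<close> originate in matrix entries. A descending block of generators
  contracts two neighbouring letters of its argument and creates a cup at the right end, so the
  entries of a word ending in such a block reduce to those of a word on one strand fewer. Deleting a
  factor x0 x1 from a ballot word is the same step on the side of the index pairs; this is why the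
  pairs that determine an intertwiner are among those that index normal forms.\<close>

abbreviation lookup where "lookup \<equiv> Poly_Mapping.lookup"
abbreviation keys where "keys \<equiv> Poly_Mapping.keys"
abbreviation single where "single \<equiv> Poly_Mapping.single"

section \<open>Linear extension from words\<close>

lemma poly_mapping_sum_singles:
  fixes m :: "'a \<Rightarrow>\<^sub>0 'b::comm_monoid_add"
  shows "m = (\<Sum>w\<in>keys m. single w (lookup m w))"
  by (rule poly_mapping_eqI) (simp add: lookup_sum lookup_single when_def in_keys_iff)

text \<open>The remainder \<open>m\<close> stays supported in \<open>S\<close>, so inductions over
  tensors of fixed degree or over words in a given alphabet keep that information.\<close>

lemma poly_mapping_single_induct [consumes 1, case_names zero add]:
  fixes m :: "'a \<Rightarrow>\<^sub>0 'b::comm_monoid_add"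
  assumes "keys m \<subseteq> S" and "P 0"
    and step: "\<And>w c m. w \<in> S \<Longrightarrow> keys m \<subseteq> S \<Longrightarrow> P m \<Longrightarrow> P (single w c + m)"
  shows "P m"
proof -
  have "finite A \<Longrightarrow> A \<subseteq> S \<Longrightarrow> keys (\<Sum>w\<in>A. single w (lookup m w)) \<subseteq> S \<and> P (\<Sum>w\<in>A. single w (lookup m w))" for A
  proof (induction A rule: finite_induct)
    case (insert w A)
    have "keys (single w (lookup m w) + (\<Sum>w\<in>A. single w (lookup m w))) \<subseteq> S"
      using keys_add[of "single w (lookup m w)"] insert by (fastforce split: if_splits)
    then show ?case using insert step by auto
  qed (simp add: assms)
  from this[OF finite_keys assms(1)] show ?thesis
    using poly_mapping_sum_singles[of m] by simp
qed

lemma keys_sum_mono: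
  assumes "finite A" "keys m \<subseteq> A" "\<And>w. g w 0 = 0"
  shows "(\<Sum>w\<in>keys m. g w (lookup m w)) = (\<Sum>w\<in>A. g w (lookup m w))"
  by (rule sum.mono_neutral_left) (use assms in \<open>auto simp: in_keys_iff\<close>)

lemma lookup_const_mult [simp]:
  fixes m :: "'m::monoid_add \<Rightarrow>\<^sub>0 'k::field"
  shows "lookup (const c * m) w = c * lookup m w"
  unfolding const_def mult_map_scale_conv_mult[symmetric] by (simp add: map.rep_eq when_def)

lemma const_0 [simp]: "const 0 = 0"
  by (simp add: const_def)

lemma const_1 [simp]: "const 1 = 1"
  by (simp add: const_def)

lemma const_mult: "const (a * b) = const a * const b"
  by (simp add: const_def mult_single)

lemma const_add: "const (a + b) = const a + const b"
  by (simp add: const_def single_add)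

lemma const_minus: "const (- a) = - const a"
  by (simp add: const_def single_uminus)

lemma const_diff: "const (a - b) = const a - const b"
  by (simp add: const_def single_diff)

lemma const_sum: "const (sum f A) = (\<Sum>a\<in>A. const (f a))"
  by (induction A rule: infinite_finite_induct) (auto simp: const_add)

lemma const_single: "const c * single w d = single w (c * d)"
  by (simp add: const_def mult_single)

lemma const_commute:
  fixes m :: "'m::monoid_add \<Rightarrow>\<^sub>0 'k::field"
  shows "m * const c = const c * m"
proof -
  have "keys m \<subseteq> UNIV" by simp
  then show ?thesis
    by (induction m rule: poly_mapping_single_induct)
      (auto simp: const_def mult_single algebra_simps)
qed

text \<open>A constant of its own separates scalars from the noncommutative product: the rules below
  move scalars to the front without touching the order of words.\<close>

definition scl :: "'k \<Rightarrow> ('m::monoid_add \<Rightarrow>\<^sub>0 'k::field) \<Rightarrow> ('m \<Rightarrow>\<^sub>0 'k)" where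
  "scl c x = const c * x"

lemma const_mult_eq_scl: "const c * x = scl c x"
  by (simp add: scl_def)

lemma scl_scl [simp]: "scl a (scl b x) = scl (a * b) x"
  by (simp add: scl_def const_mult mult.assoc)

lemma mult_scl [simp]: "x * scl c y = scl c (x * y)"
  by (simp add: scl_def const_commute flip: mult.assoc)

lemma scl_mult [simp]: "scl c x * y = scl c (x * y)"
  by (simp add: scl_def mult.assoc)

lemma scl_0 [simp]: "scl 0 x = 0" "scl c 0 = 0"
  and scl_1 [simp]: "scl 1 x = x"
  by (auto simp: scl_def)

lemma scl_add: "scl c (x + y) = scl c x + scl c y"
  and scl_diff: "scl c (x - y) = scl c x - scl c y"
  and scl_uminus [simp]: "scl c (- x) = - scl c x"
  and scl_sum: "scl c (sum f A) = (\<Sum>a\<in>A. scl c (f a))"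
  by (auto simp: scl_def algebra_simps sum_distrib_left)

lemma scl_add_left: "scl (a + b) x = scl a x + scl b x"
  and scl_diff_left: "scl (a - b) x = scl a x - scl b x"
  and scl_uminus_left [simp]: "scl (- a) x = - scl a x"
  by (auto simp: scl_def const_add const_minus const_diff algebra_simps)

lemma scl_sum_left: "scl (sum f A) x = (\<Sum>a\<in>A. scl (f a) x)"
  by (simp add: scl_def const_sum sum_distrib_right)

lemma lookup_scl [simp]: "lookup (scl c x) w = c * lookup x w"
  by (simp add: scl_def)

lemma word_append: "word (xs @ ys) = word xs * word ys"
  by (simp add: word_def mult_single plus_free_mon_def)

lemma word_Nil [simp]: "word [] = 1"
  by (simp add: word_def flip: zero_free_mon_def)

lemma word_Cons: "word (x # xs) = word [x] * word xs"
  using word_append[of "[x]" xs] by simp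

lemma lookup_word: "lookup (word xs) (Mon ys) = (if xs = ys then 1 else 0)"
  by (simp add: word_def lookup_single when_def)

lemma single_eq_scl_word: "single w c = scl c (word (letters w))"
  by (simp add: scl_def word_def const_def mult_single)

lemma keys_word [simp]: "keys (word xs :: 'g free_mon \<Rightarrow>\<^sub>0 'k::field) = {Mon xs}"
  by (simp add: word_def)

lemma keys_scl: "keys (scl c m) \<subseteq> keys m" for m :: "'m::monoid_add \<Rightarrow>\<^sub>0 'k::field"
  by (auto simp: in_keys_iff)

lemma free_induct [consumes 1, case_names zero add]:
  fixes m :: "'g free_mon \<Rightarrow>\<^sub>0 'k::field"
  assumes "\<forall>w\<in>keys m. Q (letters w)" and "P 0"
    and "\<And>l c m. Q l \<Longrightarrow> \<forall>w\<in>keys m. Q (letters w) \<Longrightarrow> P m \<Longrightarrow> P (scl c (word l) + m)"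
  shows "P m"
proof -
  have "keys m \<subseteq> {w. Q (letters w)}" using assms(1) by auto
  then show ?thesis
  proof (induction rule: poly_mapping_single_induct)
    case (add w c m)
    show ?case unfolding single_eq_scl_word by (rule assms(3)) (use add in auto)
  qed (rule assms(2))
qed

section \<open>Linear maps, as a predicate on functions\<close>

definition linear_map :: "(('m::monoid_add \<Rightarrow>\<^sub>0 'k::field) \<Rightarrow> ('n::monoid_add \<Rightarrow>\<^sub>0 'k)) \<Rightarrow> bool" where
  "linear_map f \<longleftrightarrow> (\<forall>x y. f (x + y) = f x + f y) \<and> (\<forall>c x. f (scl c x) = scl c (f x))"

lemma linear_mapI:
  assumes "\<And>x y. f (x + y) = f x + f y" "\<And>c x. f (scl c x) = scl c (f x)"
  shows "linear_map f"
  using assms by (auto simp: linear_map_def)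

lemma linear_map_add: "linear_map f \<Longrightarrow> f (x + y) = f x + f y"
  and linear_map_scale: "linear_map f \<Longrightarrow> f (scl c x) = scl c (f x)"
  by (auto simp: linear_map_def)

lemma linear_map_0: "linear_map f \<Longrightarrow> f 0 = 0"
  using linear_map_scale[of f 0 0] by simp

lemma linear_map_uminus: "linear_map f \<Longrightarrow> f (- x) = - f x"
  using linear_map_scale[of f "-1" x] by simp

lemma linear_map_diff: "linear_map f \<Longrightarrow> f (x - y) = f x - f y"
  using linear_map_add[of f x "- y"] by (simp add: linear_map_uminus)

lemma linear_map_sum: "linear_map f \<Longrightarrow> f (sum g A) = (\<Sum>a\<in>A. f (g a))"
  by (induction A rule: infinite_finite_induct) (auto simp: linear_map_0 linear_map_add)

lemmas linear_map_simps = linear_map_add linear_map_scale linear_map_0 linear_map_uminus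
  linear_map_diff linear_map_sum

lemma linear_map_comp: "linear_map f \<Longrightarrow> linear_map g \<Longrightarrow> linear_map (\<lambda>x. f (g x))"
  by (auto simp: linear_map_def)

lemma linear_map_plus: "linear_map f \<Longrightarrow> linear_map g \<Longrightarrow> linear_map (\<lambda>x. f x + g x)"
  by (auto simp: linear_map_def algebra_simps scl_add scl_diff)

lemma linear_map_minus: "linear_map f \<Longrightarrow> linear_map g \<Longrightarrow> linear_map (\<lambda>x. f x - g x)"
  by (auto simp: linear_map_def algebra_simps scl_add scl_diff)

lemma linear_map_const: "linear_map f \<Longrightarrow> linear_map (\<lambda>x. scl c (f x))"
  by (auto simp: linear_map_def algebra_simps scl_add)

lemma linear_map_lmult: "linear_map f \<Longrightarrow> linear_map (\<lambda>x. a * f x)"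
  by (auto simp: linear_map_def algebra_simps scl_add)

lemma linear_map_rmult: "linear_map f \<Longrightarrow> linear_map (\<lambda>x. f x * a)"
  by (auto simp: linear_map_def algebra_simps scl_add scl_diff)

lemma linear_map_id: "linear_map (\<lambda>x. x)"
  by (auto simp: linear_map_def)

lemma linear_map_zero: "linear_map (\<lambda>x. 0)"
  by (auto simp: linear_map_def)

lemma linear_map_of_sum: "(\<And>a. a \<in> A \<Longrightarrow> linear_map (f a)) \<Longrightarrow> linear_map (\<lambda>x. \<Sum>a\<in>A. f a x)"
  by (induction A rule: infinite_finite_induct) (auto simp: linear_map_zero linear_map_plus)

lemma linear_map_neg: "linear_map f \<Longrightarrow> linear_map (\<lambda>x. - f x)"
  by (auto simp: linear_map_def algebra_simps)

lemma linear_map_if: "linear_map f \<Longrightarrow> linear_map g \<Longrightarrow> linear_map (\<lambda>x. if b then f x else g x)"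
  by (cases b) auto

lemmas linear_map_intros = linear_map_if linear_map_plus linear_map_minus linear_map_const
  linear_map_lmult linear_map_rmult linear_map_id linear_map_zero linear_map_of_sum

lemma linear_map_lin_ext: "linear_map (lin_ext \<phi>)"
proof (rule linear_mapI)
  fix x y :: "vbasis free_mon \<Rightarrow>\<^sub>0 'a"
  show "lin_ext \<phi> (x + y) = lin_ext \<phi> x + lin_ext \<phi> y" unfolding lin_ext_def
    by (rule setsum_keys_plus_distrib) (auto simp: const_add algebra_simps)
next
  fix c and x :: "vbasis free_mon \<Rightarrow>\<^sub>0 'a"
  have "lin_ext \<phi> (scl c x) = (\<Sum>w\<in>keys x. const (lookup (scl c x) w) * \<phi> (letters w))"
    unfolding lin_ext_def by (rule keys_sum_mono) (auto simp: keys_scl)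
  then show "lin_ext \<phi> (scl c x) = scl c (lin_ext \<phi> x)"
    by (simp add: lin_ext_def scl_sum const_mult_eq_scl)
qed

lemma lin_ext_word [simp]: "lin_ext \<phi> (word l) = \<phi> l"
  by (simp add: lin_ext_def lookup_word)

lemma linear_map_ext:
  fixes f g :: "('g free_mon \<Rightarrow>\<^sub>0 'k::field) \<Rightarrow> ('h::monoid_add \<Rightarrow>\<^sub>0 'k)"
  assumes "linear_map f" "linear_map g" "\<And>l. f (word l) = g (word l)"
  shows "f m = g m"
proof -
  have "\<forall>w\<in>keys m. True" by simp
  then show ?thesis
    by (induction m rule: free_induct) (use assms in \<open>auto simp: linear_map_simps\<close>)
qed

section \<open>Homogeneous tensors: closure properties and equality tested on words\<close>

lemma tensor_power_zero [simp]: "0 \<in> tensor_power n"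
  and tensor_power_add: "x \<in> tensor_power n \<Longrightarrow> y \<in> tensor_power n \<Longrightarrow> x + y \<in> tensor_power n"
  and tensor_power_scl: "x \<in> tensor_power n \<Longrightarrow> scl c x \<in> tensor_power n"
  using keys_add[of x y] keys_scl[of c x] by (auto simp: tensor_power_def)

lemma tensor_power_word [simp]: "word l \<in> tensor_power n \<longleftrightarrow> length l = n"
  by (simp add: tensor_power_def)

lemma tensor_power_uminus: "x \<in> tensor_power n \<Longrightarrow> - x \<in> tensor_power n"
  by (simp add: tensor_power_def)

lemma tensor_power_diff: "x \<in> tensor_power n \<Longrightarrow> y \<in> tensor_power n \<Longrightarrow> x - y \<in> tensor_power n"
  using tensor_power_add[of x n "- y"] by (simp add: tensor_power_uminus)

lemma tensor_power_sum: "(\<And>a. a \<in> A \<Longrightarrow> f a \<in> tensor_power n) \<Longrightarrow> sum f A \<in> tensor_power n"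
  by (induction A rule: infinite_finite_induct) (auto simp: tensor_power_add)

lemma tensor_power_mult: "x \<in> tensor_power m \<Longrightarrow> y \<in> tensor_power n \<Longrightarrow> x * y \<in> tensor_power (m + n)"
  using keys_mult[of x y] by (fastforce simp: tensor_power_def plus_free_mon_def)

lemma tensor_power_1: "1 \<in> tensor_power 0"
  using tensor_power_word[of "[]" 0] by (simp del: tensor_power_word)

lemmas tensor_power_intros = tensor_power_add tensor_power_scl tensor_power_uminus
  tensor_power_diff tensor_power_sum

lemma tensor_induct [consumes 1, case_names zero add]:
  fixes m :: "'k::field tensors"
  assumes "m \<in> tensor_power n" and "P 0"
    and "\<And>l c m. length l = n \<Longrightarrow> m \<in> tensor_power n \<Longrightarrow> P m \<Longrightarrow> P (scl c (word l) + m)"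
  shows "P m"
proof -
  have "\<forall>w\<in>keys m. length (letters w) = n" using assms(1) by (simp add: tensor_power_def)
  then show ?thesis
    by (induction rule: free_induct) (use assms in \<open>auto simp: tensor_power_def\<close>)
qed

lemma linear_map_eq_on_words:
  assumes "linear_map f" "linear_map g" "m \<in> tensor_power n"
    and "\<And>l. length l = n \<Longrightarrow> f (word l) = g (word l)"
  shows "f m = g m"
  using assms(3)
  by (induction rule: tensor_induct) (use assms in \<open>auto simp: linear_map_simps\<close>)

lemma linear_map_in_on_words:
  assumes "linear_map f" "m \<in> tensor_power n"
    and "\<And>l. length l = n \<Longrightarrow> f (word l) \<in> tensor_power k"
  shows "f m \<in> tensor_power k"
  using assms(2)
  by (induction rule: tensor_induct) (use assms in \<open>auto simp: linear_map_simps tensor_power_intros\<close>)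

lemma lookup_word_mult: "lookup (word p * y) (Mon l) =
    (if take (length p) l = p then lookup y (Mon (drop (length p) l)) else 0)"
  for y :: "'g free_mon \<Rightarrow>\<^sub>0 'k::field"
proof -
  have "\<forall>w\<in>keys y. True" by simp
  then show ?thesis
  proof (induction y rule: free_induct)
    case (add q c m)
    have "lookup (word p * word q :: 'g free_mon \<Rightarrow>\<^sub>0 'k) (Mon l) =
        (if take (length p) l = p then lookup (word q) (Mon (drop (length p) l)) else 0)"
      using append_eq_conv_conj[of p q l] by (auto simp: lookup_word simp flip: word_append)
    with add show ?case by (simp add: algebra_simps lookup_add)
  qed simp
qed

lemma lookup_mult_word: "lookup (y * word q) (Mon l) =
    (if \<exists>p. l = p @ q then lookup y (Mon (take (length l - length q) l)) else 0)"
  for y :: "'g free_mon \<Rightarrow>\<^sub>0 'k::field"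
proof -
  have "\<forall>w\<in>keys y. True" by simp
  then show ?thesis
  proof (induction y rule: free_induct)
    case (add p c m)
    have "lookup (word p * word q :: 'g free_mon \<Rightarrow>\<^sub>0 'k) (Mon l) =
        (if \<exists>p. l = p @ q then lookup (word p) (Mon (take (length l - length q) l)) else 0)"
    proof (cases "\<exists>p. l = p @ q")
      case True
      then show ?thesis by (auto simp: lookup_word simp flip: word_append)
    next
      case False
      then have "p @ q \<noteq> l" by blast
      with False show ?thesis by (simp add: lookup_word flip: word_append)
    qed
    with add show ?case by (simp add: algebra_simps lookup_add)
  qed simp
qed

lemma tensor_eqI:
  assumes "x \<in> tensor_power n" "y \<in> tensor_power n"
    and "\<And>l. length l = n \<Longrightarrow> lookup x (Mon l) = lookup y (Mon l)"
  shows "x = y"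
proof (rule poly_mapping_eqI)
  fix w
  show "lookup x w = lookup y w"
  proof (cases "length (letters w) = n")
    case True
    then show ?thesis using assms(3)[of "letters w"] by simp
  next
    case False
    then have "w \<notin> keys x" "w \<notin> keys y" using assms by (auto simp: tensor_power_def)
    then show ?thesis by (simp add: in_keys_iff)
  qed
qed

section \<open>Divided powers and Temperley--Lieb operators on words\<close>

declare power_int_of_nat [simp del]

fun hgt :: "vbasis list \<Rightarrow> int" where
  "hgt [] = 0"
| "hgt (X0 # l) = hgt l + 1"
| "hgt (X1 # l) = hgt l - 1"

text \<open>The operators \<open>E\<^sup>(\<^sup>j\<^sup>)\<close>, \<open>F\<^sup>(\<^sup>j\<^sup>)\<close> and \<open>K\<^sup>i\<close>; the recursions come from the coproducts of the
  divided powers, in which at most the first divided power survives on the first tensor factor.\<close>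

fun Ew :: "'k::field \<Rightarrow> nat \<Rightarrow> vbasis list \<Rightarrow> 'k tensors" where
  "Ew v j [] = (if j = 0 then 1 else 0)"
| "Ew v j (X0 # l) = scl (v powi int j) (word [X0] * Ew v j l)"
| "Ew v j (X1 # l) = scl (v powi (- int j)) (word [X1] * Ew v j l)
     + (if j = 0 then 0 else word [X0] * Ew v (j - 1) l)"

fun Fw :: "'k::field \<Rightarrow> nat \<Rightarrow> vbasis list \<Rightarrow> 'k tensors" where
  "Fw v j [] = (if j = 0 then 1 else 0)"
| "Fw v j (X1 # l) = word [X1] * Fw v j l"
| "Fw v j (X0 # l) = word [X0] * Fw v j l
     + (if j = 0 then 0 else scl (v powi (int j - 1 - hgt l)) (word [X1] * Fw v (j - 1) l))"

definition Eop :: "'k::field \<Rightarrow> nat \<Rightarrow> 'k tensors \<Rightarrow> 'k tensors" where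
  "Eop v j = lin_ext (Ew v j)"

definition Fop :: "'k::field \<Rightarrow> nat \<Rightarrow> 'k tensors \<Rightarrow> 'k tensors" where
  "Fop v j = lin_ext (Fw v j)"

definition Kop :: "'k::field \<Rightarrow> int \<Rightarrow> 'k tensors \<Rightarrow> 'k tensors" where
  "Kop v i = lin_ext (\<lambda>l. scl (v powi (i * hgt l)) (word l))"

lemma linear_map_Eop [intro, simp]: "linear_map (Eop v j)"
  and linear_map_Fop [intro, simp]: "linear_map (Fop v j)"
  and linear_map_Kop [intro, simp]: "linear_map (Kop v i)"
  and linear_map_TL [intro, simp]: "linear_map (TL_gen_op v s k)"
  by (auto simp: Eop_def Fop_def Kop_def TL_gen_op_def linear_map_lin_ext)

lemma op_zero [simp]: "Eop v j 0 = 0" "Fop v j 0 = 0" "Kop v i 0 = 0" "TL_gen_op v s k 0 = 0"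
  by (auto intro: linear_map_0)

lemma linear_map_op_comp [intro]:
  assumes "linear_map f"
  shows "linear_map (\<lambda>x. Eop v j (f x))" "linear_map (\<lambda>x. Fop v j (f x))"
    "linear_map (\<lambda>x. Kop v i (f x))" "linear_map (\<lambda>x. TL_gen_op v s k (f x))"
  using assms by (auto intro: linear_map_comp)

lemmas linear_map_op_intros = linear_map_intros linear_map_op_comp

lemma Eop_word [simp]: "Eop v j (word l) = Ew v j l"
  and Fop_word [simp]: "Fop v j (word l) = Fw v j l"
  and Kop_word [simp]: "Kop v i (word l) = scl (v powi (i * hgt l)) (word l)"
  by (auto simp: Eop_def Fop_def Kop_def)

lemma Eop_1 [simp]: "Eop v j 1 = (if j = 0 then 1 else 0)"
  and Fop_1 [simp]: "Fop v j 1 = (if j = 0 then 1 else 0)"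
  and Kop_1 [simp]: "Kop v i 1 = 1"
  using Eop_word[of v j "[]"] Fop_word[of v j "[]"] Kop_word[of v i "[]"] by auto

lemma Eop_X0: "Eop v j (word [X0] * y) = scl (v powi int j) (word [X0] * Eop v j y)"
  by (rule linear_map_ext[of _ _ y]) (auto intro!: linear_map_op_intros simp flip: word_Cons)

lemma Eop_X1: "Eop v j (word [X1] * y) = scl (v powi (- int j)) (word [X1] * Eop v j y)
     + (if j = 0 then 0 else word [X0] * Eop v (j - 1) y)"
  by (rule linear_map_ext[of _ _ y]) (auto intro!: linear_map_op_intros simp flip: word_Cons)

lemma Kop_X0: "Kop v i (word [X0] * y) = scl (v powi i) (word [X0] * Kop v i y)" if "v \<noteq> 0"
  by (rule linear_map_ext[of _ _ y])
    (auto intro!: linear_map_op_intros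
      simp: that power_int_add algebra_simps simp flip: word_Cons)

lemma Kop_X1: "Kop v i (word [X1] * y) = scl (v powi (- i)) (word [X1] * Kop v i y)" if "v \<noteq> 0"
  by (rule linear_map_ext[of _ _ y])
    (auto intro!: linear_map_op_intros
      simp: that algebra_simps simp flip: word_Cons power_int_add)

lemma Fop_X1: "Fop v j (word [X1] * y) = word [X1] * Fop v j y"
  by (rule linear_map_ext[of _ _ y]) (auto intro!: linear_map_op_intros simp flip: word_Cons)

text \<open>The coproduct puts \<open>K^-1\<close> to the left of \<open>F^(j-1)\<close> with
  coefficient v^(1-j). Here it acts first, and moving it there multiplies by v^(2j-2); this gives
  the exponent \<open>int j - 1\<close>.\<close>

lemma Fop_X0: "Fop v j (word [X0] * y) = word [X0] * Fop v j y
     + (if j = 0 then 0 else scl (v powi (int j - 1)) (word [X1] * Fop v (j - 1) (Kop v (- 1) y)))"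
  if "v \<noteq> 0"
  by (rule linear_map_ext[of _ _ y])
    (auto intro!: linear_map_op_intros simp: linear_map_simps that simp flip: word_Cons power_int_add)

lemma Ew_0 [simp]: "Ew v 0 l = word l"
  by (induction l rule: hgt.induct) (auto simp flip: word_Cons)

lemma Fw_0 [simp]: "Fw v 0 l = word l"
  by (induction l rule: hgt.induct) (auto simp flip: word_Cons)

lemma Eop_0 [simp]: "Eop v 0 y = y"
  by (rule linear_map_ext[of _ _ y]) (auto intro!: linear_map_op_intros)

lemma Fop_0 [simp]: "Fop v 0 y = y"
  by (rule linear_map_ext[of _ _ y]) (auto intro!: linear_map_op_intros)

lemma Kop_0 [simp]: "Kop v 0 y = y"
  by (rule linear_map_ext[of _ _ y]) (auto intro!: linear_map_op_intros)

lemma Kop_Kop: "Kop v i (Kop v j y) = Kop v (i + j) y" if "v \<noteq> 0"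
  by (rule linear_map_ext[of _ _ y])
    (auto intro!: linear_map_op_intros simp: linear_map_simps that algebra_simps simp flip: power_int_add)

lemma hgt_append [simp]: "hgt (p @ q) = hgt p + hgt q"
  by (induction p rule: hgt.induct) auto

lemma Kop_mult: "Kop v i (x * y) = Kop v i x * Kop v i y" if "v \<noteq> 0"
proof (rule linear_map_ext[of _ _ x])
  fix l
  show "Kop v i (word l * y) = Kop v i (word l) * Kop v i y"
    by (rule linear_map_ext[of _ _ y])
      (auto intro!: linear_map_op_intros simp: that algebra_simps
         simp flip: word_append power_int_add)
qed (auto intro!: linear_map_op_intros)

lemma Kop_Eop: "Kop v i (Eop v j y) = scl (v powi (2 * i * int j)) (Eop v j (Kop v i y))" if "v \<noteq> 0"
proof (rule linear_map_ext[of _ _ y])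
  fix l
  show "Kop v i (Eop v j (word l)) = scl (v powi (2 * i * int j)) (Eop v j (Kop v i (word l)))"
  proof (induction l arbitrary: j rule: hgt.induct)
    case (2 l)
    have "Kop v i (Ew v j l) = scl (v powi (2 * i * int j)) (Eop v j (Kop v i (word l)))"
      using 2 by simp
    then show ?case
      by (simp add: linear_map_simps Kop_X0 that algebra_simps flip: power_int_add)
  next
    case (3 l)
    have "Kop v i (Ew v j l) = scl (v powi (2 * i * int j)) (Eop v j (Kop v i (word l)))" for j
      using 3 by simp
    then show ?case
      by (cases j) (simp_all add: linear_map_simps Kop_X0 Kop_X1 that scl_add algebra_simps flip: power_int_add word_Cons)
  qed (auto simp: linear_map_simps)
qed (auto intro!: linear_map_op_intros)

lemma Kop_Fop: "Kop v i (Fop v j y) = scl (v powi (- 2 * i * int j)) (Fop v j (Kop v i y))" if "v \<noteq> 0"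
proof (rule linear_map_ext[of _ _ y])
  fix l
  show "Kop v i (Fop v j (word l)) = scl (v powi (- 2 * i * int j)) (Fop v j (Kop v i (word l)))"
  proof (induction l arbitrary: j rule: hgt.induct)
    case (3 l)
    have "Kop v i (Fw v j l) = scl (v powi (- 2 * i * int j)) (Fop v j (Kop v i (word l)))" for j
      using 3 by simp
    then show ?case
      by (simp add: linear_map_simps Kop_X1 that algebra_simps flip: power_int_add)
  next
    case (2 l)
    have "Kop v i (Fw v j l) = scl (v powi (- 2 * i * int j)) (Fop v j (Kop v i (word l)))" for j
      using 2 by simp
    then show ?case
      by (cases j) (simp_all add: linear_map_simps Kop_X0 Kop_X1 that scl_add algebra_simps flip: power_int_add word_Cons)
  qed (auto simp: linear_map_simps)
qed (auto intro!: linear_map_op_intros)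

section \<open>Coproducts of the divided powers\<close>

lemma sum_atMost_pred: "(\<Sum>i\<le>Suc j. if i = 0 then 0 else f (i - 1)) = (\<Sum>i\<le>j. f i)"
  for f :: "nat \<Rightarrow> 'a::comm_monoid_add"
  by (subst sum.atMost_Suc_shift) simp

text \<open>This is the coproduct of \<open>E^(j)\<close>. It is proved by peeling letters off the
  left factor: for one letter it is the recursion that defines \<open>Ew\<close>, and both sides
  obey that recursion.\<close>

lemma Eop_mult:
  assumes "v \<noteq> 0"
  shows "Eop v j (x * y) = (\<Sum>i\<le>j. scl (v powi (int i * int (j - i))) (Eop v i (Kop v (int (j - i)) x) * Eop v (j - i) y))"
proof (rule linear_map_ext[of _ _ x])
  fix p
  show "Eop v j (word p * y) = (\<Sum>i\<le>j. scl (v powi (int i * int (j - i))) (Eop v i (Kop v (int (j - i)) (word p)) * Eop v (j - i) y))"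
  proof (induction p arbitrary: j rule: hgt.induct)
    case 1
    have "(\<Sum>i\<le>j. scl (v powi (int i * int (j - i))) (Eop v i (Kop v (int (j - i)) (word [])) * Eop v (j - i) y)) =
      (\<Sum>i\<le>j. if i = 0 then Eop v j y else 0)"
      by (intro sum.cong) auto
    then show ?case by simp
  next
    case (2 p)
    show ?case unfolding word_Cons[of X0 p] mult.assoc Eop_X0 2 sum_distrib_left scl_sum
      by (rule sum.cong) (use assms in \<open>simp_all add: Kop_X0 Eop_X0 linear_map_simps
         algebra_simps of_nat_diff flip: power_int_add\<close>)
  next
    case (3 p)
    let ?t = "\<lambda>j i. scl (v powi (int i * int (j - i))) (Eop v i (Kop v (int (j - i)) (word p)) * Eop v (j - i) y)"
    let ?r = "\<lambda>i. scl (v powi (int i * int (j - i))) (Eop v i (Kop v (int (j - i)) (word [X1] * word p)) * Eop v (j - i) y)"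
    \<comment> \<open>The first letter x1 either stays or is raised to x0. In the second case one
      \<open>E\<close> is used up, so \<open>i - 1\<close> of the remaining \<open>j - 1\<close> act
      on \<open>p\<close>.\<close>
    have *: "?r i = scl (v powi (- int j)) (word [X1] * ?t j i)
       + (if i = 0 then 0 else word [X0] * ?t (j - 1) (i - 1))" if "i \<le> j" for i
      using that assms
      by (cases i) (simp_all add: Kop_X1 Eop_X1 linear_map_simps scl_add
         algebra_simps of_nat_diff flip: power_int_add)
    have "(\<Sum>i\<le>j. ?r i) = scl (v powi (- int j)) (word [X1] * (\<Sum>i\<le>j. ?t j i))
       + (\<Sum>i\<le>j. if i = 0 then 0 else word [X0] * ?t (j - 1) (i - 1))"
      using * by (simp add: sum.distrib sum_distrib_left scl_sum)
    also have "(\<Sum>i\<le>j. if i = 0 then 0 else word [X0] * ?t (j - 1) (i - 1)) =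
        (if j = 0 then 0 else word [X0] * (\<Sum>i\<le>j - 1. ?t (j - 1) i))"
      by (cases j) (auto simp: sum_atMost_pred[of "\<lambda>i. word [X0] * ?t (j - 1) i"] sum_distrib_left scl_sum
         simp del: sum.atMost_Suc)
    finally show ?case unfolding word_Cons[of X1 p] mult.assoc[of "word [X1]"] Eop_X1
      using 3[of j] 3[of "j - 1"] by simp
  qed
qed (auto intro!: linear_map_op_intros)

lemma Fop_mult:
  assumes "v \<noteq> 0"
  shows "Fop v j (x * y) = (\<Sum>i\<le>j. scl (v powi (- int i * int (j - i))) (Fop v i x * Kop v (- int i) (Fop v (j - i) y)))"
proof (rule linear_map_ext[of _ _ x])
  fix p
  show "Fop v j (word p * y) = (\<Sum>i\<le>j. scl (v powi (- int i * int (j - i))) (Fop v i (word p) * Kop v (- int i) (Fop v (j - i) y)))"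
  \<comment> \<open>\<open>y\<close> must vary: by \<open>Fop_X0\<close>, lowering a letter x0
    applies \<open>K^-1\<close> to everything on its right, including \<open>y\<close>.\<close>
  proof (induction p arbitrary: j y rule: hgt.induct)
    case 1
    have "(\<Sum>i\<le>j. scl (v powi (- int i * int (j - i))) (Fop v i (word []) * Kop v (- int i) (Fop v (j - i) y))) =
      (\<Sum>i\<le>j. if i = 0 then Fop v j y else 0)"
      by (intro sum.cong) auto
    then show ?case by simp
  next
    case (3 p)
    show ?case unfolding word_Cons[of X1 p] mult.assoc Fop_X1 3 sum_distrib_left scl_sum
      by (rule sum.cong) simp_all
  next
    case (2 p)
    let ?t = "\<lambda>j i. scl (v powi (- int i * int (j - i))) (Fop v i (word p) * Kop v (- int i) (Fop v (j - i) y))"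
    let ?t' = "\<lambda>j i. scl (v powi (- int i * int (j - i))) (Fop v i (Kop v (- 1) (word p)) * Kop v (- int i) (Fop v (j - i) (Kop v (- 1) y)))"
    let ?r = "\<lambda>i. scl (v powi (- int i * int (j - i))) (Fop v i (word [X0] * word p) * Kop v (- int i) (Fop v (j - i) y))"
    have *: "?r i = word [X0] * ?t j i
       + (if i = 0 then 0 else scl (v powi (int j - 1)) (word [X1] * ?t' (j - 1) (i - 1)))"
      if ij: "i \<le> j" for i
    proof (cases i)
      case (Suc k)
      have K: "Kop v (- 1 - int k) (Fop v (j - Suc k) y) =
        scl (v powi (2 * int (j - Suc k))) (Kop v (- int k) (Fop v (j - Suc k) (Kop v (- 1) y)))"
        using assms by (simp add: Kop_Fop linear_map_simps Kop_Kop algebra_simps flip: power_int_add)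
      show ?thesis using Suc ij assms K
        by (simp add: Fop_X0 linear_map_simps scl_add
           algebra_simps of_nat_diff flip: power_int_add)
    qed (use assms in \<open>simp add: linear_map_simps mult.assoc\<close>)
    have "(\<Sum>i\<le>j. ?r i) = word [X0] * (\<Sum>i\<le>j. ?t j i)
       + (\<Sum>i\<le>j. if i = 0 then 0 else scl (v powi (int j - 1)) (word [X1] * ?t' (j - 1) (i - 1)))"
      using * by (simp add: sum.distrib sum_distrib_left scl_sum)
    also have "(\<Sum>i\<le>j. if i = 0 then 0 else scl (v powi (int j - 1)) (word [X1] * ?t' (j - 1) (i - 1))) =
        (if j = 0 then 0 else scl (v powi (int j - 1)) (word [X1] * (\<Sum>i\<le>j - 1. ?t' (j - 1) i)))"
      by (cases j) (auto simp: sum_atMost_pred[of "\<lambda>i. scl (v powi (int j - 1)) (word [X1] * ?t' (j - 1) i)"]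
         sum_distrib_left scl_sum simp del: sum.atMost_Suc)
    also have "(\<Sum>i\<le>j - 1. ?t' (j - 1) i) = Fop v (j - 1) (Kop v (- 1) (word p * y))"
      using assms 2[of "j - 1" "Kop v (- 1) y"]
      by (simp add: Kop_mult linear_map_simps sum_distrib_left scl_sum mult.commute[of "v powi (- hgt p)"])
    finally show ?case unfolding word_Cons[of X0 p] mult.assoc[of "word [X0]"] Fop_X0[OF assms]
      using 2[of j y] by simp
  qed
qed (use assms in \<open>auto intro!: linear_map_op_intros\<close>)

section \<open>Cups, caps and the Temperley-Lieb relations on tensors\<close>

lemma field_cancel:
  fixes v :: "'k::field"
  assumes "v \<noteq> 0"
  shows "inverse v * (v * x) = x" "v * (inverse v * x) = x" "inverse v * (x * v) = x" "v * (x * inverse v) = x"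
  using assms by (auto simp: field_simps)

text \<open>\<open>xi\<close> has rank one (\<open>xi_eq\<close>): it is the cap functional
  \<open>cap\<close> followed by the cup vector \<open>uvec\<close>. The computations with the e_i
  below are computations with cups and caps.\<close>

definition uvec :: "'k::field \<Rightarrow> 'k tensors" where
  "uvec v = scl (inverse v) (word [X0, X1]) - word [X1, X0]"

fun cap :: "'k::field \<Rightarrow> vbasis \<Rightarrow> vbasis \<Rightarrow> 'k" where
  "cap v X0 X1 = 1"
| "cap v X1 X0 = - v"
| "cap v a b = 0"

lemma xi_eq: "v \<noteq> 0 \<Longrightarrow> xi v a b = scl (cap v a b) (uvec v)"
  by (cases a; cases b) (auto simp: uvec_def const_mult_eq_scl scl_diff)

lemma uvec_mult: "uvec v * y = scl (inverse v) (word [X0] * (word [X1] * y)) - word [X1] * (word [X0] * y)"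
  by (simp add: uvec_def word_Cons[of _ "[_]"] algebra_simps)

lemma uvec_tensor: "uvec v \<in> tensor_power 2"
  by (auto simp: uvec_def intro!: tensor_power_intros)

text \<open>The bound on \<open>i\<close> matters: \<open>TL_gen_op\<close> reads the letters at
  list positions \<open>i - 1\<close> and \<open>i\<close>, which coincide for
  \<open>i = 0\<close>.\<close>

lemma TL_shift:
  assumes "1 \<le> i"
  shows "TL_gen_op v s (length p + i) (word p * y) = word p * TL_gen_op v s i y"
proof (rule linear_map_ext[of _ _ y])
  fix l
  obtain k where "i = Suc k" using assms by (cases i) auto
  then show "TL_gen_op v s (length p + i) (word p * word l) = word p * TL_gen_op v s i (word l)"
    unfolding word_append[symmetric] TL_gen_op_def lin_ext_word
    by (simp add: nth_append word_append mult.assoc)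
qed (auto intro!: linear_map_op_intros)

lemma TL_shift1:
  assumes "1 \<le> i"
  shows "TL_gen_op v s (Suc i) (word [a] * y) = word [a] * TL_gen_op v s i y"
  using TL_shift[OF assms, of v s "[a]" y] by simp

lemma TL_1:
  assumes "v \<noteq> 0"
  shows "TL_gen_op v s (Suc 0) (word [a] * (word [b] * y)) = scl (s * cap v a b) (uvec v * y)"
proof (rule linear_map_ext[of _ _ y])
  fix l
  show "TL_gen_op v s (Suc 0) (word [a] * (word [b] * word l)) = scl (s * cap v a b) (uvec v * word l)"
    unfolding word_append[symmetric] TL_gen_op_def lin_ext_word
    by (simp add: xi_eq[OF assms] const_mult_eq_scl mult.commute)
qed (auto intro!: linear_map_op_intros)

lemma TL_at:
  assumes "v \<noteq> 0"
  shows "TL_gen_op v s (Suc (length p)) (word p * (word [a] * (word [b] * y))) =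
    scl (s * cap v a b) (word p * (uvec v * y))"
  using TL_shift[of 1 v s p "word [a] * (word [b] * y)"] by (simp add: TL_1 assms)

text \<open>A closed loop: the cap functional takes the value \<open>v + inverse v\<close> on the
  cup vector.\<close>

lemma TL_1_uvec:
  assumes "v \<noteq> 0"
  shows "TL_gen_op v s (Suc 0) (uvec v * y) = scl (s * (v + inverse v)) (uvec v * y)"
  unfolding uvec_mult[of v y]
  by (simp add: linear_map_simps TL_1 assms uvec_mult algebra_simps scl_diff scl_add_left)

text \<open>Zigzag identity: a cup followed by a cap on the neighbouring pair of strands
  straightens, at the cost of the sign \<open>- 1\<close> and the factor \<open>s\<close>.
  \<open>TL_1_X_uvec\<close> is its mirror image.\<close>

lemma TL_2_uvec:
  assumes "v \<noteq> 0"
  shows "TL_gen_op v s (Suc (Suc 0)) (uvec v * (word [a] * y)) = scl (- s) (word [a] * (uvec v * y))"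
  unfolding uvec_mult[of v "word [a] * y"]
  by (cases a) (simp_all add: linear_map_simps TL_shift1 TL_1 assms field_cancel)

lemma TL_1_X_uvec:
  fixes v :: "'k::field"
  assumes "v \<noteq> 0"
  shows "TL_gen_op v s (Suc 0) (word [a] * (uvec v * y)) = scl (- s) (uvec v * (word [a] * y))"
proof (cases a)
  case X0
  with X0 show ?thesis unfolding uvec_mult[of v y]
    by (simp add: linear_map_simps TL_1 assms algebra_simps)
next
  case X1
  then show ?thesis unfolding uvec_mult[of v y]
    by (simp add: linear_map_simps TL_1 assms field_cancel right_diff_distrib)
qed

lemma list_split_at:
  assumes "k < length l"
  obtains p a q where "l = p @ a # q" "length p = k"
  using assms id_take_nth_drop[of k l] by (metis length_take min.absorb4)

lemma list_split_at2:
  assumes "Suc k < length l"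
  obtains p a b q where "l = p @ a # b # q" "length p = k"
proof -
  obtain p a q where *: "l = p @ a # q" "length p = k" using assms list_split_at[of k l] by auto
  with assms obtain b q' where "q = b # q'" by (cases q) auto
  with * that show ?thesis by blast
qed

lemma list_split_TL:
  assumes "1 \<le> i" "i < length l"
  obtains p a b q where "l = p @ a # b # q" "i = Suc (length p)"
  by (rule list_split_at2[of "i - 1" l]) (use assms that in auto)

lemma TL_word:
  assumes "v \<noteq> 0"
  shows "TL_gen_op v s (Suc (length p)) (word (p @ a # b # q)) = scl (s * cap v a b) (word p * (uvec v * word q))"
  using TL_at[OF assms, of s p a b "word q"] by (simp flip: word_append word_Cons)

lemma TL_tensor_power:
  assumes "v \<noteq> 0" "m \<in> tensor_power n" "1 \<le> i" "i < n"
  shows "TL_gen_op v s i m \<in> tensor_power n"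
proof (rule linear_map_in_on_words[OF _ assms(2)])
  fix l :: "vbasis list" assume l: "length l = n"
  obtain p a b q where *: "l = p @ a # b # q" "i = Suc (length p)"
    by (rule list_split_TL[of i l]) (use assms l in auto)
  then have "TL_gen_op v s i (word l) = scl (s * cap v a b) (word p * (uvec v * word q))"
    using TL_word[OF assms(1), of s p] assms by simp
  moreover have "word p * (uvec v * word q) \<in> tensor_power (length p + (2 + length q))"
    by (intro tensor_power_mult uvec_tensor) auto
  ultimately show "TL_gen_op v s i (word l) \<in> tensor_power n"
    using * l by (auto intro!: tensor_power_scl)
qed auto

lemma TL_right:
  assumes "v \<noteq> 0" "y \<in> tensor_power k" "1 \<le> i" "i < k"
  shows "TL_gen_op v s i (y * z) = TL_gen_op v s i y * z"
proof (rule linear_map_eq_on_words[OF _ _ assms(2)])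
  fix l :: "vbasis list" assume l: "length l = k"
  obtain p a b q where *: "l = p @ a # b # q" "i = Suc (length p)"
    by (rule list_split_TL[of i l]) (use assms l in auto)
  have "word l * z = word p * (word [a] * (word [b] * (word q * z)))"
    unfolding * word_append word_Cons[of a "b # q"] word_Cons[of b q] by (simp add: mult.assoc)
  then show "TL_gen_op v s i (word l * z) = TL_gen_op v s i (word l) * z"
    using * TL_at[OF assms(1), of s p a b "word q * z"] TL_word[OF assms(1), of s p a b q] assms
    by (simp add: mult.assoc)
qed (auto intro!: linear_map_op_intros)

lemma TL_square:
  assumes "v \<noteq> 0" "m \<in> tensor_power n" "1 \<le> i" "i < n"
  shows "TL_gen_op v s i (TL_gen_op v s i m) = scl (s * (v + inverse v)) (TL_gen_op v s i m)"
proof (rule linear_map_eq_on_words[OF _ _ assms(2)])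
  fix l :: "vbasis list" assume l: "length l = n"
  obtain p a b q where *: "l = p @ a # b # q" "i = Suc (length p)"
    by (rule list_split_TL[of i l]) (use assms l in auto)
  then have i: "i = length p + 1" using assms by simp
  show "TL_gen_op v s i (TL_gen_op v s i (word l)) = scl (s * (v + inverse v)) (TL_gen_op v s i (word l))"
    using TL_shift[of 1 v s p "uvec v * word q"]
    by (simp add: i * TL_word assms linear_map_simps TL_1_uvec mult.commute mult.left_commute)
qed (auto intro!: linear_map_op_intros)

text \<open>The first operator creates a cup and the other two are zigzags, whose factors
  \<open>- s\<close> multiply to 1.\<close>

lemma TL_braid:
  assumes "v \<noteq> 0" "s * s = 1" "m \<in> tensor_power n" "1 \<le> i" "Suc i < n"
  shows "TL_gen_op v s i (TL_gen_op v s (Suc i) (TL_gen_op v s i m)) = TL_gen_op v s i m" (is ?A)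
    and "TL_gen_op v s (Suc i) (TL_gen_op v s i (TL_gen_op v s (Suc i) m)) = TL_gen_op v s (Suc i) m" (is ?B)
proof -
  have main: "TL_gen_op v s i (TL_gen_op v s (Suc i) (TL_gen_op v s i (word l))) = TL_gen_op v s i (word l) \<and>
      TL_gen_op v s (Suc i) (TL_gen_op v s i (TL_gen_op v s (Suc i) (word l))) = TL_gen_op v s (Suc i) (word l)"
    if l: "length l = n" for l
  proof -
    obtain p a b q where *: "l = p @ a # b # q" "i = Suc (length p)"
    by (rule list_split_TL[of i l]) (use assms l in auto)
    with l assms obtain c r where q: "q = c # r" by (cases q) auto
    have A: "word l = word p * (word [a] * (word [b] * (word [c] * word r)))"
      by (simp add: * q flip: word_append word_Cons)
    have P: "TL_gen_op v s (Suc (length p)) (word p * z) = word p * TL_gen_op v s (Suc 0) z"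
       "TL_gen_op v s (Suc (Suc (length p))) (word p * z) = word p * TL_gen_op v s (Suc (Suc 0)) z" for z
      using TL_shift[of 1 v s p z] TL_shift[of 2 v s p z] by (auto simp: numeral_2_eq_2)
    have s: "s * (s * x) = x" "s * (x * s) = x" "x * s * s = x" for x using assms(2) by (metis mult.assoc mult.commute mult_1)+
    show ?thesis
      by (simp add: A *(2) P TL_1 TL_shift1 linear_map_scale TL_2_uvec TL_1_X_uvec assms(1) s linear_map_uminus)
  qed
  show ?A ?B
    by (rule linear_map_eq_on_words[OF _ _ assms(3)], auto intro!: linear_map_op_intros simp: main)+
qed

lemma TL_commute:
  assumes "v \<noteq> 0" "m \<in> tensor_power n" "1 \<le> i" "Suc i < j" "j < n"
  shows "TL_gen_op v s i (TL_gen_op v s j m) = TL_gen_op v s j (TL_gen_op v s i m)"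
proof (rule linear_map_eq_on_words[OF _ _ assms(2)])
  fix l :: "vbasis list" assume l: "length l = n"
  obtain p a b q where *: "l = p @ a # b # q" "i = Suc (length p)"
    by (rule list_split_TL[of i l]) (use assms l in auto)
  have i: "i = length p + 1" using * assms by simp
  obtain k where k: "j = length p + (2 + k)" "1 \<le> k"
    using assms i by (metis add.assoc add_2_eq_Suc' less_iff_Suc_add One_nat_def Suc_eq_plus1 add_Suc_right le_add2)
  have S: "TL_gen_op v s (2 + k) (word [x] * (word [y] * z)) = word [x] * (word [y] * TL_gen_op v s k z)" for x y z
    using TL_shift[of k v s "[x, y]" z] k by (simp add: word_Cons[of x "[y]"] mult.assoc)
  have S': "TL_gen_op v s (2 + k) (uvec v * z) = uvec v * TL_gen_op v s k z" for z
    using S by (simp add: uvec_mult linear_map_simps)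
  have A: "word l = word p * (word [a] * (word [b] * word q))"
    by (simp add: * flip: word_append word_Cons)
  have 1: "TL_gen_op v s j (word p * z) = word p * TL_gen_op v s (2 + k) z"
   and 2: "TL_gen_op v s i (word p * z) = word p * TL_gen_op v s (Suc 0) z" for z
    using TL_shift[of "2 + k" v s p z] TL_shift[of 1 v s p z] k i by auto
  show "TL_gen_op v s i (TL_gen_op v s j (word l)) = TL_gen_op v s j (TL_gen_op v s i (word l))"
    unfolding A 1 2 S TL_1[OF assms(1)] linear_map_scale[OF linear_map_TL] S' by simp
qed (auto intro!: linear_map_op_intros)

section \<open>The quantum group commutes with the Temperley-Lieb operators\<close>

lemma Eop_uvec: "Eop v j (uvec v * y) = uvec v * Eop v j y" if "v \<noteq> 0"
proof (cases j)
  case (Suc k)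
  then show ?thesis unfolding uvec_mult
    by (simp add: linear_map_simps Eop_X0 Eop_X1 scl_add algebra_simps power_int_add_1 that flip: power_int_add)
       (simp add: that power_int_add power_int_diff power_int_minus field_simps)
qed auto

lemma Fop_uvec: "Fop v j (uvec v * y) = uvec v * Fop v j y" if "v \<noteq> 0"
proof (cases j)
  case (Suc k)
  then show ?thesis unfolding uvec_mult
    by (simp add: linear_map_simps Fop_X0 Fop_X1 Kop_X1 scl_add algebra_simps that field_cancel flip: power_int_add)
qed auto

lemma Kop_uvec: "Kop v i (uvec v * y) = uvec v * Kop v i y" if "v \<noteq> 0"
  unfolding uvec_mult
  by (simp add: linear_map_simps Kop_X0 Kop_X1 algebra_simps that flip: power_int_add)

text \<open>Letters in front are stripped by the coproduct recursion until the contracted pair comes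
  first. There the claim says that the cap functional and the cup vector are invariant.\<close>

lemma Eop_TL:
  assumes "v \<noteq> 0" "m \<in> tensor_power n" "1 \<le> i" "i < n"
  shows "Eop v j (TL_gen_op v s i m) = TL_gen_op v s i (Eop v j m)"
proof (rule linear_map_eq_on_words[OF _ _ assms(2)])
  have "length l = n \<Longrightarrow> Eop v j (TL_gen_op v s i (word l)) = TL_gen_op v s i (Eop v j (word l))" for l j
    using assms(3,4)
  proof (induction i arbitrary: n l j)
    case (Suc i)
    then obtain a b l' where l: "l = a # b # l'" by (cases l; cases "tl l") auto
    show ?case
    proof (cases "i = 0")
      case True
      then show ?thesis unfolding l word_Cons[of a "b # l'"] word_Cons[of b l']
        by (cases a; cases b; cases j)
          (simp_all add: Eop_X0 Eop_X1 TL_1 assms linear_map_simps Eop_uvec power_int_minus power_int_add power_int_diff field_simps)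
    next
      case False
      then show ?thesis unfolding l word_Cons[of a "b # l'"]
        using Suc.IH[of "b # l'" "n - 1"] Suc.prems l
        by (cases a) (simp_all add: TL_shift1 Eop_X0 Eop_X1 linear_map_simps del: Eop_word)
    qed
  qed simp
  then show "length l = n \<Longrightarrow> Eop v j (TL_gen_op v s i (word l)) = TL_gen_op v s i (Eop v j (word l))" for l .
qed (auto intro!: linear_map_op_intros)

lemma Kop_TL:
  assumes "v \<noteq> 0" "m \<in> tensor_power n" "1 \<le> i" "i < n"
  shows "Kop v j (TL_gen_op v s i m) = TL_gen_op v s i (Kop v j m)"
proof (rule linear_map_eq_on_words[OF _ _ assms(2)])
  have "length l = n \<Longrightarrow> Kop v j (TL_gen_op v s i (word l)) = TL_gen_op v s i (Kop v j (word l))" for l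
    using assms(3,4)
  proof (induction i arbitrary: n l)
    case (Suc i)
    then obtain a b l' where l: "l = a # b # l'" by (cases l; cases "tl l") auto
    show ?case
    proof (cases "i = 0")
      case True
      then show ?thesis unfolding l word_Cons[of a "b # l'"] word_Cons[of b l']
        by (cases a; cases b)
          (simp_all add: Kop_X0 Kop_X1 TL_1 assms linear_map_simps Kop_uvec power_int_minus field_cancel mult.assoc mult.commute mult.left_commute)
    next
      case False
      then show ?thesis unfolding l word_Cons[of a "b # l'"]
        using Suc.IH[of "b # l'" "n - 1"] Suc.prems l
        by (cases a) (simp_all add: TL_shift1 Kop_X0 Kop_X1 assms linear_map_simps del: Kop_word)
    qed
  qed simp
  then show "length l = n \<Longrightarrow> Kop v j (TL_gen_op v s i (word l)) = TL_gen_op v s i (Kop v j (word l))" for l .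
qed (auto intro!: linear_map_op_intros)

lemma Fop_TL:
  assumes "v \<noteq> 0" "m \<in> tensor_power n" "1 \<le> i" "i < n"
  shows "Fop v j (TL_gen_op v s i m) = TL_gen_op v s i (Fop v j m)"
proof (rule linear_map_eq_on_words[OF _ _ assms(2)])
  have "length l = n \<Longrightarrow> Fop v j (TL_gen_op v s i (word l)) = TL_gen_op v s i (Fop v j (word l))" for l j
    using assms(3,4)
  proof (induction i arbitrary: n l j)
    case (Suc i)
    then obtain a b l' where l: "l = a # b # l'" by (cases l; cases "tl l") auto
    show ?case
    proof (cases "i = 0")
      case True
      then show ?thesis unfolding l word_Cons[of a "b # l'"] word_Cons[of b l']
        by (cases a; cases b; cases j)
          (simp_all add: Fop_X0 Fop_X1 Kop_X0 Kop_X1 TL_1 assms linear_map_simps Fop_uvec power_int_minus power_int_add power_int_diff field_simps)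
    next
      case False
      then have K: "Kop v (- 1) (TL_gen_op v s i (word (b # l'))) = TL_gen_op v s i (Kop v (- 1) (word (b # l')))"
        using Kop_TL[OF assms(1), of "word (b # l')" "n - 1" i "-1" s] Suc.prems l by (simp del: Kop_word)
      show ?thesis unfolding l word_Cons[of a "b # l'"]
        using Suc.IH[of "b # l'" "n - 1"] Suc.prems l False K
        by (cases a) (simp_all add: TL_shift1 Fop_X0 Fop_X1 assms linear_map_simps del: Fop_word)
    qed
  qed simp
  then show "length l = n \<Longrightarrow> Fop v j (TL_gen_op v s i (word l)) = TL_gen_op v s i (Fop v j (word l))" for l .
qed (auto intro!: linear_map_op_intros)

lemma Ew_tensor_power: "Ew v j l \<in> tensor_power (length l)"
proof (induction l arbitrary: j rule: hgt.induct)
  case (2 l)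
  then show ?case using tensor_power_mult[of "word [X0]" 1 _ "length l"] by (auto intro!: tensor_power_intros)
next
  case (3 l)
  then show ?case using tensor_power_mult[of "word [_]" 1 _ "length l"] by (auto intro!: tensor_power_intros)
qed (auto simp: tensor_power_1)

lemma Fw_tensor_power: "Fw v j l \<in> tensor_power (length l)"
proof (induction l arbitrary: j rule: hgt.induct)
  case (2 l)
  then show ?case using tensor_power_mult[of "word [_]" 1 _ "length l"] by (auto intro!: tensor_power_intros)
next
  case (3 l)
  then show ?case using tensor_power_mult[of "word [_]" 1 _ "length l"] by (auto intro!: tensor_power_intros)
qed (auto simp: tensor_power_1)

lemma Eop_tensor_power: "m \<in> tensor_power n \<Longrightarrow> Eop v j m \<in> tensor_power n"
  by (erule linear_map_in_on_words[OF linear_map_Eop]) (use Ew_tensor_power in auto)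

lemma Fop_tensor_power: "m \<in> tensor_power n \<Longrightarrow> Fop v j m \<in> tensor_power n"
  by (erule linear_map_in_on_words[OF linear_map_Fop]) (use Fw_tensor_power in auto)

lemma Kop_tensor_power: "m \<in> tensor_power n \<Longrightarrow> Kop v i m \<in> tensor_power n"
  by (erule linear_map_in_on_words[OF linear_map_Kop]) (auto intro!: tensor_power_intros)

text \<open>The image of the quantum group in the operators on the n-th tensor power, described
  without cosets or specialization. Besides the divided powers only powers of K = K1 K2^-1 occur, so
  the generators lie in the image for both choices of the algebra. The rule \<open>cong\<close>
  disregards values outside \<open>tensor_power n\<close>.\<close>

inductive_set Uops :: "'k::field \<Rightarrow> nat \<Rightarrow> ('k tensors \<Rightarrow> 'k tensors) set" for v n where
  E: "Eop v j \<in> Uops v n"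
| F: "Fop v j \<in> Uops v n"
| K: "Kop v i \<in> Uops v n"
| add: "f \<in> Uops v n \<Longrightarrow> g \<in> Uops v n \<Longrightarrow> (\<lambda>x. f x + g x) \<in> Uops v n"
| comp: "f \<in> Uops v n \<Longrightarrow> g \<in> Uops v n \<Longrightarrow> (\<lambda>x. f (g x)) \<in> Uops v n"
| scl: "f \<in> Uops v n \<Longrightarrow> (\<lambda>x. scl c (f x)) \<in> Uops v n"
| cong: "f \<in> Uops v n \<Longrightarrow> (\<And>x. x \<in> tensor_power n \<Longrightarrow> g x = f x) \<Longrightarrow> g \<in> Uops v n"

lemma Uops_tensor_power: "f \<in> Uops v n \<Longrightarrow> x \<in> tensor_power n \<Longrightarrow> f x \<in> tensor_power n"
  by (induction arbitrary: x rule: Uops.induct)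
    (auto intro: Eop_tensor_power Fop_tensor_power Kop_tensor_power tensor_power_intros)

lemma Uops_TL:
  assumes "v \<noteq> 0" "f \<in> Uops v n" "x \<in> tensor_power n" "1 \<le> i" "i < n"
  shows "f (TL_gen_op v s i x) = TL_gen_op v s i (f x)"
  using assms(2,3)
proof (induction arbitrary: x rule: Uops.induct)
  case (cong f g)
  then show ?case using TL_tensor_power[OF assms(1)] assms(4,5) by simp
qed (simp_all add: assms Eop_TL[OF assms(1) _ assms(4,5)] Fop_TL[OF assms(1) _ assms(4,5)]
  Kop_TL[OF assms(1) _ assms(4,5)] linear_map_simps Uops_tensor_power)

lemma Uops_linear:
  assumes "f \<in> Uops v n" "x \<in> tensor_power n"
  shows "y \<in> tensor_power n \<Longrightarrow> f (x + y) = f x + f y" "f (scl c x) = scl c (f x)"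
  using assms
  by (induction arbitrary: x y c rule: Uops.induct)
    (simp_all add: linear_map_simps Uops_tensor_power tensor_power_intros scl_add algebra_simps)

section \<open>Quantum binomial coefficients with integer upper argument\<close>

text \<open>The quantum binomial of an integer \<open>m\<close> over \<open>t\<close>. A quotient of
  quantum factorials may be 0/0 at a root of unity, so the recurrence \<open>qb_pascal1\<close> in
  \<open>m\<close>, with value 0 at \<open>m = 0\<close>, is solved explicitly: v^(-(t+1)m) solves
  the homogeneous equation, and its coefficient is a sum from 0 upwards or downwards to
  \<open>m\<close>.\<close>

primrec qb :: "'k::field \<Rightarrow> nat \<Rightarrow> int \<Rightarrow> 'k" where
  "qb v 0 m = 1"
| "qb v (Suc t) m = (let d = (\<lambda>l. v powi ((int t + 2) * (l + 1) - (int t + 1)) * qb v t l) in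
     v powi (- (int t + 1) * m) *
       (if m \<ge> 0 then \<Sum>l<nat m. d (int l) else - (\<Sum>l<nat (- m). d (- 1 - int l))))"

lemma int_sum_step:
  fixes d :: "int \<Rightarrow> 'a::ab_group_add"
  defines "H \<equiv> \<lambda>m. if m \<ge> 0 then \<Sum>l<nat m. d (int l) else - (\<Sum>l<nat (- m). d (- 1 - int l))"
  shows "H (m + 1) = H m + d m"
proof (cases "m \<ge> 0")
  case True
  then have "nat (m + 1) = Suc (nat m)" by simp
  with True show ?thesis by (simp add: H_def)
next
  case False
  then have "nat (- m) = Suc (nat (- (m + 1)))" by simp
  with False have "H m = - (\<Sum>l<nat (- (m + 1)). d (- 1 - int l)) - d m"
    by (simp add: H_def)
  then show ?thesis using False by (cases "m = - 1") (simp_all add: H_def)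
qed

lemma qb_Suc_0 [simp]: "qb v (Suc t) 0 = 0"
  by simp

declare qb.simps(2) [simp del]

lemma qb_pascal1:
  assumes "v \<noteq> 0"
  shows "qb v (Suc t) (m + 1) = v powi (- (int t + 1)) * qb v (Suc t) m + v powi (m - int t) * qb v t m"
proof -
  define d where "d = (\<lambda>l. v powi ((int t + 2) * (l + 1) - (int t + 1)) * qb v t l)"
  define H where "H m = (if m \<ge> 0 then \<Sum>l<nat m. d (int l) else - (\<Sum>l<nat (- m). d (- 1 - int l)))" for m
  have q: "qb v (Suc t) m = v powi (- (int t + 1) * m) * H m" for m
    by (simp add: qb.simps(2) Let_def d_def H_def)
  have "H (m + 1) = H m + d m" unfolding H_def by (rule int_sum_step)
  moreover have "v powi (- (int t + 1) * (m + 1)) * d m = v powi (m - int t) * qb v t m"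
    unfolding d_def mult.assoc[symmetric] power_int_add[OF disjI1, OF assms, symmetric]
    by (simp add: algebra_simps)
  moreover have "v powi (- (int t + 1) * (m + 1)) * H m = v powi (- (int t + 1)) * qb v (Suc t) m"
    unfolding q mult.assoc[symmetric] power_int_add[OF disjI1, OF assms, symmetric]
    by (simp add: algebra_simps)
  ultimately show ?thesis by (simp add: q[of "m + 1"] distrib_left)
qed

text \<open>The symmetry under v -> v^-1 that exchanges the two Pascal rules is not visible in the
  definition. Instead the defect \<open>D\<close> of the second rule satisfies a homogeneous
  recurrence of first order in \<open>m\<close> with an invertible coefficient and vanishes at 0,
  hence at all integers.\<close>

lemma qb_pascal2:
  assumes v: "v \<noteq> 0"
  shows "qb v (Suc t) (m + 1) = v powi (int t + 1) * qb v (Suc t) m + v powi (int t - m) * qb v t m"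
proof (induction t arbitrary: m)
  case 0
  have step: "qb v (Suc 0) (m + 1) - v * qb v (Suc 0) m = v powi (- m)" for m
  proof -
    define D where "D m = qb v (Suc 0) (m + 1) - v * qb v (Suc 0) m - v powi (- m)" for m
    have rec: "D (m + 1) = v powi (- 1) * D m" for m
    proof -
      have "v * qb v (Suc 0) (m + 1) = qb v (Suc 0) m + v powi (m + 1)"
        using v by (simp add: qb_pascal1[OF v, of 0 m] distrib_left power_int_add mult.commute)
      then show ?thesis using qb_pascal1[OF v, of 0 "m + 1"] v
        by (simp add: D_def right_diff_distrib power_int_diff) (simp add: power_int_add power_int_minus field_cancel divide_inverse mult.commute)
    qed
    have "D 0 = 0" using qb_pascal1[OF v, of 0 0] by (simp add: D_def)
    have "D m = 0"
    proof (induction m rule: int_induct[of _ 0])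
      case (step2 i)
      then show ?case using rec[of "i - 1"] v by simp
    qed (use \<open>D 0 = 0\<close> rec in auto)
    then show ?thesis by (simp add: D_def algebra_simps)
  qed
  show ?case using step[of m] by (simp add: algebra_simps)
next
  case (Suc t)
  define D where "D m = qb v (Suc (Suc t)) (m + 1) - v powi (int (Suc t) + 1) * qb v (Suc (Suc t)) m
     - v powi (int (Suc t) - m) * qb v (Suc t) m" for m
  have rec: "D (m + 1) = v powi (- (int t + 2)) * D m" for m
  proof -
    have 1: "v powi (m - int t) * qb v (Suc t) (m + 1) = v powi (m + 1) * qb v (Suc t) m + qb v t m"
      unfolding Suc distrib_left mult.assoc[symmetric] power_int_add[OF disjI1, OF v, symmetric]
      by (simp add: add.commute)
    have 2: "v powi (int t + 2) * qb v (Suc (Suc t)) (m + 1) = qb v (Suc (Suc t)) m + v powi (m + 1) * qb v (Suc t) m"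
      unfolding qb_pascal1[OF v, of "Suc t" m] distrib_left mult.assoc[symmetric] power_int_add[OF disjI1, OF v, symmetric]
      by (simp add: algebra_simps)
    have 3: "v powi (int t - m) * qb v (Suc t) (m + 1) = v powi (- 1 - m) * qb v (Suc t) m + qb v t m"
      unfolding qb_pascal1[OF v, of t m] distrib_left mult.assoc[symmetric] power_int_add[OF disjI1, OF v, symmetric]
      by (simp add: algebra_simps)
    have 4: "D (m + 1) = v powi (- (int t + 2)) * qb v (Suc (Suc t)) (m + 1) + v powi (m - int t) * qb v (Suc t) (m + 1)
      - v powi (int t + 2) * qb v (Suc (Suc t)) (m + 1) - v powi (int t - m) * qb v (Suc t) (m + 1)"
      unfolding D_def qb_pascal1[OF v, of "Suc t" "m + 1"] by (simp add: algebra_simps)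
    have "D (m + 1) = v powi (- (int t + 2)) * qb v (Suc (Suc t)) (m + 1) - qb v (Suc (Suc t)) m
        - v powi (- 1 - m) * qb v (Suc t) m"
      unfolding 4 1 2 3 by simp
    also have "\<dots> = v powi (- (int t + 2)) * D m"
      unfolding D_def right_diff_distrib mult.assoc[symmetric] power_int_add[OF disjI1, OF v, symmetric]
      by (simp add: algebra_simps)
    finally show ?thesis .
  qed
  have "D 0 = 0" using qb_pascal1[OF v, of "Suc t" 0] qb_pascal1[OF v, of t 0] by (simp add: D_def)
  have "D m = 0"
  proof (induction m rule: int_induct[of _ 0])
    case (step2 i)
    then show ?case using rec[of "i - 1"] v by simp
  qed (use \<open>D 0 = 0\<close> rec in auto)
  then show ?case by (simp add: D_def algebra_simps)
qed

lemma qb_less: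
  assumes "v \<noteq> 0"
  shows "k < t \<Longrightarrow> qb v t (int k) = 0"
proof (induction k arbitrary: t)
  case 0
  then show ?case by (cases t) auto
next
  case (Suc k)
  then obtain t' where "t = Suc t'" by (cases t) auto
  with Suc show ?case using qb_pascal1[OF assms, of t' "int k"] by (simp add: algebra_simps)
qed

text \<open>Together with \<open>qb_less\<close> this holds for every \<open>v\<close>; it is what
  later separates the weights when the powers of \<open>v\<close> cannot.\<close>

lemma qb_self:
  assumes "v \<noteq> 0"
  shows "qb v t (int t) = 1"
proof (induction t)
  case (Suc t)
  then show ?case using qb_pascal1[OF assms, of t "int t"] qb_less[OF assms, of t "Suc t"]
    by (simp add: algebra_simps)
qed simp

text \<open>Induction on the natural summand with the first Pascal rule. The other summand must be
  an integer, since it will be the weight \<open>int N - int k\<close>, which may be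
  negative.\<close>

lemma qb_vandermonde:
  assumes v: "v \<noteq> 0"
  shows "qb v t (int p + m) = (\<Sum>i\<le>t. v powi (- int p * int i + m * int (t - i)) * (qb v (t - i) (int p) * qb v i m))"
proof (induction p arbitrary: t)
  case 0
  have "(\<Sum>i\<le>t. v powi (- int 0 * int i + m * int (t - i)) * (qb v (t - i) (int 0) * qb v i m)) =
     (\<Sum>i\<le>t. if i = t then qb v t m else 0)"
  proof (rule sum.cong)
    fix i assume "i \<in> {..t}"
    then show "v powi (- int 0 * int i + m * int (t - i)) * (qb v (t - i) (int 0) * qb v i m) = (if i = t then qb v t m else 0)"
      by (cases "t - i") auto
  qed simp
  then show ?case by simp
next
  case (Suc p)
  show ?case
  proof (cases t)
    case (Suc t')
    let ?c = "\<lambda>t i. v powi (- int p * int i + m * int (t - i)) * (qb v (t - i) (int p) * qb v i m)"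
    have *: "v powi (- int (Suc p) * int i + m * int (t - i)) * (qb v (t - i) (int (Suc p)) * qb v i m) =
       v powi (- int t) * ?c t i + (if i = t then 0 else v powi (int p + m - int t') * ?c t' i)" if i: "i \<le> t" for i
    proof (cases "i = t")
      case True
      have "v powi (- int (Suc p) * int t) = v powi (- int t) * v powi (- int p * int t)"
        unfolding power_int_add[OF disjI1, OF v, symmetric] by (simp add: algebra_simps)
      with True show ?thesis by simp
    next
      case False
      define r where "r = t' - i"
      then have r: "t - i = Suc r" "t = Suc (i + r)" "t' - i = r" using False i Suc by auto
      \<comment> \<open>Leaves only two identities between powers of \<open>v\<close> to be
        checked.\<close>
      have gen: "a0 * ((b0 * x + c0 * y) * z) = a1 * (b1 * (x * z)) + a2 * (b2 * (y * z))"
        if "a0 * b0 = a1 * b1" "a0 * c0 = a2 * b2" for a0 b0 c0 x y z a1 b1 a2 b2 :: 'a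
      proof -
        have "a0 * ((b0 * x + c0 * y) * z) = (a0 * b0) * (x * z) + (a0 * c0) * (y * z)"
          by (simp add: algebra_simps)
        then show ?thesis by (simp add: that mult.assoc)
      qed
      have "int (Suc p) = int p + 1" by simp
      with r(1) have q: "qb v (t - i) (int (Suc p)) =
          v powi (- (int r + 1)) * qb v (Suc r) (int p) + v powi (int p - int r) * qb v r (int p)"
        using qb_pascal1[OF v, of r "int p"] by (simp only:)
      have "v powi (- int (Suc p) * int i + m * int (t - i)) * (qb v (t - i) (int (Suc p)) * qb v i m) =
         v powi (- int t) * ?c t i + v powi (int p + m - int t') * ?c t' i"
        unfolding q unfolding r(1) r(3)
      proof (rule gen)
        show "v powi (- int (Suc p) * int i + m * int (Suc r)) * v powi (- (int r + 1)) =
            v powi (- int t) * v powi (- int p * int i + m * int (Suc r))"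
          unfolding power_int_add[OF disjI1, OF v, symmetric] by (simp add: r(2) algebra_simps)
        show "v powi (- int (Suc p) * int i + m * int (Suc r)) * v powi (int p - int r) =
            v powi (int p + m - int t') * v powi (- int p * int i + m * int r)"
          unfolding power_int_add[OF disjI1, OF v, symmetric] using r(2) Suc by (simp add: algebra_simps)
      qed
      with False show ?thesis by simp
    qed
    have "(\<Sum>i\<le>t. v powi (- int (Suc p) * int i + m * int (t - i)) * (qb v (t - i) (int (Suc p)) * qb v i m))
      = v powi (- int t) * (\<Sum>i\<le>t. ?c t i) + (\<Sum>i\<le>t. if i = t then 0 else v powi (int p + m - int t') * ?c t' i)"
      using * by (simp add: sum.distrib sum_distrib_left)
    also have "(\<Sum>i\<le>t. if i = t then 0 else v powi (int p + m - int t') * ?c t' i) =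
       v powi (int p + m - int t') * (\<Sum>i\<le>t'. ?c t' i)"
      by (simp add: Suc sum_distrib_left)
    also have "v powi (- int t) * (\<Sum>i\<le>t. ?c t i) + \<dots> = qb v t (int (Suc p) + m)"
      using Suc.IH[of t] Suc.IH[of t'] qb_pascal1[OF v, of t' "int p + m"] Suc by (simp add: algebra_simps)
    finally show ?thesis by simp
  qed simp
qed

section \<open>The centralizer of the Temperley--Lieb algebra\<close>

abbreviation W0 :: "nat \<Rightarrow> 'k::field tensors" where
  "W0 N \<equiv> word (replicate N X0)"

abbreviation W1 :: "nat \<Rightarrow> 'k::field tensors" where
  "W1 k \<equiv> word (replicate k X1)"

definition sv :: "'k::field \<Rightarrow> nat \<Rightarrow> nat \<Rightarrow> nat \<Rightarrow> nat \<Rightarrow> 'k tensors" where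
  "sv v N k a b = Fop v a (W0 N) * Eop v b (W1 k)"

lemma hgt_replicate [simp]: "hgt (replicate N X0) = int N" "hgt (replicate k X1) = - int k"
  by (induction N) (auto, induction k, auto)

lemma Ew_X0 [simp]: "Ew v b (replicate N X0) = (if b = 0 then W0 N else 0)"
  by (induction N) (auto simp flip: word_Cons)

lemma Fw_X1 [simp]: "Fw v b (replicate k X1) = (if b = 0 then W1 k else 0)"
  by (induction k) (auto simp flip: word_Cons)

text \<open>x0^N is a highest weight vector, and this is the commutation formula on it. One more
  letter x0 raises the upper argument by 1, and the second Pascal rule merges the two contributions
  to the word part that begins with x0.\<close>

lemma EF_W0:
  assumes v: "v \<noteq> 0"
  shows "Eop v i (Fop v a (W0 N)) = (if i \<le> a then scl (qb v i (int N - int a + int i)) (Fop v (a - i) (W0 N)) else 0)"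
proof (induction N arbitrary: i a)
  case 0
  then show ?case by (cases "i = 0"; cases i) auto
next
  case (Suc N)
  have W: "W0 (Suc N) = word [X0] * W0 N" by (simp flip: word_Cons)
  show ?case
  proof (cases "i = 0 \<or> a = 0")
    case True
    then show ?thesis by (auto simp: Eop_X0 simp flip: word_Cons)
  next
    case False
    then obtain j b where j: "i = Suc j" "a = Suc b" by (metis not0_implies_Suc)
    let ?M = "int N - int a + int i"
    have E: "Eop v i (Fop v a (W0 (Suc N))) =
      scl (v powi int i) (word [X0] * Eop v i (Fop v a (W0 N)))
      + scl (v powi (int b - int N - int i)) (word [X1] * Eop v i (Fop v b (W0 N)))
      + scl (v powi (int b - int N)) (word [X0] * Eop v j (Fop v b (W0 N)))"
      unfolding W Fop_X0[OF v] using v j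
      by (simp add: linear_map_simps Eop_X0 Eop_X1 scl_add algebra_simps flip: power_int_add del: Fop_word)
    show ?thesis
    proof (cases "i \<le> a")
      case True
      have p: "qb v i (?M + 1) = v powi (int i) * qb v i ?M + v powi (int b - int N) * qb v j ?M"
        using qb_pascal2[OF v, of j ?M] j by (simp add: algebra_simps)
      have F: "Fop v (a - i) (W0 (Suc N)) = word [X0] * Fop v (a - i) (W0 N)
         + (if a = i then 0 else scl (v powi (int (a - i) - 1 - int N)) (word [X1] * Fop v (b - i) (W0 N)))"
        unfolding W Fop_X0[OF v] using v j True
        by (auto simp add: linear_map_simps simp flip: power_int_add simp del: Fop_word)
      have "Eop v i (Fop v a (W0 (Suc N))) =
         scl (v powi int i * qb v i ?M + v powi (int b - int N) * qb v j ?M) (word [X0] * Fop v (a - i) (W0 N))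
         + (if a = i then 0 else scl (v powi (int b - int N - int i) * qb v i (?M + 1)) (word [X1] * Fop v (b - i) (W0 N)))"
        unfolding E Suc using True j
        by (auto simp: scl_add_left algebra_simps not_le simp del: Fop_word)
      also have "\<dots> = scl (qb v i (?M + 1)) (Fop v (a - i) (W0 (Suc N)))"
        unfolding p[symmetric] F using True j
        by (auto simp: scl_add algebra_simps of_nat_diff simp del: Fop_word)
      finally show ?thesis using True by (simp add: algebra_simps)
    next
      case False
      then show ?thesis unfolding E Suc using j by auto
    qed
  qed
qed

text \<open>The lowest weight analogue of \<open>EF_W0\<close>; here the first Pascal rule does the
  merging.\<close>

lemma FE_W1:
  assumes v: "v \<noteq> 0"
  shows "Fop v b (Eop v c (W1 k)) = (if b \<le> c then scl (qb v b (int k - int c + int b)) (Eop v (c - b) (W1 k)) else 0)"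
proof (induction k arbitrary: b c)
  case 0
  then show ?case by (cases "b = 0"; cases b) auto
next
  case (Suc k)
  have W: "W1 (Suc k) = word [X1] * W1 k" by (simp flip: word_Cons)
  show ?case
  proof (cases "b = 0 \<or> c = 0")
    case True
    then show ?thesis by (auto simp: Fop_X1 simp flip: word_Cons)
  next
    case False
    then obtain j d where j: "b = Suc j" "c = Suc d" by (metis not0_implies_Suc)
    let ?M = "int k - int c + int b"
    have K: "Kop v (- 1) (Eop v d (W1 k)) = scl (v powi (int k - 2 * int d)) (Eop v d (W1 k))"
      using v by (simp add: Kop_Eop linear_map_simps algebra_simps flip: power_int_add del: Eop_word)
    have E: "Fop v b (Eop v c (W1 (Suc k))) =
      scl (v powi (- int c)) (word [X1] * Fop v b (Eop v c (W1 k)))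
      + word [X0] * Fop v b (Eop v d (W1 k))
      + scl (v powi (int j + int k - 2 * int d)) (word [X1] * Fop v j (Eop v d (W1 k)))"
      unfolding W Eop_X1 using v j K
      by (simp add: linear_map_simps Fop_X0 Fop_X1 scl_add algebra_simps flip: power_int_add del: Eop_word)
    show ?thesis
    proof (cases "b \<le> c")
      case True
      have p: "qb v b (?M + 1) = v powi (- int b) * qb v b ?M + v powi (int k - int d) * qb v j ?M"
        using qb_pascal1[OF v, of j ?M] j by (simp add: algebra_simps)
      have F: "Eop v (c - b) (W1 (Suc k)) = scl (v powi (int b - int c)) (word [X1] * Eop v (c - b) (W1 k))
         + (if c = b then 0 else word [X0] * Eop v (d - b) (W1 k))"
        unfolding W Eop_X1 using v j True by (simp add: of_nat_diff del: Eop_word)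
      have s: "scl (v powi (int b - int c) * qb v b (?M + 1)) x =
         scl (v powi (- int c) * qb v b ?M) x + scl (v powi (int j + int k - 2 * int d) * qb v j ?M) x"
        for x :: "vbasis free_mon \<Rightarrow>\<^sub>0 'a"
        unfolding p distrib_left mult.assoc[symmetric] power_int_add[OF disjI1, OF v, symmetric] scl_add_left
        using j by (simp add: algebra_simps)
      have "Fop v b (Eop v c (W1 (Suc k))) =
         scl (v powi (- int c) * qb v b ?M) (word [X1] * Eop v (c - b) (W1 k))
         + scl (v powi (int j + int k - 2 * int d) * qb v j ?M) (word [X1] * Eop v (c - b) (W1 k))
         + (if c = b then 0 else scl (qb v b (?M + 1)) (word [X0] * Eop v (d - b) (W1 k)))"
        unfolding E Suc using True j by (auto simp: algebra_simps not_le simp del: Eop_word)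
      also have "\<dots> = scl (qb v b (?M + 1)) (Eop v (c - b) (W1 (Suc k)))"
        unfolding s[symmetric] F by (auto simp: scl_add mult.commute simp del: Eop_word)
      finally show ?thesis using True by (simp add: algebra_simps)
    next
      case False
      then show ?thesis unfolding E Suc using j by auto
    qed
  qed
qed

lemma sum_atMost_only_0: "(\<And>i. 0 < i \<Longrightarrow> i \<le> a \<Longrightarrow> f i = 0) \<Longrightarrow> (\<Sum>i\<le>a. f i) = f 0"
  for f :: "nat \<Rightarrow> 'a::comm_monoid_add"
  by (subst sum.mono_neutral_right[of "{..a}" "{0}"]) auto

lemma sum_atMost_only_last: "(\<And>i. i < a \<Longrightarrow> f i = 0) \<Longrightarrow> (\<Sum>i\<le>a. f i) = f a"
  for f :: "nat \<Rightarrow> 'a::comm_monoid_add"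
  by (subst sum.mono_neutral_right[of "{..a}" "{a}"]) auto

text \<open>Since \<open>F\<close> kills x1, the divided power \<open>F^(a)\<close> acts on x0^N
  alone; \<open>E^(p)\<close> then distributes over both parts and \<open>EF_W0\<close> applies on
  the left. The term \<open>i = 0\<close> is a power of \<open>v\<close> times
  \<open>sv v N k a p\<close>, and all others have smaller \<open>a\<close>.\<close>

lemma EF_sorted:
  assumes v: "v \<noteq> 0"
  shows "Eop v p (Fop v a (W0 N * W1 k)) = (\<Sum>i\<le>p. scl (v powi (int a * int k + (int i + int N - 2 * int a) * int (p - i)) *
      (if i \<le> a then qb v i (int N - int a + int i) else 0)) (sv v N k (a - i) (p - i)))"
proof -
  have 1: "Fop v a (W0 N * W1 k) = scl (v powi (int a * int k)) (Fop v a (W0 N) * W1 k)"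
    unfolding Fop_mult[OF v] by (subst sum_atMost_only_last) (simp_all add: linear_map_simps)
  have 2: "Kop v i (Fop v a (W0 N)) = scl (v powi (i * (int N - 2 * int a))) (Fop v a (W0 N))" for i
    using v by (simp add: Kop_Fop linear_map_simps algebra_simps flip: power_int_add del: Fop_word)
  have 3: "v powi (int a * int k + (int i + int N - 2 * int a) * int (p - i)) =
      v powi (int a * int k) * (v powi (int i * int (p - i)) * v powi (int (p - i) * (int N - 2 * int a)))" for i
    unfolding power_int_add[OF disjI1, OF v, symmetric] by (simp add: algebra_simps)
  show ?thesis unfolding 1 linear_map_scale[OF linear_map_Eop] Eop_mult[OF v] 2 EF_W0[OF v] scl_sum 3 sv_def
    by (intro sum.cong refl) (simp add: mult_ac del: Eop_word Fop_word)
qed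

text \<open>Here \<open>E^(c)\<close> acts on x1^k alone, and whatever part \<open>i\<close> of
  \<open>F^(c)\<close> stays on the left leaves \<open>c - i\<close> to lower the right part. So
  only the vectors \<open>sv v N k i i\<close> occur.\<close>

lemma FE_sorted:
  assumes v: "v \<noteq> 0"
  shows "Fop v c (Eop v c (W0 N * W1 k)) = (\<Sum>i\<le>c. scl (v powi (int c * int N - int i * (int c + int i - int k)) *
      qb v (c - i) (int k - int i)) (sv v N k i i))"
proof -
  have 1: "Eop v c (W0 N * W1 k) = scl (v powi (int c * int N)) (W0 N * Eop v c (W1 k))"
    unfolding Eop_mult[OF v] by (subst sum_atMost_only_0) (simp_all add: linear_map_simps)
  have 2: "Kop v (- int i) (Eop v i (W1 k)) = scl (v powi (int i * (int k - 2 * int i))) (Eop v i (W1 k))" for i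
    using v by (simp add: Kop_Eop linear_map_simps algebra_simps flip: power_int_add del: Eop_word)
  have 3: "Kop v (- int i) (Fop v (c - i) (Eop v c (W1 k))) =
      scl (qb v (c - i) (int k - int i) * v powi (int i * (int k - 2 * int i))) (Eop v i (W1 k))" if "i \<le> c" for i
    using that unfolding FE_W1[OF v] by (simp add: linear_map_simps 2 of_nat_diff del: Eop_word)
  have 4: "v powi (int c * int N - int i * (int c + int i - int k)) =
     v powi (int c * int N) * (v powi (- int i * int (c - i)) * v powi (int i * (int k - 2 * int i)))" if "i \<le> c" for i
    using that unfolding power_int_add[OF disjI1, OF v, symmetric]
    by (simp add: of_nat_diff algebra_simps)
  show ?thesis unfolding 1 linear_map_scale[OF linear_map_Fop] Fop_mult[OF v] scl_sum
  proof (rule sum.cong)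
    fix i assume "i \<in> {..c}"
    then have i: "i \<le> c" by simp
    show "scl (v powi (int c * int N)) (scl (v powi (- int i * int (c - i)))
        (Fop v i (W0 N) * Kop v (- int i) (Fop v (c - i) (Eop v c (W1 k))))) =
      scl (v powi (int c * int N - int i * (int c + int i - int k)) * qb v (c - i) (int k - int i)) (sv v N k i i)"
      unfolding 3[OF i] 4[OF i] sv_def mult_scl scl_scl by (simp only: mult_ac)
  qed simp
qed

lemma sv_eq_0: "k < b \<Longrightarrow> sv v N k a b = 0"
proof -
  have "k < b \<Longrightarrow> Ew v b (replicate k X1) = 0" by (induction k arbitrary: b) auto
  then show "k < b \<Longrightarrow> sv v N k a b = 0" by (simp add: sv_def)
qed

text \<open>Both sides are combinations of the vectors \<open>sv v N k d d\<close>. The coefficients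
  agree by the quantum Vandermonde identity for N - d = (k - d) + (N - k).\<close>

lemma EF_expansion:
  assumes v: "v \<noteq> 0"
  shows "Eop v c (Fop v c (W0 N * W1 k)) =
    (\<Sum>i\<le>c. scl (qb v i (int N - int k)) (Fop v (c - i) (Eop v (c - i) (W0 N * W1 k))))"
proof -
  let ?l = "\<lambda>d. v powi (int c * int k + (int (c - d) + int N - 2 * int c) * int d) * qb v (c - d) (int N - int d)"
  let ?r = "\<lambda>i d. v powi (int (c - i) * int N - int d * (int (c - i) + int d - int k)) * qb v (c - i - d) (int k - int d)"
  have "Eop v c (Fop v c (W0 N * W1 k)) = (\<Sum>d\<le>c. scl (?l d) (sv v N k d d))"
    unfolding EF_sorted[OF v]
    by (rule sum.reindex_bij_witness[of _ "\<lambda>d. c - d" "\<lambda>d. c - d"]) (auto simp: of_nat_diff algebra_simps)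
  also have "\<dots> = (\<Sum>d\<le>c. \<Sum>i\<le>c - d. scl (qb v i (int N - int k) * ?r i d) (sv v N k d d))"
  proof (rule sum.cong)
    fix d assume d: "d \<in> {..c}"
    show "scl (?l d) (sv v N k d d) = (\<Sum>i\<le>c - d. scl (qb v i (int N - int k) * ?r i d) (sv v N k d d))"
    \<comment> \<open>Vandermonde needs \<open>k - d\<close> to be natural; for larger
      \<open>d\<close> the vector itself vanishes.\<close>
    proof (cases "d \<le> k")
      case True
      have "int N - int d = int (k - d) + (int N - int k)" using True by simp
      then have q: "qb v (c - d) (int N - int d) = (\<Sum>i\<le>c - d. v powi (- int (k - d) * int i + (int N - int k) * int (c - d - i))
          * (qb v (c - d - i) (int (k - d)) * qb v i (int N - int k)))"
        by (simp only: qb_vandermonde[OF v])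
      have "?l d = (\<Sum>i\<le>c - d. qb v i (int N - int k) * ?r i d)"
        unfolding q sum_distrib_left mult.assoc[symmetric] power_int_add[OF disjI1, OF v, symmetric]
      proof (rule sum.cong)
        fix i assume "i \<in> {..c - d}"
        then have i: "i \<le> c - d" "d \<le> c" using d by auto
        have "c - i - d = c - d - i" by simp
        moreover have "int c * int k + (int (c - d) + int N - 2 * int c) * int d + (- int (k - d) * int i + (int N - int k) * int (c - d - i))
          = int (c - i) * int N - int d * (int (c - i) + int d - int k)"
          using i True by (simp add: of_nat_diff algebra_simps)
        ultimately show "v powi (int c * int k + (int (c - d) + int N - 2 * int c) * int d + (- int (k - d) * int i + (int N - int k) * int (c - d - i))) *
            qb v (c - d - i) (int (k - d)) * qb v i (int N - int k) =
          qb v i (int N - int k) * v powi (int (c - i) * int N - int d * (int (c - i) + int d - int k)) * qb v (c - i - d) (int k - int d)"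
          using True by (simp add: of_nat_diff mult_ac)
      qed simp
      then show ?thesis by (simp add: scl_sum_left)
    qed (simp add: sv_eq_0)
  qed simp
  also have "\<dots> = (\<Sum>d\<le>c. \<Sum>i\<le>c. if i \<le> c - d then scl (qb v i (int N - int k) * ?r i d) (sv v N k d d) else 0)"
    by (intro sum.cong refl sum.mono_neutral_cong_left) auto
  also have "\<dots> = (\<Sum>i\<le>c. \<Sum>d\<le>c. if i \<le> c - d then scl (qb v i (int N - int k) * ?r i d) (sv v N k d d) else 0)"
    by (rule sum.swap)
  also have "\<dots> = (\<Sum>i\<le>c. \<Sum>d\<le>c - i. scl (qb v i (int N - int k) * ?r i d) (sv v N k d d))"
    by (intro sum.cong refl sum.mono_neutral_cong_right) auto
  also have "\<dots> = (\<Sum>i\<le>c. scl (qb v i (int N - int k)) (Fop v (c - i) (Eop v (c - i) (W0 N * W1 k))))"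
    unfolding FE_sorted[OF v] by (simp add: scl_sum)
  finally show ?thesis .
qed

section \<open>Reduction to sorted words\<close>

fun valr :: "vbasis list \<Rightarrow> nat" where
  "valr [] = 0"
| "valr (X0 # l) = valr l"
| "valr (X1 # l) = 2 ^ length l + valr l"

lemma valr_append: "valr (p @ q) = valr p * 2 ^ length q + valr q"
  by (induction p rule: valr.induct) (auto simp: power_add algebra_simps)

text \<open>\<open>valr\<close> reads a word as a binary number with digit 1 for x1, first letter
  most significant. Sorting therefore decreases it; the same number orders the words in the
  triangularity argument for normal forms.\<close>

lemma valr_swap: "valr (p @ X0 # X1 # q) < valr (p @ X1 # X0 # q)"
  by (simp add: valr_append)

lemma sorted_or_swap:
  "(\<exists>p q. l = p @ X1 # X0 # q) \<or> (\<exists>a b. l = replicate a X0 @ replicate b X1)"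
proof (induction l)
  case (Cons x l)
  show ?case
  proof (cases "\<exists>p q. l = p @ X1 # X0 # q")
    case True
    then show ?thesis by (metis append_Cons)
  next
    case False
    then obtain a b where l: "l = replicate a X0 @ replicate b X1" using Cons by blast
    show ?thesis
    proof (cases x)
      case X0
      then have "x # l = replicate (Suc a) X0 @ replicate b X1" by (simp add: l)
      then show ?thesis by blast
    next
      case X1
      show ?thesis
      proof (cases a)
        case 0
        then have "x # l = replicate 0 X0 @ replicate (Suc b) X1" by (simp add: l X1)
        then show ?thesis by blast
      next
        case (Suc a')
        then have "x # l = [] @ X1 # X0 # (replicate a' X0 @ replicate b X1)" by (simp add: l X1)
        then show ?thesis by blast
      qed
    qed
  qed
qed (metis append_Nil replicate_0)

text \<open>Commutation is asked for the generators only and everything is confined to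
  \<open>tensor_power n\<close>, so the predicate applies both to total linear maps and to
  restricted functions.\<close>

definition comm_TL :: "'k::field \<Rightarrow> 'k \<Rightarrow> nat \<Rightarrow> ('k tensors \<Rightarrow> 'k tensors) \<Rightarrow> bool" where
  "comm_TL v s n f \<longleftrightarrow> (\<forall>x\<in>tensor_power n. f x \<in> tensor_power n \<and>
     (\<forall>y\<in>tensor_power n. f (x + y) = f x + f y) \<and> (\<forall>c. f (scl c x) = scl c (f x)) \<and>
     (\<forall>i. 1 \<le> i \<longrightarrow> i < n \<longrightarrow> f (TL_gen_op v s i x) = TL_gen_op v s i (f x)))"

lemma comm_TL_Uops: "v \<noteq> 0 \<Longrightarrow> f \<in> Uops v n \<Longrightarrow> comm_TL v s n f"
  unfolding comm_TL_def
  by (auto intro: Uops_tensor_power simp: Uops_linear(1) Uops_linear(2) Uops_TL)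

lemma comm_TL_diff: "comm_TL v s n f \<Longrightarrow> comm_TL v s n g \<Longrightarrow> comm_TL v s n (\<lambda>x. f x - g x)"
  unfolding comm_TL_def by (simp add: tensor_power_diff scl_diff linear_map_diff)

lemma comm_TL_0: "comm_TL v s n f \<Longrightarrow> f 0 = 0"
  unfolding comm_TL_def by (metis scl_0(1) tensor_power_zero)

lemma word_swap:
  assumes "v \<noteq> 0" "s * s = 1"
  shows "word (p @ X1 # X0 # q) = scl (inverse v) (word (p @ X0 # X1 # q)) -
     scl s (TL_gen_op v s (Suc (length p)) (word (p @ X0 # X1 # q)))"
  unfolding TL_word[OF assms(1)] uvec_mult
  by (simp add: assms right_diff_distrib scl_diff flip: word_append word_Cons mult.assoc)

lemma comm_TL_eq_0:
  assumes v: "v \<noteq> 0" "s * s = 1" and f: "comm_TL v s n f"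
    and sorted: "\<And>N k. N + k = n \<Longrightarrow> f (W0 N * W1 k) = 0" and x: "x \<in> tensor_power n"
  shows "f x = 0"
proof -
  have word: "length l = n \<Longrightarrow> f (word l) = 0" for l
  proof (induction l rule: measure_induct_rule[of valr])
    case (less l)
    from sorted_or_swap[of l] show ?case
    proof
      assume "\<exists>a b. l = replicate a X0 @ replicate b X1"
      then show ?thesis using sorted less.prems by (auto simp: word_append)
    next
      assume "\<exists>p q. l = p @ X1 # X0 # q"
      then obtain p q where l: "l = p @ X1 # X0 # q" by blast
      let ?w = "word (p @ X0 # X1 # q)" let ?i = "Suc (length p)"
      have w: "?w \<in> tensor_power n" "1 \<le> ?i" "?i < n" using less.prems l by auto
      have 0: "f ?w = 0" using less.IH[of "p @ X0 # X1 # q"] less.prems l valr_swap[of p q] by auto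
      have T: "TL_gen_op v s ?i ?w \<in> tensor_power n" by (rule TL_tensor_power[OF v(1) w])
      have "f (TL_gen_op v s ?i ?w) = 0" using f w 0 unfolding comm_TL_def by (metis op_zero(4))
      moreover have "f (scl (inverse v) ?w + scl (- s) (TL_gen_op v s ?i ?w)) =
          f (scl (inverse v) ?w) + f (scl (- s) (TL_gen_op v s ?i ?w))"
        using f tensor_power_scl[OF w(1)] tensor_power_scl[OF T] unfolding comm_TL_def by blast
      moreover have "f (scl c x) = scl c (f x)" if "x \<in> tensor_power n" for c x
        using f that unfolding comm_TL_def by blast
      ultimately have "f (scl (inverse v) ?w + scl (- s) (TL_gen_op v s ?i ?w)) = 0"
        using w(1) T 0 by (simp del: scl_uminus_left)
      then show ?thesis using word_swap[OF v, of p q] l by simp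
    qed
  qed
  from x show ?thesis
  proof (induction rule: tensor_induct)
    case (add l c m)
    then have "f (scl c (word l) + m) = scl c (f (word l)) + f m"
      using f unfolding comm_TL_def by (metis tensor_power_scl tensor_power_word)
    with add word show ?case by simp
  qed (rule comm_TL_0[OF f])
qed

lemma comm_TL_eqI:
  assumes "v \<noteq> 0" "s * s = 1" "comm_TL v s n f" "comm_TL v s n g"
    and "\<And>N k. N + k = n \<Longrightarrow> f (W0 N * W1 k) = g (W0 N * W1 k)" "x \<in> tensor_power n"
  shows "f x = g x"
  using comm_TL_eq_0[OF assms(1,2) comm_TL_diff[OF assms(3,4)] _ assms(6)] assms(5) by simp

section \<open>Vectors killed by all e_i except one\<close>

lemma lookup_mult_append:
  assumes "x \<in> tensor_power (length p)"
  shows "lookup (x * y) (Mon (p @ q)) = lookup x (Mon p) * lookup y (Mon q)"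
  using assms
proof (induction rule: tensor_induct)
  case (add l c m)
  then show ?case by (cases "l = p") (simp_all add: distrib_right lookup_add lookup_word_mult lookup_word)
qed simp

text \<open>Dual to \<open>word_swap\<close>: if e_i kills \<open>z\<close>, then the coefficients
  of \<open>z\<close> at two words that differ by exchanging x0 x1 and x1 x0 at this place differ by
  the factor \<open>v\<close>.\<close>

lemma lookup_TL:
  assumes v: "v \<noteq> 0" and z: "z \<in> tensor_power (length (p @ X0 # X1 # q))"
  shows "lookup (TL_gen_op v s (Suc (length p)) z) (Mon (p @ X0 # X1 # q)) =
    s * inverse v * (lookup z (Mon (p @ X0 # X1 # q)) - v * lookup z (Mon (p @ X1 # X0 # q)))"
  using z
proof (induction rule: tensor_induct)
  case (add l c m)
  obtain p' a b q' where l: "l = p' @ a # b # q'" "length p' = length p"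
    by (rule list_split_at2[of "length p" l]) (use add(1) in auto)
  have w: "lookup (TL_gen_op v s (Suc (length p)) (word l)) (Mon (p @ X0 # X1 # q)) =
    s * inverse v * (lookup (word l) (Mon (p @ X0 # X1 # q)) - v * lookup (word l) (Mon (p @ X1 # X0 # q)))"
    using TL_word[OF v, of s p' a b q'] l(2) v unfolding l(1)
    by (cases a; cases b)
      (auto simp: uvec_mult right_diff_distrib lookup_minus lookup_word field_simps simp flip: word_append word_Cons)
  show ?case
    unfolding linear_map_add[OF linear_map_TL] linear_map_scale[OF linear_map_TL] lookup_add lookup_scl w add(3)
    by (simp add: algebra_simps)
qed simp

text \<open>The position \<open>N\<close> is left out because there e_i joins the last x0 to the
  first x1 of a sorted word and does not kill it.\<close>

definition TL_killed :: "'k::field \<Rightarrow> 'k \<Rightarrow> nat \<Rightarrow> nat \<Rightarrow> 'k tensors \<Rightarrow> bool" where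
  "TL_killed v s N k z \<longleftrightarrow> z \<in> tensor_power (N + k) \<and>
     (\<forall>i. 1 \<le> i \<longrightarrow> i < N + k \<longrightarrow> i \<noteq> N \<longrightarrow> TL_gen_op v s i z = 0)"

abbreviation bisorted :: "nat \<Rightarrow> nat \<Rightarrow> nat \<Rightarrow> nat \<Rightarrow> vbasis list" where
  "bisorted N k a b \<equiv> (replicate (N - a) X0 @ replicate a X1) @ (replicate b X0 @ replicate (k - b) X1)"

text \<open>By \<open>lookup_TL\<close> letters may be exchanged inside the first \<open>N\<close>
  and inside the last \<open>k\<close> positions without changing whether a coefficient vanishes.
  Sorting both halves leads to the words \<open>bisorted\<close>.\<close>

lemma TL_killed_eq_0:
  assumes v: "v \<noteq> 0" "s * s = 1" and z: "TL_killed v s N k z"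
    and sorted: "\<And>a b. a \<le> N \<Longrightarrow> b \<le> k \<Longrightarrow> lookup z (Mon (bisorted N k a b)) = 0"
  shows "z = 0"
proof -
  have s0: "s \<noteq> 0" using v by auto
  have swap: "lookup z (Mon (p @ X1 # X0 # q)) = 0"
    if "lookup z (Mon (p @ X0 # X1 # q)) = 0" "length p + length q + 2 = N + k" "Suc (length p) \<noteq> N" for p q
  proof -
    have "TL_gen_op v s (Suc (length p)) z = 0" "z \<in> tensor_power (length (p @ X0 # X1 # q))"
      using z that by (auto simp: TL_killed_def)
    with lookup_TL[OF v(1), of z p q s] that v s0 show ?thesis by simp
  qed
  have "length p = N \<Longrightarrow> length q = k \<Longrightarrow> lookup z (Mon (p @ q)) = 0" for p q
  proof (induction "p @ q" arbitrary: p q rule: measure_induct_rule[of valr])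
    case (less p q)
    consider (p) p1 p2 where "p = p1 @ X1 # X0 # p2" | (q) q1 q2 where "q = q1 @ X1 # X0 # q2"
      | (s) a b c d where "p = replicate a X0 @ replicate b X1" "q = replicate c X0 @ replicate d X1"
      using sorted_or_swap[of p] sorted_or_swap[of q] by blast
    then show ?case
    proof cases
      case p
      have "lookup z (Mon ((p1 @ X0 # X1 # p2) @ q)) = 0"
        by (rule less.hyps) (use less.prems p valr_swap[of p1 "p2 @ q"] in auto)
      then show ?thesis using swap[of p1 "p2 @ q"] p less.prems by simp
    next
      case q
      have "lookup z (Mon (p @ (q1 @ X0 # X1 # q2))) = 0"
        by (rule less.hyps) (use less.prems q valr_swap[of "p @ q1" "q2"] in auto)
      then show ?thesis using swap[of "p @ q1" q2] q less.prems by simp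
    next
      case s
      then show ?thesis using sorted[of b c] less.prems by auto
    qed
  qed
  note * = this
  show ?thesis
  proof (rule tensor_eqI[of _ "N + k"])
    fix l :: "vbasis list" assume "length l = N + k"
    then show "lookup z (Mon l) = lookup 0 (Mon l)" using *[of "take N l" "drop N l"] by simp
  qed (use z in \<open>auto simp: TL_killed_def\<close>)
qed

lemma TL_left:
  assumes "x \<in> tensor_power k" "1 \<le> i"
  shows "TL_gen_op v s (k + i) (x * y) = x * TL_gen_op v s i y"
  by (rule linear_map_eq_on_words[OF _ _ assms(1)])
    (use TL_shift[OF assms(2)] in \<open>auto intro!: linear_map_op_intros\<close>)

lemma TL_replicate:
  assumes "v \<noteq> 0" "1 \<le> i" "i < N"
  shows "TL_gen_op v s i (word (replicate N a)) = 0"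
proof -
  have "replicate N a = replicate (i - 1) a @ a # a # replicate (N - i - 1) a"
    using assms by (simp flip: replicate_Suc replicate_add)
  then show ?thesis using TL_word[OF assms(1), of s "replicate (i - 1) a" a a] assms
    by (cases a) auto
qed

lemma sv_tensor_power: "sv v N k a b \<in> tensor_power (N + k)"
  unfolding sv_def by (intro tensor_power_mult Fop_tensor_power Eop_tensor_power) auto

lemma TL_killed_sv:
  assumes v: "v \<noteq> 0"
  shows "TL_killed v s N k (sv v N k a b)"
  unfolding TL_killed_def
proof (intro conjI allI impI)
  fix i assume i: "1 \<le> i" "i < N + k" "i \<noteq> N"
  have F: "Fop v a (W0 N) \<in> tensor_power N" and E: "Eop v b (W1 k) \<in> tensor_power k"
    by (auto intro!: Fop_tensor_power Eop_tensor_power simp del: Fop_word Eop_word)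
  show "TL_gen_op v s i (sv v N k a b) = 0"
  proof (cases "i < N")
    case True
    then show ?thesis
      using TL_right[OF v F, of i s] Fop_TL[OF v, of "W0 N" N i a s] TL_replicate[OF v, of i N s X0] i
      by (simp add: sv_def del: Fop_word)
  next
    case False
    then obtain j where j: "i = N + j" "1 \<le> j" using i by (metis le_neq_implies_less less_iff_Suc_add not_le
        Suc_eq_plus1 add.assoc le_add2 Suc_le_eq zero_less_Suc add_Suc_right)
    then show ?thesis
      using TL_left[OF F, of j v s] Eop_TL[OF v, of "W1 k" k j b s] TL_replicate[OF v, of j k s X1] i
      by (simp add: sv_def del: Fop_word Eop_word)
  qed
qed (rule sv_tensor_power)

text \<open>The coefficient is exactly 1: each lowered letter has only lowered letters behind it,
  and then the exponent \<open>int j - 1 - hgt l\<close> in \<open>Fw\<close>, computed from the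
  original letters x0, is 0.\<close>

lemma lookup_Fw_sorted:
  assumes "v \<noteq> 0"
  shows "a' \<le> N \<Longrightarrow> lookup (Fw v a (replicate N X0)) (Mon (replicate (N - a') X0 @ replicate a' X1)) = (if a = a' then 1 else 0)"
proof (induction N arbitrary: a a')
  case 0
  then show ?case using lookup_word[of "[]" "[]"] by auto
next
  case (Suc N)
  show ?case
  proof (cases "a' = Suc N")
    case True
    then show ?thesis using Suc.IH[of N "a - 1"] assms by (auto simp: lookup_add lookup_word_mult)
  next
    case False
    then show ?thesis using Suc.IH[of a' a] Suc.prems by (auto simp: lookup_add lookup_word_mult Suc_diff_le)
  qed
qed

lemma lookup_Ew_sorted:
  assumes "v \<noteq> 0"
  shows "b' \<le> k \<Longrightarrow> lookup (Ew v b (replicate k X1)) (Mon (replicate b' X0 @ replicate (k - b') X1)) = (if b = b' then 1 else 0)"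
proof (induction k arbitrary: b b')
  case 0
  then show ?case using lookup_word[of "[]" "[]"] by auto
next
  case (Suc k)
  show ?case
  proof (cases b')
    case 0
    then show ?thesis using Suc.IH[of 0 b] assms by (auto simp: lookup_add lookup_word_mult)
  next
    case (Suc c)
    then show ?thesis using Suc.IH[of c "b - 1"] Suc.prems by (auto simp: lookup_add lookup_word_mult)
  qed
qed

lemma lookup_sv:
  assumes "v \<noteq> 0" "a' \<le> N" "b' \<le> k"
  shows "lookup (sv v N k a b) (Mon (bisorted N k a' b')) = (if a = a' \<and> b = b' then 1 else 0)"
proof -
  have "Fop v a (W0 N) \<in> tensor_power (length (replicate (N - a') X0 @ replicate a' X1))"
    using assms by (auto intro!: Fop_tensor_power simp del: Fop_word)
  from lookup_mult_append[OF this] show ?thesis using lookup_Fw_sorted[OF assms(1,2)] lookup_Ew_sorted[OF assms(1,3)]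
    by (simp add: sv_def)
qed

text \<open>By \<open>lookup_sv\<close> the vectors \<open>sv\<close> are dual to the coefficients
  at the bisorted words. Subtracting the combination leaves a killed vector without any such
  coefficient.\<close>

lemma TL_killed_expansion:
  assumes v: "v \<noteq> 0" "s * s = 1" and z: "TL_killed v s N k z"
  shows "z = (\<Sum>a\<le>N. \<Sum>b\<le>k. scl (lookup z (Mon (bisorted N k a b))) (sv v N k a b))" (is "z = ?y")
proof -
  have "z - ?y = 0"
  proof (rule TL_killed_eq_0[OF v])
    show "TL_killed v s N k (z - ?y)"
      using z TL_killed_sv[OF v(1), of s N k]
      by (auto simp: TL_killed_def linear_map_simps intro!: tensor_power_intros sum.neutral)
    fix a b assume ab: "a \<le> N" "b \<le> k"
    have "lookup ?y (Mon (bisorted N k a b)) = (\<Sum>a'\<le>N. \<Sum>b'\<le>k. lookup z (Mon (bisorted N k a' b')) * (if a' = a \<and> b' = b then 1 else 0))"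
      by (simp only: lookup_sum lookup_scl lookup_sv[OF v(1) ab])
    also have "\<dots> = (\<Sum>a'\<le>N. if a' = a then lookup z (Mon (bisorted N k a b)) else 0)"
    proof (rule sum.cong)
      fix a' show "(\<Sum>b'\<le>k. lookup z (Mon (bisorted N k a' b')) * (if a' = a \<and> b' = b then 1 else 0)) =
        (if a' = a then lookup z (Mon (bisorted N k a b)) else 0)"
        using ab by (cases "a' = a") (simp_all add: if_distrib[of "\<lambda>x. _ * x"] cong: if_cong)
    qed simp
    also have "\<dots> = lookup z (Mon (bisorted N k a b))" using ab by simp
    finally show "lookup (z - ?y) (Mon (bisorted N k a b)) = 0" by (simp add: lookup_minus)
  qed
  then show ?thesis by simp
qed

section \<open>Orbits of sorted words under the quantum group\<close>

lemma Uops_id: "(\<lambda>x. x) \<in> Uops v n"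
  by (rule Uops.cong[OF Uops.E[of v 0]]) simp

lemma Uops_zero: "(\<lambda>x. 0) \<in> Uops v n"
  by (rule Uops.cong[OF Uops.scl[OF Uops_id, where c = 0]]) simp

lemma Uops_diff: "f \<in> Uops v n \<Longrightarrow> g \<in> Uops v n \<Longrightarrow> (\<lambda>x. f x - g x) \<in> Uops v n"
  using Uops.add[OF _ Uops.scl[of g v n "- 1"]] by simp

lemma Uops_sum: "(\<And>a. a \<in> A \<Longrightarrow> f a \<in> Uops v n) \<Longrightarrow> (\<lambda>x. \<Sum>a\<in>A. f a x) \<in> Uops v n"
  by (induction A rule: infinite_finite_induct) (auto simp: Uops_zero intro: Uops.add)

lemma Uops_orbit_sv:
  assumes v: "v \<noteq> 0"
  shows "\<exists>u\<in>Uops v n. u (W0 N * W1 k) = sv v N k a b"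
proof (induction a arbitrary: b rule: less_induct)
  case (less a)
  let ?c = "\<lambda>i. v powi (int a * int k + (int i + int N - 2 * int a) * int (b - i)) * (if i \<le> a then qb v i (int N - int a + int i) else 0)"
  have "\<exists>u\<in>Uops v n. u (W0 N * W1 k) = scl (?c i) (sv v N k (a - i) (b - i))" if i: "i \<in> {1..b}" for i
  proof (cases "i \<le> a")
    case True
    then obtain u where "u \<in> Uops v n" "u (W0 N * W1 k) = sv v N k (a - i) (b - i)" using less[of "a - i" "b - i"] i by auto
    with True show ?thesis by (intro bexI[of _ "\<lambda>x. scl (?c i) (u x)"]) (auto intro: Uops.scl)
  next
    case False
    then show ?thesis by (intro bexI[of _ "\<lambda>x. 0"] Uops_zero) simp
  qed
  then obtain u where u: "\<And>i. i \<in> {1..b} \<Longrightarrow> u i \<in> Uops v n \<and> u i (W0 N * W1 k) = scl (?c i) (sv v N k (a - i) (b - i))"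
    by metis
  \<comment> \<open>Solves \<open>EF_sorted\<close> for its term \<open>i = 0\<close>. The
    coefficient \<open>?c 0\<close> is a power of \<open>v\<close>, as \<open>qb v 0\<close> is 1,
    so it may be inverted.\<close>
  let ?u = "\<lambda>x. scl (inverse (?c 0)) (Eop v b (Fop v a x) - (\<Sum>i\<in>{1..b}. u i x))"
  have "?u \<in> Uops v n" using u by (intro Uops.scl Uops_diff Uops.comp[OF Uops.E Uops.F] Uops_sum) auto
  moreover have "?u (W0 N * W1 k) = sv v N k a b"
  proof -
    have "{..b} = insert 0 {1..b}" by auto
    then have "Eop v b (Fop v a (W0 N * W1 k)) = scl (?c 0) (sv v N k a b) + (\<Sum>i\<in>{1..b}. scl (?c i) (sv v N k (a - i) (b - i)))"
      unfolding EF_sorted[OF v] by simp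
    moreover have "(\<Sum>i\<in>{1..b}. u i (W0 N * W1 k)) = (\<Sum>i\<in>{1..b}. scl (?c i) (sv v N k (a - i) (b - i)))"
      using u by (intro sum.cong) auto
    ultimately show ?thesis using v by simp
  qed
  ultimately show ?case by (intro bexI[of _ ?u])
qed

lemma Uops_orbit_killed:
  assumes v: "v \<noteq> 0" "s * s = 1" and z: "TL_killed v s N k z"
  shows "\<exists>u\<in>Uops v n. u (W0 N * W1 k) = z"
proof -
  obtain u where u: "\<And>a b. u a b \<in> Uops v n \<and> u a b (W0 N * W1 k) = sv v N k a b"
    using Uops_orbit_sv[OF v(1), of n N k] by metis
  let ?u = "\<lambda>x. \<Sum>a\<le>N. \<Sum>b\<le>k. scl (lookup z (Mon (bisorted N k a b))) (u a b x)"
  have "?u \<in> Uops v n" using u by (intro Uops_sum Uops.scl) auto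
  moreover have "?u (W0 N * W1 k) = z" using TL_killed_expansion[OF v z] u by simp
  ultimately show ?thesis by (intro bexI[of _ ?u])
qed

section \<open>Weights and the projections onto weight spaces\<close>

definition ones :: "vbasis list \<Rightarrow> nat" where
  "ones l = count_list l X1"

lemma ones_simps [simp]: "ones [] = 0" "ones (X0 # l) = ones l" "ones (X1 # l) = Suc (ones l)"
  "ones (p @ q) = ones p + ones q"
  by (auto simp: ones_def)

lemma ones_replicate [simp]: "ones (replicate k X1) = k" "ones (replicate k X0) = 0"
  by (induction k) auto

lemma hgt_ones: "hgt l = int (length l) - 2 * int (ones l)"
  by (induction l rule: hgt.induct) auto

lemma ones_le: "ones l \<le> length l"
  by (simp add: ones_def count_le_length)

definition Dop :: "(nat \<Rightarrow> 'k::field) \<Rightarrow> 'k tensors \<Rightarrow> 'k tensors" where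
  "Dop h = lin_ext (\<lambda>l. scl (h (ones l)) (word l))"

lemma linear_map_Dop [intro, simp]: "linear_map (Dop h)"
  by (simp add: Dop_def linear_map_lin_ext)

lemma linear_map_Dop_comp: "linear_map f \<Longrightarrow> linear_map (\<lambda>x. Dop h (f x))"
  by (rule linear_map_comp[OF linear_map_Dop])

lemma Dop_word [simp]: "Dop h (word l) = scl (h (ones l)) (word l)"
  by (simp add: Dop_def)

text \<open>Cap and cup only involve the words x0 x1 and x1 x0, so e_i preserves the number of
  letters x1.\<close>

lemma comm_TL_Dop:
  assumes "v \<noteq> 0"
  shows "comm_TL v s n (Dop h)"
  unfolding comm_TL_def
proof (intro ballI conjI allI impI)
  fix x :: "'a tensors" and i assume x: "x \<in> tensor_power n" and i: "1 \<le> i" "i < n"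
  show "Dop h (TL_gen_op v s i x) = TL_gen_op v s i (Dop h x)"
  proof (rule linear_map_eq_on_words[OF _ _ x])
    fix l :: "vbasis list" assume l: "length l = n"
    obtain p a b q where *: "l = p @ a # b # q" "i = Suc (length p)"
      by (rule list_split_TL[of i l]) (use i l in auto)
    show "Dop h (TL_gen_op v s i (word l)) = TL_gen_op v s i (Dop h (word l))"
      unfolding * linear_map_scale[OF linear_map_TL] TL_word[OF assms] Dop_word
      by (cases a; cases b)
        (simp_all add: uvec_mult linear_map_simps right_diff_distrib scl_diff mult.commute mult.left_commute
          flip: word_append word_Cons)
  qed (auto intro!: linear_map_intros linear_map_op_comp linear_map_Dop_comp)
next
  fix x :: "'a tensors" assume x: "x \<in> tensor_power n"
  then show "Dop h x \<in> tensor_power n"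
    by (rule linear_map_in_on_words[OF linear_map_Dop]) (auto intro: tensor_power_scl)
qed (auto simp: linear_map_simps)

lemma Dop_add: "Dop (\<lambda>k. h k + h' k) x = Dop h x + Dop h' x"
  by (rule linear_map_ext[of _ _ x]) (auto intro!: linear_map_intros simp: scl_add_left)

lemma Dop_scl: "Dop (\<lambda>k. c * h k) x = scl c (Dop h x)"
  by (rule linear_map_ext[of _ _ x]) (auto intro!: linear_map_intros)

lemma Dop_mult: "Dop (\<lambda>k. h k * h' k) x = Dop h (Dop h' x)"
  by (rule linear_map_ext[of _ _ x]) (auto intro!: linear_map_intros linear_map_Dop_comp simp: linear_map_simps mult.commute)

lemma Dop_eq_on:
  assumes "x \<in> tensor_power n" "\<And>k. k \<le> n \<Longrightarrow> h k = h' k"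
  shows "Dop h x = Dop h' x"
  by (rule linear_map_eq_on_words[OF _ _ assms(1)]) (use assms(2) ones_le in auto)

lemma Uops_Dop_add: "Dop h \<in> Uops v n \<Longrightarrow> Dop h' \<in> Uops v n \<Longrightarrow> Dop (\<lambda>k. h k + h' k) \<in> Uops v n"
  by (rule Uops.cong[OF Uops.add]) (auto simp: Dop_add)

lemma Uops_Dop_scl: "Dop h \<in> Uops v n \<Longrightarrow> Dop (\<lambda>k. c * h k) \<in> Uops v n"
  by (rule Uops.cong[OF Uops.scl]) (auto simp: Dop_scl)

lemma Uops_Dop_mult: "Dop h \<in> Uops v n \<Longrightarrow> Dop h' \<in> Uops v n \<Longrightarrow> Dop (\<lambda>k. h k * h' k) \<in> Uops v n"
  by (rule Uops.cong[OF Uops.comp[of "Dop h" v n "Dop h'"]]) (auto simp: Dop_mult)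

lemma Uops_Dop_cong: "Dop h \<in> Uops v n \<Longrightarrow> (\<And>k. k \<le> n \<Longrightarrow> h' k = h k) \<Longrightarrow> Dop h' \<in> Uops v n"
  by (erule Uops.cong, rule Dop_eq_on) auto

lemma Uops_Dop_K: "Dop (\<lambda>k. v powi (i * (int n - 2 * int k))) \<in> Uops v n"
proof (rule Uops.cong[OF Uops.K[of v i]])
  fix x :: "'a tensors" assume "x \<in> tensor_power n"
  then show "Dop (\<lambda>k. v powi (i * (int n - 2 * int k))) x = Kop v i x"
    by (rule linear_map_eq_on_words[rotated 2]) (auto simp: hgt_ones)
qed

text \<open>In \<open>EF_expansion\<close> the term \<open>i = a\<close> is the diagonal operator
  that is sought, and the other terms contain diagonal operators already obtained. The formula is
  known on sorted words only; both sides commute with the e_i, which carries it to all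
  tensors.\<close>

lemma Uops_Dop_qb:
  assumes v: "v \<noteq> 0"
  shows "Dop (\<lambda>k. qb v a (int n - 2 * int k)) \<in> Uops v n"
proof (induction a rule: less_induct)
  case (less a)
  let ?D = "\<lambda>a. Dop (\<lambda>k. qb v a (int n - 2 * int k))"
  let ?Q = "\<lambda>x. Eop v a (Fop v a x) - (\<Sum>i<a. Fop v (a - i) (Eop v (a - i) (?D i x)))"
  have Q: "?Q \<in> Uops v n"
    using less by (intro Uops_diff Uops.comp[OF Uops.E Uops.F] Uops_sum Uops.comp[OF Uops.F Uops.comp[OF Uops.E]]) auto
  show ?case
  proof (rule Uops.cong[OF Q])
    fix x :: "'a tensors" assume x: "x \<in> tensor_power n"
    show "?D a x = ?Q x"
    \<comment> \<open>The operators commute with the e_i for either sign; the sign 1 is chosen for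
      this argument.\<close>
    proof (rule comm_TL_eqI[OF v _ _ _ _ x, of 1])
      show "comm_TL v 1 n (?D a)" by (rule comm_TL_Dop[OF v])
      show "comm_TL v 1 n ?Q" by (rule comm_TL_Uops[OF v Q])
      show "1 * 1 = (1 :: 'a)" by simp
      fix N k :: nat assume n: "N + k = n"
      have D: "?D i (W0 N * W1 k) = scl (qb v i (int N - int k)) (W0 N * W1 k)" for i
        using n by (auto simp flip: word_append)
      have "{..a} = insert a {..<a}" by auto
      then have "Eop v a (Fop v a (W0 N * W1 k)) = scl (qb v a (int N - int k)) (W0 N * W1 k)
         + (\<Sum>i<a. scl (qb v i (int N - int k)) (Fop v (a - i) (Eop v (a - i) (W0 N * W1 k))))"
        unfolding EF_expansion[OF v] by simp
      then show "?D a (W0 N * W1 k) = ?Q (W0 N * W1 k)"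
        unfolding D by (simp add: linear_map_simps)
    qed
  qed
qed

text \<open>The first Pascal rule expresses a shift of the upper argument by 1 through a power of
  \<open>K\<close>, so shifts stay inside the image. The shift by \<open>n\<close> turns the
  argument into the natural number \<open>2 * (n - k)\<close>, to which \<open>qb_self\<close> and
  \<open>qb_less\<close> apply.\<close>

lemma Uops_Dop_qb_shift:
  assumes v: "v \<noteq> 0"
  shows "Dop (\<lambda>k. qb v t (int n - 2 * int k + int c)) \<in> Uops v n"
proof (induction c arbitrary: t)
  case 0
  then show ?case using Uops_Dop_qb[OF v] by simp
next
  case (Suc c)
  show ?case
  proof (cases t)
    case 0
    then show ?thesis using Uops_Dop_qb[OF v, of 0] by simp
  next
    case (Suc r)
    have "Dop (\<lambda>k. v powi (- (int r + 1)) * qb v (Suc r) (int n - 2 * int k + int c)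
      + v powi (int c - int r) * (v powi (1 * (int n - 2 * int k)) * qb v r (int n - 2 * int k + int c))) \<in> Uops v n"
      by (intro Uops_Dop_add Uops_Dop_scl Uops_Dop_mult Uops_Dop_K Suc.IH)
    then show ?thesis
    proof (rule Uops_Dop_cong)
      fix k
      have "int n - 2 * int k + int (Suc c) = (int n - 2 * int k + int c) + 1" by simp
      moreover have "v powi (int n - 2 * int k + int c - int r) = v powi (int c - int r) * v powi (1 * (int n - 2 * int k))"
        unfolding power_int_add[OF disjI1, OF v, symmetric] by (simp add: algebra_simps)
      ultimately show "qb v t (int n - 2 * int k + int (Suc c)) =
        v powi (- (int r + 1)) * qb v (Suc r) (int n - 2 * int k + int c)
        + v powi (int c - int r) * (v powi (1 * (int n - 2 * int k)) * qb v r (int n - 2 * int k + int c))"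
        unfolding Suc by (simp only: qb_pascal1[OF v] mult.assoc)
    qed
  qed
qed

text \<open>The binomial of 2(n - k) over 2(n - k0) is 1 at k = k0 and 0 for k > k0, whatever
  \<open>v\<close> is. Its values at k < k0 are removed with the projections already
  constructed.\<close>

lemma Uops_weight_projection:
  assumes v: "v \<noteq> 0"
  shows "k0 \<le> n \<Longrightarrow> Dop (\<lambda>k. if k = k0 then 1 else 0) \<in> Uops v n"
proof (induction k0 rule: less_induct)
  case (less k0)
  let ?q = "\<lambda>k. qb v (2 * (n - k0)) (int n - 2 * int k + int n)"
  let ?d = "\<lambda>k0 k. if k = k0 then 1 else 0 :: 'a"
  have Q: "(\<lambda>x. Dop ?q x - (\<Sum>j<k0. scl (?q j) (Dop (?d j) x))) \<in> Uops v n"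
    using less by (intro Uops_diff Uops_Dop_qb_shift[OF v] Uops_sum Uops.scl) auto
  show ?case
  proof (rule Uops.cong[OF Q])
    fix x :: "'a tensors" assume x: "x \<in> tensor_power n"
    show "Dop (?d k0) x = Dop ?q x - (\<Sum>j<k0. scl (?q j) (Dop (?d j) x))"
    proof (rule linear_map_eq_on_words[OF _ _ x])
      fix l :: "vbasis list" assume l: "length l = n"
      let ?k = "ones l"
      have le: "?k \<le> n" using ones_le[of l] l by simp
      have "(\<Sum>j<k0. scl (?q j) (Dop (?d j) (word l))) = (\<Sum>j<k0. if j = ?k then scl (?q ?k) (word l) else 0)"
        by (rule sum.cong) auto
      also have "\<dots> = (if ?k < k0 then scl (?q ?k) (word l) else 0)" by simp
      finally have S: "(\<Sum>j<k0. scl (?q j) (Dop (?d j) (word l))) = (if ?k < k0 then scl (?q ?k) (word l) else 0)" .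
      have e: "int n - 2 * int ?k + int n = int (2 * (n - ?k))" using le by (simp add: of_nat_diff)
      have "?q ?k = 1" if "?k = k0" using that qb_self[OF v, of "2 * (n - k0)"] unfolding e by simp
      moreover have "?q ?k = 0" if "?k > k0"
        unfolding e by (rule qb_less[OF v]) (use that le in auto)
      ultimately show "Dop (?d k0) (word l) = Dop ?q (word l) - (\<Sum>j<k0. scl (?q j) (Dop (?d j) (word l)))"
        unfolding S by (cases ?k k0 rule: linorder_cases) auto
    qed (auto intro!: linear_map_intros)
  qed
qed

lemma comm_TL_imp_Uops:
  assumes v: "v \<noteq> 0" "s * s = 1" and g: "comm_TL v s n g"
  shows "g \<in> Uops v n"
proof -
  have "\<exists>u\<in>Uops v n. u (W0 (n - k) * W1 k) = g (W0 (n - k) * W1 k)" if k: "k \<le> n" for k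
  proof (rule Uops_orbit_killed[OF v])
    have y: "W0 (n - k) * W1 k \<in> tensor_power n" using k by (simp flip: word_append)
    have "TL_gen_op v s i (W0 (n - k) * W1 k) = 0" if "1 \<le> i" "i < n" "i \<noteq> n - k" for i
      using TL_killed_sv[OF v(1), of s "n - k" k 0 0] that k by (auto simp: TL_killed_def sv_def)
    then show "TL_killed v s (n - k) k (g (W0 (n - k) * W1 k))"
      using g y k comm_TL_0[OF g] unfolding TL_killed_def comm_TL_def by (metis le_add_diff_inverse2)
  qed
  then obtain u where u: "\<And>k. k \<le> n \<Longrightarrow> u k \<in> Uops v n \<and> u k (W0 (n - k) * W1 k) = g (W0 (n - k) * W1 k)"
    by metis
  let ?d = "\<lambda>k0 k. if k = k0 then 1 else 0 :: 'a"
  \<comment> \<open>The projection to weight index \<open>k\<close> keeps only the sorted word with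
    \<open>k\<close> letters x1, so the separately chosen operators \<open>u k\<close> do not
    interfere.\<close>
  let ?u = "\<lambda>x. \<Sum>k\<le>n. u k (Dop (?d k) x)"
  have U: "?u \<in> Uops v n"
  proof (rule Uops_sum)
    fix k assume "k \<in> {..n}"
    then show "(\<lambda>x. u k (Dop (?d k) x)) \<in> Uops v n"
      using Uops.comp[of "u k" v n "Dop (?d k)"] u Uops_weight_projection[OF v(1), of k n] by simp
  qed
  show ?thesis
  proof (rule Uops.cong[OF U])
    fix x :: "'a tensors" assume x: "x \<in> tensor_power n"
    show "g x = ?u x"
    proof (rule comm_TL_eqI[OF v g _ _ x])
      show "comm_TL v s n ?u" by (rule comm_TL_Uops[OF v(1) U])
      fix N k :: nat assume n: "N + k = n"
      have u0: "u k' 0 = 0" if "k' \<le> n" for k'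
        using u[OF that] comm_TL_0[OF comm_TL_Uops[OF v(1)]] by blast
      have "?u (W0 N * W1 k) = (\<Sum>k'\<le>n. if k' = k then g (W0 N * W1 k) else 0)"
      proof (rule sum.cong)
        fix k' assume k': "k' \<in> {..n}"
        have "Dop (?d k') (W0 N * W1 k) = (if k' = k then W0 N * W1 k else 0)"
          by (auto simp flip: word_append)
        then show "u k' (Dop (?d k') (W0 N * W1 k)) = (if k' = k then g (W0 N * W1 k) else 0)"
          using u[of k] u0[of k'] k' n by auto
      qed simp
      then show "g (W0 N * W1 k) = ?u (W0 N * W1 k)" using n by simp
    qed
  qed
qed

section \<open>Vanishing of intertwiners at ballot entries\<close>

text \<open>A word is \<open>r\<close>-ballot if the lattice path starting at height \<open>r\<close> and going up at \<open>x\<^sub>0\<close> and down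
  at \<open>x\<^sub>1\<close> stays positive.\<close>

fun ballot :: "nat \<Rightarrow> vbasis list \<Rightarrow> bool" where
  "ballot r [] = (r > 0)"
| "ballot r (X0 # l) = (r > 0 \<and> ballot (Suc r) l)"
| "ballot r (X1 # l) = (r > 0 \<and> ballot (r - 1) l)"

lemma word_X0_X1_eq_0:
  assumes "word [X0] * x + word [X1] * y = (0 :: 'k::field tensors)"
  shows "x = 0" "y = 0"
proof -
  have *: "lookup (word [X0] * x + word [X1] * y) (Mon l) = 0" for l using assms by simp
  show "x = 0"
  proof (rule poly_mapping_eqI)
    fix w show "lookup x w = lookup 0 w"
      using *[of "X0 # letters w"] by (simp add: lookup_add lookup_word_mult)
  qed
  show "y = 0"
  proof (rule poly_mapping_eqI)
    fix w show "lookup y w = lookup 0 w"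
      using *[of "X1 # letters w"] by (simp add: lookup_add lookup_word_mult)
  qed
qed

lemma tensor_Suc_decompose:
  assumes "x \<in> tensor_power (Suc n)"
  shows "\<exists>a\<in>tensor_power n. \<exists>b\<in>tensor_power n. x = word [X0] * a + word [X1] * b"
  using assms
proof (induction rule: tensor_induct)
  case zero
  show ?case by (rule bexI[of _ 0] bexI[of _ 0])+ auto
next
  case (add l c m)
  then obtain a b where ab: "a \<in> tensor_power n" "b \<in> tensor_power n" "m = word [X0] * a + word [X1] * b" by blast
  obtain y l' where l: "l = y # l'" "length l' = n" using add by (cases l) auto
  show ?case
  proof (cases y)
    case X0
    then show ?thesis using ab l
      by (intro bexI[of _ "scl c (word l') + a"] bexI[of _ b])
        (auto simp: algebra_simps word_Cons[of X0 l'] intro!: tensor_power_intros)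
  next
    case X1
    then show ?thesis using ab l
      by (intro bexI[of _ a] bexI[of _ "scl c (word l') + b"])
        (auto simp: algebra_simps word_Cons[of X1 l'] intro!: tensor_power_intros)
  qed
qed

text \<open>Writing \<open>w = x\<^sub>0 \<otimes> a + x\<^sub>1 \<otimes> b\<close>, if \<open>w\<close> is killed by \<open>E\<^sup>(\<^sup>j\<^sup>)\<close> for all \<open>j \<ge> r\<close> then \<open>a\<close> is so for \<open>j > r\<close>; once
  \<open>a = 0\<close>, \<open>b\<close> is so for \<open>j \<ge> r - 1\<close>.  This is the recursion of ballot paths.\<close>

lemma E_killed_eq_0:
  assumes v: "v \<noteq> 0"
  shows "w \<in> tensor_power n \<Longrightarrow> (\<And>j. j \<ge> r \<Longrightarrow> Eop v j w = 0) \<Longrightarrow>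
    (\<And>l. length l = n \<Longrightarrow> ballot r l \<Longrightarrow> lookup w (Mon l) = 0) \<Longrightarrow> w = 0"
proof (induction n arbitrary: r w)
  case 0
  show ?case
  proof (cases r)
    case 0
    then show ?thesis using "0.prems"(2)[of 0] by simp
  next
    case (Suc r')
    then have z: "lookup w (Mon []) = 0" using "0.prems"(3)[of "[]"] by simp
    show ?thesis by (rule tensor_eqI[OF "0.prems"(1)]) (use z in auto)
  qed
next
  case (Suc n)
  obtain a b where ab: "a \<in> tensor_power n" "b \<in> tensor_power n" and w: "w = word [X0] * a + word [X1] * b"
    using tensor_Suc_decompose[OF Suc.prems(1)] by blast
  have E: "Eop v j w = word [X0] * (scl (v powi int j) (Eop v j a) + (if j = 0 then 0 else Eop v (j - 1) b))
     + word [X1] * scl (v powi (- int j)) (Eop v j b)" for j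
    by (simp add: w linear_map_simps Eop_X0 Eop_X1 algebra_simps)
  have 1: "scl (v powi int j) (Eop v j a) + (if j = 0 then 0 else Eop v (j - 1) b) = 0"
    and 2: "scl (v powi (- int j)) (Eop v j b) = 0" if "j \<ge> r" for j
    using word_X0_X1_eq_0[OF trans[OF E[of j, symmetric] Suc.prems(2)[OF that]]] by blast+
  have sc0: "scl c x = 0 \<Longrightarrow> c \<noteq> 0 \<Longrightarrow> x = 0" for c and x :: "'a tensors"
    by (metis scl_0(2) scl_1 scl_scl left_inverse)
  have b: "Eop v j b = 0" if "j \<ge> r" for j using 2[OF that] sc0[of "v powi (- int j)"] v by auto
  show ?case
  \<comment> \<open>For \<open>r = 0\<close> the assumption covers \<open>E^(0)\<close>, which is
    the identity.\<close>
  proof (cases "r = 0")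
    case True
    then show ?thesis using Suc.prems(2)[of 0] by simp
  next
    case r: False
    have a: "Eop v j a = 0" if "j \<ge> Suc r" for j
      using 1[of j] b[of "j - 1"] sc0[of "v powi (int j)"] v that by (cases j) auto
    have "a = 0"
    proof (rule Suc.IH[OF ab(1), of "Suc r"])
      fix l :: "vbasis list" assume "length l = n" "ballot (Suc r) l"
      then show "lookup a (Mon l) = 0"
        using Suc.prems(3)[of "X0 # l"] r by (simp add: w lookup_add lookup_word_mult)
    qed (use a in auto)
    have "b = 0"
    proof (rule Suc.IH[OF ab(2), of "r - 1"])
      fix j assume "r - 1 \<le> j"
      then show "Eop v j b = 0" using 1[of "Suc j"] \<open>a = 0\<close> by simp
    next
      fix l :: "vbasis list" assume "length l = n" "ballot (r - 1) l"
      then show "lookup b (Mon l) = 0"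
        using Suc.prems(3)[of "X1 # l"] r by (simp add: w lookup_add lookup_word_mult)
    qed
    with \<open>a = 0\<close> show ?thesis by (simp add: w)
  qed
qed

section \<open>Nested cups and intertwiners\<close>

fun flip :: "vbasis \<Rightarrow> vbasis" where
  "flip X0 = X1"
| "flip X1 = X0"

lemma flip_flip [simp]: "flip (flip a) = a" by (cases a) auto

abbreviation bar :: "vbasis list \<Rightarrow> vbasis list" where
  "bar l \<equiv> rev (map flip l)"

text \<open>The coevaluation \<open>\<Sum> coev v w \<cdot> w \<otimes> bar w\<close> is the vector of \<open>n\<close> nested cups.\<close>

fun coev :: "'k::field \<Rightarrow> vbasis list \<Rightarrow> 'k" where
  "coev v [] = 1"
| "coev v (X0 # l) = inverse v * coev v l"
| "coev v (X1 # l) = - coev v l"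

lemma coev_append: "coev v (p @ q) = coev v p * coev v q"
  by (induction p rule: hgt.induct) auto

lemma coev_nonzero: "v \<noteq> 0 \<Longrightarrow> coev v l \<noteq> 0"
  by (induction l rule: hgt.induct) auto

lemma finite_words [simp]: "finite {l :: vbasis list. length l = n}"
proof -
  have U: "(UNIV :: vbasis set) = {X0, X1}" by (auto intro: vbasis.exhaust)
  have "finite {l. set l \<subseteq> (UNIV :: vbasis set) \<and> length l = n}"
    by (rule finite_lists_length_eq) (simp add: U)
  then show ?thesis by simp
qed

lemma sum_words_Suc:
  "(\<Sum>l\<in>{l. length l = Suc n}. f l) = (\<Sum>l\<in>{l. length l = n}. f (l @ [X0]) + f (l @ [X1]))"
proof -
  have S: "{l. length l = Suc n} = (\<lambda>l. l @ [X0]) ` {l. length l = n} \<union> (\<lambda>l. l @ [X1]) ` {l. length l = n}"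
  proof (intro equalityI subsetI)
    fix l :: "vbasis list" assume "l \<in> {l. length l = Suc n}"
    then have "l = butlast l @ [last l]" "length (butlast l) = n" by (cases l rule: rev_cases; simp)+
    then show "l \<in> (\<lambda>l. l @ [X0]) ` {l. length l = n} \<union> (\<lambda>l. l @ [X1]) ` {l. length l = n}"
      by (cases "last l") (auto intro!: image_eqI[of _ _ "butlast l"])
  qed auto
  show ?thesis unfolding S
    by (subst sum.union_disjoint) (auto simp: sum.reindex inj_on_def sum.distrib)
qed

text \<open>Passing from \<open>n\<close> to \<open>n + 1\<close> nested cups inserts one cup in the
  middle, and by invariance of the cup \<open>E^(j)\<close> passes through this insertion. Without
  cups the vector is 1, which \<open>E^(j)\<close> kills for \<open>j > 0\<close>.\<close>

lemma Eop_coev: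
  assumes v: "v \<noteq> 0" and "j > 0"
  shows "Eop v j (\<Sum>l\<in>{l. length l = n}. scl (coev v l) (word l * word (bar l))) = 0"
proof (induction n)
  case 0
  then show ?case using assms by simp
next
  case (Suc n)
  \<comment> \<open>Inserts a cup behind the first \<open>n\<close> letters. The two words
    \<open>l @ [X0]\<close> and \<open>l @ [X1]\<close> in \<open>sum_words_Suc\<close> supply the
    two terms of \<open>uvec\<close>.\<close>
  define ins where "ins = lin_ext (\<lambda>l. word (take n l) * (uvec v * word (drop n l)))"
  let ?c = "\<lambda>n. \<Sum>l\<in>{l. length l = n}. scl (coev v l) (word l * word (bar l))"
  have lin: "linear_map ins" by (simp add: ins_def linear_map_lin_ext)
  have ins: "ins (x * y) = x * (uvec v * y)" if x: "x \<in> tensor_power n" for x y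
  proof (rule linear_map_eq_on_words[OF _ _ x])
    fix l :: "vbasis list" assume l: "length l = n"
    show "ins (word l * y) = word l * (uvec v * y)"
    proof (rule linear_map_ext[of _ _ y])
      show "ins (word l * word q) = word l * (uvec v * word q)" for q
        by (simp add: l ins_def flip: word_append)
    qed (auto intro!: linear_map_intros linear_map_comp[OF lin])
  qed (auto intro!: linear_map_intros linear_map_comp[OF lin])
  have "?c (Suc n) = ins (?c n)"
    unfolding sum_words_Suc linear_map_sum[OF lin]
    by (rule sum.cong)
      (auto simp: ins linear_map_scale[OF lin] uvec_mult coev_append right_diff_distrib scl_diff mult.commute
        word_append[of _ "[_]"] word_Cons[of _ "bar _"] mult.assoc)
  moreover have "Eop v j (ins x) = ins (Eop v j x)" if x: "x \<in> tensor_power (n + m)" for x m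
  proof (rule linear_map_eq_on_words[OF _ _ x])
    fix l :: "vbasis list" assume l: "length l = n + m"
    have w: "word l = word (take n l) * word (drop n l)" by (simp flip: word_append)
    have t: "word (take n l) \<in> tensor_power n" using l by simp
    show "Eop v j (ins (word l)) = ins (Eop v j (word l))"
      unfolding w ins[OF t] Eop_mult[OF v, of j "word (take n l)" "uvec v * word (drop n l)"]
        Eop_mult[OF v, of j "word (take n l)" "word (drop n l)"] linear_map_sum[OF lin] linear_map_scale[OF lin]
      by (intro sum.cong refl, subst ins) (auto intro!: Eop_tensor_power Kop_tensor_power simp: Eop_uvec v l simp del: Eop_word Kop_word)
  qed (auto intro!: linear_map_intros linear_map_op_comp linear_map_comp[OF lin] lin)
  moreover have "?c n \<in> tensor_power (n + n)"
    by (auto intro!: tensor_power_intros simp flip: word_append)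
  ultimately show ?case using Suc lin by (simp add: linear_map_0)
qed

lemma all_prefixes_Cons:
  "(\<forall>p q. a # l = p @ q \<longrightarrow> P p) \<longleftrightarrow> P [] \<and> (\<forall>p q. l = p @ q \<longrightarrow> P (a # p))"
  by (auto simp: Cons_eq_append_conv)

text \<open>The recursive form fits the induction on the first letter in
  \<open>E_killed_eq_0\<close>; the prefix form is the one that survives cutting words and deleting
  factors x0 x1.\<close>

lemma ballot_iff: "ballot r l \<longleftrightarrow> (\<forall>p q. l = p @ q \<longrightarrow> int r + hgt p > 0)"
proof (induction l arbitrary: r rule: hgt.induct)
  case (3 l)
  have "int (r - 1) = int r - 1" if "r > 0" using that by auto
  then show ?case
    unfolding all_prefixes_Cons ballot.simps 3 by (auto simp: algebra_simps)
next
  case (2 l)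
  show ?case unfolding all_prefixes_Cons ballot.simps 2 by (auto simp: algebra_simps)
qed auto

lemma hgt_bar [simp]: "hgt (bar l) = - hgt l"
  by (induction l rule: hgt.induct) auto

definition comm_U :: "'k::field \<Rightarrow> nat \<Rightarrow> ('k tensors \<Rightarrow> 'k tensors) \<Rightarrow> bool" where
  "comm_U v n f \<longleftrightarrow> (\<forall>x\<in>tensor_power n. f x \<in> tensor_power n \<and>
     (\<forall>y\<in>tensor_power n. f (x + y) = f x + f y) \<and> (\<forall>c. f (scl c x) = scl c (f x)) \<and>
     (\<forall>u\<in>Uops v n. f (u x) = u (f x)))"

lemma Dop_eq_lookup:
  assumes "x \<in> tensor_power n"
  shows "lookup (Dop h x) (Mon l) = h (ones l) * lookup x (Mon l)"
  using assms
  by (induction rule: tensor_induct) (auto simp: linear_map_simps lookup_add lookup_word algebra_simps)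

lemma comm_U_eq_0:
  assumes v: "v \<noteq> 0" and f: "comm_U v n f"
    and ballot: "\<And>r c. length r = n \<Longrightarrow> length c = n \<Longrightarrow> ballot 1 r \<Longrightarrow> ballot 1 c \<Longrightarrow> ones r = ones c \<Longrightarrow>
       lookup (f (word c)) (Mon r) = 0"
    and x: "x \<in> tensor_power n"
  shows "f x = 0"
proof -
  have in_tp: "y \<in> tensor_power n \<Longrightarrow> f y \<in> tensor_power n"
    and add: "y \<in> tensor_power n \<Longrightarrow> z \<in> tensor_power n \<Longrightarrow> f (y + z) = f y + f z"
    and scale: "y \<in> tensor_power n \<Longrightarrow> f (scl c y) = scl c (f y)"
    and comm: "y \<in> tensor_power n \<Longrightarrow> u \<in> Uops v n \<Longrightarrow> f (u y) = u (f y)" for y z c u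
    using f by (auto simp: comm_U_def)
  have f0: "f 0 = 0" using scale[of 0 0] by simp
  \<comment> \<open>\<open>f\<close> commutes with the weight projections, so entries between
    different weights vanish.\<close>
  have weight: "lookup (f (word c)) (Mon r) = 0" if "length r = n" "length c = n" "ones r \<noteq> ones c" for r c
  proof -
    have "Dop (\<lambda>k. if k = ones c then 1 else 0) \<in> Uops v n"
      using ones_le[of c] that by (intro Uops_weight_projection[OF v]) auto
    from comm[OF _ this, of "word c"] in_tp[of "word c"] that
    have "f (word c) = Dop (\<lambda>k. if k = ones c then 1 else 0) (f (word c))" by simp
    then have "lookup (f (word c)) (Mon r) = lookup (Dop (\<lambda>k. if k = ones c then 1 else 0) (f (word c))) (Mon r)"
      by simp
    also have "\<dots> = 0" using Dop_eq_lookup[OF in_tp[of "word c"]] that by simp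
    finally show ?thesis .
  qed
  \<comment> \<open>\<open>f\<close> tensored with the identity on the letters behind the first
    \<open>n\<close>; it commutes with \<open>E^(j)\<close> because \<open>f\<close> commutes with
    the left factors in the coproduct.\<close>
  define F where "F = lin_ext (\<lambda>l. f (word (take n l)) * word (drop n l))"
  have linF: "linear_map F" by (simp add: F_def linear_map_lin_ext)
  have F: "F (y * z) = f y * z" if y: "y \<in> tensor_power n" for y z
    using y
  proof (induction rule: tensor_induct)
    case zero
    then show ?case using f0 linF by (simp add: linear_map_0)
  next
    case (add l c m)
    have "F (word l * z) = f (word l) * z"
    proof (rule linear_map_ext[of _ _ z])
      show "F (word l * word q) = f (word l) * word q" for q
        using add by (simp add: F_def flip: word_append)
    qed (auto intro!: linear_map_intros linear_map_comp[OF linF])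
    moreover have "f (scl c (word l) + m) = scl c (f (word l)) + f m"
      using add \<open>\<And>z y. y \<in> tensor_power n \<Longrightarrow> z \<in> tensor_power n \<Longrightarrow> f (y + z) = f y + f z\<close>
        scale[of "word l" c] tensor_power_scl[of "word l" n c] by simp
    ultimately show ?case using add by (simp add: distrib_right linear_map_add[OF linF] linear_map_scale[OF linF])
  qed
  have EF: "Eop v j (F y) = F (Eop v j y)" if y: "y \<in> tensor_power (n + m)" for y j m
  proof (rule linear_map_eq_on_words[OF _ _ y])
    fix l :: "vbasis list" assume l: "length l = n + m"
    have w: "word l = word (take n l) * word (drop n l)" by (simp flip: word_append)
    have t: "word (take n l) \<in> tensor_power n" using l by simp
    show "Eop v j (F (word l)) = F (Eop v j (word l))"
      unfolding w F[OF t] Eop_mult[OF v] linear_map_sum[OF linF] linear_map_scale[OF linF]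
    proof (intro sum.cong refl, subst F)
      fix i
      let ?t = "word (take n l)"
      show "Eop v i (Kop v (int (j - i)) ?t) \<in> tensor_power n"
        by (intro Eop_tensor_power Kop_tensor_power t)
      have "f (Eop v i (Kop v (int (j - i)) ?t)) = Eop v i (Kop v (int (j - i)) (f ?t))"
        using comm[OF t Uops.comp[OF Uops.E Uops.K]] .
      then show "scl (v powi (int i * int (j - i))) (Eop v i (Kop v (int (j - i)) (f ?t)) * Eop v (j - i) (word (drop n l))) =
        scl (v powi (int i * int (j - i))) (f (Eop v i (Kop v (int (j - i)) ?t)) * Eop v (j - i) (word (drop n l)))" by simp
    qed
  qed (auto intro!: linear_map_intros linear_map_op_comp linear_map_comp[OF linF] linF)
  let ?c = "\<Sum>l\<in>{l. length l = n}. scl (coev v l) (word l * word (bar l))"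
  have c: "?c \<in> tensor_power (n + n)" by (auto intro!: tensor_power_intros simp flip: word_append)
  define w where "w = F ?c"
  have w_eq: "w = (\<Sum>l\<in>{l. length l = n}. scl (coev v l) (f (word l) * word (bar l)))"
    unfolding w_def linear_map_sum[OF linF] linear_map_scale[OF linF] by (rule sum.cong) (auto simp: F)
  \<comment> \<open>Up to the unit \<open>coev v c\<close>, the coefficients of \<open>w\<close> are
    the matrix entries of \<open>f\<close>.\<close>
  have w_lookup: "lookup w (Mon (r @ bar c)) = coev v c * lookup (f (word c)) (Mon r)" if "length r = n" "length c = n" for r c
  proof -
    have "lookup w (Mon (r @ bar c)) = (\<Sum>l\<in>{l. length l = n}. coev v l * (lookup (f (word l)) (Mon r) * lookup (word (bar l)) (Mon (bar c))))"
      unfolding w_eq lookup_sum lookup_scl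
      by (intro sum.cong refl arg_cong2[of _ _ _ _ "(*)"] lookup_mult_append) (use in_tp that in auto)
    also have "\<dots> = (\<Sum>l\<in>{l. length l = n}. if l = c then coev v c * lookup (f (word c)) (Mon r) else 0)"
    proof (rule sum.cong)
      fix l
      have "bar l = bar c \<longleftrightarrow> l = c" by (metis (no_types, lifting) flip_flip rev_rev_ident list.inj_map_strong)
      then show "coev v l * (lookup (f (word l)) (Mon r) * lookup (word (bar l)) (Mon (bar c))) =
         (if l = c then coev v c * lookup (f (word c)) (Mon r) else 0)" by (simp add: lookup_word)
    qed simp
    also have "\<dots> = coev v c * lookup (f (word c)) (Mon r)" using that by simp
    finally show ?thesis .
  qed
  have "w = 0"
  proof (rule E_killed_eq_0[OF v, of _ "n + n" 1])
    show "w \<in> tensor_power (n + n)" unfolding w_eq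
      by (intro tensor_power_sum tensor_power_scl tensor_power_mult in_tp) auto
    fix j :: nat assume "1 \<le> j"
    then show "Eop v j w = 0" unfolding w_def EF[OF c] using Eop_coev[OF v, of j n] linF by (simp add: linear_map_0)
  next
    fix l :: "vbasis list" assume l: "length l = n + n" "ballot 1 l"
    define r c where "r = take n l" and "c = bar (drop n l)"
    have "bar c = drop n l" by (simp add: c_def rev_map comp_def)
    then have rc: "l = r @ bar c" "length r = n" "length c = n" using l by (auto simp: r_def c_def)
    have "lookup (f (word c)) (Mon r) = 0"
    proof (cases "ones r = ones c")
      case True
      have h: "hgt r = hgt c" using True rc by (simp add: hgt_ones)
      have "ballot 1 r" using l unfolding ballot_iff rc(1) by (metis append.assoc)
      moreover have "ballot 1 c" unfolding ballot_iff
      proof (intro allI impI)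
        fix p q assume pq: "c = p @ q"
        \<comment> \<open>The prefix \<open>r @ bar q\<close> of \<open>l\<close> has height
          \<open>hgt r - hgt q\<close>, which is \<open>hgt p\<close> because \<open>r\<close> and
          \<open>c\<close> have equal height.\<close>
        then have "l = (r @ bar q) @ bar p" using rc by simp
        then have "0 < int 1 + hgt (r @ bar q)" using l(2) unfolding ballot_iff by blast
        then show "0 < int 1 + hgt p" using h pq by simp
      qed
      ultimately show ?thesis using ballot rc True by blast
    qed (use weight rc in auto)
    then show "lookup w (Mon l) = 0" using w_lookup[OF rc(2,3)] rc by simp
  qed
  have word: "f (word c) = 0" if "length c = n" for c
    by (rule tensor_eqI[OF in_tp tensor_power_zero])
      (use w_lookup[OF _ that] \<open>w = 0\<close> coev_nonzero[OF v, of c] that in auto)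
  from x show ?thesis
  proof (induction rule: tensor_induct)
    case (add l c m)
    then have "f (scl c (word l) + m) = scl c (f (word l)) + f m"
      using \<open>\<And>z y. y \<in> tensor_power n \<Longrightarrow> z \<in> tensor_power n \<Longrightarrow> f (y + z) = f y + f z\<close>
        scale[of "word l" c] tensor_power_scl[of "word l" n c] by simp
    with add word show ?case by simp
  qed (rule f0)
qed

section \<open>Jones normal forms\<close>

text \<open>The words without a factor x0 x1. Hence \<open>no01 (X1 # q)\<close> says that in
  \<open>p @ X0 # X1 # q\<close> the displayed factor x0 x1 is the last one, which makes
  \<open>p\<close> and \<open>q\<close> unique (\<open>last01_unique\<close>).\<close>

definition no01 :: "vbasis list \<Rightarrow> bool" where
  "no01 l \<longleftrightarrow> (\<exists>a b. l = replicate a X1 @ replicate b X0)"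

lemma no01_Cons: "no01 (x # l) \<Longrightarrow> no01 l"
proof -
  assume "no01 (x # l)"
  then obtain a b where *: "x # l = replicate a X1 @ replicate b X0" by (auto simp: no01_def)
  show "no01 l"
  proof (cases a)
    case 0
    with * have "l = replicate 0 X1 @ replicate (b - 1) X0" by (cases b) auto
    then show ?thesis unfolding no01_def by blast
  next
    case (Suc a')
    with * have "l = replicate a' X1 @ replicate b X0" by auto
    then show ?thesis unfolding no01_def by blast
  qed
qed

lemma no01_X1_Cons: "no01 (X1 # l) \<longleftrightarrow> no01 l"
proof
  assume "no01 l"
  then obtain a b where "l = replicate a X1 @ replicate b X0" by (auto simp: no01_def)
  then have "X1 # l = replicate (Suc a) X1 @ replicate b X0" by simp
  then show "no01 (X1 # l)" unfolding no01_def by blast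
qed (rule no01_Cons)

lemma no01_X0_Cons: "no01 (X0 # l) \<longleftrightarrow> l = replicate (length l) X0"
proof
  assume "no01 (X0 # l)"
  then obtain a b where *: "X0 # l = replicate a X1 @ replicate b X0" by (auto simp: no01_def)
  then have "a = 0" by (cases a) auto
  with * obtain b' where "l = replicate b' X0" by (cases b) auto
  then show "l = replicate (length l) X0" by simp
next
  assume *: "l = replicate (length l) X0"
  have "X0 # l = replicate 0 X1 @ replicate (Suc (length l)) X0" by (subst *) simp
  then show "no01 (X0 # l)" unfolding no01_def by blast
qed

lemma not_no01: "\<not> no01 (u @ X0 # X1 # w)"
proof (induction u)
  case Nil
  show ?case by (simp add: no01_X0_Cons)
next
  case (Cons x u)
  then show ?case using no01_Cons by auto
qed

lemma no01_or_last01: "no01 l \<or> (\<exists>p q. l = p @ X0 # X1 # q \<and> no01 (X1 # q))"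
proof (induction l)
  case (Cons x l)
  show ?case
  proof (cases "no01 l")
    case True
    then obtain a b where l: "l = replicate a X1 @ replicate b X0" by (auto simp: no01_def)
    show ?thesis
    proof (cases x)
      case X0
      show ?thesis
      proof (cases a)
        case 0
        then show ?thesis by (simp add: X0 l no01_X0_Cons)
      next
        case (Suc a')
        then have "x # l = [] @ X0 # X1 # (replicate a' X1 @ replicate b X0)" by (simp add: X0 l)
        moreover have "no01 (X1 # (replicate a' X1 @ replicate b X0))" using True Suc l by simp
        ultimately show ?thesis by blast
      qed
    next
      case X1
      then show ?thesis using True by (simp add: no01_X1_Cons)
    qed
  next
    case False
    then show ?thesis using Cons by (metis append_Cons)
  qed
qed (auto simp: no01_def)

lemma last01_unique:
  assumes "p @ X0 # X1 # q = p' @ X0 # X1 # q'" "no01 (X1 # q)" "no01 (X1 # q')"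
  shows "p = p' \<and> q = q'"
proof -
  have main: "p = p' \<and> q = q'" if "p' = p @ us" "X0 # X1 # q = us @ X0 # X1 # q'" "no01 (X1 # q)" for p p' q q' us
  proof (cases us)
    case (Cons u us')
    then have "X1 # q = us' @ X0 # X1 # q'" using that by simp
    then show ?thesis using that(3) not_no01 by metis
  qed (use that in auto)
  from assms(1) obtain us where "p = p' @ us \<and> us @ X0 # X1 # q = X0 # X1 # q' \<or>
      p @ us = p' \<and> X0 # X1 # q = us @ X0 # X1 # q'"
    by (auto simp: append_eq_append_conv2)
  then show ?thesis
    using main[of p' p us q q'] main[of p p' us q' q] assms(2,3) by metis
qed

text \<open>\<open>NF m r c w\<close>: the word \<open>w\<close> is a Jones normal form of \<open>TL\<^sub>m\<close>, whose operator has its leading matrix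
  entry in row \<open>r\<close> and column \<open>c\<close>.  The letters \<open>X1\<close> of \<open>r\<close> and \<open>c\<close> mark the right ends of the arcs at the
  top and bottom of the corresponding diagram.\<close>

inductive NF :: "nat \<Rightarrow> vbasis list \<Rightarrow> vbasis list \<Rightarrow> nat list \<Rightarrow> bool" where
  nil: "NF 0 [] [] []"
| ext: "NF m r c w \<Longrightarrow> NF (Suc m) (r @ [X0]) (c @ [X0]) w"
| blk: "NF m r (p @ q @ [b]) w \<Longrightarrow> no01 (q @ [b]) \<Longrightarrow>
    NF (Suc m) (r @ [flip b]) (p @ X0 # X1 # q) (w @ rev [Suc (length p)..<Suc m])"

lemma NF_length: "NF m r c w \<Longrightarrow> length r = m \<and> length c = m"
  by (induction rule: NF.induct) auto

lemma NF_letters: "NF m r c w \<Longrightarrow> set w \<subseteq> {1..<m}"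
  by (induction rule: NF.induct) auto

lemma no01_butlast: "no01 (q @ [b]) \<Longrightarrow> no01 q"
proof -
  assume *: "no01 (q @ [b])"
  show "no01 q"
  proof (rule ccontr)
    assume "\<not> no01 q"
    then obtain u w where "q = u @ X0 # X1 # w" using no01_or_last01 by blast
    then have "q @ [b] = u @ X0 # X1 # (w @ [b])" by simp
    then show False using * not_no01 by metis
  qed
qed

lemma NF_Suc_cases [consumes 1, case_names ext blk]:
  assumes "NF (Suc m) r c w"
  obtains (ext) r' c' where "r = r' @ [X0]" "c = c' @ [X0]" "NF m r' c' w"
  | (blk) r' p q b w' where "r = r' @ [flip b]" "c = p @ X0 # X1 # q" "w = w' @ rev [Suc (length p)..<Suc m]"
      "NF m r' (p @ q @ [b]) w'" "no01 (q @ [b])"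
  using assms by (cases rule: NF.cases) auto

text \<open>When \<open>blk\<close> appends x0 to the row, its letter \<open>b\<close> is x1; then
  \<open>q\<close> consists of x1 only and the column ends in x1, whereas \<open>ext\<close> makes
  it end in x0.\<close>

lemma ext_blk_disjoint: "c @ [X0] = p @ X0 # X1 # q \<Longrightarrow> no01 (q @ [X1]) \<Longrightarrow> False"
proof -
  assume *: "c @ [X0] = p @ X0 # X1 # q" "no01 (q @ [X1])"
  from *(1) obtain q' where "q = q' @ [X0]"
    by (cases q rule: rev_cases) (auto simp: append_eq_append_conv2 append_eq_Cons_conv Cons_eq_append_conv)
  then have "q @ [X1] = q' @ X0 # X1 # []" by simp
  then show False using *(2) not_no01 by metis
qed

lemma flip_eq_X0: "X0 = flip b \<longleftrightarrow> b = X1" "flip b = X0 \<longleftrightarrow> b = X1"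
  by (cases b; simp)+

text \<open>The rules can be undone from \<open>r\<close> and \<open>c\<close>: their last letters
  decide between \<open>ext\<close> and \<open>blk\<close>, the last factor x0 x1 of the column
  gives \<open>p\<close> and \<open>q\<close>, and the last letter of the row gives
  \<open>b\<close>.\<close>

lemma NF_unique: "NF m r c w \<Longrightarrow> NF m r c w' \<Longrightarrow> w = w'"
proof (induction arbitrary: w' rule: NF.induct)
  case nil
  then show ?case by (cases rule: NF.cases) auto
next
  case (ext m r c w)
  from ext.prems show ?case
  proof (cases rule: NF_Suc_cases)
    case (ext r' c')
    then show ?thesis using ext.IH by auto
  next
    case (blk r' p q b w'')
    then show ?thesis using ext_blk_disjoint[of c p q] by (auto simp: flip_eq_X0)
  qed
next
  case (blk m r p q b w)
  from blk.prems show ?case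
  proof (cases rule: NF_Suc_cases)
    case (ext r' c')
    then show ?thesis using ext_blk_disjoint[of c' p q] blk.hyps by (auto simp: flip_eq_X0)
  next
    case (blk r' p' q' b' w'')
    have "no01 (X1 # q)" "no01 (X1 # q')" using \<open>no01 (q @ [b])\<close> blk no01_butlast no01_X1_Cons by blast+
    then have pq: "p = p'" "q = q'" using last01_unique[of p q p' q'] blk by auto
    have f: "flip b = flip b'" "r = r'" using blk by auto
    then have "b = b'" by (metis flip_flip)
    then show ?thesis using blk(3,4) blk.IH[of w''] pq f by auto
  qed
qed

text \<open>The last factor x0 x1 of the column marks the lower end of the last block, because
  \<open>ext\<close> only appends x0 and \<open>blk\<close> inserts a factor with no other behind
  it. The straightening of products locates the block it meets in this way.\<close>

lemma NF_last_block:
  "NF m r c w \<Longrightarrow> c = p @ X0 # X1 # q \<Longrightarrow> no01 (X1 # q) \<Longrightarrow>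
    \<exists>m' w' r' c'. m' \<le> m \<and> Suc (length p) < m' \<and> w = w' @ rev [Suc (length p)..<m'] \<and> NF (m' - 1) r' c' w'"
proof (induction arbitrary: q rule: NF.induct)
  case (ext m r c w)
  obtain q0 where q: "q = q0 @ [X0]"
    using ext.prems(1) by (cases q rule: rev_cases)
      (auto simp: append_eq_append_conv2 append_eq_Cons_conv Cons_eq_append_conv)
  then have "c = p @ X0 # X1 # q0" using ext.prems by simp
  moreover have "no01 (X1 # q0)" using ext.prems(2) q no01_butlast[of "X1 # q0"] by simp
  ultimately show ?case using ext.IH[of q0] by (meson le_Suc_eq)
next
  case (blk m r p' q' b w)
  have "no01 (X1 # q')" using \<open>no01 (q' @ [b])\<close> no01_butlast no01_X1_Cons by blast
  then have "p = p'" using last01_unique[of p' q' p q] blk.prems by auto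
  moreover have "m = length p' + length q' + 1" using NF_length[OF blk.hyps(1)] by auto
  ultimately show ?case using blk.hyps(1)
    by (intro exI[of _ "Suc m"] exI[of _ w] exI[of _ r] exI[of _ "p' @ q' @ [b]"]) auto
qed auto

lemma NF_extend: "NF m r c w \<Longrightarrow> NF (m + k) (r @ replicate k X0) (c @ replicate k X0) w"
proof (induction k)
  case (Suc k)
  then show ?case using NF.ext[of "m + k"] by (simp flip: replicate_append_same add: append_assoc[symmetric] del: append_assoc)
qed simp

lemma NF_Nil: "NF m (replicate m X0) (replicate m X0) []"
  using NF_extend[OF NF.nil, of m] by simp

lemma ballot_0 [simp]: "\<not> ballot 0 l"
  by (induction l rule: hgt.induct) auto

text \<open>The rules are run backwards: if both words end in x0 these letters are removed,
  otherwise the last factor x0 x1 of \<open>c\<close> is deleted and the flipped last letter of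
  \<open>r\<close> is appended. The deletion does not change the heights of the remaining
  prefixes.\<close>

lemma ballot_imp_NF:
  "length r = m \<Longrightarrow> length c = m \<Longrightarrow> ballot 1 r \<Longrightarrow> ballot 1 c \<Longrightarrow> ones r = ones c \<Longrightarrow> \<exists>w. NF m r c w"
proof (induction m arbitrary: r c)
  case 0
  then show ?case using NF.nil by auto
next
  case (Suc m)
  obtain r' a where r: "r = r' @ [a]" using Suc.prems(1) by (cases r rule: rev_cases) auto
  obtain c' b where c: "c = c' @ [b]" using Suc.prems(2) by (cases c rule: rev_cases) auto
  have pre: "ballot 1 p" if "ballot 1 (p @ q)" for p q
    using that unfolding ballot_iff by (metis append.assoc)
  show ?case
  proof (cases "a = X0 \<and> b = X0")
    case True
    then have "\<exists>w. NF m r' c' w"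
      using Suc.prems r c pre by (intro Suc.IH) auto
    then show ?thesis using True r c NF.ext by blast
  next
    case False
    \<comment> \<open>A ballot word starts with x0, so without a factor x0 x1 it would consist of x0
      only; equal weight would force the same on \<open>r\<close>, and both words would end in
      x0.\<close>
    have "\<not> no01 c"
    proof
      assume no: "no01 c"
      obtain y l where yl: "c = y # l" using Suc.prems(2) by (cases c) auto
      have "y = X0" using Suc.prems(4) yl by (cases y) auto
      then have "l = replicate (length l) X0" using no yl no01_X0_Cons by simp
      then have c0: "c = replicate (Suc (length l)) X0" using yl \<open>y = X0\<close> by simp
      have "ones c = 0" by (subst c0) (simp del: replicate.simps)
      then have "a = X0" using Suc.prems(5) r by (cases a) auto
      moreover have "b = X0" using \<open>ones c = 0\<close> c by (cases b) auto
      ultimately show False using False by simp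
    qed
    then obtain p q where pq: "c = p @ X0 # X1 # q" "no01 (X1 # q)" using no01_or_last01 by blast
    have ones_eq: "ones r' = ones (p @ q @ [flip a])" using Suc.prems(5) r pq by (cases a) auto
    have len: "length r' = m" "length (p @ q @ [flip a]) = m" using Suc.prems(1,2) r pq by auto
    have r': "ballot 1 r'" using pre Suc.prems(3) r by blast
    \<comment> \<open>The full new column has the same length and weight as \<open>r'\<close>, so
      its height is not negative either.\<close>
    have "0 \<le> hgt r'" using r' unfolding ballot_iff by (metis append_Nil2 add.commute zless_add1_eq zle_add1_eq_le of_nat_1)
    then have h: "0 \<le> hgt (p @ q @ [flip a])" using ones_eq len by (simp only: hgt_ones)
    have "ballot 1 (p @ q @ [flip a])" unfolding ballot_iff
    proof (intro allI impI)
      fix x y assume xy: "p @ q @ [flip a] = x @ y"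
      have cc: "int 1 + hgt u > 0" if "c = u @ u'" for u u' using Suc.prems(4) that unfolding ballot_iff by blast
      consider (full) "y = []" | (pre) y' where "p @ q = x @ y'" using xy by (cases y rule: rev_cases) auto
      then show "0 < int 1 + hgt x"
      proof cases
        case full
        then show ?thesis using h xy by simp
      next
        case pre
        then obtain us where "p = x @ us \<or> x = p @ us \<and> q = us @ y'" by (auto simp: append_eq_append_conv2)
        then show ?thesis
        proof
          assume "p = x @ us" then show ?thesis using cc[of x "us @ X0 # X1 # q"] pq by simp
        next
          assume "x = p @ us \<and> q = us @ y'"
          then show ?thesis using cc[of "p @ X0 # X1 # us" y'] pq by simp
        qed
      qed
    qed
    then obtain w where w: "NF m r' (p @ q @ [flip a]) w" using Suc.IH len r' ones_eq by blast
    have "no01 (q @ [flip a])"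
    proof -
      obtain x y where q: "q = replicate x X1 @ replicate y X0" using pq(2) no01_X1_Cons no01_def by blast
      show ?thesis
      proof (cases a)
        case X1
        then have "q @ [flip a] = replicate x X1 @ replicate (Suc y) X0" by (simp add: q replicate_append_same)
        then show ?thesis unfolding no01_def by blast
      next
        case X0
        then have "b = X1" using False by (cases b) auto
        \<comment> \<open>\<open>c\<close> ends in x1, hence so does \<open>q\<close> unless it is
          empty.\<close>
        then have "y = 0" using pq(1) c q by (cases y) (auto simp: snoc_eq_iff_butlast simp flip: replicate_append_same)
        then have "q @ [flip a] = replicate (Suc x) X1 @ replicate 0 X0" using X0 by (simp add: q replicate_append_same)
        then show ?thesis unfolding no01_def by blast
      qed
    qed
    from NF.blk[OF w this] show ?thesis using r pq by auto
  qed
qed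

section \<open>Normal forms span the Temperley--Lieb algebra\<close>

text \<open>Rewriting takes place in the free algebra modulo an ideal, so that monomials remain
  lists of indices. \<open>Sp W\<close> is the span of the words in \<open>W\<close> together with
  the ideal, and \<open>weq\<close> is congruence of two words.\<close>

locale TL_ideal =
  fixes n :: nat and \<delta> :: "'k::field" and I :: "(nat free_mon \<Rightarrow>\<^sub>0 'k) set"
  assumes zero: "0 \<in> I" and add: "x \<in> I \<Longrightarrow> y \<in> I \<Longrightarrow> x + y \<in> I" and scl: "x \<in> I \<Longrightarrow> scl c x \<in> I"
    and left: "x \<in> I \<Longrightarrow> set w \<subseteq> {1..<n} \<Longrightarrow> word w * x \<in> I"
    and right: "x \<in> I \<Longrightarrow> set w \<subseteq> {1..<n} \<Longrightarrow> x * word w \<in> I"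
    and relations: "TL_relations n \<delta> \<subseteq> I"
begin

inductive_set Sp :: "nat list set \<Rightarrow> (nat free_mon \<Rightarrow>\<^sub>0 'k) set" for W where
  base: "x \<in> I \<Longrightarrow> x \<in> Sp W"
| step: "w \<in> W \<Longrightarrow> x \<in> Sp W \<Longrightarrow> scl c (word w) + x \<in> Sp W"

lemma Sp_add: "x \<in> Sp W \<Longrightarrow> y \<in> Sp W \<Longrightarrow> x + y \<in> Sp W"
proof (induction rule: Sp.induct)
  case (base x)
  from base(2,1) show ?case
  proof (induction rule: Sp.induct)
    case (step w z c)
    then show ?case using Sp.step[of w W "x + z" c] by (simp add: algebra_simps)
  qed (auto intro: Sp.base add)
qed (auto simp: add.assoc intro: Sp.step)

lemma Sp_scl: "x \<in> Sp W \<Longrightarrow> scl c x \<in> Sp W"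
  by (induction rule: Sp.induct) (auto simp: scl_add intro: Sp.intros scl)

lemma Sp_word: "w \<in> W \<Longrightarrow> word w \<in> Sp W"
  using Sp.step[of w W 0 1] Sp.base[OF zero] by simp

lemma Sp_mono: "x \<in> Sp W \<Longrightarrow> W \<subseteq> W' \<Longrightarrow> x \<in> Sp W'"
  by (induction rule: Sp.induct) (auto intro: Sp.intros)

lemma Sp_rmult: "x \<in> Sp W \<Longrightarrow> set u \<subseteq> {1..<n} \<Longrightarrow> (\<And>w. w \<in> W \<Longrightarrow> word (w @ u) \<in> Sp W') \<Longrightarrow> x * word u \<in> Sp W'"
  by (induction rule: Sp.induct)
    (auto simp: distrib_right word_append intro: Sp.base right Sp_add Sp_scl simp del: One_nat_def)

definition weq :: "nat list \<Rightarrow> nat list \<Rightarrow> bool" where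
  "weq u w \<longleftrightarrow> word u - word w \<in> I"

lemma weq_refl [simp]: "weq u u"
  by (simp add: weq_def zero)

lemma weq_sym: "weq u w \<Longrightarrow> weq w u"
  using scl[of "word u - word w" "- 1"] by (simp add: weq_def)

lemma weq_trans [trans]: "weq u w \<Longrightarrow> weq w z \<Longrightarrow> weq u z"
  using add[of "word u - word w" "word w - word z"] by (simp add: weq_def)

lemma weq_context: "weq u w \<Longrightarrow> set p \<subseteq> {1..<n} \<Longrightarrow> set q \<subseteq> {1..<n} \<Longrightarrow> weq (p @ u @ q) (p @ w @ q)"
  using left[OF right[of "word u - word w" q], of p] by (simp add: weq_def word_append algebra_simps)

lemma weq_Sp: "weq u w \<Longrightarrow> word w \<in> Sp W \<Longrightarrow> word u \<in> Sp W"
  using Sp_add[of "word u - word w" W "word w"] Sp.base by (auto simp: weq_def)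

lemma weq_braid:
  assumes "i \<in> {1..<n}" "j \<in> {1..<n}" "j = Suc i \<or> i = Suc j"
  shows "weq [i, j, i] [i]"
proof -
  have "\<bar>int i - int j\<bar> = 1" using assms(3) by auto
  then have "word [i, j, i] - word [i] \<in> TL_relations n \<delta>" using assms(1,2) unfolding TL_relations_def by blast
  then show ?thesis using relations by (auto simp: weq_def)
qed

lemma weq_far:
  assumes "i \<in> {1..<n}" "j \<in> {1..<n}" "Suc i < j \<or> Suc j < i"
  shows "weq [i, j] [j, i]"
proof -
  have "\<bar>int i - int j\<bar> > 1" using assms(3) by auto
  then have "word [i, j] - word [j, i] \<in> TL_relations n \<delta>" using assms(1,2) unfolding TL_relations_def by blast
  then show ?thesis using relations by (auto simp: weq_def)
qed

lemma square_rel: "i \<in> {1..<n} \<Longrightarrow> word [i, i] - scl \<delta> (word [i]) \<in> I"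
  by (rule subsetD[OF relations]) (auto simp: TL_relations_def scl_def)

lemma weq_commute1: "i \<in> {1..<n} \<Longrightarrow> set w \<subseteq> {1..<n} \<Longrightarrow> (\<And>j. j \<in> set w \<Longrightarrow> Suc i < j \<or> Suc j < i) \<Longrightarrow>
   weq (i # w) (w @ [i])"
proof (induction w)
  case (Cons a w)
  have "weq (i # a # w) (a # i # w)"
    using weq_context[OF weq_far[of i a], of "[]" w] Cons by simp
  also have "weq (a # i # w) (a # w @ [i])"
    using weq_context[OF Cons.IH, of "[a]" "[]"] Cons by simp
  finally show ?case by simp
qed simp

lemma weq_commute: "set u \<subseteq> {1..<n} \<Longrightarrow> set w \<subseteq> {1..<n} \<Longrightarrow>
   (\<And>i j. i \<in> set u \<Longrightarrow> j \<in> set w \<Longrightarrow> Suc i < j \<or> Suc j < i) \<Longrightarrow> weq (u @ w) (w @ u)"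
proof (induction u)
  case (Cons a u)
  have "weq (a # u @ w) (a # w @ u)"
    using weq_context[OF Cons.IH, of "[a]" "[]"] Cons by simp
  also have "weq (a # w @ u) (w @ a # u)"
    using weq_context[OF weq_commute1[of a w], of "[]" u] Cons by simp
  finally show ?case by simp
qed simp

section \<open>Straightening of descending blocks\<close>

abbreviation D :: "nat \<Rightarrow> nat \<Rightarrow> nat list" where
  "D m j \<equiv> rev [j..<m]"

lemma D_split: "j \<le> k \<Longrightarrow> k \<le> m \<Longrightarrow> D m j = D m k @ D k j"
  by (metis rev_append upt_add_eq_append le_add_diff_inverse)

text \<open>The last letter \<open>j'\<close> of the first block commutes rightwards until it meets
  \<open>[Suc j', j']\<close> in the second; the braid relation then deletes two letters, and the
  remaining tail from \<open>j'\<close> down to \<open>j\<close> commutes back to the first block.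
  The new second block starts higher, at \<open>j' + 2\<close>.\<close>

lemma weq_straighten:
  assumes "1 \<le> j" "j \<le> j'" "j' < m" "m < n'" "n' \<le> n"
  shows "weq (D m j' @ D n' j) (D m j @ D n' (j' + 2))"
proof -
  let ?a = "D m (Suc j')" and ?b = "D n' (j' + 2)" and ?c = "D j' j"
  have s: "set ?a \<subseteq> {1..<n}" "set ?b \<subseteq> {1..<n}" "set ?c \<subseteq> {1..<n}" "set [j'] \<subseteq> {1..<n}" "set [Suc j', j'] \<subseteq> {1..<n}"
    using assms by auto
  have "D m j' = ?a @ [j']" using D_split[of j' "Suc j'" m] assms by simp
  moreover have "D n' j = ?b @ [Suc j', j'] @ ?c"
    using D_split[of j "j' + 2" n'] D_split[of j "j'" "j' + 2"] assms by (simp add: upt_rec[of j'])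
  ultimately have "D m j' @ D n' j = ?a @ (j' # ?b) @ [Suc j', j'] @ ?c" by simp
  also have "weq \<dots> (?a @ (?b @ [j']) @ [Suc j', j'] @ ?c)"
    using assms s by (intro weq_context weq_commute1) auto
  also have "?a @ (?b @ [j']) @ [Suc j', j'] @ ?c = (?a @ ?b) @ [j', Suc j', j'] @ ?c" by simp
  also have "weq \<dots> ((?a @ ?b) @ [j'] @ ?c)"
    using assms s by (intro weq_context weq_braid) auto
  also have "(?a @ ?b) @ [j'] @ ?c = ?a @ (?b @ (j' # ?c)) @ []" by simp
  also have "weq \<dots> (?a @ ((j' # ?c) @ ?b) @ [])"
    using assms s by (intro weq_context weq_commute) auto
  also have "?a @ ((j' # ?c) @ ?b) @ [] = D m j @ ?b"
    using D_split[of j "Suc j'" m] assms by simp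
  finally show ?thesis .
qed

definition NFw :: "nat \<Rightarrow> nat list set" where
  "NFw m = {w. \<exists>r c. NF m r c w}"

lemma NFw_mono: "m \<le> m' \<Longrightarrow> NFw m \<subseteq> NFw m'"
  using NF_extend[of m _ _ _ "m' - m"] by (fastforce simp: NFw_def)

lemma NFw_letters: "w \<in> NFw m \<Longrightarrow> set w \<subseteq> {1..<m}"
  using NF_letters unfolding NFw_def by blast

text \<open>If the last block of \<open>w\<close> ends below \<open>j\<close>, or there is none,
  appending the new block gives a normal form. Otherwise \<open>weq_straighten\<close> applies: the
  outer induction handles the new first block, whose top is lower than that of the second, and the
  inner induction handles the second block, whose lower end has increased.\<close>

lemma NFw_block:
  "n' \<le> n \<Longrightarrow> m < n' \<Longrightarrow> 1 \<le> j \<Longrightarrow> j < n' \<Longrightarrow> w \<in> NFw m \<Longrightarrow> word (w @ D n' j) \<in> Sp (NFw n')"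
proof (induction n' arbitrary: m j w rule: less_induct)
  case (less n')
  show ?case using less.prems
  proof (induction "n' - j" arbitrary: m j w rule: less_induct)
    case inner: less
    obtain m0 where m0: "n' = Suc m0" using inner.prems by (cases n') auto
    have "w \<in> NFw m0" using subsetD[OF NFw_mono[of m m0]] inner.prems m0 by simp
    then obtain r c where NFc: "NF m0 r c w" unfolding NFw_def by blast
    have lc: "length c = m0" using NF_length[OF NFc] by simp
    define p where "p = take (j - 1) c"
    define qb where "qb = drop (j - 1) c"
    have c: "c = p @ qb" "length p = j - 1" "qb \<noteq> []"
      using lc m0 inner.prems by (auto simp: p_def qb_def)
    show ?case
    proof (cases "no01 qb")
      case True
      obtain q b where "qb = q @ [b]" using c(3) by (cases qb rule: rev_cases) auto
      then have "NF (Suc m0) (r @ [flip b]) (p @ X0 # X1 # q) (w @ D (Suc m0) (Suc (length p)))"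
        using NFc c True by (intro NF.blk) auto
      then show ?thesis using m0 c(2) inner.prems by (intro Sp_word) (auto simp: NFw_def)
    next
      case False
      then obtain p2 q where q: "qb = p2 @ X0 # X1 # q" "no01 (X1 # q)" using no01_or_last01 by blast
      define j' where "j' = Suc (length (p @ p2))"
      obtain m' w' r' c' where m': "m' \<le> m0" "j' < m'" "w = w' @ D m' j'" "NF (m' - 1) r' c' w'"
        using NF_last_block[OF NFc, of "p @ p2" q] c q unfolding j'_def by auto
      have j': "j \<le> j'" using c(2) by (simp add: j'_def)
      have w'_letters: "set w' \<subseteq> {1..<n}" 
        by (rule subset_trans[OF NF_letters[OF m'(4)]]) (use m' m0 inner.prems in auto)
      have "weq (w @ D n' j) (w' @ D m' j @ D n' (j' + 2))"
        using weq_context[OF weq_straighten[of j j' m' n'], of w' "[]"] w'_letters m' j' m0 inner.prems by simp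
      moreover have "word (w' @ D m' j @ D n' (j' + 2)) \<in> Sp (NFw n')"
      proof -
        have 1: "word (w' @ D m' j) \<in> Sp (NFw m')"
          using m' m0 inner.prems j' by (intro less.IH[of m' "m' - 1"]) (auto simp: NFw_def)
        have "word (w' @ D m' j) * word (D n' (j' + 2)) \<in> Sp (NFw n')"
        proof (rule Sp_rmult[OF 1])
          show "set (D n' (j' + 2)) \<subseteq> {1..<n}" using inner.prems by auto
          fix u assume u: "u \<in> NFw m'"
          show "word (u @ D n' (j' + 2)) \<in> Sp (NFw n')"
          \<comment> \<open>If \<open>j' + 2\<close> reaches \<open>n'\<close>, the second block has
            become empty.\<close>
          proof (cases "j' + 2 < n'")
            case True
            then show ?thesis using m' m0 inner.prems u j' by (intro inner.hyps[of _ m']) auto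
          next
            case False
            then show ?thesis using u NFw_mono[of m' n'] m' m0 by (auto intro!: Sp_word)
          qed
        qed
        then show ?thesis by (simp add: word_append mult.assoc)
      qed
      ultimately show ?thesis by (rule weq_Sp)
    qed
  qed
qed

lemma NFw_block_Sp:
  assumes "x \<in> Sp (NFw m)" "m < n'" "n' \<le> n" "1 \<le> j" "j < n'"
  shows "x * word (D n' j) \<in> Sp (NFw n')"
  by (rule Sp_rmult[OF assms(1)]) (use assms NFw_block in auto)

lemma NFw_rmult_word:
  assumes "\<And>w i. w \<in> NFw m \<Longrightarrow> 1 \<le> i \<Longrightarrow> i < m \<Longrightarrow> word (w @ [i]) \<in> Sp (NFw m)" "m \<le> n"
  shows "x \<in> Sp (NFw m) \<Longrightarrow> set u \<subseteq> {1..<m} \<Longrightarrow> x * word u \<in> Sp (NFw m)"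
proof (induction u arbitrary: x)
  case (Cons i u)
  have "x * word [i] \<in> Sp (NFw m)"
    by (rule Sp_rmult[OF Cons.prems(1)]) (use Cons.prems assms in auto)
  from Cons.IH[OF this] show ?case using Cons.prems by (simp add: word_Cons[of i u] mult.assoc)
qed simp

text \<open>Since the empty word is a normal form, closure of the span under right multiplication by
  generators gives everything. If the word ends in a block on the new strand, the generator is
  pushed into it until either the block shrinks or the change concerns only the part on
  \<open>m\<close> strands, where the induction hypothesis holds.\<close>

lemma NFw_rmult: "m \<le> n \<Longrightarrow> w \<in> NFw m \<Longrightarrow> 1 \<le> i \<Longrightarrow> i < m \<Longrightarrow> word (w @ [i]) \<in> Sp (NFw m)"
proof (induction m arbitrary: w i)
  case (Suc m)
  have IH: "x \<in> Sp (NFw m) \<Longrightarrow> set u \<subseteq> {1..<m} \<Longrightarrow> x * word u \<in> Sp (NFw m)" for x u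
    using Suc by (intro NFw_rmult_word) auto
  from Suc.prems(2) obtain r c where "NF (Suc m) r c w" by (auto simp: NFw_def)
  then show ?case
  proof (cases rule: NF.cases)
    case (ext r' c')
    then have w: "w \<in> NFw m" by (auto simp: NFw_def)
    show ?thesis
    proof (cases "i < m")
      case True
      then show ?thesis using IH[OF Sp_word[OF w], of "[i]"] Suc.prems Sp_mono NFw_mono[of m "Suc m"]
        by (auto simp: word_append)
    next
      case False
      then show ?thesis using NFw_block[of "Suc m" m i w] Suc.prems w by (auto simp: less_Suc_eq)
    qed
  next
    case (blk r' p q b w0)
    let ?j = "Suc (length p)"
    have w0: "w0 \<in> NFw m" and w: "w = w0 @ D (Suc m) ?j" using blk by (auto simp: NFw_def)
    have jm: "?j \<le> m" using NF_length[OF blk(4)] by simp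
    have w0l: "set w0 \<subseteq> {1..<n}" using NFw_letters[OF w0] Suc.prems by auto
    have B: "x \<in> Sp (NFw m) \<Longrightarrow> 1 \<le> j \<Longrightarrow> j \<le> m \<Longrightarrow> x * word (D (Suc m) j) \<in> Sp (NFw (Suc m))" for x j
      using Suc.prems by (intro NFw_block_Sp[of x m]) auto
    have B': "1 \<le> j \<Longrightarrow> j \<le> m \<Longrightarrow> word (w0 @ D (Suc m) j) \<in> Sp (NFw (Suc m))" for j
      using B[OF Sp_word[OF w0]] by (simp add: word_append)
    \<comment> \<open>With j the lower end of the last block: for i = j the square relation applies,
      i = j - 1 prolongs the block, i < j - 1 moves to its left, i = j + 1 cuts it at i by one braid
      relation, and for i > j + 1 the braid relation splits off the part below i - 1, which moves to
      the left.\<close>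
    consider "i = ?j" | "Suc i = ?j" | "Suc i < ?j" | "i = Suc ?j" | "Suc ?j < i" by linarith
    then show ?thesis
    proof cases
      case 1
      have e: "w = (w0 @ D (Suc m) (Suc ?j)) @ [i]" using D_split[of ?j "Suc ?j" "Suc m"] jm w 1 by simp
      have "word (w0 @ D (Suc m) (Suc ?j)) * (word [i, i] - scl \<delta> (word [i])) \<in> I"
        using w0l jm Suc.prems 1 by (intro left square_rel) auto
      then have "word (w @ [i]) - scl \<delta> (word w) \<in> I"
        unfolding e by (simp add: word_append word_Cons[of i "[i]"] algebra_simps)
      then show ?thesis using Sp_add[OF Sp.base Sp_scl[OF Sp_word[OF Suc.prems(2)], of \<delta>]] by fastforce
    next
      case 2
      then have "w @ [i] = w0 @ D (Suc m) i" using D_split[of i ?j "Suc m"] jm w by simp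
      then show ?thesis using B'[of i] Suc.prems 2 jm by simp
    next
      case 3
      have "weq (w0 @ (i # D (Suc m) ?j) @ []) (w0 @ (D (Suc m) ?j @ [i]) @ [])"
        using 3 w0l Suc.prems by (intro weq_context weq_commute1) auto
      then have "weq (w @ [i]) (w0 @ [i] @ D (Suc m) ?j)" using weq_sym w by simp
      moreover have "word (w0 @ [i] @ D (Suc m) ?j) \<in> Sp (NFw (Suc m))"
        using B[OF IH[OF Sp_word[OF w0], of "[i]"], of ?j] 3 jm Suc.prems
        unfolding word_append mult.assoc by simp
      ultimately show ?thesis by (rule weq_Sp)
    next
      case 4
      have e: "D (Suc m) ?j = D (Suc m) (Suc i) @ [i, ?j]"
        using D_split[of ?j "Suc i" "Suc m"] jm 4 Suc.prems by (simp add: upt_rec[of "Suc (length p)"])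
      have "weq ((w0 @ D (Suc m) (Suc i)) @ [i, ?j, i] @ []) ((w0 @ D (Suc m) (Suc i)) @ [i] @ [])"
        using 4 w0l Suc.prems jm by (intro weq_context weq_braid) auto
      moreover have "D (Suc m) i = D (Suc m) (Suc i) @ [i]" using D_split[of i "Suc i" "Suc m"] Suc.prems by simp
      ultimately have "weq (w @ [i]) (w0 @ D (Suc m) i)" using w e by simp
      then show ?thesis using weq_Sp B'[of i] Suc.prems by auto
    next
      case 5
      let ?a = "D (Suc m) (Suc i)" and ?b = "D (i - 1) ?j"
      have e: "D (Suc m) ?j = ?a @ [i, i - 1] @ ?b"
        using D_split[of ?j "Suc i" "Suc m"] D_split[of ?j "i - 1" "Suc i"] 5 Suc.prems
        by (simp add: upt_rec[of "i - Suc 0"])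
      have s: "set (w0 @ ?a) \<subseteq> {1..<n}" "set ?b \<subseteq> {1..<n}" using w0l Suc.prems 5 by auto
      have "w @ [i] = ((w0 @ ?a) @ [i, i - 1]) @ (?b @ [i]) @ []" using w e by simp
      also have "weq \<dots> (((w0 @ ?a) @ [i, i - 1]) @ (i # ?b) @ [])"
        using s 5 Suc.prems by (intro weq_context weq_sym[OF weq_commute1]) auto
      also have "((w0 @ ?a) @ [i, i - 1]) @ (i # ?b) @ [] = (w0 @ ?a) @ [i, i - 1, i] @ ?b" by simp
      also have "weq \<dots> ((w0 @ ?a) @ [i] @ ?b)"
        using s 5 Suc.prems by (intro weq_context weq_braid) auto
      also have "(w0 @ ?a) @ [i] @ ?b = w0 @ (D (Suc m) i @ ?b) @ []"
        using D_split[of i "Suc i" "Suc m"] Suc.prems by simp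
      also have "weq \<dots> (w0 @ (?b @ D (Suc m) i) @ [])"
        using s w0l 5 Suc.prems by (intro weq_context weq_commute) auto
      finally have "weq (w @ [i]) (w0 @ ?b @ D (Suc m) i)" by simp
      moreover have "word (w0 @ ?b @ D (Suc m) i) \<in> Sp (NFw (Suc m))"
      proof -
        have "set ?b \<subseteq> {1..<m}" using 5 Suc.prems by auto
        from B[OF IH[OF Sp_word[OF w0] this], of i] show ?thesis
          using 5 Suc.prems unfolding word_append mult.assoc by simp
      qed
      ultimately show ?thesis by (rule weq_Sp)
    qed
  qed
qed simp

lemma word_in_Sp: "set u \<subseteq> {1..<n} \<Longrightarrow> word u \<in> Sp (NFw n)"
  using NFw_rmult_word[of n 1 u] NFw_rmult[of n] Sp_word[of "[]" "NFw n"] NF_Nil[of n]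
  by (auto simp: NFw_def)

lemma free_in_Sp:
  assumes "\<forall>w\<in>keys x. set (letters w) \<subseteq> {1..<n}"
  shows "x \<in> Sp (NFw n)"
  using assms
  by (induction rule: free_induct) (simp_all add: Sp.base zero Sp_add Sp_scl word_in_Sp del: One_nat_def)

end

section \<open>Leading matrix entries of normal forms\<close>

abbreviation TLw :: "'k::field \<Rightarrow> 'k \<Rightarrow> nat list \<Rightarrow> 'k tensors \<Rightarrow> 'k tensors" where
  "TLw v s w \<equiv> foldr (TL_gen_op v s) w"

lemma linear_map_TLw [simp]: "linear_map (TLw v s w)"
proof (induction w)
  case (Cons i w)
  then show ?case using linear_map_op_comp(4)[of "TLw v s w" v s i] by (simp add: comp_def)
qed (simp add: linear_map_def)

lemma TLw_tensor_power: "v \<noteq> 0 \<Longrightarrow> set w \<subseteq> {1..<m} \<Longrightarrow> x \<in> tensor_power m \<Longrightarrow> TLw v s w x \<in> tensor_power m"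
  by (induction w) (auto intro: TL_tensor_power)

lemma TLw_right:
  "v \<noteq> 0 \<Longrightarrow> set w \<subseteq> {1..<m} \<Longrightarrow> x \<in> tensor_power m \<Longrightarrow> TLw v s w (x * y) = TLw v s w x * y"
proof (induction w)
  case (Cons i w)
  then show ?case using TL_right[of v "TLw v s w x" m i s y] TLw_tensor_power[of v w m x s] by auto
qed simp

text \<open>Each generator of the ascending application moves the cup over one letter by a
  zigzag.\<close>

lemma TLw_slide:
  assumes v: "v \<noteq> 0"
  shows "TLw v s (rev [Suc (Suc (length p))..<Suc (Suc (length p)) + length q]) (word p * (uvec v * word q)) =
    scl ((- s) ^ length q) (word p * (word q * uvec v))"
proof (induction q arbitrary: p)
  case (Cons a q)
  let ?k = "Suc (Suc (length p))"
  have e: "rev [?k..<?k + length (a # q)] = rev [Suc ?k..<Suc ?k + length q] @ [?k]"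
    by (subst upt_conv_Cons) auto
  have "TL_gen_op v s ?k (word p * (uvec v * word (a # q))) = scl (- s) (word (p @ [a]) * (uvec v * word q))"
    using TL_shift[of 2 v s p "uvec v * word (a # q)"] TL_2_uvec[OF v, of s a "word q"]
    by (simp add: numeral_2_eq_2 word_Cons[of a q] word_append mult.assoc)
  then have "TLw v s (rev [?k..<?k + length (a # q)]) (word p * (uvec v * word (a # q))) =
    scl (- s) (TLw v s (rev [Suc ?k..<Suc ?k + length q]) (word (p @ [a]) * (uvec v * word q)))"
    unfolding e by (simp add: linear_map_scale[OF linear_map_TLw] linear_map_uminus[OF linear_map_TLw])
  also have "\<dots> = scl (- s) (scl ((- s) ^ length q) (word (p @ [a]) * (word q * uvec v)))"
    using Cons.IH[of "p @ [a]"] by simp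
  finally show ?case by (simp add: word_append word_Cons[of a q] mult.assoc)
qed simp

text \<open>A block acts by contracting the pair at its lower end and sliding the created cup to the
  right end of the word. This is the reason for the shape of the rule \<open>blk\<close>.\<close>

lemma TLw_block:
  assumes v: "v \<noteq> 0"
  shows "TLw v s (rev [Suc (length p)..<Suc (Suc (length p + length q))]) (word (p @ a # b # q)) =
    scl (s * cap v a b * (- s) ^ length q) (word (p @ q) * uvec v)"
proof -
  have e: "rev [Suc (length p)..<Suc (Suc (length p + length q))] =
     rev [Suc (Suc (length p))..<Suc (Suc (length p)) + length q] @ [Suc (length p)]"
    by (subst upt_conv_Cons) auto
  show ?thesis
    unfolding e foldr_append foldr.simps comp_apply id_apply TL_word[OF v] linear_map_scale[OF linear_map_TLw] TLw_slide[OF v]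
    by (simp add: word_append mult.assoc)
qed

definition ent :: "'k::field \<Rightarrow> 'k \<Rightarrow> nat list \<Rightarrow> vbasis list \<Rightarrow> vbasis list \<Rightarrow> 'k" where
  "ent v s w r c = lookup (TLw v s w (word c)) (Mon r)"

lemma lookup_mult_word_snoc: "lookup (x * word [b]) (Mon (r @ [a])) = (if a = b then lookup x (Mon r) else 0)"
  by (auto simp: lookup_mult_word)

lemma ent_ext:
  assumes "v \<noteq> 0" "set w \<subseteq> {1..<m}" "length c = m"
  shows "ent v s w (r @ [a]) (c @ [b]) = (if a = b then ent v s w r c else 0)"
  using TLw_right[OF assms(1,2), of "word c" s "word [b]"] assms(3)
  by (simp add: ent_def word_append lookup_mult_word_snoc)

text \<open>Of the cup created at the right end, the second leg is the last letter \<open>a\<close>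
  of the row, and the first leg \<open>flip a\<close> is the last letter fed to \<open>w\<close>.
  The factor depending on \<open>a\<close> is the corresponding coefficient of
  \<open>uvec\<close>.\<close>

lemma ent_blk:
  assumes v: "v \<noteq> 0" and w: "set w \<subseteq> {1..<m}" and len: "length p + length q + 1 = m"
  shows "ent v s (w @ rev [Suc (length p)..<Suc m]) (r @ [a]) (p @ x # y # q) =
    s * cap v x y * (- s) ^ length q * (if a = X1 then inverse v else - 1) * ent v s w r (p @ q @ [flip a])"
proof -
  have m: "Suc m = Suc (Suc (length p + length q))" using len by simp
  have "word (p @ q) * uvec v = scl (inverse v) (word (p @ q @ [X0]) * word [X1]) - word (p @ q @ [X1]) * word [X0]"
    using uvec_mult[of v 1] by (simp add: right_diff_distrib word_append mult.assoc)
  then have "TLw v s w (word (p @ q) * uvec v) = scl (inverse v) (TLw v s w (word (p @ q @ [X0])) * word [X1])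
      - TLw v s w (word (p @ q @ [X1])) * word [X0]"
    using len by (simp add: linear_map_diff[OF linear_map_TLw] linear_map_scale[OF linear_map_TLw] TLw_right[OF v w])
  then show ?thesis unfolding ent_def m foldr_append TLw_block[OF v]
    by (cases a) (simp_all add: linear_map_scale[OF linear_map_TLw] lookup_minus lookup_mult_word_snoc)
qed

text \<open>Rows are compared first. Among equal rows the columns are compared from right to left
  and in the opposite sense, so that the column of the normal form is the greatest one: in that
  reading the pair x0 x1 exceeds x1 x0.\<close>

definition le_pair :: "vbasis list \<times> vbasis list \<Rightarrow> vbasis list \<times> vbasis list \<Rightarrow> bool" where
  "le_pair b b' \<longleftrightarrow> valr (fst b) < valr (fst b') \<or>
     valr (fst b) = valr (fst b') \<and> valr (rev (snd b')) \<le> valr (rev (snd b))"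

lemma valr_less: "valr l < 2 ^ length l"
  by (induction l rule: valr.induct) auto

lemma valr_inj: "length l = length l' \<Longrightarrow> valr l = valr l' \<Longrightarrow> l = l'"
proof (induction l arbitrary: l' rule: valr.induct)
  case (2 l)
  then show ?case using valr_less[of l] by (cases l' rule: valr.cases) auto
next
  case (3 l)
  then show ?case
    by (cases l' rule: valr.cases) (auto, metis add_leD1 not_le valr_less le_add1)
qed simp

text \<open>Read from the right, x0 x1 has the digits 10 and x1 x0 the digits 01. Inserting two
  digits at a fixed place preserves the comparison of the parts before and behind.\<close>

lemma insert_01_mono:
  assumes "length p = length p'" "length q = length q'" "x \<noteq> y"
    and "valr (rev (p' @ q')) \<le> valr (rev (p @ q))"
  shows "valr (rev (p' @ x # y # q')) \<le> valr (rev (p @ X0 # X1 # q))"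
proof -
  let ?M = "2 ^ length p :: nat"
  have lt: "valr (rev p) < ?M" "valr (rev p') < ?M" using valr_less[of "rev p"] valr_less[of "rev p'"] assms by auto
  have le: "valr (rev q') * ?M + valr (rev p') \<le> valr (rev q) * ?M + valr (rev p)"
    using assms by (simp add: valr_append)
  have 1: "valr (rev (p @ X0 # X1 # q)) = valr (rev q) * 4 * ?M + 2 * ?M + valr (rev p)"
    by (simp add: valr_append)
  have 2: "valr (rev (p' @ x # y # q')) \<le> valr (rev q') * 4 * ?M + 2 * ?M + valr (rev p')"
    using assms by (cases x; cases y) (simp_all add: valr_append)
  show ?thesis
  proof (cases "valr (rev q') < valr (rev q)")
    case True
    then have "(valr (rev q') + 1) * (4 * ?M) \<le> valr (rev q) * (4 * ?M)" by (intro mult_right_mono) auto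
    then show ?thesis using 1 2 lt by (simp add: algebra_simps)
  next
    case False
    have "\<not> valr (rev q) < valr (rev q')"
    proof
      assume "valr (rev q) < valr (rev q')"
      then have "(valr (rev q) + 1) * ?M \<le> valr (rev q') * ?M" by (intro mult_right_mono) auto
      then show False using le lt by (simp add: algebra_simps)
    qed
    then have "valr (rev q') = valr (rev q)" using False by simp
    then show ?thesis using 1 2 le by simp
  qed
qed

text \<open>Follows the rules of \<open>NF\<close>: each entry is a nonzero multiple of an entry on
  one strand fewer or vanishes, so both claims pass through \<open>ent_ext\<close> and
  \<open>ent_blk\<close>.\<close>

lemma NF_leading:
  assumes v: "v \<noteq> 0" "s \<noteq> 0"
  shows "NF m r c w \<Longrightarrow> ent v s w r c \<noteq> 0 \<and>
     (\<forall>r' c'. length r' = m \<longrightarrow> length c' = m \<longrightarrow> ent v s w r' c' \<noteq> 0 \<longrightarrow> le_pair (r, c) (r', c'))"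
proof (induction rule: NF.induct)
  case nil
  have "lookup (1 :: 'a tensors) (Mon []) = 1" using lookup_word[of "[]" "[]"] by simp
  then show ?case by (auto simp: ent_def le_pair_def)
next
  case (ext m r c w)
  have w: "set w \<subseteq> {1..<m}" and len: "length r = m" "length c = m"
    using NF_letters[OF ext.hyps] NF_length[OF ext.hyps] by auto
  show ?case
  proof (intro conjI allI impI)
    show "ent v s w (r @ [X0]) (c @ [X0]) \<noteq> 0" using ext.IH ent_ext[OF v(1) w len(2)] by simp
    fix r' c' assume *: "length r' = Suc m" "length c' = Suc m" "ent v s w r' c' \<noteq> 0"
    obtain r1 a where r1: "r' = r1 @ [a]" using *(1) by (cases r' rule: rev_cases) auto
    obtain c1 b where c1: "c' = c1 @ [b]" using *(2) by (cases c' rule: rev_cases) auto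
    have "a = b" "ent v s w r1 c1 \<noteq> 0"
      using * ent_ext[OF v(1) w, of c1 s r1 a b] r1 c1 by (auto split: if_splits)
    with ext.IH * r1 c1 have "le_pair (r, c) (r1, c1)" by auto
    then show "le_pair (r @ [X0], c @ [X0]) (r', c')"
      using \<open>a = b\<close> unfolding r1 c1 le_pair_def by (cases b) (auto simp: valr_append)
  qed
next
  case (blk m r p q b w)
  have w: "set w \<subseteq> {1..<m}" and len: "length r = m" "length p + length q + 1 = m"
    using NF_letters[OF blk.hyps(1)] NF_length[OF blk.hyps(1)] by auto
  note ent = ent_blk[OF v(1) w]
  show ?case
  proof (intro conjI allI impI)
    show "ent v s (w @ rev [Suc (length p)..<Suc m]) (r @ [flip b]) (p @ X0 # X1 # q) \<noteq> 0"
      using blk.IH v ent[OF len(2), of s r "flip b" X0 X1] by (auto simp del: upt_Suc)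
    fix r' c' assume *: "length r' = Suc m" "length c' = Suc m"
      "ent v s (w @ rev [Suc (length p)..<Suc m]) r' c' \<noteq> 0"
    obtain r1 a where r1: "r' = r1 @ [a]" using *(1) by (cases r' rule: rev_cases) auto
    obtain p1 x y q1 where c1: "c' = p1 @ x # y # q1" "length p1 = length p"
      by (rule list_split_at2[of "length p" c']) (use *(2) len in auto)
    have lq: "length q1 = length q" using c1 *(2) len by simp
    have nz: "cap v x y \<noteq> 0" "ent v s w r1 (p1 @ q1 @ [flip a]) \<noteq> 0"
      using *(3) ent[of p1 q1 s r1 a x y] len lq unfolding c1 r1 by (auto simp: c1(2) simp del: upt_Suc)
    have "x \<noteq> y" using nz(1) by (cases x; cases y) auto
    have le: "le_pair (r, p @ q @ [b]) (r1, p1 @ q1 @ [flip a])"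
      using blk.IH nz(2) *(1) r1 c1 lq len by simp
    show "le_pair (r @ [flip b], p @ X0 # X1 # q) (r', c')"
    proof (cases "valr r < valr r1")
      case True
      then show ?thesis by (cases a; cases b) (auto simp: le_pair_def r1 valr_append)
    next
      case False
      then have eq: "valr r = valr r1" and c_le: "valr (rev (p1 @ q1 @ [flip a])) \<le> valr (rev (p @ q @ [b]))"
        using le by (auto simp: le_pair_def)
      show ?thesis
      proof (cases "a = flip b")
        case True
        then have "valr (rev (p1 @ q1)) \<le> valr (rev (p @ q))"
          using c_le lq c1(2) by (cases b) (simp_all add: valr_append)
        from insert_01_mono[OF _ _ \<open>x \<noteq> y\<close> this] show ?thesis
          using True eq lq c1 by (simp add: le_pair_def r1 valr_append)
      next
        case ab: False
        show ?thesis
        proof (cases a)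
          case X0
          then have "b = X0" using ab by (cases b) auto
          \<comment> \<open>\<open>flip a = X1\<close> sets the leading digit of the reversed
            column, while \<open>b = X0\<close> leaves it 0; the comparison of columns excludes
            this.\<close>
          then have "2 ^ (length p + length q) \<le> valr (rev (p @ q))"
            using c_le X0 lq c1(2) by (simp add: add_ac)
          then show ?thesis using valr_less[of "rev (p @ q)"] by (simp add: add_ac)
        next
          case X1
          then have "b = X1" using ab by (cases b) auto
          then show ?thesis using X1 eq by (simp add: le_pair_def r1 valr_append)
        qed
      qed
    qed
  qed
qed

section \<open>Triangular systems\<close>

text \<open>Indices are added by increasing \<open>key\<close>. The new index \<open>x\<close> does
  not disturb the equations already solved, since \<open>M x b'\<close> vanishes for smaller keys,
  and its own equation is solved by dividing by \<open>M x x\<close>.\<close>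

lemma triangular_solve:
  fixes M :: "'b \<Rightarrow> 'b \<Rightarrow> 'k::field" and key :: "'b \<Rightarrow> int"
  assumes "finite B"
  shows "inj_on key B \<Longrightarrow> (\<And>b. b \<in> B \<Longrightarrow> M b b \<noteq> 0) \<Longrightarrow>
    (\<And>b b'. b \<in> B \<Longrightarrow> b' \<in> B \<Longrightarrow> M b b' \<noteq> 0 \<Longrightarrow> key b \<le> key b') \<Longrightarrow>
    \<exists>\<alpha>. \<forall>b'\<in>B. (\<Sum>b\<in>B. \<alpha> b * M b b') = h b'"
  using assms
proof (induction rule: finite_ranking_induct[where f = key])
  case (insert x S)
  show ?case
  proof (cases "x \<in> S")
    case True
    then show ?thesis using insert by (simp add: insert_absorb)
  next
    case x: False
  obtain \<alpha> where \<alpha>: "\<forall>b'\<in>S. (\<Sum>b\<in>S. \<alpha> b * M b b') = h b'"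
    using insert.IH insert.prems by (auto simp: inj_on_def)
  define \<beta> where "\<beta> = \<alpha>(x := (h x - (\<Sum>b\<in>S. \<alpha> b * M b x)) / M x x)"
  have S: "(\<Sum>b\<in>S. \<beta> b * M b b') = (\<Sum>b\<in>S. \<alpha> b * M b b')" for b'
    using insert x by (intro sum.cong) (auto simp: \<beta>_def)
  have "(\<Sum>b\<in>insert x S. \<beta> b * M b b') = h b'" if b': "b' \<in> insert x S" for b'
  proof (cases "b' = x")
    case True
    then show ?thesis using insert S x by (simp add: \<beta>_def)
  next
    case False
    then have "b' \<in> S" using b' by simp
    have "M x b' = 0"
    proof (rule ccontr)
      assume "M x b' \<noteq> 0"
      then have "key x = key b'" using insert.prems(3)[of x b'] insert.hyps(2)[of b'] \<open>b' \<in> S\<close> by force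
      then show False using insert.prems(1) False \<open>b' \<in> S\<close> by (auto simp: inj_on_def)
    qed
    then show ?thesis using insert S x \<alpha> \<open>b' \<in> S\<close> by simp
  qed
  then show ?thesis by blast
  qed
qed simp

text \<open>At an index of smallest key among those with nonzero coefficient, the equation retains a
  single term.\<close>

lemma triangular_unique:
  fixes M :: "'b \<Rightarrow> 'b \<Rightarrow> 'k::field" and key :: "'b \<Rightarrow> int"
  assumes "finite B" "inj_on key B" "\<And>b. b \<in> B \<Longrightarrow> M b b \<noteq> 0"
    and tri: "\<And>b b'. b \<in> B \<Longrightarrow> b' \<in> B \<Longrightarrow> M b b' \<noteq> 0 \<Longrightarrow> key b \<le> key b'"
    and zero: "\<And>b'. b' \<in> B \<Longrightarrow> (\<Sum>b\<in>B. \<alpha> b * M b b') = 0" and b: "b \<in> B"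
  shows "\<alpha> b = 0"
proof (rule ccontr)
  assume "\<alpha> b \<noteq> 0"
  then have "finite {b \<in> B. \<alpha> b \<noteq> 0}" "{b \<in> B. \<alpha> b \<noteq> 0} \<noteq> {}" using b assms(1) by auto
  from ex_min_if_finite[of "key ` {b \<in> B. \<alpha> b \<noteq> 0}"] this
  obtain c where c: "c \<in> B" "\<alpha> c \<noteq> 0" "\<And>b. b \<in> B \<Longrightarrow> \<alpha> b \<noteq> 0 \<Longrightarrow> \<not> key b < key c" by auto
  have "(\<Sum>b\<in>B. \<alpha> b * M b c) = (\<Sum>b\<in>B. if b = c then \<alpha> c * M c c else 0)"
  proof (rule sum.cong)
    fix b assume b: "b \<in> B"
    show "\<alpha> b * M b c = (if b = c then \<alpha> c * M c c else 0)"
    proof (cases "b = c \<or> \<alpha> b = 0 \<or> M b c = 0")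
      case False
      then have "key b = key c" using tri[OF b c(1)] c(3)[OF b] by auto
      then show ?thesis using assms(2) b c(1) False by (auto simp: inj_on_def)
    qed auto
  qed simp
  then show False using zero[OF c(1)] c assms(1,3) by simp
qed

text \<open>\<open>valr\<close> is below 2^n on words of length \<open>n\<close>, so this integer
  encodes the lexicographic order \<open>le_pair\<close> on pairs of such words.\<close>

definition pair_key :: "nat \<Rightarrow> vbasis list \<times> vbasis list \<Rightarrow> int" where
  "pair_key n b = int (valr (fst b)) * 2 ^ n - int (valr (rev (snd b)))"

lemma pair_key_mono:
  assumes "length c = n" "length c' = n" "le_pair (r, c) (r', c')"
  shows "pair_key n (r, c) \<le> pair_key n (r', c')"
proof (cases "valr r < valr r'")
  case True
  then have "(int (valr r) + 1) * 2 ^ n \<le> int (valr r') * 2 ^ n" by (intro mult_right_mono) auto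
  moreover have "int (valr (rev c')) < 2 ^ n"
    using valr_less[of "rev c'"] assms(2) by (metis length_rev of_nat_less_iff of_nat_numeral of_nat_power)
  ultimately show ?thesis unfolding pair_key_def fst_conv snd_conv distrib_right mult_1 by linarith
next
  case False
  then show ?thesis using assms(3) by (auto simp: pair_key_def le_pair_def)
qed

lemma pair_key_inj:
  assumes "length r = n" "length r' = n" "length c = n" "length c' = n" "pair_key n (r, c) = pair_key n (r', c')"
  shows "r = r' \<and> c = c'"
proof -
  have lt: "int (valr (rev c)) < 2 ^ n" "int (valr (rev c')) < 2 ^ n"
    using valr_less[of "rev c"] valr_less[of "rev c'"] assms by (simp_all flip: of_nat_power)
  have "valr r = valr r'"
  proof (rule ccontr)
    assume "valr r \<noteq> valr r'"
    then consider "valr r < valr r'" | "valr r' < valr r" by linarith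
    then show False
    proof cases
      case 1
      then have "(int (valr r) + 1) * 2 ^ n \<le> int (valr r') * 2 ^ n" by (intro mult_right_mono) auto
      then show False using assms(5) lt by (simp add: pair_key_def algebra_simps)
    next
      case 2
      then have "(int (valr r') + 1) * 2 ^ n \<le> int (valr r) * 2 ^ n" by (intro mult_right_mono) auto
      then show False using assms(5) lt by (simp add: pair_key_def algebra_simps)
    qed
  qed
  then show ?thesis using assms valr_inj[of r r'] valr_inj[of "rev c" "rev c'"] by (simp add: pair_key_def)
qed

definition NFpairs :: "nat \<Rightarrow> (vbasis list \<times> vbasis list) set" where
  "NFpairs n = {(r, c). \<exists>w. NF n r c w}"

definition NFword :: "nat \<Rightarrow> vbasis list \<times> vbasis list \<Rightarrow> nat list" where
  "NFword n b = (THE w. NF n (fst b) (snd b) w)"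

lemma NFword_eq: "NF n r c w \<Longrightarrow> NFword n (r, c) = w"
  unfolding NFword_def using NF_unique by (intro the_equality) auto

lemma NFword: "b \<in> NFpairs n \<Longrightarrow> NF n (fst b) (snd b) (NFword n b)"
  using NFword_eq by (fastforce simp: NFpairs_def)

lemma finite_NFpairs: "finite (NFpairs n)"
  by (rule finite_subset[of _ "{l. length l = n} \<times> {l. length l = n}"])
    (auto simp: NFpairs_def dest: NF_length)

lemma NF_triangular:
  fixes n :: nat
  assumes "v \<noteq> 0" "s \<noteq> 0"
  defines "M \<equiv> \<lambda>b b'. ent v s (NFword n b) (fst b') (snd b')"
  shows "inj_on (pair_key n) (NFpairs n)" "b \<in> NFpairs n \<Longrightarrow> M b b \<noteq> 0"
    "b \<in> NFpairs n \<Longrightarrow> b' \<in> NFpairs n \<Longrightarrow> M b b' \<noteq> 0 \<Longrightarrow> pair_key n b \<le> pair_key n b'"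
proof -
  have len: "length (fst b) = n \<and> length (snd b) = n" if "b \<in> NFpairs n" for b
    using NF_length[OF NFword[OF that]] .
  show "inj_on (pair_key n) (NFpairs n)"
    by (rule inj_onI) (use len pair_key_inj in \<open>metis prod.collapse\<close>)
  show "b \<in> NFpairs n \<Longrightarrow> M b b \<noteq> 0"
    using NF_leading[OF assms(1,2) NFword] by (simp add: M_def)
  assume b: "b \<in> NFpairs n" "b' \<in> NFpairs n" "M b b' \<noteq> 0"
  then have "le_pair b b'" using NF_leading[OF assms(1,2) NFword[OF b(1)]] len[OF b(2)]
    by (cases b') (simp add: M_def)
  then show "pair_key n b \<le> pair_key n b'"
    using pair_key_mono[of "snd b" n "snd b'" "fst b" "fst b'"] len b by simp
qed

section \<open>Quotient algebras and actions of free algebras\<close>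

lemma quot_alg_coset:
  assumes "ideal I A" "X \<in> carrier (quot_alg A I)"
  obtains x where "x \<in> carrier A" "X = I +>\<^bsub>A\<^esub> x"
  using assms(2) by (auto simp: quot_alg_def FactRing_def A_RCOSETS_def')

lemma coset_in_quot_alg: "x \<in> carrier A \<Longrightarrow> I +>\<^bsub>A\<^esub> x \<in> carrier (quot_alg A I)"
  by (auto simp: quot_alg_def FactRing_def A_RCOSETS_def')

text \<open>The union in \<open>quot_alg\<close> runs over all members of the coset. By linearity
  and stability of the ideal they all give the same coset.\<close>

lemma quot_alg_smult_coset:
  assumes "ideal I A" "x \<in> carrier A"
    and "\<And>x. x \<in> carrier A \<Longrightarrow> c \<odot>\<^bsub>A\<^esub> x \<in> carrier A"
    and "\<And>x y. x \<in> carrier A \<Longrightarrow> y \<in> carrier A \<Longrightarrow> c \<odot>\<^bsub>A\<^esub> (x \<oplus>\<^bsub>A\<^esub> y) = c \<odot>\<^bsub>A\<^esub> x \<oplus>\<^bsub>A\<^esub> c \<odot>\<^bsub>A\<^esub> y"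
    and "\<And>i. i \<in> I \<Longrightarrow> c \<odot>\<^bsub>A\<^esub> i \<in> I"
  shows "c \<odot>\<^bsub>quot_alg A I\<^esub> (I +>\<^bsub>A\<^esub> x) = I +>\<^bsub>A\<^esub> (c \<odot>\<^bsub>A\<^esub> x)"
proof -
  interpret ideal I A by fact
  have e: "I +>\<^bsub>A\<^esub> (c \<odot>\<^bsub>A\<^esub> y) = I +>\<^bsub>A\<^esub> (c \<odot>\<^bsub>A\<^esub> x)" if y: "y \<in> I +>\<^bsub>A\<^esub> x" for y
  proof -
    obtain i where i: "i \<in> I" "y = i \<oplus>\<^bsub>A\<^esub> x" using y by (auto simp: a_r_coset_def')
    have "c \<odot>\<^bsub>A\<^esub> y = c \<odot>\<^bsub>A\<^esub> i \<oplus>\<^bsub>A\<^esub> c \<odot>\<^bsub>A\<^esub> x" using i assms a_subset by auto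
    then have "c \<odot>\<^bsub>A\<^esub> y \<in> I +>\<^bsub>A\<^esub> (c \<odot>\<^bsub>A\<^esub> x)" using i assms(5) by (auto simp: a_r_coset_def')
    from a_repr_independence[OF this assms(3)[OF assms(2)]] show ?thesis by (simp add: a_subgroup)
  qed
  have "x \<in> I +>\<^bsub>A\<^esub> x" using assms(2) by (rule a_rcos_self)
  then have ne: "I +>\<^bsub>A\<^esub> x \<noteq> {}" by blast
  have "(\<Union>y\<in>I +>\<^bsub>A\<^esub> x. I +>\<^bsub>A\<^esub> (c \<odot>\<^bsub>A\<^esub> y)) = I +>\<^bsub>A\<^esub> (c \<odot>\<^bsub>A\<^esub> x)"
    by (rule SUP_eq_const[OF ne e])
  then show ?thesis by (simp add: quot_alg_def)
qed

text \<open>Shared by both actions: \<open>\<rho>\<close> acts by representatives and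
  \<open>h\<close> on classes. The last assumption already contains that \<open>\<rho>\<close> is
  constant on cosets.\<close>

lemma quot_alg_hom:
  assumes I: "ideal I A" and \<rho>: "\<rho> \<in> ring_hom A B"
    and s: "\<And>c x. x \<in> carrier A \<Longrightarrow> c \<odot>\<^bsub>A\<^esub> x \<in> carrier A"
      "\<And>c x y. x \<in> carrier A \<Longrightarrow> y \<in> carrier A \<Longrightarrow> c \<odot>\<^bsub>A\<^esub> (x \<oplus>\<^bsub>A\<^esub> y) = c \<odot>\<^bsub>A\<^esub> x \<oplus>\<^bsub>A\<^esub> c \<odot>\<^bsub>A\<^esub> y"
      "\<And>c i. i \<in> I \<Longrightarrow> c \<odot>\<^bsub>A\<^esub> i \<in> I"
    and \<rho>s: "\<And>c x. x \<in> carrier A \<Longrightarrow> \<rho> (c \<odot>\<^bsub>A\<^esub> x) = c \<odot>\<^bsub>B\<^esub> \<rho> x"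
    and h: "\<And>x. x \<in> carrier A \<Longrightarrow> h (I +>\<^bsub>A\<^esub> x) = \<rho> x"
  shows "h \<in> alg_hom (quot_alg A I) B" "h ` carrier (quot_alg A I) = \<rho> ` carrier A"
proof -
  interpret ideal I A by fact
  have m: "(I +>\<^bsub>A\<^esub> x) \<otimes>\<^bsub>quot_alg A I\<^esub> (I +>\<^bsub>A\<^esub> y) = I +>\<^bsub>A\<^esub> (x \<otimes>\<^bsub>A\<^esub> y)"
    "(I +>\<^bsub>A\<^esub> x) \<oplus>\<^bsub>quot_alg A I\<^esub> (I +>\<^bsub>A\<^esub> y) = I +>\<^bsub>A\<^esub> (x \<oplus>\<^bsub>A\<^esub> y)"
    if "x \<in> carrier A" "y \<in> carrier A" for x y
    using that by (auto simp: quot_alg_def FactRing_def rcoset_mult_add a_rcos_sum)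
  have o: "\<one>\<^bsub>quot_alg A I\<^esub> = I +>\<^bsub>A\<^esub> \<one>\<^bsub>A\<^esub>" by (simp add: quot_alg_def FactRing_def)
  have "h \<in> ring_hom (quot_alg A I) B"
  proof (rule ring_hom_memI)
    fix X assume "X \<in> carrier (quot_alg A I)"
    then obtain x where "x \<in> carrier A" "X = I +>\<^bsub>A\<^esub> x" by (rule quot_alg_coset[OF I])
    then show "h X \<in> carrier B" using h ring_hom_closed[OF \<rho>] by simp
    fix Y assume "Y \<in> carrier (quot_alg A I)"
    then obtain y where "y \<in> carrier A" "Y = I +>\<^bsub>A\<^esub> y" by (rule quot_alg_coset[OF I])
    with \<open>x \<in> carrier A\<close> \<open>X = I +>\<^bsub>A\<^esub> x\<close>
    show "h (X \<otimes>\<^bsub>quot_alg A I\<^esub> Y) = h X \<otimes>\<^bsub>B\<^esub> h Y" "h (X \<oplus>\<^bsub>quot_alg A I\<^esub> Y) = h X \<oplus>\<^bsub>B\<^esub> h Y"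
      using ring_hom_mult[OF \<rho>] ring_hom_add[OF \<rho>] by (simp_all add: m h)
  next
    show "h \<one>\<^bsub>quot_alg A I\<^esub> = \<one>\<^bsub>B\<^esub>" using o h ring_hom_one[OF \<rho>] by simp
  qed
  moreover have "h (c \<odot>\<^bsub>quot_alg A I\<^esub> X) = c \<odot>\<^bsub>B\<^esub> h X" if X: "X \<in> carrier (quot_alg A I)" for c X
  proof -
    obtain x where x: "x \<in> carrier A" "X = I +>\<^bsub>A\<^esub> x" using X by (rule quot_alg_coset[OF I])
    have "c \<odot>\<^bsub>quot_alg A I\<^esub> X = I +>\<^bsub>A\<^esub> (c \<odot>\<^bsub>A\<^esub> x)"
      unfolding x(2) by (rule quot_alg_smult_coset[OF I x(1) s])
    then show ?thesis using h s(1) \<rho>s x by simp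
  qed
  ultimately show "h \<in> alg_hom (quot_alg A I) B" by (simp add: alg_hom_def)
  show "h ` carrier (quot_alg A I) = \<rho> ` carrier A"
  proof (intro equalityI subsetI)
    fix y assume "y \<in> h ` carrier (quot_alg A I)"
    then obtain X where "X \<in> carrier (quot_alg A I)" "y = h X" by blast
    then show "y \<in> \<rho> ` carrier A" using h quot_alg_coset[OF I] by (metis image_eqI)
  next
    fix y assume "y \<in> \<rho> ` carrier A"
    then obtain x where "x \<in> carrier A" "y = \<rho> x" by blast
    then show "y \<in> h ` carrier (quot_alg A I)" using h[of x] coset_in_quot_alg[of x A I] by (metis image_eqI)
  qed
qed

lemma the_elem_const_on: "X \<noteq> {} \<Longrightarrow> (\<And>x. x \<in> X \<Longrightarrow> f x = y) \<Longrightarrow> the_elem (f ` X) = y"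
  by (metis the_elem_image_unique all_not_in_conv)

lemma abelian_groupI_uminus:
  fixes A :: "('k, 'a::ab_group_add) module"
  assumes "add A = (+)" "zero A = 0" "0 \<in> carrier A"
    "\<And>x y. x \<in> carrier A \<Longrightarrow> y \<in> carrier A \<Longrightarrow> x + y \<in> carrier A" "\<And>x. x \<in> carrier A \<Longrightarrow> - x \<in> carrier A"
  shows "abelian_group A"
  by (rule abelian_groupI) (use assms in \<open>auto simp: add_ac intro: bexI[of _ "- _"]\<close>)

section \<open>Free algebras and their ideals\<close>

lemma free_alg_carrier: "x \<in> carrier (free_alg X) \<longleftrightarrow> (\<forall>w\<in>keys x. set (letters w) \<subseteq> X)"
  by (simp add: free_alg_def)

lemma free_alg_ops [simp]: "mult (free_alg X) = (*)" "one (free_alg X) = 1" "zero (free_alg X) = 0"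
  "add (free_alg X) = (+)" "smult (free_alg X) = scl"
  by (auto simp: free_alg_def scl_def fun_eq_iff)

lemma free_alg_closed:
  "0 \<in> carrier (free_alg X)" "1 \<in> carrier (free_alg X)"
  "x \<in> carrier (free_alg X) \<Longrightarrow> y \<in> carrier (free_alg X) \<Longrightarrow> x + y \<in> carrier (free_alg X)"
  "x \<in> carrier (free_alg X) \<Longrightarrow> y \<in> carrier (free_alg X) \<Longrightarrow> x * y \<in> carrier (free_alg X)"
  "x \<in> carrier (free_alg X) \<Longrightarrow> - x \<in> carrier (free_alg X)"
  "x \<in> carrier (free_alg X) \<Longrightarrow> y \<in> carrier (free_alg X) \<Longrightarrow> x - y \<in> carrier (free_alg X)"
  "x \<in> carrier (free_alg X) \<Longrightarrow> scl c x \<in> carrier (free_alg X)"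
proof -
  show a: "x \<in> carrier (free_alg X) \<Longrightarrow> y \<in> carrier (free_alg X) \<Longrightarrow> x + y \<in> carrier (free_alg X)" for x y
    using keys_add[of x y] by (auto simp: free_alg_carrier)
  show b: "x \<in> carrier (free_alg X) \<Longrightarrow> - x \<in> carrier (free_alg X)" for x
    by (auto simp: free_alg_carrier)
  show "x \<in> carrier (free_alg X) \<Longrightarrow> y \<in> carrier (free_alg X) \<Longrightarrow> x - y \<in> carrier (free_alg X)"
    using a[OF _ b[of y], of x] by simp
  show "x \<in> carrier (free_alg X) \<Longrightarrow> y \<in> carrier (free_alg X) \<Longrightarrow> x * y \<in> carrier (free_alg X)"
    using keys_mult[of x y] by (fastforce simp: free_alg_carrier plus_free_mon_def)
  show "x \<in> carrier (free_alg X) \<Longrightarrow> scl c x \<in> carrier (free_alg X)"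
    using keys_scl[of c x] by (auto simp: free_alg_carrier)
qed (auto simp: free_alg_carrier zero_free_mon_def)

lemma word_in_free_alg [simp]: "word l \<in> carrier (free_alg X) \<longleftrightarrow> set l \<subseteq> X"
  by (simp add: free_alg_carrier)

lemma free_alg_sum: "(\<And>a. a \<in> A \<Longrightarrow> f a \<in> carrier (free_alg X)) \<Longrightarrow> sum f A \<in> carrier (free_alg X)"
  by (induction A rule: infinite_finite_induct) (auto intro: free_alg_closed)

lemma ring_free_alg: "ring (free_alg X)"
proof (rule ringI)
  show "abelian_group (free_alg X)"
    by (rule abelian_groupI_uminus) (auto intro: free_alg_closed)
  show "Group.monoid (free_alg X)"
    by (rule Group.monoidI) (auto intro: free_alg_closed simp: mult.assoc)
qed (auto simp: algebra_simps)

lemma idealI_uminus: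
  fixes A :: "('k, 'a::ab_group_add) module"
  assumes "ring A" "add A = (+)" "zero A = 0" "I \<subseteq> carrier A" "0 \<in> I"
    "\<And>x y. x \<in> I \<Longrightarrow> y \<in> I \<Longrightarrow> x + y \<in> I" "\<And>x. x \<in> I \<Longrightarrow> - x \<in> I"
    "\<And>a x. a \<in> I \<Longrightarrow> x \<in> carrier A \<Longrightarrow> x \<otimes>\<^bsub>A\<^esub> a \<in> I" "\<And>a x. a \<in> I \<Longrightarrow> x \<in> carrier A \<Longrightarrow> a \<otimes>\<^bsub>A\<^esub> x \<in> I"
  shows "ideal I A"
proof (rule idealI[OF assms(1)])
  interpret ring A by fact
  have neg: "\<ominus>\<^bsub>A\<^esub> x = - x" if "x \<in> I" for x
    using that assms minus_equality[of "- x" x] by auto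
  show "subgroup I (add_monoid A)"
    by (rule add.subgroupI) (use assms neg in \<open>auto simp: a_inv_def[symmetric]\<close>)
qed (use assms in auto)

lemma ideal_free_alg_scl:
  assumes "ideal I (free_alg X)" "i \<in> I"
  shows "scl c i \<in> I"
proof -
  interpret ideal I "free_alg X" by fact
  have "scl c 1 * i \<in> I" using I_l_closed[OF assms(2) free_alg_closed(7)[OF free_alg_closed(2)], of c] by simp
  then show ?thesis by simp
qed

text \<open>One form for the Temperley-Lieb generators and for those of the quantum group, so that
  passage to the quotient by relations is treated once.\<close>

definition free_action ::
    "('g \<Rightarrow> 'k::field tensors \<Rightarrow> 'k tensors) \<Rightarrow> ('g free_mon \<Rightarrow>\<^sub>0 'k) \<Rightarrow> 'k tensors \<Rightarrow> 'k tensors" where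
  "free_action op f m = (\<Sum>w\<in>keys f. const (lookup f w) * foldr op (letters w) m)"

lemma TL_free_action_eq: "TL_free_action v s = free_action (TL_gen_op v s)"
  by (simp add: fun_eq_iff TL_free_action_def free_action_def)

lemma linear_map_keys_sum: "linear_map (\<lambda>f. \<Sum>w\<in>keys f. const (lookup f w) * \<phi> w)"
  for \<phi> :: "'a::monoid_add \<Rightarrow> ('b::monoid_add \<Rightarrow>\<^sub>0 'k::field)"
proof (rule linear_mapI)
  fix x y :: "'a \<Rightarrow>\<^sub>0 'k"
  show "(\<Sum>w\<in>keys (x + y). const (lookup (x + y) w) * \<phi> w) =
      (\<Sum>w\<in>keys x. const (lookup x w) * \<phi> w) + (\<Sum>w\<in>keys y. const (lookup y w) * \<phi> w)"
    by (rule setsum_keys_plus_distrib) (auto simp: const_add algebra_simps)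
next
  fix c and x :: "'a \<Rightarrow>\<^sub>0 'k"
  have "(\<Sum>w\<in>keys (scl c x). const (lookup (scl c x) w) * \<phi> w) = (\<Sum>w\<in>keys x. const (lookup (scl c x) w) * \<phi> w)"
    by (rule keys_sum_mono) (auto simp: keys_scl)
  then show "(\<Sum>w\<in>keys (scl c x). const (lookup (scl c x) w) * \<phi> w) = scl c (\<Sum>w\<in>keys x. const (lookup x w) * \<phi> w)"
    by (simp add: scl_sum const_mult_eq_scl)
qed

lemma linear_map_free_action [simp]: "linear_map (\<lambda>f. free_action op f m)"
  unfolding free_action_def by (rule linear_map_keys_sum)

lemma free_action_word [simp]: "free_action op (word l) m = foldr op l m"
  by (simp add: free_action_def lookup_word)

lemma free_action_simps:
  "free_action op (x + y) m = free_action op x m + free_action op y m"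
  "free_action op (x - y) m = free_action op x m - free_action op y m"
  "free_action op (scl c x) m = scl c (free_action op x m)"
  "free_action op (- x) m = - free_action op x m"
  "free_action op 0 m = 0" "free_action op 1 m = m"
  "free_action op (sum g A) m = (\<Sum>a\<in>A. free_action op (g a) m)"
  using linear_map_simps[OF linear_map_free_action] free_action_word[of op "[]"] by auto

lemma foldr_linear: "(\<And>g. linear_map (op g)) \<Longrightarrow> linear_map (foldr op l)"
proof (induction l)
  case (Cons g l)
  then show ?case using linear_map_comp[of "op g" "foldr op l"] by (simp add: comp_def)
qed (simp add: linear_map_def)

lemma free_action_linear:
  assumes "\<And>g. linear_map (op g)"
  shows "linear_map (free_action op f)"
  unfolding free_action_def[abs_def] const_mult_eq_scl
  by (intro linear_map_of_sum linear_map_const foldr_linear assms)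

lemma free_action_mult:
  assumes "\<And>g. linear_map (op g)"
  shows "free_action op (x * y) m = free_action op x (free_action op y m)"
proof -
  have lin: "linear_map (\<lambda>x. free_action op x z)" for z by simp
  have "free_action op (word l * y) m = free_action op (word l) (free_action op y m)" for l
    by (rule linear_map_ext[of _ _ y])
      (use assms in \<open>auto intro!: linear_map_comp[OF lin] linear_map_intros linear_map_comp[OF free_action_linear] linear_map_comp[OF foldr_linear] simp flip: word_append\<close>)
  then show ?thesis
    by (intro linear_map_ext[of "\<lambda>x. free_action op (x * y) m" _ x])
      (auto intro!: linear_map_comp[OF lin] linear_map_intros)
qed

lemma foldr_closed: "(\<And>g x. g \<in> X \<Longrightarrow> x \<in> S \<Longrightarrow> op g x \<in> S) \<Longrightarrow> set l \<subseteq> X \<Longrightarrow> x \<in> S \<Longrightarrow> foldr op l x \<in> S"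
  by (induction l) auto

lemma free_action_tensor_power:
  assumes "\<And>g x. g \<in> X \<Longrightarrow> x \<in> tensor_power n \<Longrightarrow> op g x \<in> tensor_power n"
    and "f \<in> carrier (free_alg X)" "m \<in> tensor_power n"
  shows "free_action op f m \<in> tensor_power n"
  unfolding free_action_def const_mult_eq_scl
  using assms foldr_closed[of X "tensor_power n" op]
  by (intro tensor_power_intros) (auto simp: free_alg_carrier)

text \<open>Since the elements acting by zero form an ideal, it suffices to check the defining
  relations.\<close>

lemma free_action_kernel_ideal:
  assumes "\<And>g. linear_map (op g)" "\<And>g x. g \<in> X \<Longrightarrow> x \<in> tensor_power n \<Longrightarrow> op g x \<in> tensor_power n"
  shows "ideal {f \<in> carrier (free_alg X). \<forall>m\<in>tensor_power n. free_action op f m = 0} (free_alg X)"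
  by (rule idealI_uminus[OF ring_free_alg])
    (auto simp: free_action_simps free_action_mult[OF assms(1)] free_action_tensor_power[OF assms(2)]
       linear_map_0[OF free_action_linear[OF assms(1)]] intro: free_alg_closed)

lemma genideal_acts_0:
  assumes "\<And>g. linear_map (op g)" "\<And>g x. g \<in> X \<Longrightarrow> x \<in> tensor_power n \<Longrightarrow> op g x \<in> tensor_power n"
    and "R \<subseteq> carrier (free_alg X)" "\<And>r m. r \<in> R \<Longrightarrow> m \<in> tensor_power n \<Longrightarrow> free_action op r m = 0"
    and "f \<in> genideal (free_alg X) R" "m \<in> tensor_power n"
  shows "free_action op f m = 0"
proof -
  have "genideal (free_alg X) R \<subseteq> {f \<in> carrier (free_alg X). \<forall>m\<in>tensor_power n. free_action op f m = 0}"
    by (rule ring.genideal_minimal[OF ring_free_alg free_action_kernel_ideal[OF assms(1,2)]]) (use assms(3,4) in auto)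
  then show ?thesis using assms(5,6) by auto
qed

lemma free_action_coset:
  assumes "\<And>i. i \<in> I \<Longrightarrow> free_action op i m = 0" "ideal I (free_alg X)" "x \<in> carrier (free_alg X)"
  shows "the_elem ((\<lambda>f. free_action op f m) ` (I +>\<^bsub>free_alg X\<^esub> x)) = free_action op x m"
proof (rule the_elem_const_on)
  interpret ideal I "free_alg X" by fact
  show "I +>\<^bsub>free_alg X\<^esub> x \<noteq> {}" using a_rcos_self[OF assms(3)] by auto
  fix y assume "y \<in> I +>\<^bsub>free_alg X\<^esub> x"
  then obtain i where "i \<in> I" "y = i + x" by (auto simp: a_r_coset_def')
  then show "free_action op y m = free_action op x m" using assms(1) by (simp add: free_action_simps)
qed

lemma End_tensor_carrier:
  "f \<in> carrier (End_tensor n) \<longleftrightarrow> f \<in> tensor_power n \<rightarrow>\<^sub>E tensor_power n \<and>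
     (\<forall>x\<in>tensor_power n. \<forall>y\<in>tensor_power n. f (x + y) = f x + f y) \<and>
     (\<forall>c. \<forall>x\<in>tensor_power n. f (scl c x) = scl c (f x))"
  by (simp add: End_tensor_def scl_def)

lemma End_over_simps:
  "carrier (End_over A \<rho> n) = {f \<in> carrier (End_tensor n). \<forall>a\<in>carrier A. \<forall>x\<in>tensor_power n. f (\<rho> a x) = \<rho> a (f x)}"
  "mult (End_over A \<rho> n) = (\<lambda>f g. \<lambda>x\<in>tensor_power n. f (g x))"
  "one (End_over A \<rho> n) = (\<lambda>x\<in>tensor_power n. x)"
  "add (End_over A \<rho> n) = (\<lambda>f g. \<lambda>x\<in>tensor_power n. f x + g x)"
  "smult (End_over A \<rho> n) = (\<lambda>c f. \<lambda>x\<in>tensor_power n. scl c (f x))"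
  by (auto simp: End_over_def End_tensor_def scl_def)

section \<open>The action of the Temperley--Lieb algebra\<close>

lemma TL_relations_carrier: "TL_relations n \<delta> \<subseteq> carrier (free_alg {1..<n})"
  unfolding TL_relations_def const_mult_eq_scl by (auto intro!: free_alg_closed)

lemma comm_TL_free_action:
  assumes v: "v \<noteq> 0" and f: "comm_TL v s n f" and x: "x \<in> carrier (free_alg {1..<n})" and m: "m \<in> tensor_power n"
  shows "f (free_action (TL_gen_op v s) x m) = free_action (TL_gen_op v s) x (f m)"
proof -
  have cl: "free_action (TL_gen_op v s) y m \<in> tensor_power n" if "y \<in> carrier (free_alg {1..<n})" for y
    using that assms(1,4) by (intro free_action_tensor_power[of "{1..<n}"]) (auto intro: TL_tensor_power)
  have foldr: "f (foldr (TL_gen_op v s) l m) = foldr (TL_gen_op v s) l (f m)" if "set l \<subseteq> {1..<n}" for l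
    using that
  proof (induction l)
    case (Cons i l)
    have "foldr (TL_gen_op v s) l m \<in> tensor_power n"
      using TLw_tensor_power[OF v _ m, of l s] Cons.prems by auto
    then show ?case using Cons f by (simp add: comm_TL_def)
  qed simp
  have "\<forall>w\<in>keys x. set (letters w) \<subseteq> {1..<n}" using x by (simp add: free_alg_carrier)
  then show ?thesis
  proof (induction rule: free_induct)
    case zero
    show ?case using comm_TL_0[OF f] by (simp add: free_action_simps)
  next
    case (add l c y)
    have "foldr (TL_gen_op v s) l m \<in> tensor_power n" using cl[of "word l"] add by simp
    moreover have "free_action (TL_gen_op v s) y m \<in> tensor_power n" using cl[of y] add by (simp add: free_alg_carrier)
    ultimately have "f (scl c (foldr (TL_gen_op v s) l m) + free_action (TL_gen_op v s) y m) =
        scl c (f (foldr (TL_gen_op v s) l m)) + f (free_action (TL_gen_op v s) y m)"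
      using f unfolding comm_TL_def by (metis tensor_power_scl)
    then show ?case using add foldr by (simp add: free_action_simps)
  qed
qed

context
  fixes v s \<delta> :: "'k::field" and n :: nat
  assumes v: "v \<noteq> 0" and s: "s = 1 \<or> s = - 1" and \<delta>: "\<delta> = s * (v + inverse v)"
  notes One_nat_def [simp del]
begin

private lemma ss: "s * s = 1" and s0: "s \<noteq> 0"
  using s by auto

private definition I where "I = genideal (free_alg {1..<n}) (TL_relations n \<delta>)"

private lemma TL_gen_closed: "i \<in> {1..<n} \<Longrightarrow> x \<in> tensor_power n \<Longrightarrow> TL_gen_op v s i x \<in> tensor_power n"
  using TL_tensor_power[OF v] by auto

private lemma act_closed:
  "x \<in> carrier (free_alg {1..<n}) \<Longrightarrow> m \<in> tensor_power n \<Longrightarrow> free_action (TL_gen_op v s) x m \<in> tensor_power n"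
  by (rule free_action_tensor_power[OF TL_gen_closed])

lemma TL_relations_act_0:
  assumes "r \<in> TL_relations n \<delta>" "m \<in> tensor_power n"
  shows "free_action (TL_gen_op v s) r m = 0"
proof -
  have 1: "\<bar>int i - int j\<bar> = 1 \<longleftrightarrow> j = Suc i \<or> i = Suc j" and 2: "\<bar>int i - int j\<bar> > 1 \<longleftrightarrow> Suc i < j \<or> Suc j < i" for i j
    by arith+
  from assms(1) consider
      i where "i \<in> {1..<n}" "r = word [i, i] - scl \<delta> (word [i])"
    | i j where "i \<in> {1..<n}" "j \<in> {1..<n}" "j = Suc i \<or> i = Suc j" "r = word [i, j, i] - word [i]"
    | i j where "i \<in> {1..<n}" "j \<in> {1..<n}" "Suc i < j \<or> Suc j < i" "r = word [i, j] - word [j, i]"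
    unfolding TL_relations_def const_mult_eq_scl 1 2 by blast
  then show ?thesis
  proof cases
    case 1
    then show ?thesis using TL_square[OF v assms(2), of i s] by (simp add: free_action_simps \<delta>)
  next
    case 2
    then show ?thesis using TL_braid[OF v ss assms(2)] by (auto simp: free_action_simps)
  next
    case 3
    then show ?thesis using TL_commute[OF v assms(2), of i j s] TL_commute[OF v assms(2), of j i s]
      by (auto simp: free_action_simps)
  qed
qed

private lemma I_ideal: "ideal I (free_alg {1..<n})"
  unfolding I_def by (rule ring.genideal_ideal[OF ring_free_alg TL_relations_carrier])

private lemma I_act_0: "i \<in> I \<Longrightarrow> m \<in> tensor_power n \<Longrightarrow> free_action (TL_gen_op v s) i m = 0"
  unfolding I_def
  by (rule genideal_acts_0[OF linear_map_TL TL_gen_closed TL_relations_carrier TL_relations_act_0])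

private lemma TL_eq: "TL n \<delta> = quot_alg (free_alg {1..<n}) I"
  by (simp add: TL_def presented_alg_def I_def)

private definition \<rho> where "\<rho> x = (\<lambda>m\<in>tensor_power n. free_action (TL_gen_op v s) x m)"

private lemma TL_action_coset:
  "x \<in> carrier (free_alg {1..<n}) \<Longrightarrow> TL_action v s n (I +>\<^bsub>free_alg {1..<n}\<^esub> x) = \<rho> x"
  unfolding TL_action_def \<rho>_def TL_free_action_eq
  by (intro restrict_ext free_action_coset I_ideal I_act_0)

private lemma \<rho>_hom:
  assumes B: "mult B = (\<lambda>f g. \<lambda>x\<in>tensor_power n. f (g x))" "one B = (\<lambda>x\<in>tensor_power n. x)"
    "add B = (\<lambda>f g. \<lambda>x\<in>tensor_power n. f x + g x)"
    and c: "\<And>x. x \<in> carrier (free_alg {1..<n}) \<Longrightarrow> \<rho> x \<in> carrier B"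
  shows "\<rho> \<in> ring_hom (free_alg {1..<n}) B"
proof (rule ring_hom_memI)
  show "x \<in> carrier (free_alg {1..<n}) \<Longrightarrow> \<rho> x \<in> carrier B" for x by (rule c)
  fix x y :: "nat free_mon \<Rightarrow>\<^sub>0 'k"
  assume "x \<in> carrier (free_alg {1..<n})" "y \<in> carrier (free_alg {1..<n})"
  then show "\<rho> (x \<otimes>\<^bsub>free_alg {1..<n}\<^esub> y) = \<rho> x \<otimes>\<^bsub>B\<^esub> \<rho> y"
    by (auto simp: B \<rho>_def fun_eq_iff free_action_mult act_closed)
qed (auto simp: B fun_eq_iff \<rho>_def free_action_simps)

lemma TL_action_tensor:
  assumes "X \<in> carrier (TL n \<delta>)"
  obtains x where "x \<in> carrier (free_alg {1..<n})"
    "TL_action v s n X = (\<lambda>m\<in>tensor_power n. free_action (TL_gen_op v s) x m)"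
proof -
  obtain x where "x \<in> carrier (free_alg {1..<n})" "X = I +>\<^bsub>free_alg {1..<n}\<^esub> x"
    using assms unfolding TL_eq by (rule quot_alg_coset[OF I_ideal])
  then show ?thesis using that TL_action_coset by (simp add: \<rho>_def)
qed

lemma TL_action_gen:
  assumes "1 \<le> i" "i < n"
  shows "\<exists>X\<in>carrier (TL n \<delta>). TL_action v s n X = (\<lambda>m\<in>tensor_power n. TL_gen_op v s i m)"
proof
  have "word [i] \<in> carrier (free_alg {1..<n})" using assms by simp
  from TL_action_coset[OF this]
  show "TL_action v s n (I +>\<^bsub>free_alg {1..<n}\<^esub> word [i]) = (\<lambda>m\<in>tensor_power n. TL_gen_op v s i m)"
    by (simp add: \<rho>_def cong: restrict_cong)
  show "I +>\<^bsub>free_alg {1..<n}\<^esub> word [i] \<in> carrier (TL n \<delta>)"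
    unfolding TL_eq using assms by (intro coset_in_quot_alg) auto
qed

lemma TL_action_alg_hom:
  assumes B: "mult B = (\<lambda>f g. \<lambda>x\<in>tensor_power n. f (g x))" "one B = (\<lambda>x\<in>tensor_power n. x)"
    "add B = (\<lambda>f g. \<lambda>x\<in>tensor_power n. f x + g x)" "smult B = (\<lambda>c f. \<lambda>x\<in>tensor_power n. scl c (f x))"
    and c: "\<And>x. x \<in> carrier (free_alg {1..<n}) \<Longrightarrow> (\<lambda>m\<in>tensor_power n. free_action (TL_gen_op v s) x m) \<in> carrier B"
  shows "TL_action v s n \<in> alg_hom (TL n \<delta>) B"
    "TL_action v s n ` carrier (TL n \<delta>) = (\<lambda>x. \<lambda>m\<in>tensor_power n. free_action (TL_gen_op v s) x m) ` carrier (free_alg {1..<n})"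
proof -
  have 1: "\<rho> \<in> ring_hom (free_alg {1..<n}) B" by (rule \<rho>_hom[OF B(1-3)]) (use c in \<open>simp add: \<rho>_def\<close>)
  have 2: "\<rho> (d \<odot>\<^bsub>free_alg {1..<n}\<^esub> x) = d \<odot>\<^bsub>B\<^esub> \<rho> x" for d x
    by (auto simp: B \<rho>_def fun_eq_iff free_action_simps)
  note * = quot_alg_hom[OF I_ideal 1 _ _ _ 2 TL_action_coset]
  show "TL_action v s n \<in> alg_hom (TL n \<delta>) B"
    unfolding TL_eq by (rule *(1)) (auto intro: free_alg_closed ideal_free_alg_scl[OF I_ideal] simp: scl_add)
  have "TL_action v s n ` carrier (TL n \<delta>) = \<rho> ` carrier (free_alg {1..<n})"
    unfolding TL_eq by (rule *(2)) (auto intro: free_alg_closed ideal_free_alg_scl[OF I_ideal] simp: scl_add)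
  then show "TL_action v s n ` carrier (TL n \<delta>) =
      (\<lambda>x. \<lambda>m\<in>tensor_power n. free_action (TL_gen_op v s) x m) ` carrier (free_alg {1..<n})"
    by (simp add: \<rho>_def[abs_def])
qed

section \<open>Faithfulness and fullness of the Temperley-Lieb action\<close>

interpretation TL_ideal n \<delta> I
proof
  interpret ideal I "free_alg {1..<n}" by (rule I_ideal)
  show "0 \<in> I" using additive_subgroup.zero_closed[OF ideal.axioms(1)[OF I_ideal]] by simp
  show "x \<in> I \<Longrightarrow> y \<in> I \<Longrightarrow> x + y \<in> I" for x y
    using additive_subgroup.a_closed[OF ideal.axioms(1)[OF I_ideal], of x y] by simp
  show "x \<in> I \<Longrightarrow> scl c x \<in> I" for c x by (rule ideal_free_alg_scl[OF I_ideal])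
  show "x \<in> I \<Longrightarrow> set w \<subseteq> {1..<n} \<Longrightarrow> word w * x \<in> I" for x w using I_l_closed[of x "word w"] by simp
  show "x \<in> I \<Longrightarrow> set w \<subseteq> {1..<n} \<Longrightarrow> x * word w \<in> I" for x w using I_r_closed[of x "word w"] by simp
  show "TL_relations n \<delta> \<subseteq> I" unfolding I_def
    by (rule ring.genideal_self[OF ring_free_alg TL_relations_carrier])
qed

private lemma Sp_expand: "x \<in> Sp (NFw n) \<Longrightarrow> \<exists>\<alpha>. x - (\<Sum>b\<in>NFpairs n. scl (\<alpha> b) (word (NFword n b))) \<in> I"
proof (induction rule: Sp.induct)
  case (base x)
  then show ?case by (intro exI[of _ "\<lambda>b. 0"]) simp
next
  case (step w x c)
  then obtain \<alpha> where \<alpha>: "x - (\<Sum>b\<in>NFpairs n. scl (\<alpha> b) (word (NFword n b))) \<in> I" by blast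
  obtain r d where "NF n r d w" using step by (auto simp: NFw_def)
  then have b: "(r, d) \<in> NFpairs n" "NFword n (r, d) = w" by (auto simp: NFpairs_def NFword_eq)
  have "(\<Sum>b\<in>NFpairs n. scl ((\<alpha>((r, d) := \<alpha> (r, d) + c)) b) (word (NFword n b))) =
     (\<Sum>b\<in>NFpairs n. scl (\<alpha> b) (word (NFword n b)) + (if b = (r, d) then scl c (word w) else 0))"
    using b by (intro sum.cong) (auto simp: scl_add_left)
  also have "\<dots> = (\<Sum>b\<in>NFpairs n. scl (\<alpha> b) (word (NFword n b))) + scl c (word w)"
    using b finite_NFpairs by (simp add: sum.distrib)
  finally have "scl c (word w) + x - (\<Sum>b\<in>NFpairs n. scl ((\<alpha>((r, d) := \<alpha> (r, d) + c)) b) (word (NFword n b))) \<in> I"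
    using \<alpha> by (simp add: algebra_simps)
  then show ?case by blast
qed

text \<open>A difference of two elements with the same action is a combination of normal forms
  modulo the ideal. Its entries at the pairs in \<open>NFpairs n\<close> vanish, and the triangular
  shape forces all coefficients to be 0.\<close>

lemma TL_action_inj: "inj_on (TL_action v s n) (carrier (TL n \<delta>))"
proof (rule inj_onI)
  fix X Y assume X: "X \<in> carrier (TL n \<delta>)" and Y: "Y \<in> carrier (TL n \<delta>)" and eq: "TL_action v s n X = TL_action v s n Y"
  interpret i: ideal I "free_alg {1..<n}" by (rule I_ideal)
  obtain x where x: "x \<in> carrier (free_alg {1..<n})" "X = I +>\<^bsub>free_alg {1..<n}\<^esub> x"
    using X unfolding TL_eq by (rule quot_alg_coset[OF I_ideal])
  obtain y where y: "y \<in> carrier (free_alg {1..<n})" "Y = I +>\<^bsub>free_alg {1..<n}\<^esub> y"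
    using Y unfolding TL_eq by (rule quot_alg_coset[OF I_ideal])
  have \<rho>: "\<rho> x = \<rho> y" using eq x y TL_action_coset by simp
  have act: "free_action (TL_gen_op v s) (x - y) m = 0" if "m \<in> tensor_power n" for m
    using fun_cong[OF \<rho>, of m] that by (simp add: \<rho>_def free_action_simps)
  have "x - y \<in> carrier (free_alg {1..<n})" using x(1) y(1) by (rule free_alg_closed(6))
  then have "x - y \<in> Sp (NFw n)" by (intro free_in_Sp) (simp add: free_alg_carrier)
  from Sp_expand[OF this] obtain \<alpha> where \<alpha>: "x - y - (\<Sum>b\<in>NFpairs n. scl (\<alpha> b) (word (NFword n b))) \<in> I"
    by (rule exE)
  have "\<alpha> b = 0" if "b \<in> NFpairs n" for b
  proof (rule triangular_unique[OF finite_NFpairs NF_triangular[OF v s0] _ that])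
    fix b' assume b': "b' \<in> NFpairs n"
    have w: "word (snd b') \<in> tensor_power n" using NF_length[OF NFword[OF b']] by simp
    have "(\<Sum>b\<in>NFpairs n. scl (\<alpha> b) (TLw v s (NFword n b) (word (snd b')))) = 0"
      using I_act_0[OF \<alpha> w] act[OF w] by (simp add: free_action_simps)
    then have "lookup (\<Sum>b\<in>NFpairs n. scl (\<alpha> b) (TLw v s (NFword n b) (word (snd b')))) (Mon (fst b')) = 0" by simp
    then show "(\<Sum>b\<in>NFpairs n. \<alpha> b * ent v s (NFword n b) (fst b') (snd b')) = 0"
      by (simp add: lookup_sum ent_def)
  qed
  then have "x - y \<in> I" using \<alpha> by simp
  then have "x \<in> I +>\<^bsub>free_alg {1..<n}\<^esub> y" by (auto simp: a_r_coset_def' intro!: bexI[of _ "x - y"])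
  from i.a_repr_independence[OF this y(1) i.a_subgroup] show "X = Y" using x(2) y(2) by simp
qed

text \<open>The triangular system yields a combination of normal forms with the same entries as
  \<open>f\<close> at the pairs in \<open>NFpairs n\<close>. The difference still commutes with the
  quantum group, so \<open>comm_U_eq_0\<close> shows that it vanishes.\<close>

lemma comm_U_in_TL:
  assumes f: "comm_U v n f"
  shows "\<exists>x\<in>carrier (free_alg {1..<n}). \<forall>m\<in>tensor_power n. f m = free_action (TL_gen_op v s) x m"
proof -
  have "\<exists>\<alpha>. \<forall>b'\<in>NFpairs n. (\<Sum>b\<in>NFpairs n. \<alpha> b * ent v s (NFword n b) (fst b') (snd b')) =
      lookup (f (word (snd b'))) (Mon (fst b'))"
  proof (rule triangular_solve[OF finite_NFpairs])
    show "inj_on (pair_key n) (NFpairs n)" by (rule NF_triangular(1)[OF v s0])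
    show "ent v s (NFword n b) (fst b) (snd b) \<noteq> 0" if "b \<in> NFpairs n" for b
      using NF_triangular(2)[OF v s0 that] .
    show "pair_key n b \<le> pair_key n b'"
      if "b \<in> NFpairs n" "b' \<in> NFpairs n" "ent v s (NFword n b) (fst b') (snd b') \<noteq> 0" for b b'
      using NF_triangular(3)[OF v s0 that] .
  qed
  then obtain \<alpha> where \<alpha>: "\<forall>b'\<in>NFpairs n. (\<Sum>b\<in>NFpairs n. \<alpha> b * ent v s (NFword n b) (fst b') (snd b')) =
      lookup (f (word (snd b'))) (Mon (fst b'))" by blast
  define x where "x = (\<Sum>b\<in>NFpairs n. scl (\<alpha> b) (word (NFword n b)) :: nat free_mon \<Rightarrow>\<^sub>0 'k)"
  have xc: "x \<in> carrier (free_alg {1..<n})" unfolding x_def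
    using NF_letters[OF NFword] by (intro free_alg_sum free_alg_closed(7)) auto
  let ?a = "free_action (TL_gen_op v s) x"
  let ?g = "\<lambda>m. f m - ?a m"
  have fc: "m \<in> tensor_power n \<Longrightarrow> f m \<in> tensor_power n" for m using f by (simp add: comm_U_def)
  have ac: "m \<in> tensor_power n \<Longrightarrow> ?a m \<in> tensor_power n" for m
    by (rule free_action_tensor_power[OF TL_gen_closed xc])
  have lin: "linear_map ?a" by (rule free_action_linear) simp
  have "?g m = 0" if m: "m \<in> tensor_power n" for m
  proof (rule comm_U_eq_0[OF v _ _ m])
    show "comm_U v n ?g" unfolding comm_U_def
    proof (intro ballI conjI allI)
      fix m :: "'k tensors" assume m: "m \<in> tensor_power n"
      show "?g m \<in> tensor_power n" using fc[OF m] ac[OF m] by (rule tensor_power_diff)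
      show "?g (m + m') = ?g m + ?g m'" if "m' \<in> tensor_power n" for m'
        using f m that by (simp add: comm_U_def linear_map_add[OF lin])
      show "?g (scl c m) = scl c (?g m)" for c
        using f m by (simp add: comm_U_def linear_map_scale[OF lin] scl_diff)
      fix u assume u: "u \<in> Uops v n"
      have "f (u m) = u (f m)" using f m u by (simp add: comm_U_def)
      moreover have "u (f m + scl (- 1) (?a m)) = u (f m) + u (scl (- 1) (?a m))"
        using fc[OF m] ac[OF m] by (intro Uops_linear(1)[OF u] tensor_power_scl)
      ultimately show "?g (u m) = u (?g m)"
        using comm_TL_free_action[OF v comm_TL_Uops[OF v u] xc m, of s] Uops_linear(2)[OF u ac[OF m], of "- 1"] by simp
    qed
    fix r c assume rc: "length r = n" "length c = n" "ballot 1 r" "ballot 1 c" "ones r = ones c"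
    \<comment> \<open>Every ballot pair of equal weight indexes a normal form, so the difference
      vanishes at all ballot entries.\<close>
    obtain w where "NF n r c w" using ballot_imp_NF[OF rc] by blast
    then have "(r, c) \<in> NFpairs n" by (auto simp: NFpairs_def)
    then have "(\<Sum>b\<in>NFpairs n. \<alpha> b * ent v s (NFword n b) r c) = lookup (f (word c)) (Mon r)"
      using \<alpha> by fastforce
    then show "lookup (?g (word c)) (Mon r) = 0"
      by (simp add: x_def free_action_simps lookup_minus lookup_sum ent_def)
  qed
  then show ?thesis using xc by (intro bexI[of _ x]) auto
qed

end

section \<open>The generic action of the quantum group\<close>

text \<open>The common form of the group-like elements: x0 is scaled by \<open>a\<close> and x1 by
  \<open>b\<close> in each factor. K1, K2, their inverses and K are all of this kind.\<close>

definition Lop :: "'k::field \<Rightarrow> 'k \<Rightarrow> 'k tensors \<Rightarrow> 'k tensors" where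
  "Lop a b = lin_ext (\<lambda>l. scl (a ^ (length l - ones l) * b ^ ones l) (word l))"

lemma linear_map_Lop [intro, simp]: "linear_map (Lop a b)"
  by (simp add: Lop_def linear_map_lin_ext)

lemma Lop_word [simp]: "Lop a b (word l) = scl (a ^ (length l - ones l) * b ^ ones l) (word l)"
  by (simp add: Lop_def)

lemma Lop_1 [simp]: "Lop a b 1 = 1"
  using Lop_word[of a b "[]"] by simp

lemma linear_map_Lop_comp: "linear_map f \<Longrightarrow> linear_map (\<lambda>x. Lop a b (f x))"
  by (rule linear_map_comp[OF linear_map_Lop])

lemma Lop_X0: "Lop a b (word [X0] * y) = scl a (word [X0] * Lop a b y)"
  by (rule linear_map_ext[of _ _ y])
    (auto intro!: linear_map_intros linear_map_Lop_comp simp: Suc_diff_le ones_le mult.assoc simp flip: word_Cons)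

lemma Lop_X1: "Lop a b (word [X1] * y) = scl b (word [X1] * Lop a b y)"
  by (rule linear_map_ext[of _ _ y])
    (auto intro!: linear_map_intros linear_map_Lop_comp simp: mult.left_commute simp flip: word_Cons)

lemma Lop_Lop: "Lop a b (Lop c d y) = Lop (a * c) (b * d) y"
  by (rule linear_map_ext[of _ _ y])
    (auto intro!: linear_map_Lop_comp linear_map_id simp: linear_map_scale[OF linear_map_Lop] power_mult_distrib mult_ac)

lemma Lop_one [simp]: "Lop 1 1 y = y"
  by (rule linear_map_ext[of _ _ y]) (auto intro!: linear_map_intros)

lemma Kop_eq_Lop: "Kop v 1 y = Lop v (inverse v) y" "Kop v (- 1) y = Lop (inverse v) v y" if "v \<noteq> 0"
proof -
  have *: "v powi hgt l = v ^ (length l - ones l) * inverse v ^ ones l" for l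
  proof -
    have "hgt l = int (length l - ones l) - int (ones l)" using ones_le[of l] by (simp add: hgt_ones)
    then show ?thesis using that by (simp add: power_int_diff power_int_of_nat power_inverse divide_inverse)
  qed
  show "Kop v 1 y = Lop v (inverse v) y"
    by (rule linear_map_ext[of _ _ y]) (auto simp: *)
  show "Kop v (- 1) y = Lop (inverse v) v y"
    by (rule linear_map_ext[of _ _ y]) (auto simp: * power_int_minus inverse_mult_distrib power_inverse)
qed

lemma Lop_Eop: "b \<noteq> 0 \<Longrightarrow> Lop a b (Eop v 1 y) = scl (a * inverse b) (Eop v 1 (Lop a b y))"
proof (rule linear_map_ext[of _ _ y])
  fix l assume b: "b \<noteq> 0"
  show "Lop a b (Eop v 1 (word l)) = scl (a * inverse b) (Eop v 1 (Lop a b (word l)))"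
  proof (induction l rule: hgt.induct)
    case (2 l)
    then show ?case unfolding word_Cons[of X0 l]
      by (simp add: Eop_X0 Lop_X0 linear_map_scale[OF linear_map_Lop] linear_map_scale[OF linear_map_Eop] mult_ac
        del: Eop_word Lop_word)
  next
    case (3 l)
    then show ?case unfolding word_Cons[of X1 l] using b
      by (simp add: Eop_X1 Lop_X0 Lop_X1 linear_map_simps[OF linear_map_Lop] linear_map_simps[OF linear_map_Eop] scl_add mult_ac
          field_cancel[OF b] del: Eop_word Lop_word)
  qed (simp add: linear_map_simps[OF linear_map_Lop] linear_map_simps[OF linear_map_Eop])
qed (auto intro!: linear_map_intros linear_map_Lop_comp linear_map_op_comp)

lemma Lop_Fop: "v \<noteq> 0 \<Longrightarrow> a \<noteq> 0 \<Longrightarrow> Lop a b (Fop v 1 y) = scl (inverse a * b) (Fop v 1 (Lop a b y))"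
proof (rule linear_map_ext[of _ _ y])
  fix l assume v: "v \<noteq> 0" and a: "a \<noteq> 0"
  have KL: "Kop v (- 1) (Lop a b z) = Lop a b (Kop v (- 1) z)" for z
    using v by (simp add: Kop_eq_Lop Lop_Lop mult.commute)
  show "Lop a b (Fop v 1 (word l)) = scl (inverse a * b) (Fop v 1 (Lop a b (word l)))"
  proof (induction l rule: hgt.induct)
    case (2 l)
    then show ?case unfolding word_Cons[of X0 l] using a v
      by (simp add: Fop_X0 Lop_X0 Lop_X1 linear_map_simps[OF linear_map_Lop] linear_map_simps[OF linear_map_Fop]
          linear_map_simps[OF linear_map_Kop] KL scl_add mult_ac field_cancel[OF a] del: Fop_word Lop_word Kop_word)
  next
    case (3 l)
    then show ?case unfolding word_Cons[of X1 l]
      by (simp add: Fop_X1 Lop_X1 linear_map_scale[OF linear_map_Lop] linear_map_scale[OF linear_map_Fop] mult_ac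
        del: Fop_word Lop_word)
  qed (simp add: linear_map_simps[OF linear_map_Lop] linear_map_simps[OF linear_map_Fop])
qed (auto intro!: linear_map_intros linear_map_Lop_comp linear_map_op_comp)

lemma EF_commutator:
  assumes v: "v \<noteq> 0" "v - inverse v \<noteq> 0"
  shows "Eop v 1 (Fop v 1 y) - Fop v 1 (Eop v 1 y) = scl (1 / (v - inverse v)) (Kop v 1 y - Kop v (- 1) y)"
proof (rule linear_map_ext[of _ _ y])
  fix l
  let ?c = "1 / (v - inverse v)"
  \<comment> \<open>Lets the commutator of the tail absorb the additional term with
    \<open>K^-1\<close> that the new letter produces.\<close>
  have cd: "?c * v - ?c * inverse v = 1" using v(2) by (simp flip: diff_divide_distrib)
  have aux: "x - y = 1 \<Longrightarrow> 1 - x = - y" "x - y = 1 \<Longrightarrow> 1 + y = x" for x y :: 'a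
    by (simp_all add: diff_eq_eq)
  show "Eop v 1 (Fop v 1 (word l)) - Fop v 1 (Eop v 1 (word l)) = scl ?c (Kop v 1 (word l) - Kop v (- 1) (word l))"
  proof (induction l rule: hgt.induct)
    case 1
    then show ?case by (simp add: linear_map_simps)
  next
    case (2 l)
    let ?w = "word l" let ?A = "word [X0] :: 'a tensors"
    have KE: "scl v (Kop v (- 1) (Eop v 1 ?w)) = scl (inverse v) (Eop v 1 (Kop v (- 1) ?w))"
      using v by (simp add: Kop_Eop power_int_minus power2_eq_square field_simps del: Eop_word Kop_word)
    have "Eop v 1 (Fop v 1 (?A * ?w)) - Fop v 1 (Eop v 1 (?A * ?w)) =
       scl v (?A * (Eop v 1 (Fop v 1 ?w) - Fop v 1 (Eop v 1 ?w))) + ?A * Kop v (- 1) ?w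
       + word [X1] * (scl (inverse v) (Eop v 1 (Kop v (- 1) ?w)) - scl v (Kop v (- 1) (Eop v 1 ?w)))"
      using v by (simp add: Fop_X0 Eop_X0 Eop_X1 linear_map_simps power_int_minus scl_add scl_diff right_diff_distrib
          del: Eop_word Fop_word Kop_word)
    also have "\<dots> = scl v (?A * scl ?c (Kop v 1 ?w - Kop v (- 1) ?w)) + ?A * Kop v (- 1) ?w"
      unfolding 2 KE by simp
    also have "\<dots> = ?A * scl (?c * v) (Kop v 1 ?w) + ?A * scl (1 - ?c * v) (Kop v (- 1) ?w)"
      by (simp add: scl_diff scl_diff_left algebra_simps del: Kop_word)
    also have "1 - ?c * v = - (?c * inverse v)" by (rule aux(1)[OF cd])
    also have "?A * scl (?c * v) (Kop v 1 ?w) + ?A * scl (- (?c * inverse v)) (Kop v (- 1) ?w) =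
        scl ?c (Kop v 1 (?A * ?w) - Kop v (- 1) (?A * ?w))"
      using v by (simp add: Kop_X0 power_int_minus scl_diff del: Kop_word)
    finally show ?case unfolding word_Cons[of X0 l] .
  next
    case (3 l)
    let ?w = "word l" let ?A = "word [X1] :: 'a tensors"
    have "Eop v 1 (Fop v 1 (?A * ?w)) - Fop v 1 (Eop v 1 (?A * ?w)) =
       scl (inverse v) (?A * (Eop v 1 (Fop v 1 ?w) - Fop v 1 (Eop v 1 ?w))) - ?A * Kop v (- 1) ?w"
      using v by (simp add: Fop_X0 Fop_X1 Eop_X0 Eop_X1 linear_map_simps power_int_minus scl_add scl_diff right_diff_distrib
          del: Eop_word Fop_word Kop_word)
    also have "\<dots> = scl (inverse v) (?A * scl ?c (Kop v 1 ?w - Kop v (- 1) ?w)) - ?A * Kop v (- 1) ?w"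
      unfolding 3 ..
    also have "\<dots> = ?A * scl (?c * inverse v) (Kop v 1 ?w) - ?A * scl (1 + ?c * inverse v) (Kop v (- 1) ?w)"
      by (simp add: scl_diff scl_add_left algebra_simps del: Kop_word)
    also have "1 + ?c * inverse v = ?c * v" by (rule aux(2)[OF cd])
    also have "?A * scl (?c * inverse v) (Kop v 1 ?w) - ?A * scl (?c * v) (Kop v (- 1) ?w) =
        scl ?c (Kop v 1 (?A * ?w) - Kop v (- 1) (?A * ?w))"
      using v by (simp add: Kop_X1 power_int_minus scl_diff del: Kop_word)
    finally show ?case unfolding word_Cons[of X1 l] .
  qed
qed (auto intro!: linear_map_intros linear_map_op_comp)

section \<open>Products of divided powers\<close>

definition qnum :: "'k::field \<Rightarrow> nat \<Rightarrow> 'k" where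
  "qnum v j = (\<Sum>k<j. v powi (2 * int k - (int j - 1)))"

lemma qnum_Suc1: "v \<noteq> 0 \<Longrightarrow> qnum v (Suc j) = v powi (- int j) + v * qnum v j"
proof -
  assume v: "v \<noteq> 0"
  have "qnum v (Suc j) = v powi (- int j) + (\<Sum>k<j. v powi (2 * int (Suc k) - int j))"
    unfolding qnum_def by (subst sum.lessThan_Suc_shift) simp
  also have "(\<Sum>k<j. v powi (2 * int (Suc k) - int j)) = v * qnum v j"
    unfolding qnum_def sum_distrib_left
  proof (rule sum.cong)
    fix k
    show "v powi (2 * int (Suc k) - int j) = v * v powi (2 * int k - (int j - 1))"
      using power_int_add[of v 1 "2 * int k - (int j - 1)"] v by (simp add: algebra_simps)
  qed simp
  finally show ?thesis .
qed

lemma qnum_Suc2: "v \<noteq> 0 \<Longrightarrow> qnum v (Suc j) = v powi (int j) + inverse v * qnum v j"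
proof -
  assume v: "v \<noteq> 0"
  have "qnum v (Suc j) = (\<Sum>k<j. v powi (2 * int k - int j)) + v powi (int j)"
    unfolding qnum_def by (simp add: algebra_simps)
  also have "(\<Sum>k<j. v powi (2 * int k - int j)) = inverse v * qnum v j"
    unfolding qnum_def sum_distrib_left
  proof (rule sum.cong)
    fix k
    show "v powi (2 * int k - int j) = inverse v * v powi (2 * int k - (int j - 1))"
      using power_int_add[of v "- 1" "2 * int k - (int j - 1)"] v by (simp add: power_int_minus algebra_simps)
  qed simp
  finally show ?thesis by simp
qed

text \<open>Iterating this shows that the j-th power of \<open>E\<close> is the quantum factorial
  times \<open>Eop v j\<close>, so the operators defined by recursion really are the divided
  powers.\<close>

lemma Eop_1_Eop:
  assumes v: "v \<noteq> 0"
  shows "Eop v 1 (Eop v j y) = scl (qnum v (Suc j)) (Eop v (Suc j) y)"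
proof (rule linear_map_ext[of _ _ y])
  fix l
  show "Eop v 1 (Eop v j (word l)) = scl (qnum v (Suc j)) (Eop v (Suc j) (word l))"
  proof (induction l arbitrary: j rule: hgt.induct)
    case (2 l)
    then show ?case unfolding word_Cons[of X0 l] using v
      by (simp add: Eop_X0 linear_map_scale[OF linear_map_Eop] power_int_add_1 mult_ac del: Eop_word)
        (simp add: power_int_add mult_ac)
  next
    case (3 l)
    show ?case
    proof (cases j)
      case 0
      then show ?thesis by (simp add: qnum_def flip: word_Cons)
    next
      case (Suc i)
      let ?w = "word l"
      have "Eop v 1 (Eop v j (word [X1] * ?w)) =
         scl (v powi (- int j) * v powi (- 1) * qnum v (Suc j)) (word [X1] * Eop v (Suc j) ?w)
         + scl (v powi (- int j) + v * qnum v j) (word [X0] * Eop v j ?w)"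
        using 3[of j] 3[of i] Suc
        by (simp add: Eop_X0 Eop_X1 linear_map_simps scl_add scl_add_left mult_ac del: Eop_word)
      also have "v powi (- int j) * v powi (- 1) = v powi (- int (Suc j))"
        unfolding power_int_add[OF disjI1, OF v, symmetric] by (simp add: algebra_simps)
      also have "v powi (- int j) + v * qnum v j = qnum v (Suc j)" using qnum_Suc1[OF v, of j] by simp
      finally show ?thesis unfolding word_Cons[of X1 l]
        by (simp add: Eop_X1 scl_add mult.commute del: Eop_word)
    qed
  qed (auto simp: linear_map_simps)
qed (auto intro!: linear_map_intros linear_map_op_comp)

lemma Fop_1_Fop:
  assumes v: "v \<noteq> 0"
  shows "Fop v 1 (Fop v j y) = scl (qnum v (Suc j)) (Fop v (Suc j) y)"
proof (rule linear_map_ext[of _ _ y])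
  fix l
  show "Fop v 1 (Fop v j (word l)) = scl (qnum v (Suc j)) (Fop v (Suc j) (word l))"
  proof (induction l arbitrary: j rule: hgt.induct)
    case (3 l)
    then show ?case unfolding word_Cons[of X1 l]
      by (simp add: Fop_X1 linear_map_scale[OF linear_map_Fop] del: Fop_word)
  next
    case (2 l)
    show ?case
    proof (cases j)
      case 0
      then show ?thesis by (simp add: qnum_def flip: word_Cons)
    next
      case (Suc i)
      let ?w = "word l"
      have IH: "Fop v 1 (Fop v i (Kop v (- 1) ?w)) = scl (qnum v j) (Fop v j (Kop v (- 1) ?w))"
        using 2[of i] Suc by (simp add: linear_map_simps mult.commute)
      have K: "Kop v (- 1) (Fop v j ?w) = scl (v powi (2 * int j)) (Fop v j (Kop v (- 1) ?w))"
        using v by (simp add: Kop_Fop del: Kop_word Fop_word)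
      have "Fop v 1 (Fop v j (word [X0] * ?w)) =
         scl (qnum v (Suc j)) (word [X0] * Fop v (Suc j) ?w)
         + scl (v powi (2 * int j) + v powi (int j - 1) * qnum v j) (word [X1] * Fop v j (Kop v (- 1) ?w))"
        using 2[of j] IH K Suc v
        by (simp add: Fop_X0 Fop_X1 linear_map_simps scl_add scl_add_left mult_ac del: Fop_word Kop_word)
      also have "v powi (2 * int j) + v powi (int j - 1) * qnum v j = v powi int j * qnum v (Suc j)"
        using v unfolding qnum_Suc2[OF v] distrib_left mult.assoc[symmetric]
        by (simp add: power_int_diff power_int_add[symmetric] divide_inverse flip: mult_2)
      finally show ?thesis unfolding word_Cons[of X0 l] using v
        by (simp add: Fop_X0 scl_add mult.commute del: Fop_word Kop_word)
    qed
  qed (auto simp: linear_map_simps)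
qed (auto intro!: linear_map_intros linear_map_op_comp)

fun Gop :: "ugen \<Rightarrow> ratfun tensors \<Rightarrow> ratfun tensors" where
  "Gop gE = Eop qt 1"
| "Gop gF = Fop qt 1"
| "Gop gK1 = Lop qt 1"
| "Gop gK1inv = Lop (inverse qt) 1"
| "Gop gK2 = Lop 1 qt"
| "Gop gK2inv = Lop 1 (inverse qt)"

lemma linear_map_Gop [simp]: "linear_map (Gop g)"
  by (cases g) auto

lemma Lop_tensor_power: "m \<in> tensor_power n \<Longrightarrow> Lop a b m \<in> tensor_power n"
  by (erule linear_map_in_on_words[OF linear_map_Lop]) (auto intro!: tensor_power_intros)

lemma Gop_tensor_power: "m \<in> tensor_power n \<Longrightarrow> Gop g m \<in> tensor_power n"
  by (cases g) (auto intro: Eop_tensor_power Fop_tensor_power Lop_tensor_power)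

lemma qt_nonzero [simp]: "qt \<noteq> 0"
  by (simp add: qt_def Zero_fract_def eq_fract)

lemma linear_map_V_op [simp]: "linear_map (V_op g)"
  by (simp add: V_op_def linear_map_lin_ext)

lemma V_op_word: "V_op g (word [x]) = V_gen g x"
  by (simp add: V_op_def)

lemma V_op_tensor_power: "m \<in> tensor_power 1 \<Longrightarrow> V_op g m \<in> tensor_power 1"
proof (erule linear_map_in_on_words[OF linear_map_V_op])
  fix l :: "vbasis list" assume "length l = 1"
  then obtain x where l: "l = [x]" by (cases l) auto
  show "V_op g (word l) \<in> tensor_power 1" unfolding l V_op_word
    by (cases "(g, x)" rule: V_gen.cases) (auto simp: const_mult_eq_scl intro!: tensor_power_scl)
qed

text \<open>The tensor square of the free algebra acting on \<open>x\<close> tensor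
  \<open>y\<close>: the first leg through \<open>V_op\<close>, the second through the closed
  operators \<open>Gop\<close>.\<close>

definition Psi :: "ratfun tensors \<Rightarrow> ratfun tensors \<Rightarrow> (ugen free_mon \<times> ugen free_mon \<Rightarrow>\<^sub>0 ratfun) \<Rightarrow> ratfun tensors" where
  "Psi x y z = (\<Sum>pq\<in>keys z. const (lookup z pq) * (foldr V_op (letters (fst pq)) x * foldr Gop (letters (snd pq)) y))"

lemma linear_map_Psi [simp]: "linear_map (Psi x y)"
  unfolding Psi_def[abs_def] by (rule linear_map_keys_sum)

lemma Psi_single: "Psi x y (single (Mon p, Mon q) 1) = foldr V_op p x * foldr Gop q y"
  by (simp add: Psi_def)

lemma linear_map_ext_single:
  assumes "linear_map f" "linear_map g" "\<And>w. f (single w 1) = g (single w 1)"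
  shows "f m = g m"
proof -
  have "keys m \<subseteq> UNIV" by simp
  then show ?thesis
  proof (induction m rule: poly_mapping_single_induct)
    case (add w c m)
    have "single w c = scl c (single w 1)" by (simp add: scl_def const_single)
    with add show ?case using assms by (simp add: linear_map_add linear_map_scale)
  qed (use assms in \<open>simp add: linear_map_0\<close>)
qed

lemma foldr_V_op_linear: "linear_map (foldr V_op p)"
  by (auto intro!: foldr_linear)

text \<open>The operators \<open>Gop\<close> were obtained from words; that they follow the
  coproduct needs checking for each generator and letter only, and \<open>Psi_mult\<close> extends
  it to products.\<close>

lemma Gop_coproduct:
  assumes x: "x \<in> tensor_power 1"
  shows "Gop g (x * y) = Psi x y (comult_gen g)"
proof (rule linear_map_eq_on_words[OF _ _ x])
  have P: "linear_map (\<lambda>x. Psi x y (comult_gen g))"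
    unfolding Psi_def const_mult_eq_scl
    by (intro linear_map_of_sum linear_map_const linear_map_rmult foldr_V_op_linear)
  then show "linear_map (\<lambda>x. Psi x y (comult_gen g))" .
  fix l :: "vbasis list" assume "length l = 1"
  then obtain a where l: "l = [a]" by (cases l) auto
  have lg: "linear_map (V_op g)" for g by simp
  show "Gop g (word l * y) = Psi (word l) y (comult_gen g)" unfolding l
    by (cases g; cases a)
      (simp_all add: linear_map_add[OF linear_map_Psi] Psi_single V_op_word const_mult_eq_scl linear_map_scale[OF lg]
        linear_map_0[OF lg] Eop_X0 Eop_X1 Fop_X0 Fop_X1 Lop_X0 Lop_X1 Lop_Lop Kop_eq_Lop power_int_minus)
qed (auto intro!: linear_map_comp[OF linear_map_Gop] linear_map_intros)

lemma Psi_mult: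
  assumes x: "x \<in> tensor_power 1"
  shows "Psi x y (comult_gen g * z) = Gop g (Psi x y z)"
proof (rule linear_map_ext_single[of _ _ z])
  fix w :: "ugen free_mon \<times> ugen free_mon"
  obtain p q where w: "w = (Mon p, Mon q)" by (metis free_mon.exhaust surj_pair)
  let ?x = "foldr V_op p x" let ?y = "foldr Gop q y"
  have xs: "?x \<in> tensor_power 1"
    by (rule foldr_closed[of UNIV]) (use x V_op_tensor_power in auto)
  have s: "Psi x y (u * single w 1) = Psi ?x ?y u" for u
  proof (rule linear_map_ext_single[of _ _ u])
    fix w' :: "ugen free_mon \<times> ugen free_mon"
    obtain p' q' where w': "w' = (Mon p', Mon q')" by (metis free_mon.exhaust surj_pair)
    show "Psi x y (single w' 1 * single w 1) = Psi ?x ?y (single w' 1)"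
      by (simp add: w w' mult_single plus_free_mon_def Psi_single)
  qed (auto intro!: linear_map_comp[OF linear_map_Psi] linear_map_intros)
  show "Psi x y (comult_gen g * single w 1) = Gop g (Psi x y (single w 1))"
    unfolding s using Gop_coproduct[OF xs, of g ?y] by (simp add: w Psi_single)
qed (auto intro!: linear_map_comp[OF linear_map_Psi] linear_map_comp[OF linear_map_Gop] linear_map_intros)

lemma linear_map_comult: "linear_map comult"
  unfolding comult_def[abs_def] by (rule linear_map_keys_sum)

lemma comult_word: "comult (word l) = prod_list (map comult_gen l)"
  by (simp add: comult_def lookup_word)

lemma Psi_comult:
  assumes "x \<in> tensor_power 1"
  shows "Psi x y (comult z) = free_action Gop z (x * y)"
proof (rule linear_map_ext[of _ _ z])
  fix l
  show "Psi x y (comult (word l)) = free_action Gop (word l) (x * y)" unfolding comult_word free_action_word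
  proof (induction l)
    case Nil
    have "(1 :: ugen free_mon \<times> ugen free_mon \<Rightarrow>\<^sub>0 ratfun) = single (Mon [], Mon []) 1"
      by (simp flip: zero_free_mon_def zero_prod_def)
    then show ?case using Psi_single[of x y "[]" "[]"] by simp
  qed (simp add: Psi_mult[OF assms])
qed (auto intro!: linear_map_comp[OF linear_map_Psi] linear_map_comult)

lemma Gop_1: "Gop g 1 = scl (counit_gen g) 1"
  by (cases g) auto

text \<open>The action by iterated coproduct peels off one factor at a time, starting from the
  counit. By \<open>Psi_comult\<close> the closed operators satisfy the same recursion.\<close>

lemma generic_free_action_eq:
  "m \<in> tensor_power n \<Longrightarrow> generic_free_action n x m = free_action Gop x m"
proof (induction n arbitrary: x m)
  case 0
  from "0.prems" have "const (counit x) * m = free_action Gop x m"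
  proof (rule linear_map_eq_on_words[rotated 2])
    fix l :: "vbasis list" assume "length l = 0"
    have "foldr Gop w 1 = scl (prod_list (map counit_gen w)) 1" for w
      by (induction w) (auto simp: linear_map_scale[OF linear_map_Gop] Gop_1 mult.commute)
    then have "free_action Gop x (word l) = (\<Sum>w\<in>keys x. const (lookup x w) * const (prod_list (map counit_gen (letters w))))"
      using \<open>length l = 0\<close> by (simp add: free_action_def scl_def)
    then show "const (counit x) * word l = free_action Gop x (word l)" using \<open>length l = 0\<close>
      by (simp add: counit_def const_sum const_mult)
  qed (auto intro!: linear_map_lmult linear_map_intros free_action_linear)
  then show ?case by simp
next
  case (Suc n)
  show ?case unfolding generic_free_action.simps
  proof (rule linear_map_eq_on_words[OF _ _ Suc.prems])
    fix l :: "vbasis list" assume "length l = Suc n"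
    then obtain a l' where l: "l = a # l'" "length l' = n" by (cases l) auto
    have "(\<Sum>(p, q)\<in>keys (comult x). const (lookup (comult x) (p, q)) *
        (foldr V_op (letters p) (word [a]) * generic_free_action n (word (letters q)) (word l'))) = Psi (word [a]) (word l') (comult x)"
      unfolding Psi_def using l by (intro sum.cong) (auto simp: Suc.IH)
    then show "lin_ext (\<lambda>l. \<Sum>(p, q)\<in>keys (comult x). const (lookup (comult x) (p, q)) *
        (foldr V_op (letters p) (word [hd l]) * generic_free_action n (word (letters q)) (word (tl l)))) (word l) = free_action Gop x (word l)"
      using l by (simp add: Psi_comult flip: word_Cons)
  qed (auto intro!: linear_map_lin_ext free_action_linear)
qed

section \<open>Laurent polynomials inside the rational functions\<close>

lemma Fract_one_sum:
  fixes f :: "'a \<Rightarrow> rat poly"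
  shows "Fraction_Field.Fract (sum f A) 1 = (\<Sum>a\<in>A. Fraction_Field.Fract (f a) 1)"
proof (induction A rule: infinite_finite_induct)
  case (insert a A)
  have "Fraction_Field.Fract (p + q) 1 = Fraction_Field.Fract p 1 + Fraction_Field.Fract q 1" for p q :: "rat poly"
    by simp
  then show ?case using insert by (simp del: add_fract)
qed (simp_all add: Zero_fract_def)

lemma Fract_one_eq_0: "Fraction_Field.Fract p 1 = 0 \<longleftrightarrow> p = 0"
  by (simp add: Zero_fract_def eq_fract)

lemma qt_power: "qt ^ k = Fraction_Field.Fract (Polynomial.monom 1 k) 1"
  by (induction k) (auto simp: qt_def One_fract_def monom_Suc)

lemma of_int_fract: "(of_int c :: ratfun) = Fraction_Field.Fract (of_int c) 1"
  by (cases c rule: int_cases2) (auto simp: of_nat_fract)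

lemma laurent_eval_add: "laurent_eval x (f + g) = laurent_eval x f + laurent_eval x g"
  unfolding laurent_eval_def by (rule setsum_keys_plus_distrib) (auto simp: algebra_simps)

lemma laurent_eval_single: "laurent_eval x (single i c) = of_int c * x powi i"
  by (simp add: laurent_eval_def)

lemma laurent_eval_0 [simp]: "laurent_eval x 0 = 0"
  by (simp add: laurent_eval_def)

lemma laurent_eval_1 [simp]: "laurent_eval x 1 = 1"
  by (simp add: laurent_eval_def)

lemma laurent_eval_uminus: "laurent_eval x (- f) = - laurent_eval x f"
  using laurent_eval_add[of x f "- f"] by (simp add: add_eq_0_iff)

lemma laurent_eval_mult:
  assumes "x \<noteq> 0"
  shows "laurent_eval x (f * g) = laurent_eval x f * laurent_eval x g"
proof -
  have 1: "laurent_eval x (single i c * g) = laurent_eval x (single i c) * laurent_eval x g" for i c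
  proof -
    have "keys g \<subseteq> UNIV" by simp
    then show ?thesis
      by (induction g rule: poly_mapping_single_induct)
        (auto simp: distrib_left laurent_eval_add laurent_eval_single mult_single power_int_add assms mult_ac)
  qed
  have "keys f \<subseteq> UNIV" by simp
  then show ?thesis
    by (induction f rule: poly_mapping_single_induct) (auto simp: distrib_right laurent_eval_add 1)
qed

text \<open>\<open>qt\<close> is transcendental; this makes the preimage in the definition of
  \<open>specialize\<close> unique.\<close>

lemma laurent_eval_qt_eq_0:
  assumes "laurent_eval qt f = 0"
  shows "f = 0"
proof -
  \<comment> \<open>Multiplication by a sufficiently large power of \<open>qt\<close> clears the
    negative exponents.\<close>
  obtain N :: nat where N: "\<And>i. i \<in> keys f \<Longrightarrow> 0 \<le> i + int N"
  proof
    fix i assume "i \<in> keys f"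
    then have "nat \<bar>i\<bar> \<le> Max (insert 0 ((\<lambda>i. nat \<bar>i\<bar>) ` keys f))" by (intro Max_ge) auto
    then show "0 \<le> i + int (Max (insert 0 ((\<lambda>i. nat \<bar>i\<bar>) ` keys f)))" by linarith
  qed
  define p where "p = (\<Sum>i\<in>keys f. of_int (lookup f i) * Polynomial.monom 1 (nat (i + int N)) :: rat poly)"
  have "laurent_eval qt f * qt ^ N = (\<Sum>i\<in>keys f. of_int (lookup f i) * (qt powi i * qt powi int N))"
    by (simp add: laurent_eval_def sum_distrib_right mult.assoc power_int_of_nat)
  also have "\<dots> = (\<Sum>i\<in>keys f. of_int (lookup f i) * qt ^ nat (i + int N))"
    by (intro sum.cong refl) (auto simp flip: power_int_add power_int_of_nat simp: N)
  also have "\<dots> = Fraction_Field.Fract p 1"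
    unfolding p_def Fract_one_sum by (intro sum.cong refl) (simp add: of_int_fract qt_power)
  finally have "p = 0" using assms by (simp add: Fract_one_eq_0)
  have "lookup f j = 0" for j
  proof (rule ccontr)
    assume "lookup f j \<noteq> 0"
    then have j: "j \<in> keys f" by (simp add: in_keys_iff)
    have "Polynomial.coeff p (nat (j + int N)) = (\<Sum>i\<in>keys f. if i = j then of_int (lookup f j) else 0)"
      unfolding p_def Polynomial.coeff_sum
    proof (rule sum.cong)
      fix i assume i: "i \<in> keys f"
      have "nat (i + int N) = nat (j + int N) \<longleftrightarrow> i = j" using N[OF i] N[OF j] by auto
      moreover have "of_int c * Polynomial.monom 1 k = Polynomial.monom (of_int c :: rat) k" for c k
        by (metis mult_monom mult.right_neutral add_0 of_int_poly monom_0)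
      ultimately show "Polynomial.coeff (of_int (lookup f i) * Polynomial.monom 1 (nat (i + int N))) (nat (j + int N)) =
         (if i = j then of_int (lookup f j) else (0 :: rat))" by simp
    qed simp
    also have "\<dots> = of_int (lookup f j)" using j by simp
    finally show False using \<open>p = 0\<close> \<open>lookup f j \<noteq> 0\<close> by simp
  qed
  then show ?thesis by (intro poly_mapping_eqI) simp
qed

lemma laurent_eval_qt_inj: "laurent_eval qt f = laurent_eval qt g \<Longrightarrow> f = g"
proof -
  assume "laurent_eval qt f = laurent_eval qt g"
  then have "laurent_eval qt (f + - g) = 0" by (simp only: laurent_eval_add laurent_eval_uminus right_minus)
  from laurent_eval_qt_eq_0[OF this] show "f = g" by simp
qed

abbreviation laurents :: "ratfun set" where
  "laurents \<equiv> range (laurent_eval qt)"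

lemma specialize_laurent: "specialize v (laurent_eval qt f) = laurent_eval v f"
  unfolding specialize_def using laurent_eval_qt_inj by (metis (mono_tags, lifting) the_equality)

lemma laurents_closed:
  "0 \<in> laurents" "1 \<in> laurents" "a \<in> laurents \<Longrightarrow> b \<in> laurents \<Longrightarrow> a + b \<in> laurents"
  "a \<in> laurents \<Longrightarrow> b \<in> laurents \<Longrightarrow> a * b \<in> laurents" "a \<in> laurents \<Longrightarrow> - a \<in> laurents" "qt powi i \<in> laurents"
proof -
  show "0 \<in> laurents" by (rule range_eqI[of _ _ 0]) simp
  show "1 \<in> laurents" by (rule range_eqI[of _ _ 1]) simp
  show "a \<in> laurents \<Longrightarrow> b \<in> laurents \<Longrightarrow> a + b \<in> laurents" by (auto simp flip: laurent_eval_add)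
  show "a \<in> laurents \<Longrightarrow> b \<in> laurents \<Longrightarrow> a * b \<in> laurents" by (auto simp flip: laurent_eval_mult)
  show "a \<in> laurents \<Longrightarrow> - a \<in> laurents" by (auto simp flip: laurent_eval_uminus)
  show "qt powi i \<in> laurents" by (rule range_eqI[of _ _ "single i 1"]) (simp add: laurent_eval_single)
qed

lemma specialize_simps:
  "specialize v 0 = 0" "specialize v 1 = 1"
  "a \<in> laurents \<Longrightarrow> b \<in> laurents \<Longrightarrow> specialize v (a + b) = specialize v a + specialize v b"
  "v \<noteq> 0 \<Longrightarrow> a \<in> laurents \<Longrightarrow> b \<in> laurents \<Longrightarrow> specialize v (a * b) = specialize v a * specialize v b"
  "a \<in> laurents \<Longrightarrow> specialize v (- a) = - specialize v a" "specialize v (qt powi i) = v powi i"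
proof -
  show "specialize v 0 = 0" using specialize_laurent[of v 0] by simp
  show "specialize v 1 = 1" using specialize_laurent[of v 1] by simp
  show "specialize v (a + b) = specialize v a + specialize v b" if ab: "a \<in> laurents" "b \<in> laurents"
  proof -
    obtain f g where "a = laurent_eval qt f" "b = laurent_eval qt g" using ab by blast
    then show ?thesis using specialize_laurent[of v "f + g"] by (simp add: laurent_eval_add specialize_laurent)
  qed
  show "specialize v (a * b) = specialize v a * specialize v b" if ab: "v \<noteq> 0" "a \<in> laurents" "b \<in> laurents"
  proof -
    obtain f g where "a = laurent_eval qt f" "b = laurent_eval qt g" using ab by blast
    then show ?thesis using specialize_laurent[of v "f * g"] by (simp add: laurent_eval_mult ab specialize_laurent)
  qed
  show "specialize v (- a) = - specialize v a" if ab: "a \<in> laurents"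
  proof -
    obtain f where "a = laurent_eval qt f" using ab by blast
    then show ?thesis using specialize_laurent[of v "- f"] by (simp add: laurent_eval_uminus specialize_laurent)
  qed
  show "specialize v (qt powi i) = v powi i"
    using specialize_laurent[of v "single i 1"] by (simp add: laurent_eval_single)
qed

lemma qint_eq: "qint j = qnum qt j"
  by (simp add: qint_def qnum_def)

lemma laurent_eval_sum: "laurent_eval x (sum f A) = (\<Sum>a\<in>A. laurent_eval x (f a))"
  by (induction A rule: infinite_finite_induct) (auto simp: laurent_eval_add)

text \<open>As a Laurent polynomial it has coefficient 1 at the lowest exponent
  \<open>- (int j - 1)\<close>.\<close>

lemma qint_nonzero:
  assumes "j > 0"
  shows "qint j \<noteq> 0"
proof
  assume 0: "qint j = 0"
  define f :: laurent where "f = (\<Sum>k<j. single (2 * int k - (int j - 1)) 1)"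
  have "laurent_eval qt f = qint j"
    unfolding f_def qint_def laurent_eval_sum by (simp add: laurent_eval_single)
  then have "f = 0" using 0 laurent_eval_qt_eq_0 by simp
  moreover have "lookup f (- (int j - 1)) = (\<Sum>k<j. if k = 0 then 1 else 0)"
    unfolding f_def lookup_sum by (intro sum.cong) (auto simp: lookup_single when_def)
  ultimately show False using assms by simp
qed

lemma qfact_nonzero: "qfact j \<noteq> 0"
  by (simp add: qfact_def qint_nonzero)

lemma qfact_Suc: "qfact (Suc j) = qfact j * qint (Suc j)"
  by (simp add: qfact_def)

lemma qt_diff_nonzero: "qt - inverse qt \<noteq> 0"
proof
  assume "qt - inverse qt = 0"
  then have "laurent_eval qt (single 1 1 + single (- 1) (- 1)) = 0"
    by (simp add: laurent_eval_add laurent_eval_single power_int_minus)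
  from laurent_eval_qt_eq_0[OF this] have "lookup (single 1 1 + single (- 1) (- 1) :: laurent) 1 = 0" by simp
  then show False by (simp add: lookup_add lookup_single)
qed

section \<open>Specialization of the lattice\<close>

definition latt :: "nat \<Rightarrow> ratfun tensors set" where
  "latt n = {m \<in> tensor_power n. \<forall>w. lookup m w \<in> laurents}"

definition spec :: "'k::field \<Rightarrow> ratfun tensors \<Rightarrow> 'k tensors" where
  "spec v m = Poly_Mapping.map (specialize v) m"

lemma lookup_spec: "lookup (spec v m) w = specialize v (lookup m w)"
  by (simp add: spec_def map.rep_eq when_def specialize_simps(1))

lemma latt_tensor_power: "m \<in> latt n \<Longrightarrow> m \<in> tensor_power n"
  by (simp add: latt_def)

lemma latt_closed:
  "0 \<in> latt n" "x \<in> latt n \<Longrightarrow> y \<in> latt n \<Longrightarrow> x + y \<in> latt n"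
  "a \<in> laurents \<Longrightarrow> x \<in> latt n \<Longrightarrow> scl a x \<in> latt n" "x \<in> latt n \<Longrightarrow> - x \<in> latt n"
  using laurents_closed by (auto simp: latt_def lookup_add intro: tensor_power_intros simp del: range_eqI)

lemma latt_word [simp]: "length l = n \<Longrightarrow> word l \<in> latt n"
proof -
  assume "length l = n"
  moreover have "lookup (word l) w \<in> laurents" for w
    using laurents_closed(1,2) by (cases w) (simp add: lookup_word)
  ultimately show ?thesis by (simp add: latt_def)
qed

lemma latt_sum: "(\<And>a. a \<in> A \<Longrightarrow> f a \<in> latt n) \<Longrightarrow> sum f A \<in> latt n"
  by (induction A rule: infinite_finite_induct) (auto intro: latt_closed)

lemma latt_word_mult: "x \<in> latt n \<Longrightarrow> word p * x \<in> latt (length p + n)"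
proof -
  assume x: "x \<in> latt n"
  have "lookup (word p * x) w \<in> laurents" for w
    using laurents_closed(1) x by (cases w) (simp add: lookup_word_mult latt_def)
  then show ?thesis using x by (auto simp: latt_def intro: tensor_power_mult)
qed

lemma spec_simps:
  "spec v 0 = 0" "x \<in> latt n \<Longrightarrow> y \<in> latt n \<Longrightarrow> spec v (x + y) = spec v x + spec v y"
  "v \<noteq> 0 \<Longrightarrow> a \<in> laurents \<Longrightarrow> x \<in> latt n \<Longrightarrow> spec v (scl a x) = scl (specialize v a) (spec v x)"
  "x \<in> latt n \<Longrightarrow> spec v (- x) = - spec v x"
  "spec v (word l) = word l" "spec v (word p * z) = word p * spec v z"
proof -
  show "spec v 0 = 0" by (rule poly_mapping_eqI) (simp add: lookup_spec specialize_simps)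
  show "x \<in> latt n \<Longrightarrow> y \<in> latt n \<Longrightarrow> spec v (x + y) = spec v x + spec v y"
    by (rule poly_mapping_eqI) (simp add: lookup_spec lookup_add latt_def specialize_simps(3))
  show "v \<noteq> 0 \<Longrightarrow> a \<in> laurents \<Longrightarrow> x \<in> latt n \<Longrightarrow> spec v (scl a x) = scl (specialize v a) (spec v x)"
    by (rule poly_mapping_eqI) (simp add: lookup_spec latt_def specialize_simps(4))
  show "x \<in> latt n \<Longrightarrow> spec v (- x) = - spec v x"
    by (rule poly_mapping_eqI) (simp add: lookup_spec latt_def specialize_simps(5))
  show "spec v (word l) = word l"
  proof (rule poly_mapping_eqI)
    fix w show "lookup (spec v (word l)) w = lookup (word l) w"
      by (cases w) (simp add: lookup_spec lookup_word specialize_simps)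
  qed
  show "spec v (word p * z) = word p * spec v z"
  proof (rule poly_mapping_eqI)
    fix w show "lookup (spec v (word p * z)) w = lookup (word p * spec v z) w"
      by (cases w) (simp add: lookup_spec lookup_word_mult specialize_simps)
  qed
qed

lemma spec_sum: "(\<And>a. a \<in> A \<Longrightarrow> f a \<in> latt n) \<Longrightarrow> spec v (sum f A) = (\<Sum>a\<in>A. spec v (f a))"
proof (induction A rule: infinite_finite_induct)
  case (insert a A)
  have "f a \<in> latt n" "sum f A \<in> latt n" using insert.prems by (auto intro: latt_sum)
  then show ?case using insert spec_simps(2)[of "f a" n "sum f A" v] by simp
qed (simp_all add: spec_simps(1))

text \<open>The recursion contains powers of the parameter and no quotients. Hence the divided power
  preserves the lattice, although quantum factorials are divided out in its definition, and its
  specialization obeys the recursion at \<open>v\<close>.\<close>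

lemma latt_spec_Ew:
  assumes v: "v \<noteq> 0"
  shows "Ew qt j l \<in> latt (length l) \<and> spec v (Ew qt j l) = Ew v j l"
proof (induction l arbitrary: j rule: hgt.induct)
  case 1
  show ?case using latt_word[of "[]" 0] spec_simps(5)[of v "[]"] by (auto simp: spec_simps(1) latt_closed(1))
next
  case (2 l)
  have "word [X0] * Ew qt j l \<in> latt (Suc (length l))" using latt_word_mult[of "Ew qt j l" "length l" "[X0]"] 2 by simp
  then show ?case using 2 v laurents_closed(6) by (simp add: latt_closed spec_simps specialize_simps)
next
  case (3 l)
  have 1: "word [a] * Ew qt j l \<in> latt (Suc (length l))" for a j
    using latt_word_mult[of "Ew qt j l" "length l" "[a]"] 3 by simp
  then have 2: "scl (qt powi (- int j)) (word [X1] * Ew qt j l) \<in> latt (Suc (length l))"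
    using laurents_closed(6) by (intro latt_closed)
  then show ?case using 3 1
    by (auto simp: latt_closed spec_simps(2)[OF 2 1] spec_simps(3)[OF v laurents_closed(6) 1] spec_simps(5,6) specialize_simps(6))
qed

lemma latt_spec_Fw:
  assumes v: "v \<noteq> 0"
  shows "Fw qt j l \<in> latt (length l) \<and> spec v (Fw qt j l) = Fw v j l"
proof (induction l arbitrary: j rule: hgt.induct)
  case 1
  show ?case using latt_word[of "[]" 0] spec_simps(5)[of v "[]"] by (auto simp: spec_simps(1) latt_closed(1))
next
  case (3 l)
  have "word [X1] * Fw qt j l \<in> latt (Suc (length l))" using latt_word_mult[of "Fw qt j l" "length l" "[X1]"] 3 by simp
  then show ?case using 3 by (simp add: spec_simps)
next
  case (2 l)
  have 1: "word [a] * Fw qt j l \<in> latt (Suc (length l))" for a j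
    using latt_word_mult[of "Fw qt j l" "length l" "[a]"] 2 by simp
  then have 3: "scl (qt powi i) (word [X1] * Fw qt j l) \<in> latt (Suc (length l))" for i j
    using laurents_closed(6) by (intro latt_closed)
  show ?case using 2 1 3
    by (auto simp: latt_closed spec_simps(2)[OF 1 3] spec_simps(3)[OF v laurents_closed(6) 1] spec_simps(5,6) specialize_simps(6)
        simp flip: word_Cons)
qed

section \<open>The integral forms\<close>

lemma gl2_relations_act_0: "r \<in> gl2_relations \<Longrightarrow> free_action Gop r m = 0"
  unfolding gl2_relations_def const_mult_eq_scl
  using EF_commutator[OF qt_nonzero qt_diff_nonzero, of m]
  by (auto simp: free_action_simps Lop_Lop Lop_Eop Lop_Fop linear_map_scale[OF linear_map_Eop] linear_map_scale[OF linear_map_Fop]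
     Kop_eq_Lop simp del: One_nat_def)

section \<open>The generic algebra as a quotient of the free algebra\<close>

definition IQ :: "ufree set" where
  "IQ = genideal (free_alg UNIV) gl2_relations"

lemma free_alg_UNIV [simp]: "carrier (free_alg UNIV) = UNIV"
  by (simp add: free_alg_def)

lemma IQ_ideal: "ideal IQ (free_alg UNIV)"
  unfolding IQ_def by (rule ring.genideal_ideal[OF ring_free_alg]) simp

lemma IQ_act_0: "i \<in> IQ \<Longrightarrow> m \<in> tensor_power n \<Longrightarrow> free_action Gop i m = 0"
  unfolding IQ_def
  by (rule genideal_acts_0[OF linear_map_Gop, of UNIV]) (auto intro: Gop_tensor_power gl2_relations_act_0)

lemma UQ_eq: "UQ = quot_alg (free_alg UNIV) IQ"
  by (simp add: UQ_def presented_alg_def IQ_def)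

lemma uclass_eq: "uclass x = IQ +>\<^bsub>free_alg UNIV\<^esub> x"
  by (simp add: uclass_def IQ_def)

lemma uclass_carrier [simp]: "uclass x \<in> carrier UQ"
  unfolding uclass_eq UQ_eq by (rule coset_in_quot_alg) simp

lemma UQ_cases:
  assumes "a \<in> carrier UQ"
  obtains x where "a = uclass x"
  using assms unfolding UQ_eq uclass_eq by (rule quot_alg_coset[OF IQ_ideal])

lemma uclass_simps:
  "uclass x \<otimes>\<^bsub>UQ\<^esub> uclass y = uclass (x * y)" "uclass x \<oplus>\<^bsub>UQ\<^esub> uclass y = uclass (x + y)"
  "\<one>\<^bsub>UQ\<^esub> = uclass 1" "c \<odot>\<^bsub>UQ\<^esub> uclass x = uclass (scl c x)" "\<zero>\<^bsub>UQ\<^esub> = uclass 0"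
proof -
  interpret ideal IQ "free_alg UNIV" by (rule IQ_ideal)
  show "uclass x \<otimes>\<^bsub>UQ\<^esub> uclass y = uclass (x * y)"
    unfolding UQ_eq uclass_eq quot_alg_def FactRing_def by (simp add: rcoset_mult_add)
  show "uclass x \<oplus>\<^bsub>UQ\<^esub> uclass y = uclass (x + y)"
    unfolding UQ_eq uclass_eq quot_alg_def FactRing_def by (simp add: a_rcos_sum)
  show "\<one>\<^bsub>UQ\<^esub> = uclass 1" unfolding UQ_eq uclass_eq quot_alg_def FactRing_def by simp
  have "IQ +>\<^bsub>free_alg UNIV\<^esub> \<zero>\<^bsub>free_alg UNIV\<^esub> = IQ"
    by (rule a_coset_add_zero) simp
  then show "\<zero>\<^bsub>UQ\<^esub> = uclass 0" unfolding UQ_eq uclass_eq quot_alg_def FactRing_def by simp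
  have "c \<odot>\<^bsub>quot_alg (free_alg UNIV) IQ\<^esub> (IQ +>\<^bsub>free_alg UNIV\<^esub> x) = IQ +>\<^bsub>free_alg UNIV\<^esub> (c \<odot>\<^bsub>free_alg UNIV\<^esub> x)"
    by (rule quot_alg_smult_coset[OF IQ_ideal]) (auto simp: scl_add ideal_free_alg_scl[OF IQ_ideal])
  then show "c \<odot>\<^bsub>UQ\<^esub> uclass x = uclass (scl c x)" unfolding UQ_eq uclass_eq by simp
qed

lemma ring_cong:
  assumes "ring R" and S: "carrier S = carrier R" "mult S = mult R" "one S = one R" "zero S = zero R" "add S = add R"
  shows "ring S"
proof -
  interpret R: ring R by fact
  show ?thesis
  proof (rule ringI)
    show "abelian_group S"
      by (rule abelian_groupI) (auto simp: S R.a_assoc R.a_comm R.a_lcomm R.l_neg intro: bexI[of _ "\<ominus>\<^bsub>R\<^esub> _"])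
    show "Group.monoid S" by (rule Group.monoidI) (auto simp: S R.m_assoc)
  qed (auto simp: S R.l_distr R.r_distr)
qed

lemma ring_quot_alg: "ideal I A \<Longrightarrow> ring (quot_alg A I)"
  by (rule ring_cong[OF ideal.quotient_is_ring]) (auto simp: quot_alg_def)

lemma ring_UQ: "ring UQ"
  unfolding UQ_eq by (rule ring_quot_alg[OF IQ_ideal])

lemma uclass_inv: "\<ominus>\<^bsub>UQ\<^esub> uclass x = uclass (- x)"
proof -
  interpret ring UQ by (rule ring_UQ)
  show ?thesis by (rule minus_equality) (simp_all add: uclass_simps)
qed

lemma uclass_pow: "uclass x [^]\<^bsub>UQ\<^esub> (j::nat) = uclass (x ^ j)"
proof -
  interpret ring UQ by (rule ring_UQ)
  show ?thesis by (induction j) (auto simp: uclass_simps power_commutes)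
qed

lemma divided_power_eq: "divided_power g j = uclass (scl (1 / qfact j) (word [g] ^ j))"
  by (simp add: divided_power_def uclass_pow uclass_simps)

lemma generic_action_uclass:
  assumes "m \<in> tensor_power n"
  shows "generic_action n (uclass x) m = free_action Gop x m"
proof -
  have "the_elem ((\<lambda>f. free_action Gop f m) ` uclass x) = free_action Gop x m"
    unfolding uclass_eq by (rule free_action_coset[OF IQ_act_0[OF _ assms] IQ_ideal]) auto
  then show ?thesis by (simp add: generic_action_def generic_free_action_eq[OF assms])
qed

lemma free_action_power:
  "free_action Gop (word [g] ^ Suc j) m = Gop g (free_action Gop (word [g] ^ j) m)"
  by (simp add: free_action_mult)

text \<open>Quantum factorials are nonzero in the rational functions, so the identity for powers
  obtained by iterating \<open>Eop_1_Eop\<close> and \<open>Fop_1_Fop\<close> may be divided by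
  them.\<close>

lemma divided_power_act:
  "free_action Gop (scl (1 / qfact j) (word [gE] ^ j)) m = Eop qt j m"
  "free_action Gop (scl (1 / qfact j) (word [gF] ^ j)) m = Fop qt j m"
proof -
  have "free_action Gop (word [gE] ^ j) m = scl (qfact j) (Eop qt j m)"
  proof (induction j)
    case (Suc j)
    then show ?case unfolding free_action_power
      using Eop_1_Eop[OF qt_nonzero, of j m] by (simp add: linear_map_scale[OF linear_map_Eop] qfact_Suc qint_eq)
  qed (simp add: free_action_simps qfact_def)
  then show "free_action Gop (scl (1 / qfact j) (word [gE] ^ j)) m = Eop qt j m"
    by (simp add: free_action_simps qfact_nonzero)
  have "free_action Gop (word [gF] ^ j) m = scl (qfact j) (Fop qt j m)"
  proof (induction j)
    case (Suc j)
    then show ?case unfolding free_action_power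
      using Fop_1_Fop[OF qt_nonzero, of j m] by (simp add: linear_map_scale[OF linear_map_Fop] qfact_Suc qint_eq)
  qed (simp add: free_action_simps qfact_def)
  then show "free_action Gop (scl (1 / qfact j) (word [gF] ^ j)) m = Fop qt j m"
    by (simp add: free_action_simps qfact_nonzero)
qed

section \<open>Elements acting on the specialized lattice\<close>

lemma linear_map_integral_action [simp]: "linear_map (integral_action v n a)"
  by (simp add: integral_action_def linear_map_lin_ext)

lemma integral_action_word: "integral_action v n a (word l) = spec v (generic_action n a (word l))"
  by (simp add: integral_action_def spec_def)

text \<open>The invariant that is carried through the induction over \<open>generate_ring\<close>.
  Commutation with the e_i is part of it, so that it too has to be verified on generators
  only.\<close>

definition integral_elt :: "'k::field \<Rightarrow> 'k \<Rightarrow> nat \<Rightarrow> ufree set \<Rightarrow> bool" where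
  "integral_elt v s n a \<longleftrightarrow> a \<in> carrier UQ \<and> (\<forall>l. length l = n \<longrightarrow> generic_action n a (word l) \<in> latt n) \<and>
     comm_TL v s n (integral_action v n a)"

text \<open>Multiplicativity requires this for all lattice vectors: in a product the inner element
  sends a word to a general vector of the lattice.\<close>

lemma integral_action_spec:
  assumes v: "v \<noteq> 0" and a: "integral_elt v s n a" and m: "m \<in> latt n"
  shows "generic_action n a m \<in> latt n" "spec v (generic_action n a m) = integral_action v n a (spec v m)"
proof -
  obtain x where x: "a = uclass x" using a unfolding integral_elt_def by (auto elim: UQ_cases)
  have len: "length (letters w) = n" if "w \<in> keys m" for w using m that by (simp add: latt_def tensor_power_def)
  have mw: "m = (\<Sum>w\<in>keys m. scl (lookup m w) (word (letters w)))"
    by (subst poly_mapping_sum_singles) (simp add: single_eq_scl_word)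
  have lm: "lookup m w \<in> laurents" for w using m by (simp add: latt_def)
  have lin: "linear_map (free_action Gop x)" by (rule free_action_linear) simp
  have g: "generic_action n a m = (\<Sum>w\<in>keys m. scl (lookup m w) (generic_action n a (word (letters w))))"
    unfolding x generic_action_uclass[OF latt_tensor_power[OF m]]
    by (subst (1) mw) (simp add: linear_map_sum[OF lin] linear_map_scale[OF lin] generic_action_uclass len)
  have t: "scl (lookup m w) (generic_action n a (word (letters w))) \<in> latt n" if "w \<in> keys m" for w
    using a len[OF that] lm by (intro latt_closed) (auto simp: integral_elt_def)
  show "generic_action n a m \<in> latt n" unfolding g by (rule latt_sum[OF t])
  have "spec v m = (\<Sum>w\<in>keys m. scl (specialize v (lookup m w)) (word (letters w)))"
    by (subst (1) mw, subst spec_sum[of _ _ n])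
      (use len lm v in \<open>auto intro!: latt_closed simp: spec_simps(3)[of v _ _ n] spec_simps(5)\<close>)
  then have "integral_action v n a (spec v m) = (\<Sum>w\<in>keys m. scl (specialize v (lookup m w)) (spec v (generic_action n a (word (letters w)))))"
    by (simp add: linear_map_sum[OF linear_map_integral_action] linear_map_scale[OF linear_map_integral_action] integral_action_word)
  also have "\<dots> = spec v (generic_action n a m)" unfolding g
    by (subst spec_sum[OF t]) (use a len lm in \<open>auto simp: spec_simps(3)[OF v, of _ _ n] integral_elt_def\<close>)
  finally show "spec v (generic_action n a m) = integral_action v n a (spec v m)" ..
qed

lemma comm_TL_cong: "comm_TL v s n f \<Longrightarrow> v \<noteq> 0 \<Longrightarrow> (\<And>x. x \<in> tensor_power n \<Longrightarrow> g x = f x) \<Longrightarrow> comm_TL v s n g"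
  by (auto simp: comm_TL_def tensor_power_intros TL_tensor_power)

lemma comm_TL_plus: "comm_TL v s n f \<Longrightarrow> comm_TL v s n g \<Longrightarrow> comm_TL v s n (\<lambda>x. f x + g x)"
  by (simp add: comm_TL_def tensor_power_add scl_add linear_map_add)

lemma comm_TL_scl: "comm_TL v s n f \<Longrightarrow> comm_TL v s n (\<lambda>x. scl c (f x))"
  by (simp add: comm_TL_def tensor_power_scl scl_add linear_map_scale mult.commute)

lemma comm_TL_comp: "comm_TL v s n f \<Longrightarrow> comm_TL v s n g \<Longrightarrow> comm_TL v s n (\<lambda>x. f (g x))"
  by (simp add: comm_TL_def)

lemma comm_TL_id: "comm_TL v s n (\<lambda>x. x)"
  by (simp add: comm_TL_def)

lemma comm_TL_tensor_power: "comm_TL v s n f \<Longrightarrow> x \<in> tensor_power n \<Longrightarrow> f x \<in> tensor_power n"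
  by (simp add: comm_TL_def)

lemma generic_action_ops:
  assumes "a \<in> carrier UQ" "b \<in> carrier UQ" "m \<in> tensor_power n"
  shows "generic_action n (a \<oplus>\<^bsub>UQ\<^esub> b) m = generic_action n a m + generic_action n b m"
    "generic_action n (a \<otimes>\<^bsub>UQ\<^esub> b) m = generic_action n a (generic_action n b m)"
    "generic_action n (\<ominus>\<^bsub>UQ\<^esub> a) m = - generic_action n a m"
    "generic_action n (c \<odot>\<^bsub>UQ\<^esub> a) m = scl c (generic_action n a m)"
proof -
  obtain x where x: "a = uclass x" using assms(1) by (rule UQ_cases)
  obtain y where y: "b = uclass y" using assms(2) by (rule UQ_cases)
  have "free_action Gop y m \<in> tensor_power n"
    by (rule free_action_tensor_power[of UNIV]) (use assms Gop_tensor_power in auto)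
  then show "generic_action n (a \<otimes>\<^bsub>UQ\<^esub> b) m = generic_action n a (generic_action n b m)"
    using assms(3) by (simp add: x y uclass_simps generic_action_uclass free_action_mult)
  show "generic_action n (a \<oplus>\<^bsub>UQ\<^esub> b) m = generic_action n a m + generic_action n b m"
    "generic_action n (\<ominus>\<^bsub>UQ\<^esub> a) m = - generic_action n a m"
    "generic_action n (c \<odot>\<^bsub>UQ\<^esub> a) m = scl c (generic_action n a m)"
    using assms(3) by (auto simp: x y uclass_simps uclass_inv generic_action_uclass free_action_simps)
qed

lemma integral_action_ops:
  assumes v: "v \<noteq> 0" and a: "integral_elt v s n a" and b: "integral_elt v s n b" and m: "m \<in> tensor_power n"
  shows "integral_action v n (a \<oplus>\<^bsub>UQ\<^esub> b) m = integral_action v n a m + integral_action v n b m"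
    "integral_action v n (a \<otimes>\<^bsub>UQ\<^esub> b) m = integral_action v n a (integral_action v n b m)"
    "integral_action v n (\<ominus>\<^bsub>UQ\<^esub> a) m = - integral_action v n a m"
    "integral_action v n (laurent_eval qt f \<odot>\<^bsub>UQ\<^esub> a) m = scl (laurent_eval v f) (integral_action v n a m)"
proof -
  have c: "a \<in> carrier UQ" "b \<in> carrier UQ" using a b by (auto simp: integral_elt_def)
  have la: "generic_action n a (word l) \<in> latt n" and lb: "generic_action n b (word l) \<in> latt n" if "length l = n" for l
    using a b that by (auto simp: integral_elt_def)
  note ops = generic_action_ops[OF c]
  show "integral_action v n (a \<oplus>\<^bsub>UQ\<^esub> b) m = integral_action v n a m + integral_action v n b m"
    by (rule linear_map_eq_on_words[OF _ _ m])
      (auto intro!: linear_map_plus simp: integral_action_word ops spec_simps(2)[OF la lb])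
  show "integral_action v n (\<ominus>\<^bsub>UQ\<^esub> a) m = - integral_action v n a m"
    by (rule linear_map_eq_on_words[OF _ _ m])
      (auto intro!: linear_map_neg simp: integral_action_word ops spec_simps(4)[OF la])
  show "integral_action v n (laurent_eval qt f \<odot>\<^bsub>UQ\<^esub> a) m = scl (laurent_eval v f) (integral_action v n a m)"
    by (rule linear_map_eq_on_words[OF _ _ m])
      (auto intro!: linear_map_const simp: integral_action_word ops spec_simps(3)[OF v _ la] specialize_laurent)
  show "integral_action v n (a \<otimes>\<^bsub>UQ\<^esub> b) m = integral_action v n a (integral_action v n b m)"
    by (rule linear_map_eq_on_words[OF _ _ m])
      (auto intro!: linear_map_comp[OF linear_map_integral_action linear_map_integral_action] simp: integral_action_word ops integral_action_spec(2)[OF v a lb])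
qed

lemma integral_elt_closed:
  assumes v: "v \<noteq> 0" and a: "integral_elt v s n a" and b: "integral_elt v s n b"
  shows "integral_elt v s n (a \<oplus>\<^bsub>UQ\<^esub> b)" "integral_elt v s n (a \<otimes>\<^bsub>UQ\<^esub> b)" "integral_elt v s n (\<ominus>\<^bsub>UQ\<^esub> a)"
    "integral_elt v s n (laurent_eval qt f \<odot>\<^bsub>UQ\<^esub> a)"
proof -
  interpret ring UQ by (rule ring_UQ)
  have c: "a \<in> carrier UQ" "b \<in> carrier UQ" using a b by (auto simp: integral_elt_def)
  have la: "generic_action n a (word l) \<in> latt n" and lb: "generic_action n b (word l) \<in> latt n" if "length l = n" for l
    using a b that by (auto simp: integral_elt_def)
  have ca: "comm_TL v s n (integral_action v n a)" and cb: "comm_TL v s n (integral_action v n b)"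
    using a b by (auto simp: integral_elt_def)
  note ops = generic_action_ops[OF c] and iops = integral_action_ops[OF v a b]
  show "integral_elt v s n (a \<oplus>\<^bsub>UQ\<^esub> b)" unfolding integral_elt_def
    using c la lb comm_TL_cong[OF comm_TL_plus[OF ca cb] v iops(1)] by (auto simp: ops intro: latt_closed)
  show "integral_elt v s n (a \<otimes>\<^bsub>UQ\<^esub> b)" unfolding integral_elt_def
    using c comm_TL_cong[OF comm_TL_comp[OF ca cb] v iops(2)] integral_action_spec(1)[OF v a lb] by (auto simp: ops)
  show "integral_elt v s n (\<ominus>\<^bsub>UQ\<^esub> a)" unfolding integral_elt_def
    using c la comm_TL_cong[OF comm_TL_scl[OF ca, of "- 1"] v] iops(3) by (auto simp: ops intro: latt_closed)
  have "laurent_eval qt f \<odot>\<^bsub>UQ\<^esub> a \<in> carrier UQ" using c by (auto elim!: UQ_cases simp: uclass_simps)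
  then show "integral_elt v s n (laurent_eval qt f \<odot>\<^bsub>UQ\<^esub> a)" unfolding integral_elt_def
    using la comm_TL_cong[OF comm_TL_scl[OF ca] v iops(4)] by (auto simp: ops intro: latt_closed)
qed

lemma integral_eltI:
  assumes v: "v \<noteq> 0" and g: "\<And>l. length l = n \<Longrightarrow> free_action Gop x (word l) \<in> latt n"
    and f: "linear_map f" "comm_TL v s n f" "\<And>l. length l = n \<Longrightarrow> spec v (free_action Gop x (word l)) = f (word l)"
  shows "integral_elt v s n (uclass x)" "m \<in> tensor_power n \<Longrightarrow> integral_action v n (uclass x) m = f m"
proof -
  show i: "integral_action v n (uclass x) m = f m" if "m \<in> tensor_power n" for m
    by (rule linear_map_eq_on_words[OF _ f(1) that]) (auto simp: integral_action_word generic_action_uclass f(3))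
  show "integral_elt v s n (uclass x)" unfolding integral_elt_def
    using comm_TL_cong[OF f(2) v i] g by (auto simp: generic_action_uclass)
qed

lemma integral_elt_one:
  assumes v: "v \<noteq> 0"
  shows "integral_elt v s n \<one>\<^bsub>UQ\<^esub>" "m \<in> tensor_power n \<Longrightarrow> integral_action v n \<one>\<^bsub>UQ\<^esub> m = m"
  unfolding uclass_simps(3)
  by (rule integral_eltI[OF v _ linear_map_id comm_TL_id]; simp add: free_action_simps spec_simps(5))+

lemma integral_elt_E:
  assumes v: "v \<noteq> 0"
  shows "integral_elt v s n (divided_power gE j)" "m \<in> tensor_power n \<Longrightarrow> integral_action v n (divided_power gE j) m = Eop v j m"
  unfolding divided_power_eq
  by (rule integral_eltI[OF v _ linear_map_Eop comm_TL_Uops[OF v Uops.E]];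
      use latt_spec_Ew[OF v] in \<open>auto simp: divided_power_act\<close>)+

lemma integral_elt_F:
  assumes v: "v \<noteq> 0"
  shows "integral_elt v s n (divided_power gF j)" "m \<in> tensor_power n \<Longrightarrow> integral_action v n (divided_power gF j) m = Fop v j m"
  unfolding divided_power_eq
  by (rule integral_eltI[OF v _ linear_map_Fop comm_TL_Uops[OF v Uops.F]];
      use latt_spec_Fw[OF v] in \<open>auto simp: divided_power_act\<close>)+

lemma comm_TL_Lop:
  assumes v: "v \<noteq> 0"
  shows "comm_TL v s n (Lop a b)"
proof (rule comm_TL_cong[OF comm_TL_Dop[OF v, of s n "\<lambda>k. a ^ (n - k) * b ^ k"] v])
  fix x :: "'a tensors" assume "x \<in> tensor_power n"
  then show "Lop a b x = Dop (\<lambda>k. a ^ (n - k) * b ^ k) x"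
    by (rule linear_map_eq_on_words[OF linear_map_Lop linear_map_Dop]) auto
qed

lemma integral_elt_L:
  assumes v: "v \<noteq> 0" and x: "\<And>m. free_action Gop x m = Lop (qt powi i) (qt powi j) m"
  shows "integral_elt v s n (uclass x)" "m \<in> tensor_power n \<Longrightarrow> integral_action v n (uclass x) m = Lop (v powi i) (v powi j) m"
proof -
  \<comment> \<open>Collecting exponents exhibits the eigenvalue as a single Laurent monomial, which
    lies in the lattice ring and specializes termwise.\<close>
  have e: "(w powi i) ^ k * (w powi j) ^ r = w powi (i * int k + j * int r)" if "w \<noteq> 0" for w :: "'c::field" and k r
    using that by (simp add: power_int_add power_int_mult power_int_of_nat)
  have g: "free_action Gop x (word l) \<in> latt n" if "length l = n" for l
    unfolding x Lop_word e[OF qt_nonzero] using that laurents_closed(6) by (intro latt_closed) auto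
  have s: "spec v (free_action Gop x (word l)) = Lop (v powi i) (v powi j) (word l)" if "length l = n" for l
    unfolding x Lop_word e[OF qt_nonzero] e[OF v]
    using spec_simps(3)[OF v laurents_closed(6) latt_word[OF that]] by (simp add: spec_simps(5) specialize_simps(6))
  show "integral_elt v s n (uclass x)" "m \<in> tensor_power n \<Longrightarrow> integral_action v n (uclass x) m = Lop (v powi i) (v powi j) m"
    by (rule integral_eltI[OF v g linear_map_Lop comm_TL_Lop[OF v] s]; assumption)+
qed

lemma integral_elt_K:
  assumes v: "v \<noteq> 0"
  shows "integral_elt v s n (uclass (word [gK1, gK2inv]))" "integral_elt v s n (uclass (word [gK2, gK1inv]))"
    "m \<in> tensor_power n \<Longrightarrow> integral_action v n (uclass (word [gK1, gK2inv])) m = Kop v 1 m"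
    "m \<in> tensor_power n \<Longrightarrow> integral_action v n (uclass (word [gK2, gK1inv])) m = Kop v (- 1) m"
    "integral_elt v s n (uclass (word [gK1]))" "integral_elt v s n (uclass (word [gK1inv]))"
    "integral_elt v s n (uclass (word [gK2]))" "integral_elt v s n (uclass (word [gK2inv]))"
  using integral_elt_L[OF v, of "word [gK1, gK2inv]" 1 "- 1"] integral_elt_L[OF v, of "word [gK2, gK1inv]" "- 1" 1]
    integral_elt_L[OF v, of "word [gK1]" 1 0] integral_elt_L[OF v, of "word [gK1inv]" "- 1" 0]
    integral_elt_L[OF v, of "word [gK2]" 0 1] integral_elt_L[OF v, of "word [gK2inv]" 0 "- 1"]
  by (auto simp: Lop_Lop power_int_minus Kop_eq_Lop[OF v])

lemma UA_integral_elt: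
  assumes v: "v \<noteq> 0" and UA: "UA = UA_gl2 \<or> UA = UA_sl2" and a: "a \<in> carrier UA"
  shows "integral_elt v s n a"
proof -
  \<comment> \<open>The union of both generating sets lets one induction serve both
    algebras.\<close>
  define G where "G = range (\<lambda>f. laurent_eval qt f \<odot>\<^bsub>UQ\<^esub> \<one>\<^bsub>UQ\<^esub>) \<union> (gl2_generators \<union> sl2_generators)"
  have G: "integral_elt v s n h" if "h \<in> G" for h
    using that integral_elt_K[OF v] integral_elt_E[OF v] integral_elt_F[OF v]
      integral_elt_closed(4)[OF v integral_elt_one(1)[OF v] integral_elt_one(1)[OF v]]
    by (auto simp: G_def gl2_generators_def sl2_generators_def)
  obtain S where S: "S \<subseteq> G" "a \<in> generate_ring UQ S"
  proof -
    have "a \<in> generate_ring UQ (range (\<lambda>f. laurent_eval qt f \<odot>\<^bsub>UQ\<^esub> \<one>\<^bsub>UQ\<^esub>) \<union> gl2_generators) \<or>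
        a \<in> generate_ring UQ (range (\<lambda>f. laurent_eval qt f \<odot>\<^bsub>UQ\<^esub> \<one>\<^bsub>UQ\<^esub>) \<union> sl2_generators)"
      using UA a by (auto simp: UA_gl2_def UA_sl2_def laurent_subalgebra_def)
    then show ?thesis
      by (elim disjE; intro that; (assumption | force simp: G_def))
  qed
  from S(2) show ?thesis
    by (induction rule: generate_ring.induct)
      (use S(1) G integral_elt_one[OF v] in \<open>auto intro: integral_elt_closed[OF v]\<close>)
qed

section \<open>The specialized algebra\<close>

text \<open>The product of \<open>B\<close> is a record field and not a type class operation, so it
  is extended bilinearly by hand instead of through the convolution product.\<close>

definition bil :: "('b \<Rightarrow> 'b \<Rightarrow> 'b) \<Rightarrow> ('b \<Rightarrow>\<^sub>0 int) \<Rightarrow> ('b \<Rightarrow>\<^sub>0 int) \<Rightarrow> ('b \<Rightarrow>\<^sub>0 int)" where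
  "bil g y z = (\<Sum>p\<in>keys y. \<Sum>q\<in>keys z. single (g p q) (lookup y p * lookup z q))"

lemma bil_add_left: "bil g (y + y') z = bil g y z + bil g y' z"
  unfolding bil_def
  by (rule setsum_keys_plus_distrib) (auto simp: distrib_right single_add sum.distrib)

lemma bil_add_right: "bil g y (z + z') = bil g y z + bil g y z'"
proof -
  have "(\<Sum>q\<in>keys (z + z'). single (g p q) (lookup y p * lookup (z + z') q)) =
    (\<Sum>q\<in>keys z. single (g p q) (lookup y p * lookup z q)) + (\<Sum>q\<in>keys z'. single (g p q) (lookup y p * lookup z' q))" for p
    by (rule setsum_keys_plus_distrib) (auto simp: distrib_left single_add)
  then show ?thesis by (simp add: bil_def sum.distrib)
qed

lemma bil_0 [simp]: "bil g 0 z = 0" "bil g y 0 = 0"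
  by (auto simp: bil_def)

lemma bil_single: "bil g (single p a) (single q b) = single (g p q) (a * b)"
  by (cases "a = 0 \<or> b = 0") (auto simp: bil_def)

section \<open>The ring of formal tensors\<close>

lemma formal_tensors_simps:
  "carrier (formal_tensors B) = {z. keys z \<subseteq> {p. fst p \<in> carrier B}}"
  "mult (formal_tensors B) = bil (\<lambda>p q. (fst p \<otimes>\<^bsub>B\<^esub> fst q, snd p * snd q))"
  "one (formal_tensors B) = single (\<one>\<^bsub>B\<^esub>, 1) 1" "zero (formal_tensors B) = 0" "add (formal_tensors B) = (+)"
  by (auto simp: formal_tensors_def bil_def fun_eq_iff)

lemma formal_smult: "c \<odot>\<^bsub>formal_tensors B\<^esub> z = (\<Sum>p\<in>keys z. single (fst p, c * snd p) (lookup z p))"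
  by (simp add: formal_tensors_def)

lemma formal_smult_add:
  "c \<odot>\<^bsub>formal_tensors B\<^esub> (y + z) = c \<odot>\<^bsub>formal_tensors B\<^esub> y + c \<odot>\<^bsub>formal_tensors B\<^esub> z"
  unfolding formal_smult by (rule setsum_keys_plus_distrib) (auto simp: single_add)

lemma formal_smult_single: "c \<odot>\<^bsub>formal_tensors B\<^esub> single p k = single (fst p, c * snd p) k"
  unfolding formal_smult by (cases "k = 0") auto

lemma formal_smult_0: "c \<odot>\<^bsub>formal_tensors B\<^esub> 0 = 0"
  by (simp add: formal_smult)

lemma formal_induct [consumes 1, case_names zero add]:
  assumes "z \<in> carrier (formal_tensors B)" "P 0"
    "\<And>a c k z. a \<in> carrier B \<Longrightarrow> z \<in> carrier (formal_tensors B) \<Longrightarrow> P z \<Longrightarrow> P (single (a, c) k + z)"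
  shows "P z"
proof -
  have "keys z \<subseteq> {p. fst p \<in> carrier B}" using assms(1) by (simp add: formal_tensors_simps)
  then show ?thesis
  proof (induction rule: poly_mapping_single_induct)
    case (add w c m)
    then show ?case using assms(3)[of "fst w" m "snd w" c] by (simp add: formal_tensors_simps)
  qed (rule assms(2))
qed

lemma formal_closed:
  "0 \<in> carrier (formal_tensors B)"
  "y \<in> carrier (formal_tensors B) \<Longrightarrow> z \<in> carrier (formal_tensors B) \<Longrightarrow> y + z \<in> carrier (formal_tensors B)"
  "z \<in> carrier (formal_tensors B) \<Longrightarrow> - z \<in> carrier (formal_tensors B)"
  "y \<in> carrier (formal_tensors B) \<Longrightarrow> z \<in> carrier (formal_tensors B) \<Longrightarrow> y - z \<in> carrier (formal_tensors B)"
  "a \<in> carrier B \<Longrightarrow> single (a, c) k \<in> carrier (formal_tensors B)"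
proof -
  show add: "y + z \<in> carrier (formal_tensors B)"
    if "y \<in> carrier (formal_tensors B)" "z \<in> carrier (formal_tensors B)" for y z
    using that keys_add[of y z] unfolding formal_tensors_simps by blast
  show neg: "- z \<in> carrier (formal_tensors B)" if "z \<in> carrier (formal_tensors B)" for z
    using that by (simp add: formal_tensors_simps)
  show "y \<in> carrier (formal_tensors B) \<Longrightarrow> z \<in> carrier (formal_tensors B) \<Longrightarrow> y - z \<in> carrier (formal_tensors B)"
    using add[OF _ neg[of z], of y] by simp
qed (auto simp: formal_tensors_simps)

lemma formal_smult_closed: "z \<in> carrier (formal_tensors B) \<Longrightarrow> c \<odot>\<^bsub>formal_tensors B\<^esub> z \<in> carrier (formal_tensors B)"
  by (induction rule: formal_induct)
    (auto simp: formal_smult_add formal_smult_single formal_smult_0 intro: formal_closed)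

lemma formal_mult_closed:
  assumes "ring B" "y \<in> carrier (formal_tensors B)" "z \<in> carrier (formal_tensors B)"
  shows "y \<otimes>\<^bsub>formal_tensors B\<^esub> z \<in> carrier (formal_tensors B)"
proof -
  interpret ring B by fact
  have 1: "single (a, c) k \<otimes>\<^bsub>formal_tensors B\<^esub> z \<in> carrier (formal_tensors B)" if "a \<in> carrier B" for a c k
    using assms(3)
    by (induction rule: formal_induct)
      (use that in \<open>auto simp: formal_tensors_simps(2) bil_add_right bil_single intro: formal_closed\<close>)
  from assms(2) show ?thesis
    by (induction rule: formal_induct)
      (use 1 in \<open>auto simp: formal_tensors_simps(2) bil_add_left intro: formal_closed\<close>)
qed

lemma ring_formal_tensors:
  assumes "ring B"
  shows "ring (formal_tensors B :: ('k::field, 'b \<times> 'k \<Rightarrow>\<^sub>0 int) module)" (is "ring ?F")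
proof -
  interpret ring B by fact
  have closed: "y \<otimes>\<^bsub>?F\<^esub> z \<in> carrier ?F" if "y \<in> carrier ?F" "z \<in> carrier ?F" for y z
    using formal_mult_closed[OF assms that] .
  have assoc1: "(single (a, c) k \<otimes>\<^bsub>?F\<^esub> single (b, d) j) \<otimes>\<^bsub>?F\<^esub> z = single (a, c) k \<otimes>\<^bsub>?F\<^esub> (single (b, d) j \<otimes>\<^bsub>?F\<^esub> z)"
    if "a \<in> carrier B" "b \<in> carrier B" "z \<in> carrier ?F" for a b c d k j z
    using that(3)
    by (induction rule: formal_induct)
      (use that in \<open>auto simp: formal_tensors_simps(2) bil_add_right bil_single m_assoc mult.assoc\<close>)
  have assoc2: "(single (a, c) k \<otimes>\<^bsub>?F\<^esub> y) \<otimes>\<^bsub>?F\<^esub> z = single (a, c) k \<otimes>\<^bsub>?F\<^esub> (y \<otimes>\<^bsub>?F\<^esub> z)"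
    if a: "a \<in> carrier B" and y: "y \<in> carrier ?F" and z: "z \<in> carrier ?F" for a c k y z
    using y by (induction rule: formal_induct)
      (use assoc1[OF a _ z] in \<open>auto simp: formal_tensors_simps(2) bil_add_right bil_add_left\<close>)
  have assoc: "(x \<otimes>\<^bsub>?F\<^esub> y) \<otimes>\<^bsub>?F\<^esub> z = x \<otimes>\<^bsub>?F\<^esub> (y \<otimes>\<^bsub>?F\<^esub> z)"
    if x: "x \<in> carrier ?F" and y: "y \<in> carrier ?F" and z: "z \<in> carrier ?F" for x y z
    using x by (induction rule: formal_induct)
      (use assoc2[OF _ y z] in \<open>auto simp: formal_tensors_simps(2) bil_add_left\<close>)
  have one: "\<one>\<^bsub>?F\<^esub> \<otimes>\<^bsub>?F\<^esub> z = z" "z \<otimes>\<^bsub>?F\<^esub> \<one>\<^bsub>?F\<^esub> = z" if "z \<in> carrier ?F" for z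
    using that by (induction rule: formal_induct, auto simp: formal_tensors_simps(2,3) bil_add_right bil_add_left bil_single)+
  show ?thesis
  proof (rule ringI)
    show "abelian_group ?F"
      by (rule abelian_groupI_uminus) (auto intro: formal_closed simp: formal_tensors_simps(4,5))
    show "Group.monoid ?F"
      by (rule Group.monoidI) (use closed assoc one in \<open>auto simp: formal_tensors_simps(3) intro: formal_closed\<close>)
  qed (auto simp: formal_tensors_simps(2,5) bil_add_left bil_add_right)
qed

text \<open>A scalar \<open>c\<close> acts as multiplication by the pair of 1 and \<open>c\<close>;
  hence every ideal is stable under scalars.\<close>

lemma formal_smult_eq_mult:
  assumes "ring B" "z \<in> carrier (formal_tensors B)"
  shows "c \<odot>\<^bsub>formal_tensors B\<^esub> z = single (\<one>\<^bsub>B\<^esub>, c) 1 \<otimes>\<^bsub>formal_tensors B\<^esub> z"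
proof -
  interpret ring B by fact
  show ?thesis using assms(2)
    by (induction rule: formal_induct)
      (auto simp: formal_smult_add formal_smult_single formal_smult_0 formal_tensors_simps(2) bil_add_right bil_single)
qed

lemma ideal_formal_smult:
  assumes "ring B" "ideal I (formal_tensors B)" "i \<in> I"
  shows "c \<odot>\<^bsub>formal_tensors B\<^esub> i \<in> I"
proof -
  interpret B: ring B by fact
  interpret I: ideal I "formal_tensors B" by fact
  have "i \<in> carrier (formal_tensors B)" using I.a_subset assms(3) by auto
  then show ?thesis
    using I.I_l_closed[OF assms(3), of "single (\<one>\<^bsub>B\<^esub>, c) 1"] formal_smult_eq_mult[OF assms(1), of i c]
    by (simp add: formal_closed)
qed

section \<open>The action of formal tensors\<close>

lemma formal_action_add: "formal_action v n (y + z) m = formal_action v n y m + formal_action v n z m"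
proof -
  have *: "formal_action v n z m = (\<Sum>p\<in>keys z. const (of_int (lookup z p) * snd p) * integral_action v n (fst p) m)" for z
    unfolding formal_action_def by (rule sum.cong) auto
  show ?thesis unfolding * by (rule setsum_keys_plus_distrib) (auto simp: distrib_right const_add)
qed

lemma formal_action_single: "formal_action v n (single (a, c) k) m = scl (of_int k * c) (integral_action v n a m)"
  by (cases "k = 0") (auto simp: formal_action_def const_mult_eq_scl)

lemma formal_action_0 [simp]: "formal_action v n 0 m = 0"
  by (simp add: formal_action_def)

lemma formal_action_uminus: "formal_action v n (- z) m = - formal_action v n z m"
  using formal_action_add[of v n z "- z" m] by (simp add: add_eq_0_iff)

lemma formal_action_diff: "formal_action v n (y - z) m = formal_action v n y m - formal_action v n z m"
  using formal_action_add[of v n y "- z" m] by (simp add: formal_action_uminus)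

context
  fixes v s \<delta> :: "'k::field" and n :: nat and UA :: "(ratfun, ufree set) module"
  assumes v: "v \<noteq> 0" and UA: "UA = UA_gl2 \<or> UA = UA_sl2"
begin

private definition gens where
  "gens = range (\<lambda>f. laurent_eval qt f \<odot>\<^bsub>UQ\<^esub> \<one>\<^bsub>UQ\<^esub>) \<union> (if UA = UA_gl2 then gl2_generators else sl2_generators)"

private lemma UA_eq: "UA = UQ\<lparr>carrier := generate_ring UQ gens\<rparr>"
  using UA by (auto simp: gens_def UA_gl2_def UA_sl2_def laurent_subalgebra_def)

private lemma gens_carrier: "gens \<subseteq> carrier UQ"
  by (auto simp: gens_def gl2_generators_def sl2_generators_def divided_power_eq uclass_simps)

private lemma UA_simps: "mult UA = mult UQ" "add UA = add UQ" "one UA = one UQ" "zero UA = zero UQ" "smult UA = smult UQ"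
  "carrier UA = generate_ring UQ gens"
proof -
  have "mult B = mult UQ \<and> add B = add UQ \<and> one B = one UQ \<and> zero B = zero UQ \<and> smult B = smult UQ \<and> carrier B = A"
    if "B = UQ\<lparr>carrier := A\<rparr>" for A and B :: "(ratfun, ufree set) module"
    using that by simp
  from this[OF UA_eq] show "mult UA = mult UQ" "add UA = add UQ" "one UA = one UQ" "zero UA = zero UQ" "smult UA = smult UQ"
    "carrier UA = generate_ring UQ gens" by blast+
qed

private lemma ring_UA: "ring UA"
proof (rule ring_cong)
  interpret ring UQ by (rule ring_UQ)
  show "ring (UQ\<lparr>carrier := generate_ring UQ gens\<rparr>)" by (rule generate_ring_is_ring[OF gens_carrier])
qed (simp_all add: UA_simps)

private lemma elt: "a \<in> carrier UA \<Longrightarrow> integral_elt v s n a"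
  by (rule UA_integral_elt[OF v UA])

private lemma UA_smult_closed: "a \<in> carrier UA \<Longrightarrow> laurent_eval qt f \<odot>\<^bsub>UA\<^esub> a \<in> carrier UA"
proof -
  assume a: "a \<in> carrier UA"
  obtain x where x: "a = uclass x" using elt[OF a] by (auto simp: integral_elt_def elim: UQ_cases)
  have "laurent_eval qt f \<odot>\<^bsub>UQ\<^esub> a = (laurent_eval qt f \<odot>\<^bsub>UQ\<^esub> \<one>\<^bsub>UQ\<^esub>) \<otimes>\<^bsub>UQ\<^esub> a"
    by (simp add: x uclass_simps)
  also have "\<dots> \<in> generate_ring UQ gens"
  proof (rule generate_ring.eng_mult)
    show "laurent_eval qt f \<odot>\<^bsub>UQ\<^esub> \<one>\<^bsub>UQ\<^esub> \<in> generate_ring UQ gens"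
      by (rule generate_ring.incl) (simp add: gens_def)
    show "a \<in> generate_ring UQ gens" using a by (simp only: UA_simps)
  qed
  finally show ?thesis by (simp add: UA_simps)
qed

private abbreviation Fm :: "('k, ufree set \<times> 'k \<Rightarrow>\<^sub>0 int) module" where "Fm \<equiv> formal_tensors UA"

private lemma uact_comm_TL: "z \<in> carrier Fm \<Longrightarrow> comm_TL v s n (formal_action v n z)"
proof (induction rule: formal_induct)
  case zero
  show ?case by (simp add: comm_TL_def)
next
  case (add a c k z)
  have "comm_TL v s n (integral_action v n a)" using elt[OF add(1)] by (simp add: integral_elt_def)
  from comm_TL_plus[OF comm_TL_scl[OF this, of "of_int k * c"] add(3)]
  show ?case by (rule comm_TL_cong) (simp_all add: v formal_action_add formal_action_single)
qed

private lemma uact_mult: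
  assumes "y \<in> carrier Fm" "z \<in> carrier Fm" "m \<in> tensor_power n"
  shows "formal_action v n (y \<otimes>\<^bsub>Fm\<^esub> z) m = formal_action v n y (formal_action v n z m)"
proof -
  have 1: "formal_action v n (single (a, c) k \<otimes>\<^bsub>Fm\<^esub> z) m = formal_action v n (single (a, c) k) (formal_action v n z m)"
    if a: "a \<in> carrier UA" for a c k
    using assms(2)
  proof (induction rule: formal_induct)
    case zero
    then show ?case by (simp add: formal_tensors_simps(2) formal_action_single linear_map_0[OF linear_map_integral_action])
  next
    case (add b d j z)
    then show ?case
      using integral_action_ops(2)[OF v elt[OF a] elt[OF add(1)] assms(3)]
      by (simp add: formal_tensors_simps(2) bil_add_right bil_single formal_action_add formal_action_single UA_simps
          linear_map_add[OF linear_map_integral_action] linear_map_scale[OF linear_map_integral_action] scl_add mult_ac)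
  qed
  from assms(1) show ?thesis
    by (induction rule: formal_induct)
      (use 1 in \<open>auto simp: formal_tensors_simps(2) bil_add_left formal_action_add\<close>)
qed

private lemma uact_smult: "z \<in> carrier Fm \<Longrightarrow> formal_action v n (c \<odot>\<^bsub>Fm\<^esub> z) m = scl c (formal_action v n z m)"
  by (induction rule: formal_induct)
    (auto simp: formal_smult_add formal_smult_single formal_smult_0 formal_action_add formal_action_single scl_add mult_ac)

private lemma uact_0: "z \<in> carrier Fm \<Longrightarrow> formal_action v n z 0 = 0"
  using comm_TL_0[OF uact_comm_TL] .

private lemma uact_closed: "z \<in> carrier Fm \<Longrightarrow> m \<in> tensor_power n \<Longrightarrow> formal_action v n z m \<in> tensor_power n"
  using comm_TL_tensor_power[OF uact_comm_TL] .

private definition Ker where "Ker = {z \<in> carrier Fm. \<forall>m\<in>tensor_power n. formal_action v n z m = 0}"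

text \<open>As with the free algebras, an ideal of elements acting by zero that contains the
  relations makes the action descend to the quotient.\<close>

private lemma Ker_ideal: "ideal Ker Fm"
proof (rule idealI_uminus[OF ring_formal_tensors[OF ring_UA]])
  show "x \<otimes>\<^bsub>Fm\<^esub> a \<in> Ker" if "a \<in> Ker" "x \<in> carrier Fm" for a x
    using that formal_mult_closed[OF ring_UA, of x a] by (simp add: Ker_def uact_mult uact_0)
  show "a \<otimes>\<^bsub>Fm\<^esub> x \<in> Ker" if "a \<in> Ker" "x \<in> carrier Fm" for a x
    using that formal_mult_closed[OF ring_UA, of a x] by (simp add: Ker_def uact_mult uact_closed)
qed (auto simp: Ker_def formal_tensors_simps(4,5) formal_action_add formal_action_uminus intro: formal_closed)

text \<open>Biadditivity is clear from the form of the action. Balancedness holds because a Laurent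
  polynomial evaluated at \<open>qt\<close> acts on the specialized lattice as its value at
  \<open>v\<close>.\<close>

private lemma relations_Ker: "tensor_relations v UA \<subseteq> Ker"
proof
  interpret ring UA by (rule ring_UA)
  fix r :: "ufree set \<times> 'k \<Rightarrow>\<^sub>0 int"
  assume "r \<in> tensor_relations v UA"
  then have "(\<exists>a b c. a \<in> carrier UA \<and> b \<in> carrier UA \<and> r = single (a \<oplus>\<^bsub>UA\<^esub> b, c) 1 - single (a, c) 1 - single (b, c) 1) \<or>
    (\<exists>a c d. a \<in> carrier UA \<and> r = single (a, c + d) 1 - single (a, c) 1 - single (a, d) 1) \<or>
    (\<exists>f a c. a \<in> carrier UA \<and> r = single (laurent_eval qt f \<odot>\<^bsub>UA\<^esub> a, c) 1 - single (a, laurent_eval v f * c) 1)"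
    unfolding tensor_relations_def Let_def Un_iff mem_Collect_eq by metis
  then consider
      a b c where "a \<in> carrier UA" "b \<in> carrier UA" "r = single (a \<oplus>\<^bsub>UA\<^esub> b, c) 1 - single (a, c) 1 - single (b, c) 1"
    | a c d where "a \<in> carrier UA" "r = single (a, c + d) 1 - single (a, c) 1 - single (a, d) 1"
    | f a c where "a \<in> carrier UA" "r = single (laurent_eval qt f \<odot>\<^bsub>UA\<^esub> a, c) 1 - single (a, laurent_eval v f * c) 1"
    by (elim disjE exE conjE) metis+
  then show "r \<in> Ker"
  proof cases
    case 1
    then show ?thesis using integral_action_ops(1)[OF v elt[OF 1(1)] elt[OF 1(2)]]
      by (auto simp: Ker_def formal_action_diff formal_action_single UA_simps(2) scl_add intro!: formal_closed)
         (simp add: UA_simps generate_ring.eng_add)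
  next
    case 2
    then show ?thesis
      by (auto simp: Ker_def formal_action_diff formal_action_single scl_add_left intro!: formal_closed)
  next
    case 3
    then show ?thesis using integral_action_ops(4)[OF v elt[OF 3(1)] elt[OF 3(1)]] UA_smult_closed[OF 3(1), of f]
      by (auto simp: Ker_def formal_action_diff formal_action_single UA_simps(5) mult.commute intro!: formal_closed)
  qed
qed

private definition J where "J = genideal Fm (tensor_relations v UA)"

private lemma relations_carrier: "tensor_relations v UA \<subseteq> carrier Fm"
  using relations_Ker by (auto simp: Ker_def)

private lemma J_ideal: "ideal J Fm"
  unfolding J_def by (rule ring.genideal_ideal[OF ring_formal_tensors[OF ring_UA] relations_carrier])

private lemma J_Ker: "J \<subseteq> Ker"
  unfolding J_def by (rule ring.genideal_minimal[OF ring_formal_tensors[OF ring_UA] Ker_ideal relations_Ker])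

private lemma U_eq: "specialized_alg v UA = quot_alg Fm J"
  by (simp add: specialized_alg_def J_def)

private definition \<sigma> where "\<sigma> z = (\<lambda>m\<in>tensor_power n. formal_action v n z m)"

text \<open>Representatives of a class differ by an element of \<open>J\<close>, which acts by zero,
  so \<open>the_elem\<close> is applied to a one-element set.\<close>

private lemma U_action_coset: "z \<in> carrier Fm \<Longrightarrow> U_action v n (J +>\<^bsub>Fm\<^esub> z) = \<sigma> z"
  unfolding U_action_def \<sigma>_def
proof (intro restrict_ext the_elem_const_on)
  interpret ideal J Fm by (rule J_ideal)
  assume z: "z \<in> carrier Fm"
  then show "J +>\<^bsub>Fm\<^esub> z \<noteq> {}" using a_rcos_self by blast
  fix m :: "'k tensors" and y assume m: "m \<in> tensor_power n" and "y \<in> J +>\<^bsub>Fm\<^esub> z"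
  then obtain i where "i \<in> J" "y = i + z" by (auto simp: a_r_coset_def' formal_tensors_simps(5))
  then show "formal_action v n y m = formal_action v n z m"
    using J_Ker m by (auto simp: formal_action_add Ker_def)
qed

lemma U_action_alg_hom:
  assumes B: "mult B = (\<lambda>f g. \<lambda>x\<in>tensor_power n. f (g x))" "one B = (\<lambda>x\<in>tensor_power n. x)"
    "add B = (\<lambda>f g. \<lambda>x\<in>tensor_power n. f x + g x)" "smult B = (\<lambda>c f. \<lambda>x\<in>tensor_power n. scl c (f x))"
    and c: "\<And>f. comm_TL v s n f \<Longrightarrow> (\<lambda>m\<in>tensor_power n. f m) \<in> carrier B"
  shows "U_action v n \<in> alg_hom (specialized_alg v UA) B"
proof -
  have 1: "\<sigma> \<in> ring_hom Fm B"
  proof (rule ring_hom_memI)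
    fix y z assume "y \<in> carrier Fm" "z \<in> carrier Fm"
    then show "\<sigma> (y \<otimes>\<^bsub>Fm\<^esub> z) = \<sigma> y \<otimes>\<^bsub>B\<^esub> \<sigma> z" "\<sigma> (y \<oplus>\<^bsub>Fm\<^esub> z) = \<sigma> y \<oplus>\<^bsub>B\<^esub> \<sigma> z"
      by (auto simp: B \<sigma>_def fun_eq_iff uact_mult uact_closed formal_tensors_simps(5) formal_action_add)
  next
    show "\<sigma> z \<in> carrier B" if "z \<in> carrier Fm" for z
      unfolding \<sigma>_def by (rule c[OF uact_comm_TL[OF that]])
    show "\<sigma> \<one>\<^bsub>Fm\<^esub> = \<one>\<^bsub>B\<^esub>"
      by (auto simp: B \<sigma>_def fun_eq_iff formal_tensors_simps(3) formal_action_single UA_simps integral_elt_one(2)[OF v])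
  qed
  have 2: "\<sigma> (d \<odot>\<^bsub>Fm\<^esub> x) = d \<odot>\<^bsub>B\<^esub> \<sigma> x" if "x \<in> carrier Fm" for d x
    using that by (auto simp: B \<sigma>_def fun_eq_iff uact_smult)
  show ?thesis unfolding U_eq
    by (rule quot_alg_hom(1)[OF J_ideal 1 _ _ _ 2 U_action_coset])
      (auto intro: formal_smult_closed ideal_formal_smult[OF ring_UA J_ideal] simp: formal_smult_add formal_tensors_simps(5))
qed

lemma U_action_comm_TL:
  assumes "X \<in> carrier (specialized_alg v UA)"
  obtains f where "comm_TL v s n f" "U_action v n X = (\<lambda>m\<in>tensor_power n. f m)"
proof -
  obtain z where "z \<in> carrier Fm" "X = J +>\<^bsub>Fm\<^esub> z"
    using assms unfolding U_eq by (rule quot_alg_coset[OF J_ideal])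
  then show ?thesis using that[OF uact_comm_TL] U_action_coset by (simp add: \<sigma>_def)
qed

text \<open>Links the concrete operators to the specialized algebra: each generator of
  \<open>Uops v n\<close> comes from a formal tensor, and sums, products and multiples are lifted
  accordingly.\<close>

private lemma Uops_act: "f \<in> Uops v n \<Longrightarrow> \<exists>z\<in>carrier Fm. \<forall>m\<in>tensor_power n. formal_action v n z m = f m"
proof (induction rule: Uops.induct)
  have elts: "\<exists>z\<in>carrier Fm. \<forall>m\<in>tensor_power n. formal_action v n z m = f m"
    if "a \<in> carrier UA" "\<And>m. m \<in> tensor_power n \<Longrightarrow> integral_action v n a m = f m" for a f
    using that by (intro bexI[of _ "single (a, 1) 1"]) (auto simp: formal_action_single intro: formal_closed)
  have dp: "divided_power gE j \<in> carrier UA" "divided_power gF j \<in> carrier UA" for j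
    unfolding UA_simps(6) by (rule generate_ring.incl; simp add: gens_def gl2_generators_def sl2_generators_def)+
  \<comment> \<open>For gl2 the element \<open>K\<close> is a product of two generators, for sl2 it
    is itself a generator.\<close>
  have kk: "uclass (word [gK1, gK2inv]) \<in> carrier UA \<and> uclass (word [gK2, gK1inv]) \<in> carrier UA"
  proof (cases "UA = UA_gl2")
    case True
    have "uclass (word [g]) \<in> generate_ring UQ gens" if "g \<in> {gK1, gK1inv, gK2, gK2inv}" for g
    proof (rule generate_ring.incl)
      show "uclass (word [g]) \<in> gens" using that unfolding gens_def gl2_generators_def if_P[OF True] by blast
    qed
    then have "uclass (word [g]) \<otimes>\<^bsub>UQ\<^esub> uclass (word [h]) \<in> generate_ring UQ gens"
      if "g \<in> {gK1, gK1inv, gK2, gK2inv}" "h \<in> {gK1, gK1inv, gK2, gK2inv}" for g h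
      using that by (intro generate_ring.eng_mult)
    moreover have "uclass (word [g]) \<otimes>\<^bsub>UQ\<^esub> uclass (word [h]) = uclass (word [g, h])" for g h
      unfolding uclass_simps word_append[symmetric] by simp
    ultimately show ?thesis unfolding UA_simps(6) by (metis insertI1 insertI2)
  next
    case False
    have "uclass (word [gK1, gK2inv]) \<in> gens" "uclass (word [gK2, gK1inv]) \<in> gens"
      unfolding gens_def sl2_generators_def if_not_P[OF False] by blast+
    then show ?thesis unfolding UA_simps(6) by (blast intro: generate_ring.incl)
  qed
  {
    case (E j)
    show ?case by (rule elts[OF dp(1)]) (rule integral_elt_E(2)[OF v])
  next
    case (F j)
    show ?case by (rule elts[OF dp(2)]) (rule integral_elt_F(2)[OF v])
  next
    case (K i)
    show ?case
    \<comment> \<open>Integer powers of \<open>K\<close> are reached from the identity in both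
      directions, by multiplying with \<open>K\<close> or its inverse.\<close>
    proof (induction i rule: int_induct[of _ 0])
      case base
      interpret ring UA by (rule ring_UA)
      have "integral_action v n \<one>\<^bsub>UA\<^esub> m = Kop v 0 m" if "m \<in> tensor_power n" for m
        using that by (simp add: UA_simps(3) integral_elt_one(2)[OF v])
      from elts[OF one_closed this] show ?case by simp
    next
      case (step1 i)
      then obtain z where z: "z \<in> carrier Fm" "\<forall>m\<in>tensor_power n. formal_action v n z m = Kop v i m" by blast
      let ?y = "single (uclass (word [gK1, gK2inv]), 1) 1 \<otimes>\<^bsub>Fm\<^esub> z"
      have k: "single (uclass (word [gK1, gK2inv]), 1) 1 \<in> carrier Fm" by (rule formal_closed(5)) (use kk in blast)
      show ?case
      proof (rule bexI[of _ ?y])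
        show "\<forall>m\<in>tensor_power n. formal_action v n ?y m = Kop v (i + 1) m"
          using z by (auto simp: uact_mult[OF k z(1)] formal_action_single integral_elt_K(3)[OF v] Kop_tensor_power Kop_Kop[OF v] add.commute)
        show "?y \<in> carrier Fm" by (rule formal_mult_closed[OF ring_UA k z(1)])
      qed
    next
      case (step2 i)
      then obtain z where z: "z \<in> carrier Fm" "\<forall>m\<in>tensor_power n. formal_action v n z m = Kop v i m" by blast
      let ?y = "single (uclass (word [gK2, gK1inv]), 1) 1 \<otimes>\<^bsub>Fm\<^esub> z"
      have k: "single (uclass (word [gK2, gK1inv]), 1) 1 \<in> carrier Fm" by (rule formal_closed(5)) (use kk in blast)
      show ?case
      proof (rule bexI[of _ ?y])
        show "\<forall>m\<in>tensor_power n. formal_action v n ?y m = Kop v (i - 1) m"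
          using z by (auto simp: uact_mult[OF k z(1)] formal_action_single integral_elt_K(4)[OF v] Kop_tensor_power Kop_Kop[OF v])
        show "?y \<in> carrier Fm" by (rule formal_mult_closed[OF ring_UA k z(1)])
      qed
    qed
  }
next
  case (add f g)
  then obtain y z where "y \<in> carrier Fm" "\<forall>m\<in>tensor_power n. formal_action v n y m = f m"
    "z \<in> carrier Fm" "\<forall>m\<in>tensor_power n. formal_action v n z m = g m" by blast
  then show ?case by (intro bexI[of _ "y + z"]) (auto simp: formal_action_add intro: formal_closed)
next
  case (comp f g)
  then obtain y z where yz: "y \<in> carrier Fm" "\<forall>m\<in>tensor_power n. formal_action v n y m = f m"
    "z \<in> carrier Fm" "\<forall>m\<in>tensor_power n. formal_action v n z m = g m" by blast
  show ?case
    by (rule bexI[of _ "y \<otimes>\<^bsub>Fm\<^esub> z"])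
      (use yz Uops_tensor_power[OF comp(2)] in \<open>auto simp: uact_mult[OF yz(1,3)] formal_mult_closed[OF ring_UA]\<close>)
next
  case (scl f c)
  then obtain z where "z \<in> carrier Fm" "\<forall>m\<in>tensor_power n. formal_action v n z m = f m" by blast
  then show ?case by (intro bexI[of _ "c \<odot>\<^bsub>Fm\<^esub> z"]) (auto simp: uact_smult intro: formal_smult_closed)
next
  case (cong f g)
  then show ?case by auto
qed

lemma Uops_in_U_action:
  assumes "f \<in> Uops v n"
  shows "\<exists>X\<in>carrier (specialized_alg v UA). U_action v n X = (\<lambda>m\<in>tensor_power n. f m)"
proof -
  obtain z where z: "z \<in> carrier Fm" "\<forall>m\<in>tensor_power n. formal_action v n z m = f m"
    using Uops_act[OF assms] by blast
  have "U_action v n (J +>\<^bsub>Fm\<^esub> z) = (\<lambda>m\<in>tensor_power n. f m)"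
    using U_action_coset[OF z(1)] z(2) by (auto simp: \<sigma>_def fun_eq_iff)
  then show ?thesis unfolding U_eq using coset_in_quot_alg[OF z(1)] by blast
qed

end

section \<open>Schur--Weyl duality\<close>

lemma comm_TL_restrict_End: "comm_TL v s n f \<Longrightarrow> (\<lambda>m\<in>tensor_power n. f m) \<in> carrier (End_tensor n)"
  by (auto simp: End_tensor_carrier comm_TL_def tensor_power_intros)

theorem theorem9p8:
  fixes v s \<delta> :: "'k::field" and n :: nat
    and UA :: "(ratfun, ufree set) module" and U :: "('k, (ufree set \<times> 'k \<Rightarrow>\<^sub>0 int) set) module"
  assumes "v \<noteq> 0"
    and "s = 1 \<or> s = - 1" and "\<delta> = s * (v + inverse v)"
    and "UA = UA_gl2 \<or> UA = UA_sl2"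
    and "U = specialized_alg v UA"
  shows
    "U_action v n \<in> alg_hom U (End_over (TL n \<delta>) (TL_action v s n) n)
     \<and> U_action v n ` carrier U = carrier (End_over (TL n \<delta>) (TL_action v s n) n)
     \<and> TL_action v s n \<in> alg_hom (TL n \<delta>) (End_over U (U_action v n) n)
     \<and> TL_action v s n ` carrier (TL n \<delta>) = carrier (End_over U (U_action v n) n)
     \<and> bij_betw (TL_action v s n) (carrier (TL n \<delta>)) (carrier (End_over U (U_action v n) n))"
proof -
  note v = assms(1) and TL = assms(1-3) and UA = assms(1,4)
  have ss: "s * s = 1" using assms(2) by auto
  let ?T = "End_over (TL n \<delta>) (TL_action v s n) n" and ?E = "End_over U (U_action v n) n"
  let ?a = "free_action (TL_gen_op v s)"
  have lin: "linear_map (?a x)" for x by (rule free_action_linear) simp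
  have a_tp: "?a x m \<in> tensor_power n" if "x \<in> carrier (free_alg {1..<n})" "m \<in> tensor_power n" for x m
    using that TL_tensor_power[OF v] by (intro free_action_tensor_power[of "{1..<n}"]) auto

  \<comment> \<open>Elements of the Temperley-Lieb algebra act as combinations of words in the e_i,
    so commuting with the generators is enough.\<close>
  have f_in_T: "(\<lambda>m\<in>tensor_power n. f m) \<in> carrier ?T" if f: "comm_TL v s n f" for f
  proof -
    have "f (TL_action v s n X m) = TL_action v s n X (f m) \<and> TL_action v s n X m \<in> tensor_power n"
      if X: "X \<in> carrier (TL n \<delta>)" and m: "m \<in> tensor_power n" for X m
    proof -
      obtain x where "x \<in> carrier (free_alg {1..<n})" "TL_action v s n X = (\<lambda>m\<in>tensor_power n. ?a x m)"
        by (rule TL_action_tensor[OF TL X])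
      then show ?thesis using comm_TL_free_action[OF v f _ m] comm_TL_tensor_power[OF f m] a_tp m by simp
    qed
    then show ?thesis using comm_TL_restrict_End[OF f] comm_TL_tensor_power[OF f] by (auto simp: End_over_simps)
  qed
  have U_hom: "U_action v n \<in> alg_hom U ?T"
    unfolding assms(5) by (rule U_action_alg_hom[OF UA _ _ _ _ f_in_T]) (simp_all add: End_over_simps)

  \<comment> \<open>Conversely, each e_i is itself the action of an element of the algebra.\<close>
  have T_comm: "comm_TL v s n f" if f: "f \<in> carrier ?T" for f
    unfolding comm_TL_def
  proof (intro ballI conjI allI impI)
    fix x :: "'k tensors" and i assume x: "x \<in> tensor_power n" and i: "1 \<le> i" "i < n"
    obtain X where X: "X \<in> carrier (TL n \<delta>)" "TL_action v s n X = (\<lambda>m\<in>tensor_power n. TL_gen_op v s i m)"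
      using TL_action_gen[OF TL i] by blast
    have "f x \<in> tensor_power n" using f x by (auto simp: End_over_simps End_tensor_carrier)
    moreover have "f (TL_action v s n X x) = TL_action v s n X (f x)" using f X(1) x by (simp add: End_over_simps)
    ultimately show "f (TL_gen_op v s i x) = TL_gen_op v s i (f x)" using x by (simp add: X(2))
  qed (use f in \<open>auto simp: End_over_simps End_tensor_carrier\<close>)
  \<comment> \<open>Members of \<open>End_tensor n\<close> are undefined outside the tensor power,
    so restriction leaves them unchanged.\<close>
  have ext: "(\<lambda>m\<in>tensor_power n. f m) = f" if "f \<in> carrier (End_tensor n)" for f :: "'k tensors \<Rightarrow> 'k tensors"
    using that by (auto simp: End_tensor_carrier PiE_restrict)
  have U_img: "U_action v n ` carrier U = carrier ?T"
  proof (intro equalityI subsetI)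
    fix f assume "f \<in> U_action v n ` carrier U"
    then show "f \<in> carrier ?T" using U_hom by (auto simp: alg_hom_def ring_hom_def)
  next
    fix f assume f: "f \<in> carrier ?T"
    have "f \<in> Uops v n" by (rule comm_TL_imp_Uops[OF v ss T_comm[OF f]])
    then obtain X where "X \<in> carrier U" "U_action v n X = (\<lambda>m\<in>tensor_power n. f m)"
      using Uops_in_U_action[OF UA] unfolding assms(5) by blast
    then show "f \<in> U_action v n ` carrier U" using ext[of f] f by (auto simp: End_over_simps)
  qed

  have a_in_E: "(\<lambda>m\<in>tensor_power n. ?a x m) \<in> carrier ?E" if x: "x \<in> carrier (free_alg {1..<n})" for x
  proof -
    have "(\<lambda>m\<in>tensor_power n. ?a x m) \<in> carrier (End_tensor n)"
      using a_tp[OF x] by (auto simp: End_tensor_carrier linear_map_add[OF lin] linear_map_scale[OF lin] tensor_power_intros)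
    moreover have "?a x (U_action v n X m) = U_action v n X (?a x m) \<and> U_action v n X m \<in> tensor_power n"
      if "X \<in> carrier U" and m: "m \<in> tensor_power n" for X m
    proof -
      obtain f where f: "comm_TL v s n f" "U_action v n X = (\<lambda>m\<in>tensor_power n. f m)"
        using U_action_comm_TL[OF UA] \<open>X \<in> carrier U\<close> unfolding assms(5) by blast
      then show ?thesis using comm_TL_free_action[OF v f(1) x m] comm_TL_tensor_power[OF f(1) m] a_tp[OF x m] m by simp
    qed
    ultimately show ?thesis using a_tp[OF x] by (auto simp: End_over_simps)
  qed
  have TL_hom: "TL_action v s n \<in> alg_hom (TL n \<delta>) ?E"
    and TL_img: "TL_action v s n ` carrier (TL n \<delta>) = (\<lambda>x. \<lambda>m\<in>tensor_power n. ?a x m) ` carrier (free_alg {1..<n})"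
    by (rule TL_action_alg_hom[OF TL _ _ _ _ a_in_E]; simp add: End_over_simps)+
  have TL_surj: "TL_action v s n ` carrier (TL n \<delta>) = carrier ?E"
  proof (intro equalityI subsetI)
    fix f assume "f \<in> TL_action v s n ` carrier (TL n \<delta>)"
    then show "f \<in> carrier ?E" using a_in_E unfolding TL_img by blast
  next
    fix f assume f: "f \<in> carrier ?E"
    \<comment> \<open>Every operator in \<open>Uops v n\<close> is the action of an element of
      \<open>U\<close>, so commuting with \<open>U\<close> implies commuting with these
      operators.\<close>
    have "comm_U v n f" unfolding comm_U_def
    proof (intro ballI conjI allI)
      fix x :: "'k tensors" and u assume x: "x \<in> tensor_power n" and u: "u \<in> Uops v n"
      obtain X where X: "X \<in> carrier U" "U_action v n X = (\<lambda>m\<in>tensor_power n. u m)"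
        using Uops_in_U_action[OF UA u] unfolding assms(5) by blast
      have "f x \<in> tensor_power n" using f x by (auto simp: End_over_simps End_tensor_carrier)
      moreover have "f (U_action v n X x) = U_action v n X (f x)" using f X(1) x by (simp add: End_over_simps)
      ultimately show "f (u x) = u (f x)" using x by (simp add: X(2))
    qed (use f in \<open>auto simp: End_over_simps End_tensor_carrier\<close>)
    from comm_U_in_TL[OF TL this] obtain x where x: "x \<in> carrier (free_alg {1..<n})"
      "\<forall>m\<in>tensor_power n. f m = ?a x m" by blast
    then have "(\<lambda>m\<in>tensor_power n. ?a x m) = (\<lambda>m\<in>tensor_power n. f m)" by (auto simp: fun_eq_iff)
    also have "\<dots> = f" using ext[of f] f by (simp add: End_over_simps)
    finally show "f \<in> TL_action v s n ` carrier (TL n \<delta>)" unfolding TL_img using x(1) by blast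
  qed
  have "bij_betw (TL_action v s n) (carrier (TL n \<delta>)) (carrier ?E)"
    using TL_action_inj[OF TL] TL_surj by (simp add: bij_betw_def)
  with U_hom U_img TL_hom TL_surj show ?thesis by blast
qed

end
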